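(* For any energy function $H:\Omega_f\to\mathbb{R}\cup\{+\infty\}$ on the finite point configurations of $\mathbb{R}^d$ which is stable and intensity regular, there exists at least one stationary Gibbs point process for $H$ with finite intensity. That is, there exists a stationary probability measure $P$ on $(\Omega,\mathcal{F})$ with finite intensity such that, for every bounded $\Delta\subset\mathbb{R}^d$ and every bounded measurable function $f$ on $\Omega$, $$\int f(\omega)\,P(d\omega)=\int\int f(\omega'_\Delta\omega_{\Delta^c})\,\frac{1}{Z_\Delta(\omega_{\Delta^c})}\,e^{-H_\Delta(\omega'_\Delta\omega_{\Delta^c})}\,\pi_\Delta(d\omega'_\Delta)\,P(d\omega),$$ where $Z_\Delta(\omega_{\Delta^c})=\int e^{-H_\Delta(\omega'_\Delta\omega_{\Delta^c})}\,\pi_\Delta(d\omega'_\Delta)$ (DLR equations).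
   Context: All subsets of $\mathbb{R}^d$ considered are assumed Borel measurable; $\lambda^d$ is Lebesgue measure on $\mathbb{R}^d$. **Configurations.** $\Omega$ is the set of locally finite subsets $\omega$ of $\mathbb{R}^d$, i.e. $|\omega\cap\Delta|<\infty$ for every bounded $\Delta$, where $|\cdot|$ is the cardinality. Write $\omega_\Delta=\omega\cap\Delta$, $\Delta^c=\mathbb{R}^d\setminus\Delta$ and $\omega\omega'=\omega\cup\omega'$. $\Omega_f$ is the set of finite configurations and $\Omega_\Lambda$ the set of configurations contained in $\Lambda$. $\mathcal{F}$ is the $\sigma$-field on $\Omega$ generated by the maps $\omega\mapsto|\omega_\Delta|$, $\Delta$ bounded. A point process is a probability measure on $(\Omega,\mathcal{F})$. For bounded $\Delta$, $\pi_\Delta$ is the Poisson point process in $\Delta$ with intensity one. **Intensity, stationarity.** $P$ has finite intensity if $E^P[|\omega_\Delta|]<\infty$ for every bounded $\Delta$. Put $$\xi(P)=\sup\left\{\frac{E^P[|\omega_\Lambda|]}{\lambda^d(\Lambda)}:\ \Lambda\subset\mathbb{R}^d,\ 0<\lambda^d(\Lambda)<+\infty\right\};$$ $P$ has bounded intensity if $\xi(P)<+\infty$. $P$ is stationary if $P=P\circ\tau_u^{-1}$ for every $u\in\mathbb{R}^d$, where $\tau_u$ is the translation of vector $u$. A stationary $P$ with finite intensity has intensity measure $i(P)\lambda^d$ with $i(P)=\xi(P)<+\infty$. **Energy function.** A measurable function $H:\Omega_f\to\mathbb{R}\cup\{+\infty\}$ which is non degenerate ($H(\emptyset)<+\infty$),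 hereditary (for all $\omega\in\Omega_f$ and $x\in\omega$, $H(\omega)<+\infty$ implies $H(\omega\setminus\{x\})<+\infty$) and stationary ($H(\tau_u\omega)=H(\omega)$ for all $\omega\in\Omega_f$, $u\in\mathbb{R}^d$). **Stable.** There exists a constant $A\le0$ such that $H(\omega)\ge A|\omega|$ for all $\omega\in\Omega_f$. **Intensity regular.** For every bounded $\Delta\subset\mathbb{R}^d$ one can find an increasing sequence $(\Delta_l)_{l\ge0}$ of bounded subsets of $\mathbb{R}^d$, with union $\mathbb{R}^d$, such that $\Delta\subset\Delta_0$ and, writing $H^l_\Delta(\omega)=H(\omega_{\Delta_l})-H(\omega_{\Delta_l\setminus\Delta})$, $$\left|H^{l+1}_\Delta(\omega)-H^l_\Delta(\omega)\right|\le|\omega_\Delta|\,G^l_\Delta(\omega_{\Delta^c}),$$ where $G^l_\Delta$ is a non negative function on $\Omega_{\Delta^c}$ such that for any probability measure $P$ on $\Omega$ $$E^P\left[G^l_\Delta(\omega_{\Delta^c})\right]\le\alpha_l\,\psi(\xi(P)),$$ with $\psi$ an increasing function and $(\alpha_l)_{l\ge0}$ a sequence satisfying $\sum_{l=0}^{+\infty}\alpha_l<+\infty$. **Local energy.** For $H$ intensity regular and $\Delta$ bounded, with $(\Delta_l)$ as in the previous definition, the local energy is defined, for $P$-almost every $\omega$ when $P$ is a probability measure with bounded intensity, by $$H_\Delta(\omega)=H^0_\Delta(\omega)+\sum_{l=0}^{+\infty}\left[H^{l+1}_\Delta(\omega)-H^l_\Delta(\omega)\right].$$ For a finite configuration $\omega$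 contained in a bounded set $\Lambda$, it equals $H(\omega_\Lambda)-H(\omega_{\Lambda\setminus\Delta})$. **Gibbs point process.** For $H$ stable and intensity regular, a Gibbs point process for $H$ is a probability measure $P$ on $\Omega$ with bounded intensity which satisfies the DLR equation displayed in the claim for all bounded $\Delta$ and all bounded measurable $f$. *)

theory Defs
  imports "HOL-Probability.Probability"
begin

section \<open>Configurations and point processes\<close>

abbreviation bounded_borel :: "'a::euclidean_space set \<Rightarrow> bool" where
  "bounded_borel \<Delta> \<equiv> bounded \<Delta> \<and> \<Delta> \<in> sets borel"

definition configs :: "'a::euclidean_space set set" where
  "configs = {\<omega>. \<forall>\<Delta>. bounded \<Delta> \<longrightarrow> finite (\<omega> \<inter> \<Delta>)}"

definition config_algebra :: "'a::euclidean_space set measure" where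
  "config_algebra = sigma configs
     {{\<omega> \<in> configs. card (\<omega> \<inter> \<Delta>) \<in> N} | \<Delta> N. bounded_borel \<Delta>}"

definition finite_configs :: "'a::euclidean_space set measure" where
  "finite_configs = restrict_space config_algebra {\<omega>. finite \<omega>}"

definition outer_configs :: "'a::euclidean_space set \<Rightarrow> 'a set measure" where
  "outer_configs \<Delta> = restrict_space config_algebra {\<omega>. \<omega> \<subseteq> - \<Delta>}"

definition point_process :: "'a::euclidean_space set measure \<Rightarrow> bool" where
  "point_process P \<longleftrightarrow> prob_space P \<and> sets P = sets config_algebra"

text \<open>The number of points is taken in the extended sense (counting measure), since
  \<open>\<omega> \<inter> \<Lambda>\<close> may be infinite when \<open>\<Lambda>\<close> is unbounded.\<close>

definition mean_count :: "'a::euclidean_space set measure \<Rightarrow> 'a set \<Rightarrow> ennreal" where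
  "mean_count P \<Lambda> = (\<integral>\<^sup>+ \<omega>. emeasure (count_space UNIV) (\<omega> \<inter> \<Lambda>) \<partial>P)"

definition finite_intensity :: "'a::euclidean_space set measure \<Rightarrow> bool" where
  "finite_intensity P \<longleftrightarrow> (\<forall>\<Delta>. bounded_borel \<Delta> \<longrightarrow> mean_count P \<Delta> < \<infinity>)"

definition intensity_sup :: "'a::euclidean_space set measure \<Rightarrow> ennreal" where
  "intensity_sup P =
     (SUP \<Lambda> \<in> {\<Lambda> \<in> sets borel. 0 < emeasure lborel \<Lambda> \<and> emeasure lborel \<Lambda> < \<infinity>}.
        mean_count P \<Lambda> / emeasure lborel \<Lambda>)"

definition bounded_intensity :: "'a::euclidean_space set measure \<Rightarrow> bool" where
  "bounded_intensity P \<longleftrightarrow> intensity_sup P < \<infinity>"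

definition stationary :: "'a::euclidean_space set measure \<Rightarrow> bool" where
  "stationary P \<longleftrightarrow> (\<forall>u. distr P config_algebra (\<lambda>\<omega>. (+) u ` \<omega>) = P)"


section \<open>The Poisson point process in a bounded set\<close>

text \<open>The law of the Poisson process with intensity one in \<open>\<Delta>\<close>, by its usual expansion
  over the number \<open>n\<close> of points:
  \<open>exp (- \<lambda>(\<Delta>)) * (\<Sum>n. 1/n! * \<lambda>\<^sup>n {x \<in> \<Delta>\<^sup>n. {x\<^sub>1, \<dots>, x\<^sub>n} \<in> A})\<close>. That this is a
  probability measure with the Poisson void probabilities is proved below.\<close>

definition poisson_content :: "'a::euclidean_space set \<Rightarrow> 'a set set \<Rightarrow> ennreal" where
  "poisson_content \<Delta> A = ennreal (exp (- measure lborel \<Delta>)) *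
     (\<Sum>n. emeasure (\<Pi>\<^sub>M i\<in>{..<n}. lborel) {x \<in> {..<n} \<rightarrow>\<^sub>E \<Delta>. x ` {..<n} \<in> A} / fact n)"

definition poisson_process :: "'a::euclidean_space set \<Rightarrow> 'a set measure" where
  "poisson_process \<Delta> = measure_of configs (sets config_algebra) (poisson_content \<Delta>)"

lemma space_config_algebra [simp]: "space config_algebra = configs"
  unfolding config_algebra_def by (rule space_measure_of) auto

lemma finite_in_configs: "finite \<omega> \<Longrightarrow> \<omega> \<in> configs"
  by (auto simp: configs_def)

lemma sets_config_algebra:
  "sets config_algebra =
     sigma_sets configs {{\<omega> \<in> configs. card (\<omega> \<inter> \<Delta>) \<in> N} | \<Delta> N. bounded_borel \<Delta>}"
  unfolding config_algebra_def by (rule sets_measure_of) auto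

lemma measurable_image_config:
  fixes n :: nat
  shows "(\<lambda>x. x ` {..<n}) \<in> (\<Pi>\<^sub>M i\<in>{..<n}. lborel) \<rightarrow>\<^sub>M (config_algebra :: 'a::euclidean_space set measure)"
  unfolding config_algebra_def
proof (rule measurable_measure_of)
  let ?L = "\<Pi>\<^sub>M i\<in>{..<n}. (lborel :: 'a measure)"
  fix Y :: "'a set set"
  assume "Y \<in> {{\<omega> \<in> configs. card (\<omega> \<inter> \<Delta>) \<in> N} | \<Delta> N. bounded_borel \<Delta>}"
  then obtain \<Delta> N where \<Delta>: "\<Delta> \<in> sets borel"
    and Y: "Y = {\<omega> \<in> configs. card (\<omega> \<inter> \<Delta>) \<in> N}" by auto
  define c where "c x = (\<Sum>i<n. if x i \<in> \<Delta> \<and> (\<forall>j<i. x j \<noteq> x i) then 1 else 0 :: nat)"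
    for x :: "nat \<Rightarrow> 'a"
  have c: "card (x ` {..<n} \<inter> \<Delta>) = c x" for x :: "nat \<Rightarrow> 'a"
  proof -
    have "card (x ` {..<n} \<inter> \<Delta>) = card {i\<in>{..<n}. x i \<in> \<Delta> \<and> (\<forall>j<i. x j \<noteq> x i)}"
    proof (rule bij_betw_same_card[symmetric], unfold bij_betw_def, intro conjI)
      show "inj_on x {i\<in>{..<n}. x i \<in> \<Delta> \<and> (\<forall>j<i. x j \<noteq> x i)}"
        by (rule inj_onI) (metis (mono_tags, lifting) linorder_neqE_nat mem_Collect_eq)
      show "x ` {i\<in>{..<n}. x i \<in> \<Delta> \<and> (\<forall>j<i. x j \<noteq> x i)} = x ` {..<n} \<inter> \<Delta>"
      proof (intro equalityI subsetI)
        fix y assume y: "y \<in> x ` {..<n} \<inter> \<Delta>"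
        then obtain k where k: "k < n" "x k = y" by auto
        define i where "i = (LEAST i. x i = y)"
        have i: "x i = y" "i \<le> k" "\<forall>j<i. x j \<noteq> y"
          unfolding i_def using k by (auto intro: LeastI Least_le dest: not_less_Least)
        then show "y \<in> x ` {i\<in>{..<n}. x i \<in> \<Delta> \<and> (\<forall>j<i. x j \<noteq> x i)}"
          using y k by (intro image_eqI[of _ _ i]) auto
      qed auto
    qed
    also have "\<dots> = c x" unfolding c_def by (simp add: sum.If_cases Int_def)
    finally show ?thesis .
  qed
  have cm: "c \<in> ?L \<rightarrow>\<^sub>M count_space UNIV"
    unfolding c_def
  proof (rule measurable_sum_nat)
    fix i assume "i \<in> {..<n}"
    then have i: "i < n" by simp
    have comp: "(\<lambda>x. x j) \<in> ?L \<rightarrow>\<^sub>M borel" if "j < n" for j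
      using measurable_component_singleton[of j "{..<n}" "\<lambda>_. lborel :: 'a measure"] that by simp
    have [measurable]: "(\<lambda>x. x i) \<in> ?L \<rightarrow>\<^sub>M borel" by (rule comp) fact
    have "(\<lambda>x. x i \<in> \<Delta> \<and> (\<forall>j\<in>{..<i}. x j \<noteq> x i)) \<in> ?L \<rightarrow>\<^sub>M count_space UNIV"
    proof (intro pred_intros_logic(3) pred_intros_finite(3))
      show "Measurable.pred ?L (\<lambda>x. x i \<in> \<Delta>)" using \<Delta> by measurable
      fix j assume "j \<in> {..<i}"
      then have "(\<lambda>x. x j) \<in> ?L \<rightarrow>\<^sub>M borel" using i by (intro comp) simp
      then have "(\<lambda>x. x j - x i) \<in> ?L \<rightarrow>\<^sub>M borel"
        using comp[OF i] by (rule borel_measurable_diff)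
      then have "Measurable.pred ?L (\<lambda>x. x j - x i \<in> {0})"
        by (rule pred_sets2[rotated]) simp
      then show "Measurable.pred ?L (\<lambda>x. x j \<noteq> x i)"
        by (intro pred_intros_logic) simp
    qed simp
    then have [measurable]: "Measurable.pred ?L (\<lambda>x. x i \<in> \<Delta> \<and> (\<forall>j<i. x j \<noteq> x i))"
      by (simp add: lessThan_def)
    show "(\<lambda>x. if x i \<in> \<Delta> \<and> (\<forall>j<i. x j \<noteq> x i) then 1 else 0 :: nat) \<in> ?L \<rightarrow>\<^sub>M count_space UNIV"
      by measurable
  qed
  have "(\<lambda>x. x ` {..<n}) -` Y \<inter> space ?L = c -` N \<inter> space ?L"
    by (auto simp: Y c finite_in_configs)
  then show "(\<lambda>x. x ` {..<n}) -` Y \<inter> space ?L \<in> sets ?L"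
    using measurable_sets[OF cm, of N] by simp
qed (auto simp: finite_in_configs)

lemma poisson_content_sets:
  fixes n :: nat
  assumes A: "A \<in> sets config_algebra" and \<Delta>: "\<Delta> \<in> sets borel"
  shows "{x \<in> {..<n} \<rightarrow>\<^sub>E \<Delta>. x ` {..<n} \<in> A} \<in> sets (\<Pi>\<^sub>M i\<in>{..<n}. lborel)"
proof -
  have "{x \<in> {..<n} \<rightarrow>\<^sub>E \<Delta>. x ` {..<n} \<in> A} =
      ({..<n} \<rightarrow>\<^sub>E \<Delta>) \<inter> ((\<lambda>x. x ` {..<n}) -` A \<inter> space (\<Pi>\<^sub>M i\<in>{..<n}. lborel))"
    by (auto simp: space_PiM PiE_def)
  also have "\<dots> \<in> sets (\<Pi>\<^sub>M i\<in>{..<n}. lborel)"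
    using \<Delta> by (intro sets.Int measurable_sets[OF measurable_image_config A] sets_PiM_I_finite) auto
  finally show ?thesis .
qed

lemma sets_poisson_process [simp, measurable_cong]:
  "sets (poisson_process \<Delta>) = sets config_algebra"
  unfolding poisson_process_def
  using sets.sigma_sets_eq[of config_algebra] sets.space_closed[of config_algebra]
  by (subst sets_measure_of) simp_all

lemma space_poisson_process [simp]: "space (poisson_process \<Delta>) = configs"
  using sets_eq_imp_space_eq[OF sets_poisson_process, of \<Delta>] by simp

lemma emeasure_poisson_process:
  assumes \<Delta>: "\<Delta> \<in> sets borel" and A: "A \<in> sets config_algebra"
  shows "emeasure (poisson_process \<Delta>) A = poisson_content \<Delta> A"
proof (rule emeasure_measure_of[OF poisson_process_def])
  show "sets config_algebra \<subseteq> Pow configs"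
    using sets.space_closed[of config_algebra] by simp
  show "A \<in> sets (poisson_process \<Delta>)" using A by simp
  show "positive (sets (poisson_process \<Delta>)) (poisson_content \<Delta>)"
    by (auto simp: positive_def poisson_content_def)
  show "countably_additive (sets (poisson_process \<Delta>)) (poisson_content \<Delta>)"
  proof (rule countably_additiveI)
    fix B :: "nat \<Rightarrow> 'a set set"
    assume B: "range B \<subseteq> sets (poisson_process \<Delta>)" "disjoint_family B"
    define S where "S n C = {x \<in> {..<n} \<rightarrow>\<^sub>E \<Delta>. x ` {..<n} \<in> C}" for n :: nat and C
    let ?e = "\<lambda>n C. emeasure (\<Pi>\<^sub>M i\<in>{..<n}. lborel) (S n C)"
    have sum: "?e n (\<Union>i. B i) = (\<Sum>i. ?e n (B i))" for n
    proof -
      have "(\<Union>i. S n (B i)) = S n (\<Union>i. B i)" by (auto simp: S_def)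
      moreover have "range (\<lambda>i. S n (B i)) \<subseteq> sets (\<Pi>\<^sub>M i\<in>{..<n}. lborel)"
        using B(1) \<Delta> unfolding S_def by (auto intro!: poisson_content_sets)
      moreover have "disjoint_family (\<lambda>i. S n (B i))"
        using B(2) by (auto simp: disjoint_family_on_def S_def)
      ultimately show ?thesis by (simp add: suminf_emeasure)
    qed
    have "(\<Sum>i. poisson_content \<Delta> (B i)) =
        ennreal (exp (- measure lborel \<Delta>)) * (\<Sum>i. \<Sum>n. ?e n (B i) / fact n)"
      by (simp add: poisson_content_def S_def)
    also have "(\<Sum>i. \<Sum>n. ?e n (B i) / fact n) = (\<Sum>n. \<Sum>i. ?e n (B i) / fact n)"
      using nn_integral_suminf[of "\<lambda>i n. ?e n (B i) / fact n" "count_space UNIV"]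
      unfolding nn_integral_count_space_nat by simp
    also have "\<dots> = (\<Sum>n. (\<Sum>i. ?e n (B i)) / fact n)"
      by simp
    finally show "(\<Sum>i. poisson_content \<Delta> (B i)) = poisson_content \<Delta> (\<Union>i. B i)"
      unfolding poisson_content_def S_def[symmetric] sum .
  qed
qed

lemma emeasure_poisson_process_void:
  assumes \<Delta>: "bounded_borel \<Delta>" and B: "B \<in> sets borel" "B \<subseteq> \<Delta>"
  shows "emeasure (poisson_process \<Delta>) {\<omega> \<in> configs. \<omega> \<inter> B = {}} = exp (- measure lborel B)"
proof -
  interpret product_sigma_finite "\<lambda>_::nat. lborel :: 'a measure" ..
  let ?m = "measure (lborel :: 'a measure)"
  have bB: "bounded B" using B \<Delta> bounded_subset by blast
  have fin: "emeasure lborel C = ennreal (?m C)" if "C \<subseteq> \<Delta>" "C \<in> sets borel" for C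
    using that \<Delta> emeasure_bounded_finite[of C] bounded_subset[of \<Delta> C]
    by (intro emeasure_eq_ennreal_measure) auto
  have "{\<omega> \<in> configs. \<omega> \<inter> B = {}} = {\<omega> \<in> configs. card (\<omega> \<inter> B) \<in> {0}}"
    using bB by (auto simp: configs_def)
  also have "\<dots> \<in> sets config_algebra"
    unfolding sets_config_algebra using bB B by (intro sigma_sets.Basic) blast
  finally have V: "{\<omega> \<in> configs. \<omega> \<inter> B = {}} \<in> sets config_algebra" .
  have "{x \<in> {..<n} \<rightarrow>\<^sub>E \<Delta>. x ` {..<n} \<in> {\<omega> \<in> configs. \<omega> \<inter> B = {}}} = {..<n} \<rightarrow>\<^sub>E (\<Delta> - B)" for n :: nat
    by (auto simp: PiE_def Pi_iff finite_in_configs)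
  moreover have "emeasure (\<Pi>\<^sub>M i\<in>{..<n}. lborel) ({..<n} \<rightarrow>\<^sub>E (\<Delta> - B)) = ennreal (?m (\<Delta> - B)) ^ n"
    for n :: nat
    using \<Delta> B by (subst emeasure_PiM) (auto simp: fin)
  ultimately have "poisson_content \<Delta> {\<omega> \<in> configs. \<omega> \<inter> B = {}} =
      exp (- ?m \<Delta>) * (\<Sum>n. ennreal (?m (\<Delta> - B)) ^ n / fact n)"
    unfolding poisson_content_def by simp
  also have "(\<Sum>n. ennreal (?m (\<Delta> - B)) ^ n / fact n) = (\<Sum>n. ennreal (?m (\<Delta> - B) ^ n / fact n))"
  proof (intro suminf_cong)
    fix n
    have "(fact n :: ennreal) = ennreal (fact n)"
      using ennreal_of_nat_eq_real_of_nat[of "fact n"] by simp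
    then show "ennreal (?m (\<Delta> - B)) ^ n / fact n = ennreal (?m (\<Delta> - B) ^ n / fact n)"
      by (simp add: divide_ennreal[symmetric] ennreal_power)
  qed
  also have "\<dots> = ennreal (exp (?m (\<Delta> - B)))"
  proof -
    have "(\<lambda>n. ?m (\<Delta> - B) ^ n / fact n) sums exp (?m (\<Delta> - B))"
      using exp_converges[of "?m (\<Delta> - B)"] by (simp add: divide_inverse mult.commute)
    then show ?thesis by (intro suminf_ennreal_eq) auto
  qed
  also have "ennreal (exp (- ?m \<Delta>)) * \<dots> = exp (?m (\<Delta> - B) - ?m \<Delta>)"
    by (simp add: ennreal_mult[symmetric] mult_exp_exp)
  also have "?m (\<Delta> - B) = ?m \<Delta> - ?m B"
    using \<Delta> B fin by (intro measure_Diff) auto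
  finally show ?thesis using \<Delta> V by (simp add: emeasure_poisson_process)
qed

lemma prob_space_poisson_process:
  assumes "bounded_borel \<Delta>"
  shows "prob_space (poisson_process \<Delta>)"
  using emeasure_poisson_process_void[OF assms, of "{}"] by (intro prob_spaceI) simp


section \<open>Energy functions\<close>

text \<open>Only the values of \<open>H\<close> on finite configurations are ever used.\<close>

definition energy_function :: "('a::euclidean_space set \<Rightarrow> ereal) \<Rightarrow> bool" where
  "energy_function H \<longleftrightarrow>
     H \<in> borel_measurable finite_configs \<and>
     (\<forall>\<omega>. finite \<omega> \<longrightarrow> H \<omega> \<noteq> - \<infinity>) \<and>
     H {} < \<infinity> \<and>
     (\<forall>\<omega> x. finite \<omega> \<and> x \<in> \<omega> \<and> H \<omega> < \<infinity> \<longrightarrow> H (\<omega> - {x}) < \<infinity>) \<and>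
     (\<forall>\<omega> u. finite \<omega> \<longrightarrow> H ((+) u ` \<omega>) = H \<omega>)"

definition stable_energy :: "('a::euclidean_space set \<Rightarrow> ereal) \<Rightarrow> bool" where
  "stable_energy H \<longleftrightarrow> (\<exists>A::real. A \<le> 0 \<and> (\<forall>\<omega>. finite \<omega> \<longrightarrow> H \<omega> \<ge> ereal (A * card \<omega>)))"

text \<open>The energy of the points of \<open>\<Delta>\<close> inside a bounded set \<open>D\<close>. As \<open>\<infinity> - \<infinity> = \<infinity>\<close> in \<^typ>\<open>ereal\<close>,
  heredity makes this \<open>\<infinity>\<close> whenever \<open>H (\<omega> \<inter> D) = \<infinity>\<close>; it is never \<open>- \<infinity>\<close>.\<close>

definition energy_in :: "('a::euclidean_space set \<Rightarrow> ereal) \<Rightarrow> 'a set \<Rightarrow> 'a set \<Rightarrow> 'a set \<Rightarrow> ereal" where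
  "energy_in H \<Delta> D \<omega> = H (\<omega> \<inter> D) - H (\<omega> \<inter> (D - \<Delta>))"

text \<open>\<open>D\<close> is a sequence witnessing intensity regularity for \<open>\<Delta>\<close>. The estimate is required for
  all configurations for which its left-hand side contains no difference \<open>\<infinity> - \<infinity>\<close>: by heredity
  this is what the two finiteness premises say. Without them, under any fixed value of
  \<open>\<infinity> - \<infinity>\<close>, a pair of distant points violating a hard-core constraint would already break the
  estimate. The function \<open>\<psi>\<close> is real-valued on \<open>[0, \<infinity>)\<close> and its value at \<open>\<infinity>\<close> is unrestricted.\<close>

definition regular_sequence ::
    "('a::euclidean_space set \<Rightarrow> ereal) \<Rightarrow> 'a set \<Rightarrow> (nat \<Rightarrow> 'a set) \<Rightarrow> bool" where
  "regular_sequence H \<Delta> D \<longleftrightarrow>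
     (\<forall>l. bounded_borel (D l)) \<and> incseq D \<and> (\<Union>l. D l) = UNIV \<and> \<Delta> \<subseteq> D 0 \<and>
     (\<exists>(G :: nat \<Rightarrow> 'a set \<Rightarrow> real) (\<alpha> :: nat \<Rightarrow> real) (\<psi> :: ennreal \<Rightarrow> ennreal).
        (\<forall>l. G l \<in> borel_measurable (outer_configs \<Delta>)) \<and>
        (\<forall>l. \<forall>\<omega>\<in>space (outer_configs \<Delta>). 0 \<le> G l \<omega>) \<and>
        (\<forall>l. \<forall>\<omega>\<in>configs. H (\<omega> \<inter> (D (Suc l) - \<Delta>)) < \<infinity> \<and> energy_in H \<Delta> (D l) \<omega> < \<infinity> \<longrightarrow>
           \<bar>energy_in H \<Delta> (D (Suc l)) \<omega> - energy_in H \<Delta> (D l) \<omega>\<bar>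
             \<le> ereal (card (\<omega> \<inter> \<Delta>) * G l (\<omega> - \<Delta>))) \<and>
        mono \<psi> \<and> (\<forall>t<\<infinity>. \<psi> t < \<infinity>) \<and>
        (\<forall>l. 0 \<le> \<alpha> l) \<and> summable \<alpha> \<and>
        (\<forall>l P. point_process P \<longrightarrow>
           (\<integral>\<^sup>+ \<omega>. ennreal (G l (\<omega> - \<Delta>)) \<partial>P) \<le> ennreal (\<alpha> l) * \<psi> (intensity_sup P)))"

definition intensity_regular :: "('a::euclidean_space set \<Rightarrow> ereal) \<Rightarrow> bool" where
  "intensity_regular H \<longleftrightarrow> (\<forall>\<Delta>. bounded_borel \<Delta> \<longrightarrow> (\<exists>D. regular_sequence H \<Delta> D))"

text \<open>If \<open>H (\<omega> \<inter> D l) = \<infinity>\<close> for some \<open>l\<close>, then this is \<open>\<infinity>\<close>.\<close>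

definition local_energy ::
    "('a::euclidean_space set \<Rightarrow> ereal) \<Rightarrow> 'a set \<Rightarrow> (nat \<Rightarrow> 'a set) \<Rightarrow> 'a set \<Rightarrow> ereal" where
  "local_energy H \<Delta> D \<omega> = energy_in H \<Delta> (D 0) \<omega> +
     (\<Sum>l. energy_in H \<Delta> (D (Suc l)) \<omega> - energy_in H \<Delta> (D l) \<omega>)"


section \<open>Gibbs point processes\<close>

text \<open>\<open>exp (- h)\<close>; the value at \<open>- \<infinity>\<close> is irrelevant.\<close>

definition exp_minus :: "ereal \<Rightarrow> real" where
  "exp_minus h = (if h = \<infinity> then 0 else exp (- real_of_ereal h))"

definition partition_function ::
    "('a::euclidean_space set \<Rightarrow> ereal) \<Rightarrow> 'a set \<Rightarrow> (nat \<Rightarrow> 'a set) \<Rightarrow> 'a set \<Rightarrow> real" where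
  "partition_function H \<Delta> D \<eta> =
     (\<integral>\<omega>'. exp_minus (local_energy H \<Delta> D (\<omega>' \<inter> \<Delta> \<union> \<eta>)) \<partial>poisson_process \<Delta>)"

text \<open>The case \<open>f = 1\<close> forces, for almost every \<open>\<omega>\<close>, the Boltzmann weight to be integrable with
  \<open>0 < Z\<close>, since otherwise the right-hand inner integral is \<open>0\<close> (by \<open>1 / 0 = 0\<close>). The local
  energy does not depend, up to null sets, on the sequence \<open>D\<close>; the equation is required for
  every admissible one.\<close>

definition DLR :: "('a::euclidean_space set \<Rightarrow> ereal) \<Rightarrow> 'a set \<Rightarrow> 'a set measure \<Rightarrow> bool" where
  "DLR H \<Delta> P \<longleftrightarrow>
     (\<forall>D (f :: 'a set \<Rightarrow> real).
        regular_sequence H \<Delta> D \<and> f \<in> borel_measurable config_algebra \<and>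
        bounded (f ` configs) \<longrightarrow>
        (\<integral>\<omega>. f \<omega> \<partial>P) =
        (\<integral>\<omega>. (\<integral>\<omega>'. f (\<omega>' \<inter> \<Delta> \<union> (\<omega> - \<Delta>)) * (1 / partition_function H \<Delta> D (\<omega> - \<Delta>)) *
                 exp_minus (local_energy H \<Delta> D (\<omega>' \<inter> \<Delta> \<union> (\<omega> - \<Delta>)))
              \<partial>poisson_process \<Delta>) \<partial>P))"

definition gibbs_point_process ::
    "('a::euclidean_space set \<Rightarrow> ereal) \<Rightarrow> 'a set measure \<Rightarrow> bool" where
  "gibbs_point_process H P \<longleftrightarrow>
     point_process P \<and> bounded_intensity P \<and> (\<forall>\<Delta>. bounded_borel \<Delta> \<longrightarrow> DLR H \<Delta> P)"

end

theory Submission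
  imports Defs
begin

text \<open>
  The finite-volume Gibbs measure in a large cube, averaged over the translations by vectors of
  that cube, is asymptotically stationary, and a limit of such averages is the required process.

  Compactness does not need entropy. The density of the finite-volume measure with respect to the
  Poisson process is at most \<open>exp (a |\<omega>|) / Z\<close>, so exponential moments of additive functionals
  factorise over disjoint cells of a tiling. This bounds the intensity, and it bounds
  the averaged probability of a local event \<open>A\<close> by \<open>(C + exp c * \<mu> A) / c\<close> for every \<open>c > 0\<close>, with
  a finite measure \<open>\<mu>\<close> absolutely continuous with respect to the Poisson process in the window of
  \<open>A\<close>. Hence every setwise limit on local events (along a filter given by Tychonoff's theorem) is
  countably additive and absolutely continuous on each window, and the windows fit together.

  Since the local energy vanishes when \<open>\<Delta>\<close> is empty, the DLR equation in \<open>\<Delta>\<close> is equivalent to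
  \<open>E f = exp (\<lambda>(\<Delta>)) * E (1{\<omega>\<^sub>\<Delta> = {}} * \<integral> f(\<omega>'\<^sub>\<Delta> \<omega>) exp (- H\<^sub>\<Delta>(\<omega>'\<^sub>\<Delta> \<omega>)) d\<pi>\<^sub>\<Delta>(\<omega>'))\<close>, which contains no
  normalising constant. After truncation both sides are expectations of bounded Lipschitz functions
  of the local energy; replacing \<open>H\<^sub>\<Delta>\<close> by the local function \<open>H\<^sub>\<Delta>\<^sup>l\<close> costs at most the tail
  of \<open>\<alpha>\<^sub>l\<close> times \<open>\<psi>\<close> of a uniform bound of the intensities, so the identity passes to the limit.
\<close>


section \<open>Configurations and void events\<close>

text \<open>\<open>H\<close> is merely measurable, so weak convergence says nothing about functions
  of the energy; setwise convergence on all events of a window is required. There are uncountably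
  many of these, hence a filter finer than \<open>sequentially\<close> in place of a subsequence.
  The bound (C + exp c * \<mu> A) / c plays the part of uniform integrability: logarithms of weights
  and of normalisations are of the order of the volume, which gives a cost C per cell that does not
  shrink with \<mu> A; taking c large makes it harmless, and only then is \<mu> A made small.
  Averaging over translations turns a bound for a sum over all cells into one for a single window.
  The obstacle in the DLR equation is its normalisation, a function of the whole outer configuration
  for which no uniform upper bound is at hand. The identity with an empty \<Delta> is a linear
  relation between expectations, so it can be truncated and passed to the limit; tested with
  functions of the outer configuration it then shows that the normalisation is almost surely
  positive and finite, and the DLR equation follows by division.\<close>

definition avoid :: "'a::euclidean_space set \<Rightarrow> 'a set set" where
  "avoid B = {\<omega> \<in> configs. \<omega> \<inter> B = {}}"

lemma configs_finite_Int: "\<omega> \<in> configs \<Longrightarrow> bounded B \<Longrightarrow> finite (\<omega> \<inter> B)"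
  by (auto simp: configs_def)

lemma configs_subset: "\<omega> \<in> configs \<Longrightarrow> \<omega>' \<subseteq> \<omega> \<Longrightarrow> \<omega>' \<in> configs"
  unfolding configs_def by (auto intro: finite_subset[of "\<omega>' \<inter> _" "\<omega> \<inter> _"])

lemma configs_Un: "\<omega> \<in> configs \<Longrightarrow> \<omega>' \<in> configs \<Longrightarrow> \<omega> \<union> \<omega>' \<in> configs"
  unfolding configs_def by (auto simp: Int_Un_distrib2)

lemma configs_shift:
  assumes "\<omega> \<in> configs" shows "(+) u ` \<omega> \<in> (configs :: 'a::euclidean_space set set)"
  unfolding configs_def
proof safe
  fix B :: "'a set" assume "bounded B"
  then have "bounded ((+) (- u) ` B)" by (rule bounded_translation)
  then have "finite (\<omega> \<inter> (+) (- u) ` B)" using assms by (auto simp: configs_def)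
  then have "finite ((+) u ` (\<omega> \<inter> (+) (- u) ` B))" by simp
  moreover have "(+) u ` \<omega> \<inter> B \<subseteq> (+) u ` (\<omega> \<inter> (+) (- u) ` B)"
    by (force simp: image_iff)
  ultimately show "finite ((+) u ` \<omega> \<inter> B)" by (rule rev_finite_subset)
qed

lemma bounded_borel_Int1 [simp]: "bounded A \<Longrightarrow> bounded (A \<inter> B)"
  and bounded_borel_Int2 [simp]: "bounded B \<Longrightarrow> bounded (A \<inter> B)"
  by (auto intro: bounded_subset)

lemma measurable_card_config:
  assumes "bounded_borel \<Delta>"
  shows "(\<lambda>\<omega>. card (\<omega> \<inter> \<Delta>)) \<in> config_algebra \<rightarrow>\<^sub>M count_space UNIV"
proof (rule measurableI)
  fix N :: "nat set"
  have "(\<lambda>\<omega>. card (\<omega> \<inter> \<Delta>)) -` N \<inter> space config_algebra = {\<omega> \<in> configs. card (\<omega> \<inter> \<Delta>) \<in> N}"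
    by auto
  also have "\<dots> \<in> sets config_algebra"
    unfolding sets_config_algebra using assms by (intro sigma_sets.Basic) blast
  finally show "(\<lambda>\<omega>. card (\<omega> \<inter> \<Delta>)) -` N \<inter> space config_algebra \<in> sets config_algebra" .
qed simp

text \<open>\<open>card\<close> vanishes on infinite sets, so for unbounded \<open>\<Lambda>\<close>
  the count is taken as a supremum of finite counts over growing balls.\<close>

lemma measurable_count_config:
  assumes \<Lambda>: "\<Lambda> \<in> sets borel"
  shows "(\<lambda>\<omega>. emeasure (count_space UNIV) (\<omega> \<inter> \<Lambda>)) \<in> borel_measurable (config_algebra :: 'a::euclidean_space set measure)"
proof -
  have eq: "emeasure (count_space UNIV) (\<omega> \<inter> \<Lambda>) =
    (SUP k. of_nat (card (\<omega> \<inter> (\<Lambda> \<inter> ball 0 (real k)))))" if "\<omega> \<in> configs" for \<omega> :: "'a set"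
  proof -
    have "\<omega> \<inter> \<Lambda> = (\<Union>k. \<omega> \<inter> (\<Lambda> \<inter> ball 0 (real k)))"
      using reals_Archimedean2 by fastforce
    then have "emeasure (count_space UNIV) (\<omega> \<inter> \<Lambda>) = emeasure (count_space UNIV) (\<Union>k. \<omega> \<inter> (\<Lambda> \<inter> ball 0 (real k)))"
      by simp
    also have "\<dots> = (SUP k. emeasure (count_space UNIV) (\<omega> \<inter> (\<Lambda> \<inter> ball 0 (real k))))"
      by (intro SUP_emeasure_incseq[symmetric]) (auto simp: incseq_def)
    also have "\<dots> = (SUP k. of_nat (card (\<omega> \<inter> (\<Lambda> \<inter> ball 0 (real k)))))"
      using that by (subst emeasure_count_space_finite) (auto intro: configs_finite_Int)
    finally show ?thesis .
  qed
  have "(\<lambda>\<omega>. SUP k. of_nat (card (\<omega> \<inter> (\<Lambda> \<inter> ball 0 (real k)))) :: ennreal) \<in> borel_measurable config_algebra"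
    using \<Lambda> by (intro borel_measurable_SUP measurable_compose[OF measurable_card_config]) auto
  then show ?thesis by (subst measurable_cong[OF eq]) simp_all
qed

lemma avoid_sets [measurable]:
  assumes "B \<in> sets borel" shows "avoid B \<in> sets config_algebra"
proof -
  have "avoid B = (\<lambda>\<omega>. emeasure (count_space UNIV) (\<omega> \<inter> B)) -` {0} \<inter> space config_algebra"
    by (auto simp: avoid_def emeasure_count_space_eq_0)
  also have "\<dots> \<in> sets config_algebra"
    by (rule measurable_sets[OF measurable_count_config[OF assms]]) simp
  finally show ?thesis .
qed

section \<open>Void events generate the configuration algebra and determine laws\<close>

lemma finite_separated:
  fixes T :: "'a::metric_space set"
  assumes "finite T" shows "\<exists>e>0. \<forall>x\<in>T. \<forall>y\<in>T. x \<noteq> y \<longrightarrow> e \<le> dist x y"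
proof -
  \<comment> \<open>The inserted 1 keeps \<open>D\<close> nonempty when \<open>T\<close> has fewer
    than two points, so that \<open>Min D\<close> exists.\<close>
  define D where "D = insert 1 ((\<lambda>(x,y). dist x y) ` {(x, y) \<in> T \<times> T. x \<noteq> y})"
  have fin: "finite D" unfolding D_def using assms
    by (intro finite.insertI finite_imageI finite_subset[OF _ finite_cartesian_product[OF assms assms]]) auto
  have "0 < Min D" using fin by (subst Min_gr_iff) (auto simp: D_def)
  moreover have "\<forall>x\<in>T. \<forall>y\<in>T. x \<noteq> y \<longrightarrow> Min D \<le> dist x y"
  proof (intro ballI impI)
    fix x y assume "x \<in> T" "y \<in> T" "x \<noteq> y"
    then have "dist x y \<in> D" by (auto simp: D_def image_iff)
    then show "Min D \<le> dist x y" using fin by simp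
  qed
  ultimately show ?thesis by blast
qed

text \<open>Finitely many points have pairwise disjoint basic neighbourhoods because they are a
  positive distance apart; conversely, disjoint sets are hit at distinct points. For a countable
  basis the right-hand side is a countable union of finite intersections of hitting events, the
  complements of void events.\<close>

lemma le_card_iff_disjoint_basis:
  fixes A :: "'a::metric_space set"
  assumes fin: "finite A" and \<B>: "topological_basis \<B>"
  shows "n \<le> card A \<longleftrightarrow>
    (\<exists>\<U>. finite \<U> \<and> \<U> \<subseteq> \<B> \<and> disjoint \<U> \<and> card \<U> = n \<and> (\<forall>U\<in>\<U>. A \<inter> U \<noteq> {}))"
proof
  assume "n \<le> card A"
  then obtain T where T: "T \<subseteq> A" "card T = n" "finite T" using fin
    by (meson obtain_subset_with_card_n)
  obtain e where e: "e > 0" "\<And>x y. x \<in> T \<Longrightarrow> y \<in> T \<Longrightarrow> x \<noteq> y \<Longrightarrow> e \<le> dist x y"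
    using finite_separated[OF \<open>finite T\<close>] by blast
  have "\<exists>U\<in>\<B>. x \<in> U \<and> U \<subseteq> ball x (e/2)" for x
    using topological_basisE[OF \<B> open_ball, of x x "e/2"] e(1) by (metis centre_in_ball half_gt_zero)
  then obtain U where U: "\<And>x. U x \<in> \<B>" "\<And>x. x \<in> U x" "\<And>x. U x \<subseteq> ball x (e/2)" by metis
  have disj: "U x \<inter> U y = {}" if "x \<in> T" "y \<in> T" "x \<noteq> y" for x y
  proof -
    have "ball x (e/2) \<inter> ball y (e/2) = {}" using e(2)[OF that]
      by (auto simp: disjoint_iff) (smt (verit) dist_commute dist_triangle field_sum_of_halves)
    then show ?thesis using U(3)[of x] U(3)[of y] by blast
  qed
  have inj: "inj_on U T"
    using disj U(2) by (intro inj_onI) (metis disjoint_iff)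
  have "disjoint (U ` T)" using disj by (auto simp: disjoint_def)
  moreover have "card (U ` T) = n" using inj T by (simp add: card_image)
  moreover have "\<forall>V\<in>U ` T. A \<inter> V \<noteq> {}" using T U(2) by auto
  ultimately show "\<exists>\<U>. finite \<U> \<and> \<U> \<subseteq> \<B> \<and> disjoint \<U> \<and> card \<U> = n \<and> (\<forall>U\<in>\<U>. A \<inter> U \<noteq> {})"
    using T U(1) by (intro exI[of _ "U ` T"]) auto
next
  assume "\<exists>\<U>. finite \<U> \<and> \<U> \<subseteq> \<B> \<and> disjoint \<U> \<and> card \<U> = n \<and> (\<forall>U\<in>\<U>. A \<inter> U \<noteq> {})"
  then obtain \<U> where \<U>: "finite \<U>" "disjoint \<U>" "card \<U> = n" "\<forall>U\<in>\<U>. A \<inter> U \<noteq> {}" by blast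
  then have "\<forall>U\<in>\<U>. \<exists>y. y \<in> A \<inter> U" by blast
  then obtain x where x: "\<And>U. U \<in> \<U> \<Longrightarrow> x U \<in> A \<inter> U" by (auto dest!: bchoice)
  have "inj_on x \<U>"
  proof (rule inj_onI)
    fix U V assume "U \<in> \<U>" "V \<in> \<U>" "x U = x V"
    then have "U \<inter> V \<noteq> {}" using x by (metis IntD2 IntI empty_iff)
    then show "U = V" using \<open>disjoint \<U>\<close> \<open>U \<in> \<U>\<close> \<open>V \<in> \<U>\<close> by (auto simp: disjoint_def)
  qed
  then have "card \<U> \<le> card A" using x fin by (intro card_inj_on_le[of x]) auto
  then show "n \<le> card A" using \<U> by simp
qed

text \<open>The void events of bounded open sets suffice: counts of open sets are recovered by placing
  disjoint basic open sets, counts of Borel sets by a Dynkin argument.\<close>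

lemma measurable_configI:
  fixes f :: "'b \<Rightarrow> 'a::euclidean_space set"
  assumes f: "\<And>x. x \<in> space M \<Longrightarrow> f x \<in> configs"
    and avoid: "\<And>B. bounded B \<Longrightarrow> open B \<Longrightarrow> {x \<in> space M. f x \<inter> B = {}} \<in> sets M"
  shows "f \<in> M \<rightarrow>\<^sub>M config_algebra"
proof -
  define N where "N B x = emeasure (count_space UNIV) (f x \<inter> B)" for B x
  have Nfin: "N B x = of_nat (card (f x \<inter> B))" if "x \<in> space M" "bounded B" for x B
    using that f by (simp add: N_def emeasure_count_space configs_finite_Int)
  have Nopen: "N B \<in> borel_measurable M" if B: "bounded B" "open B" for B
  proof -
    obtain \<B> :: "'a set set" where \<B>: "countable \<B>" "topological_basis \<B>"
      using ex_countable_basis by blast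
    define \<C> where "\<C> n = {\<U>. finite \<U> \<and> \<U> \<subseteq> \<B> \<and> disjoint \<U> \<and> card \<U> = n}" for n
    have c: "countable (\<C> n)" for n unfolding \<C>_def
      by (rule countable_subset[OF _ countable_Collect_finite_subset[OF \<B>(1)]]) auto
    have ge: "{x \<in> space M. n \<le> card (f x \<inter> B)} \<in> sets M" for n
    proof -
      have "{x \<in> space M. n \<le> card (f x \<inter> B)} =
        (\<Union>\<U>\<in>\<C> n. {x \<in> space M. \<forall>U\<in>\<U>. f x \<inter> B \<inter> U \<noteq> {}})"
      proof -
        have "n \<le> card (f x \<inter> B) \<longleftrightarrow> (\<exists>\<U>\<in>\<C> n. \<forall>U\<in>\<U>. f x \<inter> B \<inter> U \<noteq> {})" if "x \<in> space M" for x
          using le_card_iff_disjoint_basis[OF configs_finite_Int[OF f[OF that] B(1)] \<B>(2), of n]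
          by (auto simp: \<C>_def)
        then show ?thesis by auto
      qed
      also have "\<dots> \<in> sets M"
      proof (rule sets.countable_UN''[OF c])
        fix \<U> assume "\<U> \<in> \<C> n"
        then have \<U>: "finite \<U>" "\<And>U. U \<in> \<U> \<Longrightarrow> open U" 
          using topological_basis_open[OF \<B>(2)] by (auto simp: \<C>_def)
        show "{x \<in> space M. \<forall>U\<in>\<U>. f x \<inter> B \<inter> U \<noteq> {}} \<in> sets M"
        proof (rule sets.sets_Collect_finite_All[OF _ \<U>(1)])
          fix U assume "U \<in> \<U>"
          then have "{x \<in> space M. f x \<inter> (B \<inter> U) = {}} \<in> sets M"
            using B \<U>(2) by (intro avoid) auto
          then show "{x \<in> space M. f x \<inter> B \<inter> U \<noteq> {}} \<in> sets M"
            by (intro sets.sets_Collect_neg) (simp add: Int_assoc)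
        qed
      qed
      finally show ?thesis .
    qed
    have "{x \<in> space M. card (f x \<inter> B) = n} = 
        {x \<in> space M. n \<le> card (f x \<inter> B)} - {x \<in> space M. Suc n \<le> card (f x \<inter> B)}" for n by auto
    then have "{x \<in> space M. card (f x \<inter> B) = n} \<in> sets M" for n using ge by auto
    then have "(\<lambda>x. card (f x \<inter> B)) \<in> M \<rightarrow>\<^sub>M count_space UNIV"
      by (subst measurable_count_space_eq2_countable) (auto simp: vimage_def Int_def conj_commute)
    then have "(\<lambda>x. of_nat (card (f x \<inter> B)) :: ennreal) \<in> borel_measurable M" 
      by (rule measurable_compose) simp
    then show ?thesis using Nfin B by (subst measurable_cong) auto
  qed
  \<comment> \<open>The fixed bounded window \<open>V\<close> keeps all counts finite, so that the
    complement case may subtract.\<close>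
  have N: "N (B \<inter> V) \<in> borel_measurable M" if B: "B \<in> sets borel" and V: "bounded V" "open V" for B V
  proof -
    have Int: "Int_stable {S::'a set. open S}" by (auto simp: Int_stable_def)
    have "B \<in> sigma_sets UNIV {S. open S}" using B by (simp add: borel_def)
    with Int subset_UNIV[of "{S::'a set. open S}", folded Pow_UNIV] show ?thesis
    proof (induction rule: sigma_sets_induct_disjoint)
      case (basic A)
      then show ?case using V by (intro Nopen) auto
    next
      case empty
      then show ?case by (simp add: N_def)
    next
      case (compl A)
      have eq: "N ((UNIV - A) \<inter> V) x = N V x - N (A \<inter> V) x" if "x \<in> space M" for x
      proof -
        have fin: "finite (f x \<inter> V)" using f[OF that] V by (auto intro: configs_finite_Int)
        have "f x \<inter> ((UNIV - A) \<inter> V) = (f x \<inter> V) - (f x \<inter> (A \<inter> V))" by auto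
        moreover have "emeasure (count_space UNIV) ((f x \<inter> V) - (f x \<inter> (A \<inter> V))) = 
          emeasure (count_space UNIV) (f x \<inter> V) - emeasure (count_space UNIV) (f x \<inter> (A \<inter> V))"
          using fin finite_subset[of "f x \<inter> (A \<inter> V)" "f x \<inter> V"]
          by (intro emeasure_Diff) (auto simp: emeasure_count_space)
        ultimately show ?thesis by (simp add: N_def)
      qed
      have "(\<lambda>x. N V x - N (A \<inter> V) x) \<in> borel_measurable M"
        using compl Nopen[OF V] by measurable
      then show ?case
        by (rule measurable_cong[of M "N ((UNIV - A) \<inter> V)", THEN iffD2, rotated]) (rule eq)
    next
      case (union A)
      have "N (\<Union> (range A) \<inter> V) x = (\<Sum>i. N (A i \<inter> V) x)" for x
      proof -
        have "f x \<inter> (\<Union> (range A) \<inter> V) = (\<Union>i. f x \<inter> (A i \<inter> V))" by auto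
        moreover have "(\<Sum>i. emeasure (count_space UNIV) (f x \<inter> (A i \<inter> V))) = emeasure (count_space UNIV) (\<Union>i. f x \<inter> (A i \<inter> V))"
          using union(1) by (intro suminf_emeasure) (auto simp: disjoint_family_on_def)
        ultimately show ?thesis by (simp add: N_def)
      qed
      then show ?case using union by simp
    qed
  qed
  show ?thesis unfolding config_algebra_def
  proof (rule measurable_measure_of)
    fix Y :: "'a set set"
    assume "Y \<in> {{\<omega> \<in> configs. card (\<omega> \<inter> \<Delta>) \<in> K} | \<Delta> K. bounded_borel \<Delta>}"
    then obtain \<Delta> K where \<Delta>: "bounded \<Delta>" "\<Delta> \<in> sets borel"
      and Y: "Y = {\<omega> \<in> configs. card (\<omega> \<inter> \<Delta>) \<in> K}" by auto
    obtain r where r: "\<Delta> \<subseteq> ball 0 r" using bounded_subset_ballD[OF \<Delta>(1)] by blast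
    have "N \<Delta> \<in> borel_measurable M"
      using N[OF \<Delta>(2), of "ball 0 r"] r by (simp add: Int_absorb2)
    moreover have "of_nat ` K \<in> sets (borel :: ennreal measure)"
      by (rule sets.countable) (simp_all add: countable_image[OF countableI_type])
    ultimately have m: "N \<Delta> -` (of_nat ` K) \<inter> space M \<in> sets M" by (rule measurable_sets)
    have "x \<in> f -` Y \<longleftrightarrow> x \<in> N \<Delta> -` (of_nat ` K)" if "x \<in> space M" for x
      using f[OF that] Nfin[OF that \<Delta>(1)] unfolding Y by auto
    then have "f -` Y \<inter> space M = N \<Delta> -` (of_nat ` K) \<inter> space M" by blast
    then show "f -` Y \<inter> space M \<in> sets M" using m by simp
  qed (use f in auto)
qed

text \<open>The nontrivial inclusion is \<open>measurable_configI\<close> applied to the identity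
  map on the algebra generated by the void events.\<close>

lemma sets_config_algebra_avoid:
  "sets config_algebra = sigma_sets configs {avoid B |B :: 'a::euclidean_space set. bounded B \<and> open B}"
    (is "_ = sigma_sets _ ?E")
proof
  have sub: "?E \<subseteq> Pow configs" by (auto simp: avoid_def)
  have "(\<lambda>\<omega>. \<omega>) \<in> sigma configs ?E \<rightarrow>\<^sub>M config_algebra"
  proof (rule measurable_configI)
    fix B :: "'a set" assume "bounded B" "open B"
    then have "avoid B \<in> sets (sigma configs ?E)" using sub by auto
    then show "{x \<in> space (sigma configs ?E). x \<inter> B = {}} \<in> sets (sigma configs ?E)"
      using sub by (simp add: avoid_def)
  qed (use sub in auto)
  then have 1: "(\<lambda>\<omega>. \<omega>) -` A \<inter> space (sigma configs ?E) \<in> sets (sigma configs ?E)"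
    if "A \<in> sets config_algebra" for A using that by (rule measurable_sets)
  show "sets config_algebra \<subseteq> sigma_sets configs ?E"
  proof
    fix A :: "'a set set" assume A: "A \<in> sets config_algebra"
    then have "A \<subseteq> configs" using sets.sets_into_space[of A config_algebra] by simp
    then have "(\<lambda>\<omega>. \<omega>) -` A \<inter> space (sigma configs ?E) = A" using sub by auto
    with 1[OF A] show "A \<in> sigma_sets configs ?E" using sub by simp
  qed
  have "?E \<subseteq> sets config_algebra" by (auto intro!: avoid_sets)
  then show "sigma_sets configs ?E \<subseteq> sets config_algebra"
    using sets.sigma_sets_subset[of ?E config_algebra] by simp
qed

text \<open>Renyi's uniqueness theorem: void events form an intersection-stable generator, since
  avoiding \<open>A\<close> and \<open>B\<close> means avoiding their union. Several identities of
  laws below are checked on void probabilities only.\<close>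

lemma config_measure_eqI:
  fixes M N :: "'a::euclidean_space set measure"
  assumes sets: "sets M = sets config_algebra" "sets N = sets config_algebra"
    and fin: "finite_measure M"
    and eq: "\<And>B. bounded B \<Longrightarrow> open B \<Longrightarrow> emeasure M (avoid B) = emeasure N (avoid B)"
  shows "M = N"
proof (rule measure_eqI_generator_eq[where \<Omega>=configs and E="{avoid B |B :: 'a set. bounded B \<and> open B}" and A="\<lambda>_. avoid {}"])
  show "Int_stable {avoid B |B :: 'a set. bounded B \<and> open B}"
  proof (rule Int_stableI)
    fix a b assume "a \<in> {avoid B |B :: 'a set. bounded B \<and> open B}" "b \<in> {avoid B |B :: 'a set. bounded B \<and> open B}"
    then obtain A B where "a = avoid A" "b = avoid B" "bounded A" "bounded B" "open A" "open B" by auto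
    moreover have "avoid A \<inter> avoid B = avoid (A \<union> B)" by (auto simp: avoid_def)
    ultimately show "a \<inter> b \<in> {avoid B |B :: 'a set. bounded B \<and> open B}" by auto
  qed
  show "emeasure M (avoid {}) \<noteq> \<infinity>" using finite_measure.emeasure_finite[OF fin] by simp
  show "{avoid B |B :: 'a set. bounded B \<and> open B} \<subseteq> Pow configs" by (auto simp: avoid_def)
  show "range (\<lambda>_. avoid {}) \<subseteq> {avoid B |B :: 'a set. bounded B \<and> open B}" by auto
  show "(\<Union>i::nat. avoid {}) = (configs :: 'a set set)" by (simp add: avoid_def)
qed (use eq in \<open>auto simp: sets sets_config_algebra_avoid\<close>)

section \<open>Measurability of restriction, union and translation\<close>

lemma measurable_restrict_config:
  assumes "\<Delta> \<in> sets borel"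
  shows "(\<lambda>\<omega>. \<omega> \<inter> \<Delta>) \<in> config_algebra \<rightarrow>\<^sub>M (config_algebra :: 'a::euclidean_space set measure)"
proof (rule measurable_configI)
  fix B :: "'a set" assume "open B"
  then have "avoid (\<Delta> \<inter> B) \<in> sets config_algebra" using assms by (intro avoid_sets) auto
  then show "{x \<in> space config_algebra. x \<inter> \<Delta> \<inter> B = {}} \<in> sets config_algebra"
    by (simp add: avoid_def Int_assoc)
qed (auto intro: configs_subset)

lemma measurable_Diff_config:
  assumes "\<Delta> \<in> sets borel"
  shows "(\<lambda>\<omega>. \<omega> - \<Delta>) \<in> config_algebra \<rightarrow>\<^sub>M (config_algebra :: 'a::euclidean_space set measure)"
  using measurable_restrict_config[of "- \<Delta>"] assms by (simp add: Diff_eq borel_comp)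

lemma measurable_Un_config:
  assumes f: "f \<in> M \<rightarrow>\<^sub>M config_algebra" and g: "g \<in> M \<rightarrow>\<^sub>M config_algebra"
  shows "(\<lambda>x. f x \<union> g x) \<in> M \<rightarrow>\<^sub>M (config_algebra :: 'a::euclidean_space set measure)"
proof (rule measurable_configI)
  fix B :: "'a set" assume "open B"
  then have B: "avoid B \<in> sets config_algebra" by (intro avoid_sets) auto
  have "{x \<in> space M. (f x \<union> g x) \<inter> B = {}} = (f -` avoid B \<inter> space M) \<inter> (g -` avoid B \<inter> space M)"
    using measurable_space[OF f] measurable_space[OF g] by (auto simp: avoid_def)
  also have "\<dots> \<in> sets M" using measurable_sets[OF f B] measurable_sets[OF g B] by auto
  finally show "{x \<in> space M. (f x \<union> g x) \<inter> B = {}} \<in> sets M" .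
qed (use measurable_space[OF f] measurable_space[OF g] in \<open>auto intro: configs_Un\<close>)

text \<open>Joint measurability in vector and configuration is needed for the averages. By
  continuity of addition, u + x lies in the open set \<open>B\<close> iff basic neighbourhoods U of
  u and V of x have their sum in \<open>B\<close>; so hitting \<open>B\<close> after the shift is a
  countable union of products of U with the event of hitting V.\<close>

lemma measurable_shift_config:
  "(\<lambda>(u, \<omega>). (+) u ` \<omega>) \<in> borel \<Otimes>\<^sub>M config_algebra \<rightarrow>\<^sub>M (config_algebra :: 'a::euclidean_space set measure)"
proof (rule measurable_configI)
  let ?M = "borel \<Otimes>\<^sub>M (config_algebra :: 'a set measure)"
  fix B :: "'a set" assume B: "open B"
  obtain \<B> :: "'a set set" where \<B>: "countable \<B>" "topological_basis \<B>"
    using ex_countable_basis by blast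
  define \<C> where "\<C> = {(U, V) \<in> \<B> \<times> \<B>. \<forall>u\<in>U. \<forall>v\<in>V. u + v \<in> B}"
  have c: "countable \<C>" unfolding \<C>_def
    by (rule countable_subset[OF _ countable_SIGMA[OF \<B>(1) \<B>(1)]]) auto
  have ex: "\<exists>(U, V)\<in>\<C>. u \<in> U \<and> x \<in> V" if "u + x \<in> B" for u x
  proof -
    have "open ((\<lambda>p::'a\<times>'a. fst p + snd p) -` B)"
      using B by (intro open_vimage continuous_intros) auto
    moreover have "(u, x) \<in> (\<lambda>p::'a\<times>'a. fst p + snd p) -` B" using that by simp
    ultimately obtain U' V' where UV: "open U'" "open V'" "(u, x) \<in> U' \<times> V'"
        "U' \<times> V' \<subseteq> (\<lambda>p. fst p + snd p) -` B"
      by (rule open_prod_elim)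
    then have mem: "u \<in> U'" "x \<in> V'" and sum: "\<And>a b. a \<in> U' \<Longrightarrow> b \<in> V' \<Longrightarrow> a + b \<in> B" by auto
    obtain U where U: "U \<in> \<B>" "u \<in> U" "U \<subseteq> U'" using topological_basisE[OF \<B>(2) UV(1) mem(1)] by blast
    obtain V where V: "V \<in> \<B>" "x \<in> V" "V \<subseteq> V'" using topological_basisE[OF \<B>(2) UV(2) mem(2)] by blast
    have "\<forall>a\<in>U. \<forall>b\<in>V. a + b \<in> B" using U V sum by blast
    then have "(U, V) \<in> \<C>" using U V by (simp add: \<C>_def)
    then show ?thesis using U V by blast
  qed
  have "(\<Union>(U, V)\<in>\<C>. U \<times> (configs - avoid V)) \<in> sets ?M"
  proof (rule sets.countable_UN''[OF c])
    fix p assume "p \<in> \<C>"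
    then have "open (fst p)" "open (snd p)" using topological_basis_open[OF \<B>(2)] by (auto simp: \<C>_def)
    then show "(case p of (U, V) \<Rightarrow> U \<times> (configs - avoid V)) \<in> sets ?M"
      using sets.compl_sets[OF avoid_sets[of "snd p"]] by (auto simp: split_beta)
  qed
  also have "(\<Union>(U, V)\<in>\<C>. U \<times> (configs - avoid V)) = {p \<in> space ?M. (case p of (u, \<omega>) \<Rightarrow> (+) u ` \<omega>) \<inter> B \<noteq> {}}"
    (is "?L = ?R")
  proof
    show "?L \<subseteq> ?R" by (auto simp: \<C>_def avoid_def space_pair_measure) 
    show "?R \<subseteq> ?L" 
    proof
      fix p assume "p \<in> ?R"
      then obtain u \<omega> x where p: "p = (u, \<omega>)" "\<omega> \<in> configs" "x \<in> \<omega>" "u + x \<in> B" by (auto simp: space_pair_measure)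
      from ex[OF p(4)] obtain U V where "(U, V) \<in> \<C>" "u \<in> U" "x \<in> V" by auto
      then show "p \<in> ?L" using p by (intro UN_I[of "(U, V)"]) (auto simp: avoid_def)
    qed
  qed
  finally have "{p \<in> space ?M. (case p of (u, \<omega>) \<Rightarrow> (+) u ` \<omega>) \<inter> B \<noteq> {}} \<in> sets ?M" .
  from sets.compl_sets[OF this]
  show "{p \<in> space ?M. (case p of (u, \<omega>) \<Rightarrow> (+) u ` \<omega>) \<inter> B = {}} \<in> sets ?M"
    by (rule back_subst[of "\<lambda>X. X \<in> sets ?M"]) auto
qed (auto simp: space_pair_measure intro: configs_shift)

lemma measurable_shift_config1:
  "(\<lambda>\<omega>. (+) u ` \<omega>) \<in> config_algebra \<rightarrow>\<^sub>M (config_algebra :: 'a::euclidean_space set measure)"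
  using measurable_compose[OF measurable_Pair1' measurable_shift_config, of u] by simp

section \<open>Poisson processes\<close>

lemma poisson_avoid:
  assumes \<Delta>: "bounded_borel \<Delta>" and B: "B \<in> sets borel"
  shows "emeasure (poisson_process \<Delta>) (avoid B) = ennreal (exp (- measure lborel (B \<inter> \<Delta>)))"
proof -
  have "{x \<in> {..<n} \<rightarrow>\<^sub>E \<Delta>. x ` {..<n} \<in> avoid B} = {x \<in> {..<n} \<rightarrow>\<^sub>E \<Delta>. x ` {..<n} \<in> avoid (B \<inter> \<Delta>)}" for n :: nat
    by (auto simp: avoid_def)
  then have "poisson_content \<Delta> (avoid B) = poisson_content \<Delta> (avoid (B \<inter> \<Delta>))"
    by (simp add: poisson_content_def)
  also have "\<dots> = ennreal (exp (- measure lborel (B \<inter> \<Delta>)))"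
    using emeasure_poisson_process_void[OF \<Delta>, of "B \<inter> \<Delta>"] B \<Delta>
    by (subst emeasure_poisson_process[symmetric]) (auto simp: avoid_def[symmetric] intro!: avoid_sets)
  finally show ?thesis using \<Delta> B by (simp add: emeasure_poisson_process avoid_sets)
qed

section \<open>Superposition of independent Poisson processes\<close>

lemma measurable_poisson_process [simp]:
  "measurable (poisson_process \<Delta>) N = measurable config_algebra N"
  by (rule measurable_cong_sets) simp_all

lemma sigma_finite_poisson: "bounded_borel \<Delta> \<Longrightarrow> sigma_finite_measure (poisson_process \<Delta>)"
  using prob_space_poisson_process[of \<Delta>] prob_space_imp_sigma_finite by blast

lemma measurable_join_config:
  assumes "\<Delta>1 \<in> sets borel" "\<Delta>2 \<in> sets borel"
    and M: "sets M = sets config_algebra" and N: "sets N = sets config_algebra"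
  shows "(\<lambda>(a, b). (a \<inter> \<Delta>1) \<union> (b \<inter> \<Delta>2)) \<in> M \<Otimes>\<^sub>M N \<rightarrow>\<^sub>M (config_algebra :: 'a::euclidean_space set measure)"
proof -
  have "(\<lambda>p. (fst p \<inter> \<Delta>1) \<union> (snd p \<inter> \<Delta>2)) \<in> M \<Otimes>\<^sub>M N \<rightarrow>\<^sub>M config_algebra"
    using measurable_fst[of M N] measurable_snd[of M N] assms(1,2)
    by (intro measurable_Un_config measurable_compose[OF _ measurable_restrict_config])
       (simp_all add: measurable_cong_sets[OF refl M] measurable_cong_sets[OF refl N])
  then show ?thesis by (simp add: split_beta')
qed

text \<open>Void probabilities factorise because exp turns the additivity of Lebesgue measure into a
  product. Each sample is cut to its own region, since \<open>poisson_process\<close> lives inside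
  its region only up to a null set.\<close>

lemma poisson_superposition:
  fixes \<Delta>1 \<Delta>2 :: "'a::euclidean_space set"
  assumes \<Delta>: "bounded_borel \<Delta>1" "bounded_borel \<Delta>2" and disj: "\<Delta>1 \<inter> \<Delta>2 = {}"
  shows "distr (poisson_process \<Delta>1 \<Otimes>\<^sub>M poisson_process \<Delta>2) config_algebra (\<lambda>(a, b). (a \<inter> \<Delta>1) \<union> (b \<inter> \<Delta>2))
    = poisson_process (\<Delta>1 \<union> \<Delta>2)" (is "?D = _")
proof (rule config_measure_eqI)
  let ?p1 = "poisson_process \<Delta>1" and ?p2 = "poisson_process \<Delta>2"
  interpret p1: prob_space ?p1 by (rule prob_space_poisson_process) fact
  interpret p2: prob_space ?p2 by (rule prob_space_poisson_process) fact
  interpret p: pair_prob_space ?p1 ?p2 ..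
  note [measurable] = measurable_join_config[of \<Delta>1 \<Delta>2 ?p1 ?p2, simplified \<Delta> sets_poisson_process simp_thms]
  have m: "(\<lambda>(a, b). (a \<inter> \<Delta>1) \<union> (b \<inter> \<Delta>2)) \<in> ?p1 \<Otimes>\<^sub>M ?p2 \<rightarrow>\<^sub>M config_algebra"
    using \<Delta> by (intro measurable_join_config) auto
  then interpret D: prob_space ?D by (rule p.prob_space_distr)
  show "finite_measure ?D" by (rule D.finite_measure_axioms)
  show "sets ?D = sets config_algebra" by simp
  show "sets (poisson_process (\<Delta>1 \<union> \<Delta>2)) = sets config_algebra" by simp
  fix B :: "'a set" assume "open B" "bounded B"
  then have B: "B \<in> sets borel" by auto
  have "emeasure ?D (avoid B) = emeasure (?p1 \<Otimes>\<^sub>M ?p2) ((\<lambda>(a, b). (a \<inter> \<Delta>1) \<union> (b \<inter> \<Delta>2)) -` avoid B \<inter> space (?p1 \<Otimes>\<^sub>M ?p2))"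
    using B by (intro emeasure_distr m avoid_sets)
  also have "(\<lambda>(a, b). (a \<inter> \<Delta>1) \<union> (b \<inter> \<Delta>2)) -` avoid B \<inter> space (?p1 \<Otimes>\<^sub>M ?p2) = avoid (B \<inter> \<Delta>1) \<times> avoid (B \<inter> \<Delta>2)"
    by (auto simp: avoid_def space_pair_measure intro: configs_Un configs_subset)
  also have "emeasure (?p1 \<Otimes>\<^sub>M ?p2) (avoid (B \<inter> \<Delta>1) \<times> avoid (B \<inter> \<Delta>2)) =
      emeasure ?p1 (avoid (B \<inter> \<Delta>1)) * emeasure ?p2 (avoid (B \<inter> \<Delta>2))"
    using B \<Delta> by (intro p2.emeasure_pair_measure_Times) (auto intro!: avoid_sets)
  also have "\<dots> = ennreal (exp (- (measure lborel (B \<inter> \<Delta>1) + measure lborel (B \<inter> \<Delta>2))))"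
    using poisson_avoid[OF \<Delta>(1), of "B \<inter> \<Delta>1"] poisson_avoid[OF \<Delta>(2), of "B \<inter> \<Delta>2"]
      sets.Int[OF B, of \<Delta>1] sets.Int[OF B, of \<Delta>2] \<Delta>
    by (simp add: Int_assoc ennreal_mult[symmetric] mult_exp_exp)
  also have "measure lborel (B \<inter> \<Delta>1) + measure lborel (B \<inter> \<Delta>2) = measure lborel ((B \<inter> \<Delta>1) \<union> (B \<inter> \<Delta>2))"
  proof (rule measure_Union[symmetric])
    show "emeasure lborel (B \<inter> \<Delta>1) \<noteq> \<infinity>" "emeasure lborel (B \<inter> \<Delta>2) \<noteq> \<infinity>"
      using emeasure_bounded_finite[of "B \<inter> \<Delta>1"] emeasure_bounded_finite[of "B \<inter> \<Delta>2"] \<Delta> by auto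
  qed (use B \<Delta> disj in auto)
  also have "(B \<inter> \<Delta>1) \<union> (B \<inter> \<Delta>2) = B \<inter> (\<Delta>1 \<union> \<Delta>2)" by auto
  finally show "emeasure ?D (avoid B) = emeasure (poisson_process (\<Delta>1 \<union> \<Delta>2)) (avoid B)"
    using B \<Delta> by (subst poisson_avoid) auto
qed

lemma nn_integral_poisson_Un:
  fixes F :: "'a::euclidean_space set \<Rightarrow> ennreal"
  assumes \<Delta>: "bounded_borel \<Delta>1" "bounded_borel \<Delta>2" and disj: "\<Delta>1 \<inter> \<Delta>2 = {}"
    and F: "F \<in> borel_measurable config_algebra"
  shows "(\<integral>\<^sup>+\<omega>. F \<omega> \<partial>poisson_process (\<Delta>1 \<union> \<Delta>2)) =
    (\<integral>\<^sup>+a. \<integral>\<^sup>+b. F ((a \<inter> \<Delta>1) \<union> (b \<inter> \<Delta>2)) \<partial>poisson_process \<Delta>2 \<partial>poisson_process \<Delta>1)"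
proof -
  let ?p1 = "poisson_process \<Delta>1" and ?p2 = "poisson_process \<Delta>2"
  interpret p2: sigma_finite_measure ?p2 by (rule sigma_finite_poisson) fact
  have m: "(\<lambda>(a, b). (a \<inter> \<Delta>1) \<union> (b \<inter> \<Delta>2)) \<in> ?p1 \<Otimes>\<^sub>M ?p2 \<rightarrow>\<^sub>M config_algebra"
    using \<Delta> by (intro measurable_join_config) auto
  have "(\<integral>\<^sup>+\<omega>. F \<omega> \<partial>poisson_process (\<Delta>1 \<union> \<Delta>2)) = (\<integral>\<^sup>+p. F (case p of (a, b) \<Rightarrow> (a \<inter> \<Delta>1) \<union> (b \<inter> \<Delta>2)) \<partial>(?p1 \<Otimes>\<^sub>M ?p2))"
    unfolding poisson_superposition[OF assms(1-3), symmetric]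
    using F m by (intro nn_integral_distr) auto
  also have "\<dots> = (\<integral>\<^sup>+a. \<integral>\<^sup>+b. F (case (a, b) of (a, b) \<Rightarrow> (a \<inter> \<Delta>1) \<union> (b \<inter> \<Delta>2)) \<partial>?p2 \<partial>?p1)"
    by (rule p2.nn_integral_fst[symmetric]) (rule measurable_compose[OF m F])
  finally show ?thesis by simp
qed

text \<open>Keep only the event that \<open>\<Lambda>' - \<Lambda>\<close> is empty, whose
  probability is the reciprocal of the prefactor. It serves to enlarge a cube until it contains all
  cells of a tiling.\<close>

lemma nn_integral_poisson_le_restrict:
  fixes F :: "'a::euclidean_space set \<Rightarrow> ennreal"
  assumes \<Lambda>: "bounded_borel \<Lambda>" "bounded_borel \<Lambda>'" "\<Lambda> \<subseteq> \<Lambda>'"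
    and F: "F \<in> borel_measurable config_algebra"
  shows "(\<integral>\<^sup>+\<omega>. F (\<omega> \<inter> \<Lambda>) \<partial>poisson_process \<Lambda>) \<le>
     ennreal (exp (measure lborel (\<Lambda>' - \<Lambda>))) * (\<integral>\<^sup>+\<omega>. F (\<omega> \<inter> \<Lambda>') \<partial>poisson_process \<Lambda>')"
proof -
  let ?R = "\<Lambda>' - \<Lambda>"
  have R: "bounded_borel ?R" using \<Lambda> by (auto intro: bounded_subset)
  have F1: "(\<lambda>\<omega>. F (\<omega> \<inter> \<Lambda>)) \<in> borel_measurable config_algebra" if "\<Lambda> \<in> sets borel" for \<Lambda>
    by (rule measurable_compose[OF measurable_restrict_config[OF that] F])
  have "(\<integral>\<^sup>+\<omega>. F (\<omega> \<inter> \<Lambda>') \<partial>poisson_process \<Lambda>') = 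
      (\<integral>\<^sup>+a. \<integral>\<^sup>+b. F (((a \<inter> \<Lambda>) \<union> (b \<inter> ?R)) \<inter> \<Lambda>') \<partial>poisson_process ?R \<partial>poisson_process \<Lambda>)"
    using nn_integral_poisson_Un[OF \<Lambda>(1) R _ F1[of \<Lambda>']] \<Lambda> by (simp add: Un_absorb1)
  also have "\<dots> \<ge> (\<integral>\<^sup>+a. \<integral>\<^sup>+b. F (a \<inter> \<Lambda>) * indicator (avoid ?R) b \<partial>poisson_process ?R \<partial>poisson_process \<Lambda>)"
  proof (intro nn_integral_mono)
    fix a b
    have "b \<inter> ?R = {} \<Longrightarrow> ((a \<inter> \<Lambda>) \<union> (b \<inter> ?R)) \<inter> \<Lambda>' = a \<inter> \<Lambda>" using \<Lambda> by auto
    then show "F (a \<inter> \<Lambda>) * indicator (avoid ?R) b \<le> F (((a \<inter> \<Lambda>) \<union> (b \<inter> ?R)) \<inter> \<Lambda>')"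
      by (auto simp: avoid_def split: split_indicator)
  qed
  also have "(\<integral>\<^sup>+a. \<integral>\<^sup>+b. F (a \<inter> \<Lambda>) * indicator (avoid ?R) b \<partial>poisson_process ?R \<partial>poisson_process \<Lambda>)
    = (\<integral>\<^sup>+a. F (a \<inter> \<Lambda>) * ennreal (exp (- measure lborel ?R)) \<partial>poisson_process \<Lambda>)"
    using R poisson_avoid[OF R, of ?R]
    by (intro nn_integral_cong) (subst nn_integral_cmult_indicator, auto intro!: avoid_sets)
  also have "\<dots> = (\<integral>\<^sup>+a. F (a \<inter> \<Lambda>) \<partial>poisson_process \<Lambda>) * ennreal (exp (- measure lborel ?R))"
    using \<Lambda> F1 by (intro nn_integral_multc) auto
  finally have "ennreal (exp (measure lborel ?R)) * ((\<integral>\<^sup>+a. F (a \<inter> \<Lambda>) \<partial>poisson_process \<Lambda>) * ennreal (exp (- measure lborel ?R)))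
    \<le> ennreal (exp (measure lborel ?R)) * (\<integral>\<^sup>+\<omega>. F (\<omega> \<inter> \<Lambda>') \<partial>poisson_process \<Lambda>')"
    by (rule mult_left_mono) simp
  moreover have "ennreal (exp (measure lborel ?R)) * (x * ennreal (exp (- measure lborel ?R))) = x" for x
    by (simp add: mult.left_commute mult.commute[of x] ennreal_mult[symmetric] mult_exp_exp)
       (simp add: mult.assoc[symmetric] ennreal_mult[symmetric] mult_exp_exp)
  ultimately show ?thesis by simp
qed

section \<open>Translation covariance\<close>

lemma shift_vimage: "(+) (- u) -` S = (+) u ` (S :: 'a::group_add set)"
proof (intro set_eqI iffI)
  fix x assume "x \<in> (+) (- u) -` S"
  then have "x = u + (- u + x)" "- u + x \<in> S" by (simp_all add: add.assoc[symmetric])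
  then show "x \<in> (+) u ` S" by blast
qed (auto simp: add.assoc[symmetric])

lemma measure_lborel_shift:
  assumes "S \<in> sets borel"
  shows "measure lborel ((+) u ` S) = measure lborel (S :: 'a::euclidean_space set)"
proof -
  have "(+) (- u) -` S \<inter> space borel \<in> sets borel" using assms by (intro measurable_sets) auto
  then have "measure lborel ((+) u ` S) = measure lborel ((+) (- u) -` S \<inter> space lborel)" by (simp add: shift_vimage)
  also have "\<dots> = measure (distr lborel borel ((+) (- u))) S"
    using assms by (intro measure_distr[symmetric]) auto
  also have "\<dots> = measure lborel S" by (simp add: lborel_distr_plus)
  finally show ?thesis .
qed

lemma bounded_borel_shift:
  assumes "bounded_borel \<Delta>" shows "bounded_borel ((+) u ` (\<Delta> :: 'a::euclidean_space set))"
proof -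
  have "(+) (- u) -` \<Delta> \<inter> space borel \<in> sets borel" using assms by (intro measurable_sets) auto
  then show ?thesis using assms bounded_translation[of \<Delta> u] by (simp add: shift_vimage)
qed

lemma poisson_shift:
  fixes \<Delta> :: "'a::euclidean_space set"
  assumes \<Delta>: "bounded_borel \<Delta>"
  shows "distr (poisson_process \<Delta>) config_algebra (\<lambda>\<omega>. (+) u ` \<omega>) = poisson_process ((+) u ` \<Delta>)" (is "?D = _")
proof (rule config_measure_eqI)
  interpret p: prob_space "poisson_process \<Delta>" by (rule prob_space_poisson_process) fact
  have m: "(\<lambda>\<omega>. (+) u ` \<omega>) \<in> poisson_process \<Delta> \<rightarrow>\<^sub>M config_algebra"
    unfolding measurable_poisson_process by (rule measurable_shift_config1)
  then interpret D: prob_space ?D by (rule p.prob_space_distr)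
  show "finite_measure ?D" by (rule D.finite_measure_axioms)
  fix B :: "'a set" assume B: "bounded B" "open B"
  have B': "(+) (- u) ` B = (+) u -` B" using shift_vimage[of "- u" B] unfolding minus_minus by (rule sym)
  have s: "bounded_borel ((+) (- u) ` B)" using B by (intro bounded_borel_shift) auto
  have "emeasure ?D (avoid B) = emeasure (poisson_process \<Delta>) ((\<lambda>\<omega>. (+) u ` \<omega>) -` avoid B \<inter> space (poisson_process \<Delta>))"
    using B by (intro emeasure_distr m avoid_sets) auto
  also have "(\<lambda>\<omega>. (+) u ` \<omega>) -` avoid B \<inter> space (poisson_process \<Delta>) = avoid ((+) (- u) ` B)"
    unfolding B' by (auto simp: avoid_def configs_shift)
  also have "emeasure (poisson_process \<Delta>) \<dots> = ennreal (exp (- measure lborel ((+) (- u) ` B \<inter> \<Delta>)))"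
    using s \<Delta> by (intro poisson_avoid) auto
  also have "measure lborel ((+) (- u) ` B \<inter> \<Delta>) = measure lborel ((+) u ` ((+) (- u) ` B \<inter> \<Delta>))"
    using s \<Delta> by (intro measure_lborel_shift[symmetric]) auto
  also have "(+) u ` ((+) (- u) ` B \<inter> \<Delta>) = B \<inter> (+) u ` \<Delta>"
    unfolding B' by auto
  finally show "emeasure ?D (avoid B) = emeasure (poisson_process ((+) u ` \<Delta>)) (avoid B)"
    using poisson_avoid[OF bounded_borel_shift[OF \<Delta>], of B u] B by simp
qed simp_all

section \<open>Expectations and exponential moments of Poisson processes\<close>

lemma nn_integral_poisson:
  fixes F :: "'a::euclidean_space set \<Rightarrow> ennreal"
  assumes \<Delta>: "bounded_borel \<Delta>" and F: "F \<in> borel_measurable config_algebra"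
  shows "(\<integral>\<^sup>+\<omega>. F \<omega> \<partial>poisson_process \<Delta>) = ennreal (exp (- measure lborel \<Delta>)) *
     (\<Sum>n. (\<integral>\<^sup>+x. F (x ` {..<n}) * indicator ({..<n} \<rightarrow>\<^sub>E \<Delta>) x \<partial>(\<Pi>\<^sub>M i\<in>{..<n}. lborel)) / fact n)"
  (is "_ = ?c * (\<Sum>n. ?T F n / fact n)")
  using F
proof (induction rule: borel_measurable_induct)
  case (cong f g)
  have "(\<integral>\<^sup>+\<omega>. f \<omega> \<partial>poisson_process \<Delta>) = (\<integral>\<^sup>+\<omega>. g \<omega> \<partial>poisson_process \<Delta>)"
    using cong by (intro nn_integral_cong) simp
  moreover have "f (x ` {..<n}) = g (x ` {..<n})" for x and n :: nat
    using cong by (simp add: finite_in_configs)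
  ultimately show ?case using cong by simp
next
  case (set A)
  have "?T (indicator A) n = emeasure (\<Pi>\<^sub>M i\<in>{..<n}. lborel) {x \<in> {..<n} \<rightarrow>\<^sub>E \<Delta>. x ` {..<n} \<in> A}" for n :: nat
  proof -
    have "?T (indicator A) n = (\<integral>\<^sup>+x. indicator {x \<in> {..<n} \<rightarrow>\<^sub>E \<Delta>. x ` {..<n} \<in> A} x \<partial>(\<Pi>\<^sub>M i\<in>{..<n}. lborel))"
      by (intro nn_integral_cong) (auto split: split_indicator)
    also have "\<dots> = emeasure (\<Pi>\<^sub>M i\<in>{..<n}. lborel) {x \<in> {..<n} \<rightarrow>\<^sub>E \<Delta>. x ` {..<n} \<in> A}"
      using set \<Delta> by (intro nn_integral_indicator poisson_content_sets) auto
    finally show ?thesis .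
  qed
  then show ?case using set \<Delta> by (simp add: emeasure_poisson_process poisson_content_def)
next
  note mi [measurable] = measurable_image_config
  have ind [measurable]: "({..<n} \<rightarrow>\<^sub>E \<Delta>) \<in> sets (\<Pi>\<^sub>M i\<in>{..<n}. lborel)" for n :: nat
    using \<Delta> by (intro sets_PiM_I_finite) auto
  {
    case (mult u c)
    have [measurable]: "u \<in> borel_measurable config_algebra" by fact
    have "?T (\<lambda>x. c * u x) n = c * ?T u n" for n :: nat
      by (subst nn_integral_cmult[symmetric]) (auto simp: mult.assoc)
    then show ?case using mult by (simp add: nn_integral_cmult mult.left_commute ennreal_times_divide[symmetric])
  next
    case (add u v)
    have [measurable]: "u \<in> borel_measurable config_algebra" "v \<in> borel_measurable config_algebra" by fact+
    have "?T (\<lambda>x. v x + u x) n = ?T v n + ?T u n" for n :: nat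
      by (subst nn_integral_add[symmetric]) (auto simp: distrib_right)
    then show ?case using add by (simp add: nn_integral_add distrib_left add_divide_distrib_ennreal suminf_add[symmetric])
  next
    case (seq U)
    have [measurable]: "U i \<in> borel_measurable config_algebra" for i by fact
    have inc: "incseq (\<lambda>i x. U i (x ` {..<n}) * indicator ({..<n} \<rightarrow>\<^sub>E \<Delta>) x)" for n :: nat
      using \<open>incseq U\<close> by (auto simp: incseq_def le_fun_def split: split_indicator)
    have T: "?T (SUP i. U i) n = (SUP i. ?T (U i) n)" for n :: nat
    proof -
      have "?T (SUP i. U i) n = (\<integral>\<^sup>+x. (SUP i. U i (x ` {..<n}) * indicator ({..<n} \<rightarrow>\<^sub>E \<Delta>) x) \<partial>(\<Pi>\<^sub>M i\<in>{..<n}. lborel))"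
        by (intro nn_integral_cong) (simp add: SUP_mult_right_ennreal image_comp)
      also have "\<dots> = (SUP i. ?T (U i) n)"
        using inc by (intro nn_integral_monotone_convergence_SUP) auto
      finally show ?thesis .
    qed
    have "(\<integral>\<^sup>+\<omega>. (SUP i. U i) \<omega> \<partial>poisson_process \<Delta>) = (SUP i. \<integral>\<^sup>+\<omega>. U i \<omega> \<partial>poisson_process \<Delta>)"
      using \<open>incseq U\<close> by (simp add: image_comp nn_integral_monotone_convergence_SUP)
    also have "\<dots> = ?c * (SUP i. \<Sum>n. ?T (U i) n / fact n)"
      by (simp add: seq.IH SUP_mult_left_ennreal)
    also have "(SUP i. \<Sum>n. ?T (U i) n / fact n) = (\<Sum>n. SUP i. ?T (U i) n / fact n)"
    proof (rule ennreal_suminf_SUP_eq[symmetric])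
      fix n show "incseq (\<lambda>i. ?T (U i) n / fact n)"
        using inc[of n] by (intro incseq_SucI divide_right_mono_ennreal nn_integral_mono) (auto simp: incseq_def le_fun_def)
    qed
    also have "\<dots> = (\<Sum>n. ?T (SUP i. U i) n / fact n)"
      unfolding T by (simp add: divide_ennreal_def SUP_mult_right_ennreal)
    finally show ?case .
  }
qed

text \<open>The expansion becomes an exponential series in exp a times the volume. Coinciding
  coordinates only lower the number of points, so the estimate \<open>card \<le> n\<close> replaces
  the argument that they have measure zero; the factor exp (- volume) is dropped as well.\<close>

lemma poisson_exp_moment:
  fixes a :: real and \<Delta> :: "'a::euclidean_space set"
  assumes \<Delta>: "bounded_borel \<Delta>" and a: "0 \<le> a"
  shows "(\<integral>\<^sup>+\<omega>. ennreal (exp (a * card (\<omega> \<inter> \<Delta>))) \<partial>poisson_process \<Delta>) \<le> ennreal (exp (exp a * measure lborel \<Delta>))"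
proof -
  interpret product_sigma_finite "\<lambda>_::nat. lborel :: 'a measure" ..
  let ?m = "measure lborel \<Delta>"
  have fin: "emeasure lborel \<Delta> = ennreal ?m"
    using \<Delta> emeasure_bounded_finite[of \<Delta>] by (intro emeasure_eq_ennreal_measure) auto
  have ind: "({..<n} \<rightarrow>\<^sub>E \<Delta>) \<in> sets (\<Pi>\<^sub>M i\<in>{..<n}. lborel)" for n :: nat
    using \<Delta> by (intro sets_PiM_I_finite) auto
  have m: "(\<lambda>\<omega>. ennreal (exp (a * card (\<omega> \<inter> \<Delta>)))) \<in> borel_measurable config_algebra"
    by (rule measurable_compose[OF measurable_card_config[OF \<Delta>]]) simp
  have T: "(\<integral>\<^sup>+x. ennreal (exp (a * card (x ` {..<n} \<inter> \<Delta>))) * indicator ({..<n} \<rightarrow>\<^sub>E \<Delta>) x \<partial>(\<Pi>\<^sub>M i\<in>{..<n}. lborel)) / fact n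
     \<le> ennreal ((exp a * ?m) ^ n / fact n)" for n :: nat
  proof -
    have "card (x ` {..<n} \<inter> \<Delta>) \<le> n" for x
      by (metis card_image_le card_lessThan card_mono finite_imageI finite_lessThan inf_le1 le_trans)
    then have "(\<integral>\<^sup>+x. ennreal (exp (a * card (x ` {..<n} \<inter> \<Delta>))) * indicator ({..<n} \<rightarrow>\<^sub>E \<Delta>) x \<partial>(\<Pi>\<^sub>M i\<in>{..<n}. lborel))
      \<le> (\<integral>\<^sup>+x. ennreal (exp (a * n)) * indicator ({..<n} \<rightarrow>\<^sub>E \<Delta>) x \<partial>(\<Pi>\<^sub>M i\<in>{..<n}. lborel))"
      using a by (intro nn_integral_mono mult_right_mono ennreal_leI) (auto intro!: mult_left_mono)
    also have "\<dots> = ennreal (exp (a * n)) * ennreal ?m ^ n"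
      using ind \<Delta> by (subst nn_integral_cmult_indicator) (auto simp: emeasure_PiM fin)
    also have "\<dots> = ennreal ((exp a * ?m) ^ n)"
      by (simp add: ennreal_mult[symmetric] ennreal_power power_mult_distrib exp_of_nat2_mult)
    finally have le: "(\<integral>\<^sup>+x. ennreal (exp (a * card (x ` {..<n} \<inter> \<Delta>))) * indicator ({..<n} \<rightarrow>\<^sub>E \<Delta>) x \<partial>(\<Pi>\<^sub>M i\<in>{..<n}. lborel))
       \<le> ennreal ((exp a * ?m) ^ n)" .
    have "(fact n :: ennreal) = ennreal (fact n)"
      using ennreal_of_nat_eq_real_of_nat[of "fact n"] by simp
    with divide_right_mono_ennreal[OF le, of "fact n"] show ?thesis
      by (simp add: divide_ennreal)
  qed
  have "(\<lambda>n. (exp a * ?m) ^ n / fact n) sums exp (exp a * ?m)"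
    using exp_converges[of "exp a * ?m"] by (simp add: divide_inverse mult.commute)
  then have "(\<Sum>n. ennreal ((exp a * ?m) ^ n / fact n)) = ennreal (exp (exp a * ?m))"
    by (intro suminf_ennreal_eq) auto
  moreover have "(\<Sum>n. (\<integral>\<^sup>+x. ennreal (exp (a * card (x ` {..<n} \<inter> \<Delta>))) * indicator ({..<n} \<rightarrow>\<^sub>E \<Delta>) x \<partial>(\<Pi>\<^sub>M i\<in>{..<n}. lborel)) / fact n)
    \<le> (\<Sum>n. ennreal ((exp a * ?m) ^ n / fact n))"
    using T by (intro suminf_le) auto
  ultimately have "(\<integral>\<^sup>+\<omega>. ennreal (exp (a * card (\<omega> \<inter> \<Delta>))) \<partial>poisson_process \<Delta>)
     \<le> ennreal (exp (- ?m)) * ennreal (exp (exp a * ?m))"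
    unfolding nn_integral_poisson[OF \<Delta> m] by (intro mult_left_mono) auto
  also have "\<dots> \<le> 1 * ennreal (exp (exp a * ?m))"
    by (intro mult_right_mono) (auto simp: ennreal_le_1)
  finally show ?thesis by simp
qed

text \<open>The weight exp (a * card) is multiplicative over disjoint regions and the Poisson
  process is independent over them, so one cell after another splits off. What remains of
  \<open>\<Lambda>\<close> at the end contributes its exponential moment.\<close>

lemma poisson_cells_bound:
  fixes B :: "'i \<Rightarrow> 'a::euclidean_space set" and f :: "'i \<Rightarrow> 'a set \<Rightarrow> ennreal" and a :: real
  assumes "finite J" and a: "0 \<le> a"
    and "\<And>j. j \<in> J \<Longrightarrow> bounded_borel (B j)" "disjoint_family_on B J"
    and "\<And>j. j \<in> J \<Longrightarrow> f j \<in> borel_measurable config_algebra"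
    and "bounded_borel \<Lambda>" "(\<Union>j\<in>J. B j) \<subseteq> \<Lambda>"
  shows "(\<integral>\<^sup>+\<omega>. ennreal (exp (a * card (\<omega> \<inter> \<Lambda>))) * (\<Prod>j\<in>J. f j (\<omega> \<inter> B j)) \<partial>poisson_process \<Lambda>) \<le>
     ennreal (exp (exp a * measure lborel \<Lambda>)) *
     (\<Prod>j\<in>J. \<integral>\<^sup>+\<omega>. ennreal (exp (a * card (\<omega> \<inter> B j))) * f j (\<omega> \<inter> B j) \<partial>poisson_process (B j))"
  using assms(1,3-)
proof (induction J arbitrary: \<Lambda> rule: finite_induct)
  case empty
  then show ?case using poisson_exp_moment[of \<Lambda> a] a by simp
next
  case (insert i J)
  let ?R = "\<Lambda> - B i"
  let ?e = "\<lambda>\<Lambda> \<omega>. ennreal (exp (a * card (\<omega> \<inter> \<Lambda>)))"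
  have Bi: "bounded_borel (B i)" and R: "bounded_borel ?R" and disj: "\<And>j. j \<in> J \<Longrightarrow> B j \<inter> B i = {}"
    using insert by (auto intro: bounded_subset simp: disjoint_family_on_def)
  have fm: "(\<lambda>\<omega>. f j (\<omega> \<inter> B j)) \<in> borel_measurable config_algebra" if "j \<in> insert i J" for j
    using insert.prems that by (intro measurable_compose[OF measurable_restrict_config, of "B j" "f j"]) auto
  have em: "?e \<Delta> \<in> borel_measurable config_algebra" if "bounded_borel \<Delta>" for \<Delta>
    by (rule measurable_compose[OF measurable_card_config[OF that]]) simp
  have m: "(\<lambda>\<omega>. ?e \<Lambda> \<omega> * (\<Prod>j\<in>insert i J. f j (\<omega> \<inter> B j))) \<in> borel_measurable config_algebra"
    using fm em insert.prems by (intro borel_measurable_times_ennreal borel_measurable_prod) auto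
  have mJ: "(\<lambda>\<omega>. ?e ?R \<omega> * (\<Prod>j\<in>J. f j (\<omega> \<inter> B j))) \<in> borel_measurable config_algebra"
    using fm em R by (intro borel_measurable_times_ennreal borel_measurable_prod) auto
  have mi: "(\<lambda>\<omega>. ?e (B i) \<omega> * f i (\<omega> \<inter> B i)) \<in> borel_measurable config_algebra"
    using fm em Bi by (intro borel_measurable_times_ennreal) auto
  have \<Lambda>: "?R \<union> B i = \<Lambda>" using insert.prems by auto
  have "(\<integral>\<^sup>+\<omega>. ?e \<Lambda> \<omega> * (\<Prod>j\<in>insert i J. f j (\<omega> \<inter> B j)) \<partial>poisson_process \<Lambda>) =
    (\<integral>\<^sup>+x. \<integral>\<^sup>+y. ?e \<Lambda> ((x \<inter> ?R) \<union> (y \<inter> B i)) * (\<Prod>j\<in>insert i J. f j (((x \<inter> ?R) \<union> (y \<inter> B i)) \<inter> B j))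
      \<partial>poisson_process (B i) \<partial>poisson_process ?R)"
    using nn_integral_poisson_Un[OF R Bi _ m, unfolded \<Lambda>] by auto
  also have "\<dots> = (\<integral>\<^sup>+x. \<integral>\<^sup>+y. (?e ?R x * (\<Prod>j\<in>J. f j (x \<inter> B j))) * (?e (B i) y * f i (y \<inter> B i))
      \<partial>poisson_process (B i) \<partial>poisson_process ?R)"
  proof (intro nn_integral_cong)
    fix x y assume "x \<in> space (poisson_process ?R)" "y \<in> space (poisson_process (B i))"
    then have fin: "finite (x \<inter> ?R)" "finite (y \<inter> B i)" using R Bi by (auto intro: configs_finite_Int)
    have c: "card (((x \<inter> ?R) \<union> (y \<inter> B i)) \<inter> \<Lambda>) = card (x \<inter> ?R) + card (y \<inter> B i)"
    proof -
      have "((x \<inter> ?R) \<union> (y \<inter> B i)) \<inter> \<Lambda> = (x \<inter> ?R) \<union> (y \<inter> B i)" using \<Lambda> by auto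
      then show ?thesis using fin by (simp add: card_Un_disjoint disjoint_iff)
    qed
    have "((x \<inter> ?R) \<union> (y \<inter> B i)) \<inter> B i = y \<inter> B i" by auto
    moreover have "((x \<inter> ?R) \<union> (y \<inter> B i)) \<inter> B j = x \<inter> B j" if "j \<in> J" for j
      using disj[OF that] insert.prems that by auto
    ultimately show "?e \<Lambda> ((x \<inter> ?R) \<union> (y \<inter> B i)) * (\<Prod>j\<in>insert i J. f j (((x \<inter> ?R) \<union> (y \<inter> B i)) \<inter> B j)) =
       (?e ?R x * (\<Prod>j\<in>J. f j (x \<inter> B j))) * (?e (B i) y * f i (y \<inter> B i))"
      using insert.hyps unfolding c
      by (simp add: distrib_left exp_add ennreal_mult ac_simps)
  qed
  also have "\<dots> = (\<integral>\<^sup>+x. ?e ?R x * (\<Prod>j\<in>J. f j (x \<inter> B j)) \<partial>poisson_process ?R) * 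
      (\<integral>\<^sup>+y. ?e (B i) y * f i (y \<inter> B i) \<partial>poisson_process (B i))"
    using mJ mi by (simp add: nn_integral_cmult nn_integral_multc)
  also have "\<dots> \<le> (ennreal (exp (exp a * measure lborel ?R)) *
     (\<Prod>j\<in>J. \<integral>\<^sup>+\<omega>. ?e (B j) \<omega> * f j (\<omega> \<inter> B j) \<partial>poisson_process (B j))) * 
      (\<integral>\<^sup>+y. ?e (B i) y * f i (y \<inter> B i) \<partial>poisson_process (B i))"
    using insert.prems R disj by (intro mult_right_mono insert.IH) (auto simp: disjoint_family_on_def)
  also have "\<dots> = ennreal (exp (exp a * measure lborel ?R)) *
     (\<Prod>j\<in>insert i J. \<integral>\<^sup>+\<omega>. ?e (B j) \<omega> * f j (\<omega> \<inter> B j) \<partial>poisson_process (B j))"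
    using insert.hyps by (simp add: ac_simps)
  also have "\<dots> \<le> ennreal (exp (exp a * measure lborel \<Lambda>)) *
     (\<Prod>j\<in>insert i J. \<integral>\<^sup>+\<omega>. ?e (B j) \<omega> * f j (\<omega> \<inter> B j) \<partial>poisson_process (B j))"
    using insert.prems emeasure_bounded_finite[of \<Lambda>] R
    by (intro mult_right_mono ennreal_leI) (auto intro!: measure_mono_fmeasurable fmeasurableI)
  finally show ?case .
qed

section \<open>Finite-volume Gibbs measures\<close>

lemma exp_minus_measurable [measurable]: "exp_minus \<in> borel_measurable borel"
  unfolding exp_minus_def[abs_def] by measurable

lemma exp_minus_nonneg [simp]: "0 \<le> exp_minus h"
  by (simp add: exp_minus_def)

lemma exp_minus_eq_0_iff [simp]: "exp_minus h = 0 \<longleftrightarrow> h = \<infinity>"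
  by (simp add: exp_minus_def)

lemma exp_minus_add:
  "x \<noteq> - \<infinity> \<Longrightarrow> \<bar>y\<bar> \<noteq> \<infinity> \<Longrightarrow> exp_minus (x - y) * exp_minus y = exp_minus x"
  by (cases x; cases y) (auto simp: exp_minus_def mult_exp_exp)

section \<open>Stable energies and the series of the local energy\<close>

locale stable_interaction =
  fixes H :: "'a::euclidean_space set \<Rightarrow> ereal" and a :: real
  assumes energy: "energy_function H"
    and a_nonneg: "0 \<le> a"
    and stable: "\<And>\<omega>. finite \<omega> \<Longrightarrow> ereal (- (a * card \<omega>)) \<le> H \<omega>"
begin

lemma H_not_MInf: "finite \<omega> \<Longrightarrow> H \<omega> \<noteq> - \<infinity>"
  using energy by (auto simp: energy_function_def)

lemma H_empty: "H {} < \<infinity>"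
  using energy by (auto simp: energy_function_def)

lemma H_shift: "finite \<omega> \<Longrightarrow> H ((+) u ` \<omega>) = H \<omega>"
  using energy by (auto simp: energy_function_def)

text \<open>The one-point removal in \<open>energy_function\<close>, iterated over the finite set of
  removed points.\<close>

lemma H_hereditary:
  assumes "finite \<omega>" "H \<omega> < \<infinity>" "\<eta> \<subseteq> \<omega>" shows "H \<eta> < \<infinity>"
proof -
  have her: "H (\<omega> - {x}) < \<infinity>" if "finite \<omega>" "x \<in> \<omega>" "H \<omega> < \<infinity>" for \<omega> x
    using energy that unfolding energy_function_def by metis
  have "finite \<zeta> \<Longrightarrow> finite \<eta> \<Longrightarrow> \<zeta> \<inter> \<eta> = {} \<Longrightarrow> H (\<eta> \<union> \<zeta>) < \<infinity> \<Longrightarrow> H \<eta> < \<infinity>" for \<zeta>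
  proof (induction \<zeta> rule: finite_induct)
    case (insert x \<zeta>)
    have "H (\<eta> \<union> insert x \<zeta> - {x}) < \<infinity>" using insert.prems insert.hyps by (intro her) auto
    moreover have "\<eta> \<union> insert x \<zeta> - {x} = \<eta> \<union> \<zeta>" using insert by auto
    ultimately show ?case using insert by auto
  qed simp
  from this[of "\<omega> - \<eta>"] show ?thesis using assms by (auto simp: Un_absorb1 intro: finite_subset)
qed

lemma exp_minus_H_le: "finite \<omega> \<Longrightarrow> exp_minus (H \<omega>) \<le> exp (a * card \<omega>)"
  using stable[of \<omega>] H_not_MInf[of \<omega>] by (cases "H \<omega>") (auto simp: exp_minus_def)

lemma measurable_H_restrict:
  assumes "bounded_borel \<Lambda>"
  shows "(\<lambda>\<omega>. H (\<omega> \<inter> \<Lambda>)) \<in> borel_measurable config_algebra"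
proof -
  have 1: "(\<lambda>\<omega>. \<omega> \<inter> \<Lambda>) \<in> config_algebra \<rightarrow>\<^sub>M finite_configs"
    unfolding finite_configs_def using assms
    by (intro measurable_restrict_space2 measurable_restrict_config) (auto intro: configs_finite_Int)
  have "H \<in> borel_measurable finite_configs" using energy by (simp add: energy_function_def)
  from measurable_compose[OF 1 this] show ?thesis .
qed

lemma measurable_energy_in:
  assumes "bounded_borel D" "\<Delta> \<in> sets borel"
  shows "energy_in H \<Delta> D \<in> borel_measurable config_algebra"
  unfolding energy_in_def[abs_def] using assms
  by (intro borel_measurable_ereal_diff measurable_H_restrict) (auto intro: bounded_subset)

lemma measurable_local_energy:
  assumes "\<And>l. bounded_borel (D l)" "\<Delta> \<in> sets borel"
  shows "local_energy H \<Delta> D \<in> borel_measurable config_algebra"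
  unfolding local_energy_def[abs_def] using assms
  by (intro borel_measurable_ereal_add borel_measurable_extreal_suminf borel_measurable_ereal_diff measurable_energy_in)

lemma energy_in_not_MInf:
  assumes "finite (\<omega> \<inter> D)" "H (\<omega> \<inter> (D - \<Delta>)) < \<infinity>"
  shows "energy_in H \<Delta> D \<omega> \<noteq> - \<infinity>"
proof -
  have "finite (\<omega> \<inter> (D - \<Delta>))" using assms(1) by (rule rev_finite_subset) auto
  then show ?thesis
    using H_not_MInf[OF assms(1)] H_not_MInf[of "\<omega> \<inter> (D - \<Delta>)"] assms(2)
    by (cases "H (\<omega> \<inter> D)"; cases "H (\<omega> \<inter> (D - \<Delta>))") (auto simp: energy_in_def)
qed

lemma energy_in_eq_PInf_iff:
  assumes "finite (\<omega> \<inter> D)" "H (\<omega> \<inter> (D - \<Delta>)) < \<infinity>"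
  shows "energy_in H \<Delta> D \<omega> = \<infinity> \<longleftrightarrow> H (\<omega> \<inter> D) = \<infinity>"
proof -
  have "finite (\<omega> \<inter> (D - \<Delta>))" using assms(1) by (rule rev_finite_subset) auto
  then show ?thesis
    using H_not_MInf[OF assms(1)] H_not_MInf[of "\<omega> \<inter> (D - \<Delta>)"] assms(2)
    by (cases "H (\<omega> \<inter> D)"; cases "H (\<omega> \<inter> (D - \<Delta>))") (auto simp: energy_in_def)
qed

text \<open>Heredity read backwards: a subconfiguration of infinite energy makes every larger
  configuration infinite. Infinite values therefore never revert to finite ones along
  \<open>D\<close>.\<close>

lemma energy_in_PInf_mono:
  assumes "\<And>l. finite (\<omega> \<inter> D l)" "incseq D" "\<And>l. H (\<omega> \<inter> (D l - \<Delta>)) < \<infinity>"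
    and "k \<le> l" "energy_in H \<Delta> (D k) \<omega> = \<infinity>"
  shows "energy_in H \<Delta> (D l) \<omega> = \<infinity>"
proof -
  have "\<omega> \<inter> D k \<subseteq> \<omega> \<inter> D l" using \<open>incseq D\<close> \<open>k \<le> l\<close> by (auto simp: incseq_def)
  then have "H (\<omega> \<inter> D l) < \<infinity> \<Longrightarrow> H (\<omega> \<inter> D k) < \<infinity>" by (rule H_hereditary[OF assms(1), rotated])
  then show ?thesis
    using assms(5) unfolding energy_in_eq_PInf_iff[OF assms(1,3)] by auto
qed

text \<open>The series telescopes once the first energy is finite. Later infinite energies do no
  harm, because they persist and \<infinity> - \<infinity> = \<infinity> in \<open>ereal\<close>; if
  already the first energy is infinite, both sides are infinite.\<close>

lemma local_energy_eqI:
  assumes fin: "\<And>l. finite (\<omega> \<inter> D l)" and inc: "incseq D"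
    and bd: "\<And>l. H (\<omega> \<inter> (D l - \<Delta>)) < \<infinity>"
    and lim: "(\<lambda>l. energy_in H \<Delta> (D l) \<omega>) \<longlonglongrightarrow> e"
  shows "local_energy H \<Delta> D \<omega> = e"
proof -
  let ?E = "\<lambda>l. energy_in H \<Delta> (D l) \<omega>"
  have nM: "?E l \<noteq> - \<infinity>" for l using energy_in_not_MInf[OF fin bd] .
  note mono = energy_in_PInf_mono[OF fin inc bd]
  show ?thesis
  proof (cases "?E 0 = \<infinity>")
    case True
    then have "?E l = \<infinity>" for l using mono[of 0 l] by simp
    then have "e = \<infinity>" using lim by (simp add: LIMSEQ_const_iff)
    then show ?thesis using True by (simp add: local_energy_def)
  next
    case False
    then obtain r where r: "?E 0 = ereal r" using nM[of 0] by (cases "?E 0") auto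
    have part: "(\<Sum>k<n. ?E (Suc k) - ?E k) = ?E n - ?E 0" for n
    proof (induction n)
      case 0
      then show ?case by (simp add: r zero_ereal_def)
    next
      case (Suc n)
      \<comment> \<open>The third premise excludes an infinite \<open>x\<close> followed by a finite
        \<open>y\<close>, where the left-hand side would be \<infinity> and the right-hand side
        finite.\<close>
      have "x \<noteq> - \<infinity> \<Longrightarrow> y \<noteq> - \<infinity> \<Longrightarrow> (x = \<infinity> \<Longrightarrow> y = \<infinity>) \<Longrightarrow> (x - ereal r) + (y - x) = y - ereal r" for x y
        by (cases x; cases y) auto
      from this[OF nM nM mono[of n "Suc n"]] show ?case by (simp add: Suc r)
    qed
    have "(\<lambda>n. ?E n - ?E 0) \<longlonglongrightarrow> e - ?E 0"
      using lim by (intro tendsto_diff_ereal_general tendsto_const) (auto simp: r)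
    then have "(\<lambda>k. ?E (Suc k) - ?E k) sums (e - ?E 0)"
      by (simp add: sums_def part)
    then have "local_energy H \<Delta> D \<omega> = ?E 0 + (e - ?E 0)"
      by (simp add: local_energy_def sums_iff)
    also have "\<dots> = e" by (cases e) (auto simp: r)
    finally show ?thesis .
  qed
qed

text \<open>The sets \<open>D l\<close> eventually contain the whole finite configuration, from
  where on the partial energies are constant.\<close>

lemma local_energy_finite:
  assumes fin: "finite \<omega>" and inc: "incseq D" and UN: "(\<Union>l. D l) = UNIV"
    and bd: "H (\<omega> - \<Delta>) < \<infinity>"
  shows "local_energy H \<Delta> D \<omega> = H \<omega> - H (\<omega> - \<Delta>)"
proof (rule local_energy_eqI)
  show "incseq D" by fact
  show "H (\<omega> \<inter> (D l - \<Delta>)) < \<infinity>" for l using fin bd H_hereditary[of "\<omega> - \<Delta>" "\<omega> \<inter> (D l - \<Delta>)"] by auto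
  have "\<exists>L. \<omega> \<subseteq> D L" using fin
  proof (induction \<omega> rule: finite_induct)
    case (insert x \<omega>)
    then obtain L where "\<omega> \<subseteq> D L" by blast
    moreover obtain M where "x \<in> D M" using UN by blast
    moreover have "D L \<subseteq> D (max L M)" "D M \<subseteq> D (max L M)" using inc by (simp_all add: incseqD)
    ultimately have "insert x \<omega> \<subseteq> D (max L M)" by blast
    then show ?case by blast
  qed simp
  then obtain L where L: "\<omega> \<subseteq> D L" by blast
  have "energy_in H \<Delta> (D l) \<omega> = H \<omega> - H (\<omega> - \<Delta>)" if "L \<le> l" for l
  proof -
    have "\<omega> \<subseteq> D l" using L inc that by (auto simp: incseq_def)
    then have "\<omega> \<inter> D l = \<omega>" "\<omega> \<inter> (D l - \<Delta>) = \<omega> - \<Delta>" by auto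
    then show ?thesis by (simp add: energy_in_def)
  qed
  then have "\<forall>\<^sub>F l in sequentially. energy_in H \<Delta> (D l) \<omega> = H \<omega> - H (\<omega> - \<Delta>)"
    by (auto simp: eventually_sequentially)
  then show "(\<lambda>l. energy_in H \<Delta> (D l) \<omega>) \<longlonglongrightarrow> H \<omega> - H (\<omega> - \<Delta>)"
    by (rule tendsto_eventually)
qed (use fin in auto)

section \<open>The Gibbs measure of a bounded set with empty surroundings\<close>

definition gibbs_weight :: "'a set \<Rightarrow> 'a set \<Rightarrow> ennreal" where
  "gibbs_weight \<Lambda> \<omega> = ennreal (exp_minus (H (\<omega> \<inter> \<Lambda>)))"

definition gibbs_norm :: "'a set \<Rightarrow> ennreal" where
  "gibbs_norm \<Lambda> = (\<integral>\<^sup>+\<omega>. gibbs_weight \<Lambda> \<omega> \<partial>poisson_process \<Lambda>)"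

text \<open>The restriction map is almost surely the identity here. Pushing forward under it makes
  \<open>\<omega> \<inter> \<Lambda>\<close> appear literally in every integral, without null-set
  arguments.\<close>

definition gibbs :: "'a set \<Rightarrow> 'a set measure" where
  "gibbs \<Lambda> = distr (density (poisson_process \<Lambda>) (\<lambda>\<omega>. gibbs_weight \<Lambda> \<omega> / gibbs_norm \<Lambda>))
     config_algebra (\<lambda>\<omega>. \<omega> \<inter> \<Lambda>)"

lemma sets_gibbs [simp, measurable_cong]: "sets (gibbs \<Lambda>) = sets config_algebra"
  by (simp add: gibbs_def)

lemma space_gibbs [simp]: "space (gibbs \<Lambda>) = configs"
  by (simp add: gibbs_def)

lemma measurable_gibbs [simp]: "measurable (gibbs \<Lambda>) N = measurable config_algebra N"
  by (rule measurable_cong_sets) simp_all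

lemma measurable_gibbs_weight:
  "bounded_borel \<Lambda> \<Longrightarrow> gibbs_weight \<Lambda> \<in> borel_measurable config_algebra"
  unfolding gibbs_weight_def[abs_def]
  by (intro measurable_compose[OF measurable_H_restrict measurable_compose[OF exp_minus_measurable]]) auto

lemma gibbs_weight_le:
  assumes "bounded_borel \<Lambda>" "\<omega> \<in> configs"
  shows "gibbs_weight \<Lambda> \<omega> \<le> ennreal (exp (a * card (\<omega> \<inter> \<Lambda>)))"
  unfolding gibbs_weight_def using assms by (intro ennreal_leI exp_minus_H_le) (auto intro: configs_finite_Int)

text \<open>The empty configuration alone bounds the normalisation from below by a quantity whose
  logarithm is of the order of the volume.\<close>

lemma gibbs_norm_ge:
  assumes "bounded_borel \<Lambda>"
  shows "ennreal (exp_minus (H {}) * exp (- measure lborel \<Lambda>)) \<le> gibbs_norm \<Lambda>"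
proof -
  have "ennreal (exp_minus (H {}) * exp (- measure lborel \<Lambda>)) =
    (\<integral>\<^sup>+\<omega>. ennreal (exp_minus (H {})) * indicator (avoid \<Lambda>) \<omega> \<partial>poisson_process \<Lambda>)"
    using assms poisson_avoid[OF assms, of \<Lambda>]
    by (subst nn_integral_cmult_indicator) (auto simp: ennreal_mult intro!: avoid_sets)
  also have "\<dots> \<le> gibbs_norm \<Lambda>"
    unfolding gibbs_norm_def by (intro nn_integral_mono) (auto simp: gibbs_weight_def avoid_def split: split_indicator)
  finally show ?thesis .
qed

lemma exp_minus_H_empty: "0 < exp_minus (H {})"
  using H_empty by (simp add: exp_minus_def)

lemma gibbs_norm_pos: "bounded_borel \<Lambda> \<Longrightarrow> 0 < gibbs_norm \<Lambda>"
  using exp_minus_H_empty by (intro less_le_trans[OF _ gibbs_norm_ge]) auto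

lemma gibbs_norm_finite:
  assumes "bounded_borel \<Lambda>" shows "gibbs_norm \<Lambda> < \<infinity>"
proof -
  have "gibbs_norm \<Lambda> \<le> (\<integral>\<^sup>+\<omega>. ennreal (exp (a * card (\<omega> \<inter> \<Lambda>))) \<partial>poisson_process \<Lambda>)"
    unfolding gibbs_norm_def using gibbs_weight_le[OF assms] by (intro nn_integral_mono) auto
  also have "\<dots> \<le> ennreal (exp (exp a * measure lborel \<Lambda>))"
    by (rule poisson_exp_moment[OF assms a_nonneg])
  finally show ?thesis by (rule le_less_trans) simp
qed

lemma nn_integral_gibbs:
  assumes \<Lambda>: "bounded_borel \<Lambda>" and F: "F \<in> borel_measurable config_algebra"
  shows "(\<integral>\<^sup>+\<omega>. F \<omega> \<partial>gibbs \<Lambda>) = (\<integral>\<^sup>+\<omega>. gibbs_weight \<Lambda> \<omega> * F (\<omega> \<inter> \<Lambda>) \<partial>poisson_process \<Lambda>) / gibbs_norm \<Lambda>"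
proof -
  note m = measurable_restrict_config[of \<Lambda>] measurable_gibbs_weight[OF \<Lambda>]
  have F': "(\<lambda>\<omega>. F (\<omega> \<inter> \<Lambda>)) \<in> borel_measurable config_algebra"
    using measurable_compose[OF m(1) F] \<Lambda> by simp
  have "(\<integral>\<^sup>+\<omega>. F \<omega> \<partial>gibbs \<Lambda>) = (\<integral>\<^sup>+\<omega>. F (\<omega> \<inter> \<Lambda>) \<partial>density (poisson_process \<Lambda>) (\<lambda>\<omega>. gibbs_weight \<Lambda> \<omega> / gibbs_norm \<Lambda>))"
    unfolding gibbs_def using F m \<Lambda> by (intro nn_integral_distr) auto
  also have "\<dots> = (\<integral>\<^sup>+\<omega>. (gibbs_weight \<Lambda> \<omega> / gibbs_norm \<Lambda>) * F (\<omega> \<inter> \<Lambda>) \<partial>poisson_process \<Lambda>)"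
    using F' m by (intro nn_integral_density) auto
  also have "\<dots> = (\<integral>\<^sup>+\<omega>. (gibbs_weight \<Lambda> \<omega> * F (\<omega> \<inter> \<Lambda>)) / gibbs_norm \<Lambda> \<partial>poisson_process \<Lambda>)"
    by (simp add: divide_ennreal_def ac_simps)
  also have "\<dots> = (\<integral>\<^sup>+\<omega>. gibbs_weight \<Lambda> \<omega> * F (\<omega> \<inter> \<Lambda>) \<partial>poisson_process \<Lambda>) / gibbs_norm \<Lambda>"
    using F' m by (intro nn_integral_divide) auto
  finally show ?thesis .
qed

lemma prob_space_gibbs:
  assumes "bounded_borel \<Lambda>" shows "prob_space (gibbs \<Lambda>)"
proof (rule prob_spaceI)
  have "emeasure (gibbs \<Lambda>) (space (gibbs \<Lambda>)) = (\<integral>\<^sup>+\<omega>. 1 \<partial>gibbs \<Lambda>)" by simp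
  also have "\<dots> = gibbs_norm \<Lambda> / gibbs_norm \<Lambda>"
    using nn_integral_gibbs[OF assms, of "\<lambda>_. 1"] by (simp add: gibbs_norm_def)
  also have "\<dots> = 1" using gibbs_norm_pos[OF assms] gibbs_norm_finite[OF assms]
    by (intro ennreal_divide_self) auto
  finally show "emeasure (gibbs \<Lambda>) (space (gibbs \<Lambda>)) = 1" .
qed

text \<open>Finite configurations of infinite energy have weight
  \<open>exp_minus \<infinity> = 0\<close>.\<close>

lemma AE_gibbsI:
  assumes \<Lambda>: "bounded_borel \<Lambda>" and S: "S \<in> sets config_algebra"
    and "\<And>\<omega>. finite \<omega> \<Longrightarrow> \<omega> \<subseteq> \<Lambda> \<Longrightarrow> H \<omega> < \<infinity> \<Longrightarrow> \<omega> \<in> S"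
  shows "emeasure (gibbs \<Lambda>) (configs - S) = 0"
proof -
  have S': "configs - S \<in> sets config_algebra" using sets.compl_sets[OF S] by simp
  have "emeasure (gibbs \<Lambda>) (configs - S) = (\<integral>\<^sup>+\<omega>. indicator (configs - S) \<omega> \<partial>gibbs \<Lambda>)"
    using S' by simp
  also have "\<dots> = (\<integral>\<^sup>+\<omega>. gibbs_weight \<Lambda> \<omega> * indicator (configs - S) (\<omega> \<inter> \<Lambda>) \<partial>poisson_process \<Lambda>) / gibbs_norm \<Lambda>"
    using S' by (intro nn_integral_gibbs[OF \<Lambda>]) simp
  also have "(\<integral>\<^sup>+\<omega>. gibbs_weight \<Lambda> \<omega> * indicator (configs - S) (\<omega> \<inter> \<Lambda>) \<partial>poisson_process \<Lambda>) = (\<integral>\<^sup>+\<omega>. 0 \<partial>poisson_process \<Lambda>)"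
  proof (intro nn_integral_cong)
    fix \<omega> assume "\<omega> \<in> space (poisson_process \<Lambda>)"
    then have "finite (\<omega> \<inter> \<Lambda>)" using \<Lambda> by (auto intro: configs_finite_Int)
    then show "gibbs_weight \<Lambda> \<omega> * indicator (configs - S) (\<omega> \<inter> \<Lambda>) = 0"
      using assms(3)[of "\<omega> \<inter> \<Lambda>"] by (auto simp: gibbs_weight_def less_top[symmetric] split: split_indicator)
  qed
  finally show ?thesis by simp
qed

lemma gibbs_shift:
  assumes \<Lambda>: "bounded_borel \<Lambda>"
  shows "distr (gibbs \<Lambda>) config_algebra (\<lambda>\<omega>. (+) u ` \<omega>) = gibbs ((+) u ` \<Lambda>)"
proof (rule measure_eqI)
  fix S assume "S \<in> sets (distr (gibbs \<Lambda>) config_algebra (\<lambda>\<omega>. (+) u ` \<omega>))"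
  then have S: "S \<in> sets config_algebra" by simp
  let ?u = "(+) u ` \<Lambda>"
  have u: "bounded_borel ?u" by (rule bounded_borel_shift[OF \<Lambda>])
  have ms: "(\<lambda>\<omega>. F ((+) u ` \<omega>)) \<in> borel_measurable config_algebra" if "F \<in> borel_measurable config_algebra" for F :: "'a set \<Rightarrow> ennreal"
    by (rule measurable_compose[OF measurable_shift_config1 that])
  have mr: "(\<lambda>\<omega>. F (\<omega> \<inter> ?u)) \<in> borel_measurable config_algebra" if "F \<in> borel_measurable config_algebra" for F :: "'a set \<Rightarrow> ennreal"
    using u by (intro measurable_compose[OF measurable_restrict_config that]) auto
  have Int: "(+) u ` \<omega> \<inter> ?u = (+) u ` (\<omega> \<inter> \<Lambda>)" for \<omega> by auto
  have *: "(\<integral>\<^sup>+\<omega>. F \<omega> \<partial>poisson_process ?u) = (\<integral>\<^sup>+\<omega>. F ((+) u ` \<omega>) \<partial>poisson_process \<Lambda>)"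
    if "F \<in> borel_measurable config_algebra" for F
    unfolding poisson_shift[OF \<Lambda>, symmetric] using that measurable_shift_config1
    by (intro nn_integral_distr) auto
  have w: "gibbs_weight ?u ((+) u ` \<omega>) = gibbs_weight \<Lambda> \<omega>" if "\<omega> \<in> configs" for \<omega>
    using that \<Lambda> by (simp add: gibbs_weight_def Int H_shift configs_finite_Int)
  have n: "gibbs_norm ?u = gibbs_norm \<Lambda>"
    unfolding gibbs_norm_def using w measurable_gibbs_weight[OF u]
    by (subst *) (auto intro!: nn_integral_cong)
  have "emeasure (distr (gibbs \<Lambda>) config_algebra (\<lambda>\<omega>. (+) u ` \<omega>)) S = (\<integral>\<^sup>+\<omega>. indicator S \<omega> \<partial>distr (gibbs \<Lambda>) config_algebra (\<lambda>\<omega>. (+) u ` \<omega>))"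
    using S by simp
  also have "\<dots> = (\<integral>\<^sup>+\<omega>. indicator S ((+) u ` \<omega>) \<partial>gibbs \<Lambda>)"
    using S measurable_shift_config1 by (intro nn_integral_distr) auto
  also have "\<dots> = (\<integral>\<^sup>+\<omega>. gibbs_weight \<Lambda> \<omega> * indicator S ((+) u ` (\<omega> \<inter> \<Lambda>)) \<partial>poisson_process \<Lambda>) / gibbs_norm \<Lambda>"
    using S ms by (intro nn_integral_gibbs[OF \<Lambda>]) auto
  also have "(\<integral>\<^sup>+\<omega>. gibbs_weight \<Lambda> \<omega> * indicator S ((+) u ` (\<omega> \<inter> \<Lambda>)) \<partial>poisson_process \<Lambda>) =
     (\<integral>\<^sup>+\<omega>. gibbs_weight ?u \<omega> * indicator S (\<omega> \<inter> ?u) \<partial>poisson_process ?u)"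
    using S w measurable_gibbs_weight[OF u] mr[of "indicator S"]
    by (subst *) (auto simp: Int intro!: nn_integral_cong)
  also have "\<dots> / gibbs_norm \<Lambda> = (\<integral>\<^sup>+\<omega>. indicator S \<omega> \<partial>gibbs ?u)"
    unfolding n[symmetric] using S by (intro nn_integral_gibbs[OF u, symmetric]) auto
  also have "\<dots> = emeasure (gibbs ?u) S" using S by simp
  finally show "emeasure (distr (gibbs \<Lambda>) config_algebra (\<lambda>\<omega>. (+) u ` \<omega>)) S = emeasure (gibbs ?u) S" .
qed simp

end

section \<open>Resampling the points of a bounded set\<close>

lemma measurable_resample:
  assumes "\<Delta> \<in> sets borel"
  shows "(\<lambda>(\<omega>, \<omega>'). \<omega>' \<inter> \<Delta> \<union> (\<omega> - \<Delta>)) \<in> config_algebra \<Otimes>\<^sub>M config_algebra \<rightarrow>\<^sub>M (config_algebra :: 'a::euclidean_space set measure)"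
proof -
  have "(\<lambda>(\<omega>, \<omega>'). (\<omega> \<inter> (- \<Delta>)) \<union> (\<omega>' \<inter> \<Delta>)) \<in> config_algebra \<Otimes>\<^sub>M config_algebra \<rightarrow>\<^sub>M (config_algebra :: 'a set measure)"
    using assms by (intro measurable_join_config) auto
  then show ?thesis by (simp add: Diff_eq Un_commute)
qed

lemma measurable_resample_integral:
  fixes F :: "'a::euclidean_space set \<Rightarrow> ennreal"
  assumes \<Delta>: "bounded_borel \<Delta>" and F: "F \<in> borel_measurable config_algebra"
  shows "(\<lambda>\<omega>. \<integral>\<^sup>+\<omega>'. F (\<omega>' \<inter> \<Delta> \<union> (\<omega> - \<Delta>)) \<partial>poisson_process \<Delta>) \<in> borel_measurable config_algebra"
proof -
  interpret sigma_finite_measure "poisson_process \<Delta>" by (rule sigma_finite_poisson) fact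
  have "(\<lambda>(\<omega>, \<omega>'). F (\<omega>' \<inter> \<Delta> \<union> (\<omega> - \<Delta>))) \<in> borel_measurable (config_algebra \<Otimes>\<^sub>M config_algebra)"
    using measurable_compose[OF measurable_resample F] \<Delta> by (simp add: split_beta')
  then have "(\<lambda>(\<omega>, \<omega>'). F (\<omega>' \<inter> \<Delta> \<union> (\<omega> - \<Delta>))) \<in> borel_measurable (config_algebra \<Otimes>\<^sub>M poisson_process \<Delta>)"
    by (simp add: measurable_cong_sets[OF sets_pair_measure_cong[OF refl sets_poisson_process]])
  then show ?thesis by (rule borel_measurable_nn_integral)
qed

context stable_interaction
begin

text \<open>The DLR equation of the finite-volume measure with its normalisation eliminated: the
  configuration outside \<open>\<Delta>\<close> is compared with the event that \<open>\<Delta>\<close> is empty, on which the local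
  energy vanishes.\<close>

lemma gibbs_resample:
  assumes \<Lambda>: "bounded_borel \<Lambda>" and \<Delta>: "bounded_borel \<Delta>" "\<Delta> \<subseteq> \<Lambda>"
    and D: "\<And>l. bounded_borel (D l)" "incseq D" "(\<Union>l. D l) = UNIV"
    and F: "F \<in> borel_measurable config_algebra"
  shows "(\<integral>\<^sup>+\<omega>. F \<omega> \<partial>gibbs \<Lambda>) = ennreal (exp (measure lborel \<Delta>)) *
    (\<integral>\<^sup>+\<omega>. indicator (avoid \<Delta>) \<omega> * (\<integral>\<^sup>+\<omega>'. F (\<omega>' \<inter> \<Delta> \<union> (\<omega> - \<Delta>)) *
      ennreal (exp_minus (local_energy H \<Delta> D (\<omega>' \<inter> \<Delta> \<union> (\<omega> - \<Delta>)))) \<partial>poisson_process \<Delta>) \<partial>gibbs \<Lambda>)"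
proof -
  let ?R = "\<Lambda> - \<Delta>"
  have R: "bounded_borel ?R" and RD: "?R \<union> \<Delta> = \<Lambda>" using \<Lambda> \<Delta> by (auto intro: bounded_subset)
  have Rdisj: "?R \<inter> \<Delta> = {}" by auto
  define K where "K \<omega> = F \<omega> * ennreal (exp_minus (local_energy H \<Delta> D \<omega>))" for \<omega>
  have K: "K \<in> borel_measurable config_algebra"
    unfolding K_def[abs_def] using D \<Delta> F
    by (intro borel_measurable_times_ennreal measurable_compose[OF measurable_local_energy measurable_compose[OF exp_minus_measurable]]) auto
  define \<Phi> where "\<Phi> \<omega> = (\<integral>\<^sup>+\<omega>'. K (\<omega>' \<inter> \<Delta> \<union> (\<omega> - \<Delta>)) \<partial>poisson_process \<Delta>)" for \<omega>
  have \<Phi>: "\<Phi> \<in> borel_measurable config_algebra"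
    unfolding \<Phi>_def[abs_def] by (rule measurable_resample_integral[OF \<Delta>(1) K])
  have m\<Phi>: "(\<lambda>\<omega>. indicator (avoid \<Delta>) \<omega> * \<Phi> \<omega>) \<in> borel_measurable config_algebra"
    using \<Phi> \<Delta> by (intro borel_measurable_times_ennreal borel_measurable_indicator avoid_sets) auto
  note mr = measurable_compose[OF measurable_restrict_config]
  have m1: "(\<lambda>\<omega>. gibbs_weight \<Lambda> \<omega> * (indicator (avoid \<Delta>) (\<omega> \<inter> \<Lambda>) * \<Phi> (\<omega> \<inter> \<Lambda>))) \<in> borel_measurable config_algebra"
    using \<Lambda> by (intro borel_measurable_times_ennreal mr[OF _ m\<Phi>] measurable_gibbs_weight) auto
  have m2: "(\<lambda>\<omega>. gibbs_weight \<Lambda> \<omega> * F (\<omega> \<inter> \<Lambda>)) \<in> borel_measurable config_algebra"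
    using \<Lambda> by (intro borel_measurable_times_ennreal mr[OF _ F] measurable_gibbs_weight) auto
  \<comment> \<open>Both sides with the outer points \<open>x \<inter> ?R\<close> held fixed. On the
    left only an empty \<open>y \<inter> \<Delta>\<close> contributes, which yields the factor exp
    (- \<lambda>(\<Delta>)) and leaves the weight of the outer points alone.\<close>
  have key: "(\<integral>\<^sup>+y. gibbs_weight \<Lambda> (x \<inter> ?R \<union> y \<inter> \<Delta>) *
        (indicator (avoid \<Delta>) ((x \<inter> ?R \<union> y \<inter> \<Delta>) \<inter> \<Lambda>) * \<Phi> ((x \<inter> ?R \<union> y \<inter> \<Delta>) \<inter> \<Lambda>)) \<partial>poisson_process \<Delta>)
     = ennreal (exp (- measure lborel \<Delta>)) *
       (\<integral>\<^sup>+y. gibbs_weight \<Lambda> (x \<inter> ?R \<union> y \<inter> \<Delta>) * F ((x \<inter> ?R \<union> y \<inter> \<Delta>) \<inter> \<Lambda>) \<partial>poisson_process \<Delta>)"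
    if x: "x \<in> configs" for x
  proof -
    have fx: "finite (x \<inter> ?R)" using x R by (auto intro: configs_finite_Int)
    have Int: "(x \<inter> ?R \<union> y \<inter> \<Delta>) \<inter> \<Lambda> = y \<inter> \<Delta> \<union> (x \<inter> ?R)" for y using \<Delta> by auto
    have "(\<integral>\<^sup>+y. gibbs_weight \<Lambda> (x \<inter> ?R \<union> y \<inter> \<Delta>) *
        (indicator (avoid \<Delta>) ((x \<inter> ?R \<union> y \<inter> \<Delta>) \<inter> \<Lambda>) * \<Phi> ((x \<inter> ?R \<union> y \<inter> \<Delta>) \<inter> \<Lambda>)) \<partial>poisson_process \<Delta>)
      = (\<integral>\<^sup>+y. (ennreal (exp_minus (H (x \<inter> ?R))) * \<Phi> (x \<inter> ?R)) * indicator (avoid \<Delta>) y \<partial>poisson_process \<Delta>)"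
    proof (intro nn_integral_cong)
      fix y assume "y \<in> space (poisson_process \<Delta>)"
      then have y: "y \<in> configs" by simp
      have c: "y \<inter> \<Delta> \<union> x \<inter> ?R \<in> configs"
        using x y by (auto intro: configs_Un configs_subset)
      show "gibbs_weight \<Lambda> (x \<inter> ?R \<union> y \<inter> \<Delta>) *
          (indicator (avoid \<Delta>) ((x \<inter> ?R \<union> y \<inter> \<Delta>) \<inter> \<Lambda>) * \<Phi> ((x \<inter> ?R \<union> y \<inter> \<Delta>) \<inter> \<Lambda>))
        = (ennreal (exp_minus (H (x \<inter> ?R))) * \<Phi> (x \<inter> ?R)) * indicator (avoid \<Delta>) y"
      proof (cases "y \<inter> \<Delta> = {}")
        case True
        then have "x \<inter> ?R \<inter> \<Lambda> = x \<inter> ?R" by auto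
        moreover have "x \<inter> ?R \<in> avoid \<Delta>" "y \<in> avoid \<Delta>" using True y c by (auto simp: avoid_def)
        ultimately show ?thesis using True by (simp add: gibbs_weight_def mult.assoc)
      next
        case False
        then show ?thesis unfolding Int by (auto simp: avoid_def split: split_indicator)
      qed
    qed
    also have "\<dots> = (ennreal (exp_minus (H (x \<inter> ?R))) * \<Phi> (x \<inter> ?R)) * ennreal (exp (- measure lborel \<Delta>))"
      using \<Delta> poisson_avoid[OF \<Delta>(1), of \<Delta>] by (subst nn_integral_cmult_indicator) (auto intro!: avoid_sets)
    also have "ennreal (exp_minus (H (x \<inter> ?R))) * \<Phi> (x \<inter> ?R) =
       (\<integral>\<^sup>+y. ennreal (exp_minus (H (x \<inter> ?R))) * K (y \<inter> \<Delta> \<union> (x \<inter> ?R - \<Delta>)) \<partial>poisson_process \<Delta>)"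
    proof -
      have "(\<lambda>y. K (y \<inter> \<Delta> \<union> (x \<inter> ?R - \<Delta>))) \<in> borel_measurable config_algebra"
        using measurable_compose[OF measurable_Pair1' measurable_compose[OF measurable_resample K], of "x \<inter> ?R"] \<Delta> x
        by (auto intro: configs_subset)
      then show ?thesis unfolding \<Phi>_def by (intro nn_integral_cmult[symmetric]) simp
    qed
    also have "\<dots> = (\<integral>\<^sup>+y. gibbs_weight \<Lambda> (x \<inter> ?R \<union> y \<inter> \<Delta>) * F ((x \<inter> ?R \<union> y \<inter> \<Delta>) \<inter> \<Lambda>) \<partial>poisson_process \<Delta>)"
    proof (intro nn_integral_cong)
      fix y assume "y \<in> space (poisson_process \<Delta>)"
      then have fy: "finite (y \<inter> \<Delta>)" using \<Delta> by (auto intro: configs_finite_Int)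
      let ?\<omega> = "y \<inter> \<Delta> \<union> (x \<inter> ?R)"
      have f: "finite ?\<omega>" using fx fy by simp
      have d: "x \<inter> ?R - \<Delta> = x \<inter> ?R" "?\<omega> - \<Delta> = x \<inter> ?R" by auto
      \<comment> \<open>The total energy is the outer energy plus the local energy. If the outer
        energy is infinite, so is the total one by heredity, and both sides vanish whatever value
        the local energy has.\<close>
      have "ennreal (exp_minus (H (x \<inter> ?R))) * ennreal (exp_minus (local_energy H \<Delta> D ?\<omega>)) = ennreal (exp_minus (H ?\<omega>))"
      proof (cases "H (x \<inter> ?R) < \<infinity>")
        case True
        then have "local_energy H \<Delta> D ?\<omega> = H ?\<omega> - H (x \<inter> ?R)"
          using local_energy_finite[OF f D(2,3), of \<Delta>] by (simp add: d)
        then show ?thesis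
          using exp_minus_add[of "H ?\<omega>" "H (x \<inter> ?R)"] H_not_MInf[OF f] H_not_MInf[OF fx] True
          by (auto simp: ennreal_mult[symmetric] mult.commute)
      next
        case False
        then have "H ?\<omega> = \<infinity>" using H_hereditary[OF f, of "x \<inter> ?R"] by auto
        moreover have "H (x \<inter> ?R) = \<infinity>" using False by simp
        ultimately show ?thesis by (simp add: exp_minus_def)
      qed
      from arg_cong[OF this, of "\<lambda>z. F ?\<omega> * z"]
      show "ennreal (exp_minus (H (x \<inter> ?R))) * K (y \<inter> \<Delta> \<union> (x \<inter> ?R - \<Delta>)) =
        gibbs_weight \<Lambda> (x \<inter> ?R \<union> y \<inter> \<Delta>) * F ((x \<inter> ?R \<union> y \<inter> \<Delta>) \<inter> \<Lambda>)"
        unfolding K_def d gibbs_weight_def Int by (simp add: ac_simps)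
    qed
    finally show ?thesis by (simp add: mult.commute)
  qed
  have "(\<integral>\<^sup>+\<omega>. indicator (avoid \<Delta>) \<omega> * \<Phi> \<omega> \<partial>gibbs \<Lambda>) =
     (\<integral>\<^sup>+\<omega>. gibbs_weight \<Lambda> \<omega> * (indicator (avoid \<Delta>) (\<omega> \<inter> \<Lambda>) * \<Phi> (\<omega> \<inter> \<Lambda>)) \<partial>poisson_process \<Lambda>) / gibbs_norm \<Lambda>"
    using m\<Phi> by (rule nn_integral_gibbs[OF \<Lambda>])
  also have "(\<integral>\<^sup>+\<omega>. gibbs_weight \<Lambda> \<omega> * (indicator (avoid \<Delta>) (\<omega> \<inter> \<Lambda>) * \<Phi> (\<omega> \<inter> \<Lambda>)) \<partial>poisson_process \<Lambda>) =
     (\<integral>\<^sup>+x. \<integral>\<^sup>+y. gibbs_weight \<Lambda> (x \<inter> ?R \<union> y \<inter> \<Delta>) *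
        (indicator (avoid \<Delta>) ((x \<inter> ?R \<union> y \<inter> \<Delta>) \<inter> \<Lambda>) * \<Phi> ((x \<inter> ?R \<union> y \<inter> \<Delta>) \<inter> \<Lambda>)) \<partial>poisson_process \<Delta> \<partial>poisson_process ?R)"
    using nn_integral_poisson_Un[OF R \<Delta>(1) _ m1, unfolded RD] by auto
  also have "\<dots> = (\<integral>\<^sup>+x. ennreal (exp (- measure lborel \<Delta>)) * 
      (\<integral>\<^sup>+y. gibbs_weight \<Lambda> (x \<inter> ?R \<union> y \<inter> \<Delta>) * F ((x \<inter> ?R \<union> y \<inter> \<Delta>) \<inter> \<Lambda>) \<partial>poisson_process \<Delta>) \<partial>poisson_process ?R)"
    using key by (intro nn_integral_cong) simp
  also have "\<dots> = ennreal (exp (- measure lborel \<Delta>)) * (\<integral>\<^sup>+x.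
      (\<integral>\<^sup>+y. gibbs_weight \<Lambda> (x \<inter> ?R \<union> y \<inter> \<Delta>) * F ((x \<inter> ?R \<union> y \<inter> \<Delta>) \<inter> \<Lambda>) \<partial>poisson_process \<Delta>) \<partial>poisson_process ?R)"
  proof (rule nn_integral_cmult)
    interpret sigma_finite_measure "poisson_process \<Delta>" by (rule sigma_finite_poisson) fact
    have "(\<lambda>(x, y). gibbs_weight \<Lambda> (x \<inter> ?R \<union> y \<inter> \<Delta>) * F ((x \<inter> ?R \<union> y \<inter> \<Delta>) \<inter> \<Lambda>))
      \<in> borel_measurable (poisson_process ?R \<Otimes>\<^sub>M poisson_process \<Delta>)"
      using measurable_compose[OF measurable_join_config[OF _ _ sets_poisson_process sets_poisson_process] m2, of ?R \<Delta>] R \<Delta>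
      by (simp add: split_beta')
    then show "(\<lambda>x. \<integral>\<^sup>+y. gibbs_weight \<Lambda> (x \<inter> ?R \<union> y \<inter> \<Delta>) * F ((x \<inter> ?R \<union> y \<inter> \<Delta>) \<inter> \<Lambda>) \<partial>poisson_process \<Delta>)
      \<in> borel_measurable (poisson_process ?R)"
      by (rule borel_measurable_nn_integral)
  qed
  also have "\<dots> = ennreal (exp (- measure lborel \<Delta>)) * (\<integral>\<^sup>+\<omega>. gibbs_weight \<Lambda> \<omega> * F (\<omega> \<inter> \<Lambda>) \<partial>poisson_process \<Lambda>)"
    by (simp only: nn_integral_poisson_Un[OF R \<Delta>(1) Rdisj m2, unfolded RD])
  finally have "(\<integral>\<^sup>+\<omega>. indicator (avoid \<Delta>) \<omega> * \<Phi> \<omega> \<partial>gibbs \<Lambda>) =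
     ennreal (exp (- measure lborel \<Delta>)) * (\<integral>\<^sup>+\<omega>. F \<omega> \<partial>gibbs \<Lambda>)"
    by (simp add: nn_integral_gibbs[OF \<Lambda> F] divide_ennreal_def mult.assoc)
  then have "ennreal (exp (measure lborel \<Delta>)) * (\<integral>\<^sup>+\<omega>. indicator (avoid \<Delta>) \<omega> * \<Phi> \<omega> \<partial>gibbs \<Lambda>) =
     (ennreal (exp (measure lborel \<Delta>)) * ennreal (exp (- measure lborel \<Delta>))) * (\<integral>\<^sup>+\<omega>. F \<omega> \<partial>gibbs \<Lambda>)"
    by (simp add: mult.assoc)
  also have "ennreal (exp (measure lborel \<Delta>)) * ennreal (exp (- measure lborel \<Delta>)) = 1"
    by (simp add: ennreal_mult[symmetric] mult_exp_exp)
  finally show ?thesis by (simp add: \<Phi>_def K_def)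
qed

end

section \<open>Averaging over translations\<close>

definition cube :: "real \<Rightarrow> 'a::euclidean_space set" where
  "cube r = cbox (- (r *\<^sub>R One)) (r *\<^sub>R One)"

lemma mem_cube: "x \<in> cube r \<longleftrightarrow> (\<forall>i\<in>Basis. \<bar>x \<bullet> i\<bar> \<le> r)"
  by (auto simp: cube_def mem_box abs_le_iff)

lemma bounded_borel_cube [simp]: "bounded (cube r)" "cube r \<in> sets borel"
  by (auto simp: cube_def)

lemma emeasure_cube:
  "0 \<le> r \<Longrightarrow> emeasure lborel (cube r :: 'a::euclidean_space set) = ennreal ((2 * r) ^ DIM('a))"
  unfolding cube_def by (subst emeasure_lborel_cbox) (auto simp: inner_Basis algebra_simps)

lemma measure_cube: "0 \<le> r \<Longrightarrow> measure lborel (cube r :: 'a::euclidean_space set) = (2 * r) ^ DIM('a)"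
  by (simp add: measure_def emeasure_cube)

lemma bounded_subset_cube:
  assumes "bounded (S :: 'a::euclidean_space set)" obtains q where "0 \<le> q" "S \<subseteq> cube q"
proof -
  obtain b where b: "\<And>x. x \<in> S \<Longrightarrow> norm x \<le> b" using assms by (auto simp: bounded_iff)
  have "S \<subseteq> cube (max 0 b)"
    using b by (auto simp: mem_cube intro!: max.coboundedI2 order_trans[OF Basis_le_norm])
  then show ?thesis using that[of "max 0 b"] by simp
qed

text \<open>Half-open, so that translates by distinct vectors of the lattice of mesh 2 k are
  disjoint; \<open>hbox 0\<close> is empty.\<close>

definition hbox :: "nat \<Rightarrow> 'a::euclidean_space set" where
  "hbox k = {x. \<forall>i\<in>Basis. - real k \<le> x \<bullet> i \<and> x \<bullet> i < real k}"

text \<open>A fundamental domain of the lattice of mesh \<open>L\<close>: it parametrises the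
  offsets of a tiling.\<close>

definition corner_box :: "real \<Rightarrow> 'a::euclidean_space set" where
  "corner_box L = {x. \<forall>i\<in>Basis. 0 \<le> x \<bullet> i \<and> x \<bullet> i < L}"

lemma borel_half_open: "{x. \<forall>i\<in>Basis. l \<le> x \<bullet> i \<and> x \<bullet> i < (u::real)} \<in> sets (borel :: 'a::euclidean_space measure)"
proof -
  have "{x \<in> space borel. \<forall>i\<in>Basis. l \<le> x \<bullet> i \<and> x \<bullet> i < u} \<in> sets (borel :: 'a measure)"
    by (intro sets.sets_Collect_finite_All) auto
  then show ?thesis by simp
qed

lemma hbox_subset_cube: "hbox k \<subseteq> (cube (real k) :: 'a::euclidean_space set)"
proof
  fix x :: 'a assume x: "x \<in> hbox k"
  show "x \<in> cube (real k)" unfolding mem_cube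
  proof
    fix i :: 'a assume "i \<in> Basis"
    then have "- real k \<le> x \<bullet> i" "x \<bullet> i < real k" using x by (auto simp: hbox_def)
    then show "\<bar>x \<bullet> i\<bar> \<le> real k" by linarith
  qed
qed

lemma bounded_borel_hbox [simp]: "bounded (hbox k)" "hbox k \<in> sets borel"
  using hbox_subset_cube[of k] by (auto simp: hbox_def borel_half_open intro: bounded_subset[OF bounded_borel_cube(1)])

lemma hbox_0 [simp]: "hbox 0 = ({} :: 'a::euclidean_space set)"
  using nonempty_Basis by (auto simp: hbox_def ex_in_conv)

lemma hbox_mono: "k \<le> l \<Longrightarrow> hbox k \<subseteq> hbox l"
  by (auto simp: hbox_def)

lemma cube_subset_hbox: "r < real k \<Longrightarrow> cube r \<subseteq> hbox k"
  by (auto simp: hbox_def mem_cube) fastforce+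

lemma bounded_subset_hbox:
  assumes "bounded (S :: 'a::euclidean_space set)" obtains k where "S \<subseteq> hbox k"
proof -
  obtain q where "S \<subseteq> cube q" using bounded_subset_cube[OF assms] by blast
  moreover obtain k where "q < real k" using reals_Archimedean2 by blast
  ultimately show ?thesis using cube_subset_hbox[of q k] that by blast
qed

lemma UN_hbox: "(\<Union>k. hbox k) = (UNIV :: 'a::euclidean_space set)"
proof -
  have "x \<in> (\<Union>k. hbox k)" for x :: 'a
    using bounded_subset_hbox[of "{x}"] by auto
  then show ?thesis by auto
qed

lemma measure_hbox_le: "measure lborel (hbox k :: 'a::euclidean_space set) \<le> (2 * real k) ^ DIM('a)"
proof -
  have "measure lborel (hbox k :: 'a set) \<le> measure lborel (cube (real k) :: 'a set)"
    using hbox_subset_cube[of k] emeasure_bounded_finite[of "cube (real k) :: 'a set"]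
    by (intro measure_mono_fmeasurable fmeasurableI) auto
  then show ?thesis by (simp add: measure_cube)
qed

lemma corner_box_borel [simp]: "corner_box L \<in> sets borel"
  unfolding corner_box_def by (rule borel_half_open)

lemma emeasure_corner_box_le:
  assumes "0 \<le> L" shows "emeasure lborel (corner_box L :: 'a::euclidean_space set) \<le> ennreal (L ^ DIM('a))"
proof -
  have "emeasure lborel (corner_box L :: 'a set) \<le> emeasure lborel (cbox 0 (L *\<^sub>R One) :: 'a set)"
    by (intro emeasure_mono) (auto simp: corner_box_def mem_box less_imp_le)
  also have "\<dots> = ennreal (L ^ DIM('a))"
    using assms by (subst emeasure_lborel_cbox) (auto simp: inner_Basis)
  finally show ?thesis .
qed

definition lattice :: "real \<Rightarrow> int \<Rightarrow> 'a::euclidean_space set" where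
  "lattice L M = (\<lambda>f. \<Sum>i\<in>Basis. (L * real_of_int (f i)) *\<^sub>R i) ` (Basis \<rightarrow>\<^sub>E {- M..<M})"

lemma finite_lattice [simp]: "finite (lattice L M)"
  unfolding lattice_def by (intro finite_imageI finite_PiE) auto

lemma card_lattice_le: "0 \<le> M \<Longrightarrow> real (card (lattice L M :: 'a::euclidean_space set)) \<le> (2 * real_of_int M) ^ DIM('a)"
proof -
  assume "0 \<le> M"
  have "card (lattice L M :: 'a set) \<le> card ((Basis :: 'a set) \<rightarrow>\<^sub>E {- M..<M})"
    unfolding lattice_def by (intro card_image_le finite_PiE) auto
  also have "\<dots> = nat (2 * M) ^ DIM('a)" by (simp add: card_PiE)
  finally have "real (card (lattice L M :: 'a set)) \<le> real (nat (2 * M) ^ DIM('a))" by (simp only: of_nat_le_iff)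
  then show ?thesis using \<open>0 \<le> M\<close> by simp
qed

lemma lattice_inner:
  assumes "v \<in> lattice L M" "i \<in> Basis"
  obtains z where "v \<bullet> i = L * real_of_int z" "- M \<le> z" "z < M"
proof -
  obtain f where f: "f \<in> Basis \<rightarrow>\<^sub>E {- M..<M}" "v = (\<Sum>i\<in>Basis. (L * real_of_int (f i)) *\<^sub>R i)"
    using assms by (auto simp: lattice_def)
  then have "v \<bullet> i = L * real_of_int (f i)" using assms by simp
  then show ?thesis using that[of "f i"] f assms by (auto simp: PiE_iff)
qed

lemma lattice_separated:
  assumes "v \<in> lattice L M" "v' \<in> lattice L M" "0 < L" "\<And>i. i \<in> Basis \<Longrightarrow> \<bar>v \<bullet> i - v' \<bullet> i\<bar> < L"
  shows "v = v'"
proof (rule euclidean_eqI)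
  fix i :: 'a assume i: "i \<in> Basis"
  obtain z z' where z: "v \<bullet> i = L * real_of_int z" "v' \<bullet> i = L * real_of_int z'"
    using lattice_inner[OF assms(1) i] lattice_inner[OF assms(2) i] by metis
  have "\<bar>v \<bullet> i - v' \<bullet> i\<bar> = L * \<bar>real_of_int z - real_of_int z'\<bar>"
    using \<open>0 < L\<close> unfolding z right_diff_distrib[symmetric] by (simp add: abs_mult)
  then have "L * \<bar>real_of_int z - real_of_int z'\<bar> < L * 1" using assms(4)[OF i] by simp
  then have "\<bar>real_of_int z - real_of_int z'\<bar> < 1" using \<open>0 < L\<close> by (simp only: mult_less_cancel_left_pos)
  then have "z = z'" by linarith
  then show "v \<bullet> i = v' \<bullet> i" by (simp add: z)
qed

text \<open>The lattice point is obtained by rounding down each coordinate of u / L. The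
  \<open>if\<close> in the witness makes the coefficient function extensional, as \<open>PiE\<close>
  demands.\<close>

lemma lattice_covers:
  assumes "0 < L" "r < L * real_of_int M" "u \<in> cube r"
  shows "\<exists>v\<in>lattice L M. u - v \<in> corner_box L"
proof -
  define v where "v = (\<Sum>i\<in>Basis. (L * real_of_int (if i \<in> Basis then \<lfloor>(u \<bullet> i) / L\<rfloor> else undefined)) *\<^sub>R i)"
  have vi: "v \<bullet> i = L * real_of_int \<lfloor>(u \<bullet> i) / L\<rfloor>" if "i \<in> Basis" for i using that by (simp add: v_def)
  have "\<lfloor>(u \<bullet> i) / L\<rfloor> \<in> {- M..<M}" if i: "i \<in> Basis" for i
  proof -
    have "\<bar>u \<bullet> i\<bar> < L * real_of_int M" using assms i by (auto simp: mem_cube)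
    then have "(u \<bullet> i) / L < real_of_int M" "- real_of_int M < (u \<bullet> i) / L"
      using \<open>0 < L\<close> by (auto simp: field_simps)
    then show ?thesis by (auto simp: floor_less_iff le_floor_iff)
  qed
  then have "v \<in> lattice L M" unfolding v_def lattice_def
    by (intro image_eqI[where x="\<lambda>i. if i \<in> Basis then \<lfloor>(u \<bullet> i) / L\<rfloor> else undefined"] refl) (auto simp: PiE_iff extensional_def)
  moreover have "u - v \<in> corner_box L"
    unfolding corner_box_def
  proof (intro CollectI ballI)
    fix i :: 'a assume i: "i \<in> Basis"
    define z where "z = real_of_int \<lfloor>(u \<bullet> i) / L\<rfloor>"
    have "z \<le> (u \<bullet> i) / L" "(u \<bullet> i) / L < z + 1" unfolding z_def by linarith+
    then have "L * z \<le> u \<bullet> i" "u \<bullet> i < L * z + L"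
      using \<open>0 < L\<close> by (auto simp: field_simps)
    then show "0 \<le> (u - v) \<bullet> i \<and> (u - v) \<bullet> i < L" using vi[OF i] by (simp add: inner_diff_left z_def)
  qed
  ultimately show ?thesis by blast
qed

lemma nn_integral_lborel_shift:
  assumes "f \<in> borel_measurable borel"
  shows "(\<integral>\<^sup>+x. f (v + x) \<partial>lborel) = (\<integral>\<^sup>+x. f x \<partial>(lborel :: 'a::euclidean_space measure))"
proof -
  have "(\<integral>\<^sup>+x. f x \<partial>(lborel :: 'a measure)) = (\<integral>\<^sup>+x. f x \<partial>distr lborel borel ((+) v))"
    by (simp add: lborel_distr_plus)
  also have "\<dots> = (\<integral>\<^sup>+x. f (v + x) \<partial>lborel)" using assms by (intro nn_integral_distr) auto
  finally show ?thesis by simp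
qed

text \<open>Turns an integral over all translations into an integral, over the offset of a tiling,
  of a sum over the lattice. For a fixed offset the terms of the sum belong to disjoint cells, where
  moments factorise.\<close>

lemma nn_integral_tiling_le:
  fixes h :: "'a::euclidean_space \<Rightarrow> ennreal"
  assumes h: "h \<in> borel_measurable borel" and LM: "0 < L" "r < L * real_of_int M"
  shows "(\<integral>\<^sup>+u. h u * indicator (cube r) u \<partial>lborel) \<le>
    (\<integral>\<^sup>+s. (\<Sum>v\<in>lattice L M. h (v + s)) * indicator (corner_box L) s \<partial>lborel)"
proof -
  have m: "(\<lambda>s. h (v + s)) \<in> borel_measurable borel" for v
    by (rule measurable_compose[OF _ h]) simp
  have ind: "(\<lambda>u. indicator (corner_box L) (u - v) :: ennreal) \<in> borel_measurable borel" for v :: 'a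
    by (rule measurable_compose[of "\<lambda>u. u - v" borel borel "indicator (corner_box L)"])
       (auto intro!: borel_measurable_indicator corner_box_borel)
  have "(\<integral>\<^sup>+u. h u * indicator (cube r) u \<partial>lborel) \<le> (\<integral>\<^sup>+u. (\<Sum>v\<in>lattice L M. h u * indicator (corner_box L) (u - v)) \<partial>lborel)"
  proof (intro nn_integral_mono)
    fix u :: 'a
    show "h u * indicator (cube r) u \<le> (\<Sum>v\<in>lattice L M. h u * indicator (corner_box L) (u - v))"
    proof (cases "u \<in> cube r")
      case True
      then obtain v where v: "v \<in> lattice L M" "u - v \<in> corner_box L" using lattice_covers[OF LM] by blast
      then have "h u * indicator (corner_box L) (u - v) \<le> (\<Sum>v\<in>lattice L M. h u * indicator (corner_box L) (u - v))"
        by (intro member_le_sum) auto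
      then show ?thesis using v True by simp
    qed simp
  qed
  also have "\<dots> = (\<Sum>v\<in>lattice L M. \<integral>\<^sup>+u. h u * indicator (corner_box L) (u - v) \<partial>lborel)"
    using h ind by (intro nn_integral_sum) auto
  also have "\<dots> = (\<Sum>v\<in>lattice L M. \<integral>\<^sup>+s. h (v + s) * indicator (corner_box L) s \<partial>lborel)"
  proof (intro sum.cong refl)
    fix v :: 'a
    have "(\<lambda>u. h u * indicator (corner_box L) (u - v)) \<in> borel_measurable borel" using h ind by auto
    from nn_integral_lborel_shift[OF this, of v]
    show "(\<integral>\<^sup>+u. h u * indicator (corner_box L) (u - v) \<partial>lborel) = (\<integral>\<^sup>+s. h (v + s) * indicator (corner_box L) s \<partial>lborel)" by simp
  qed
  also have "\<dots> = (\<integral>\<^sup>+s. (\<Sum>v\<in>lattice L M. h (v + s) * indicator (corner_box L) s) \<partial>lborel)"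
    using m by (intro nn_integral_sum[symmetric]) (auto intro!: borel_measurable_times_ennreal borel_measurable_indicator)
  finally show ?thesis by (simp add: sum_distrib_right)
qed

text \<open>The translate of \<open>cube r\<close> has the same volume and still contains
  \<open>cube (r - q)\<close>, so both differences are bounded by the difference of the two
  volumes.\<close>

lemma emeasure_shifted_cube_diff:
  fixes v :: "'a::euclidean_space"
  assumes "v \<in> cube q" "0 \<le> q" "q \<le> r"
  shows "emeasure lborel (cube r - cube (r - q) :: 'a set) \<le> ennreal ((2 * r) ^ DIM('a) - (2 * (r - q)) ^ DIM('a))"
    and "emeasure lborel ((+) v ` cube r - cube r) \<le> ennreal ((2 * r) ^ DIM('a) - (2 * (r - q)) ^ DIM('a))"
proof -
  let ?d = "DIM('a)"
  have sub: "cube (r - q) \<subseteq> (cube r :: 'a set)" using assms by (auto simp: mem_cube) force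
  have le: "(2 * (r - q)) ^ ?d \<le> (2 * r) ^ ?d" using assms by (intro power_mono) auto
  have eq: "emeasure lborel (cube r :: 'a set) - emeasure lborel (cube (r - q) :: 'a set) = ennreal ((2 * r) ^ ?d - (2 * (r - q)) ^ ?d)"
    using assms by (simp add: emeasure_cube ennreal_minus)
  show "emeasure lborel (cube r - cube (r - q) :: 'a set) \<le> ennreal ((2 * r) ^ ?d - (2 * (r - q)) ^ ?d)"
    using assms sub by (subst emeasure_Diff) (auto simp: eq, simp add: emeasure_cube)
  let ?S = "(+) v ` cube r :: 'a set"
  have S: "bounded_borel ?S" by (rule bounded_borel_shift) simp
  have eS: "emeasure lborel ?S = emeasure lborel (cube r :: 'a set)"
    using measure_lborel_shift[of "cube r :: 'a set" v] S emeasure_bounded_finite[of ?S] emeasure_bounded_finite[of "cube r :: 'a set"]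
    by (simp add: emeasure_eq_ennreal_measure)
  have subS: "cube (r - q) \<subseteq> ?S"
  proof
    fix x :: 'a assume x: "x \<in> cube (r - q)"
    have "x - v \<in> cube r"
      unfolding mem_cube
    proof
      fix i :: 'a assume "i \<in> Basis"
      then have "\<bar>x \<bullet> i\<bar> \<le> r - q" "\<bar>v \<bullet> i\<bar> \<le> q" using x assms by (auto simp: mem_cube)
      then show "\<bar>(x - v) \<bullet> i\<bar> \<le> r" by (simp add: inner_diff_left)
    qed
    then show "x \<in> ?S" by (intro image_eqI[of _ _ "x - v"]) auto
  qed
  have "emeasure lborel (?S - cube r) \<le> emeasure lborel (?S - cube (r - q))"
    using sub S by (intro emeasure_mono) auto
  also have "\<dots> = emeasure lborel ?S - emeasure lborel (cube (r - q) :: 'a set)"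
    using subS S assms by (intro emeasure_Diff) (auto simp: emeasure_cube)
  finally show "emeasure lborel (?S - cube r) \<le> ennreal ((2 * r) ^ ?d - (2 * (r - q)) ^ ?d)"
    unfolding eS eq .
qed

text \<open>The share of \<open>cube r\<close> outside \<open>cube (r - q)\<close> in dimension d.
  It measures every finite-size error of the averages and vanishes as r grows.\<close>

definition boundary_fraction :: "nat \<Rightarrow> real \<Rightarrow> real \<Rightarrow> real" where
  "boundary_fraction d q r = 1 - ((r - q) / r) ^ d"

lemma boundary_fraction_tendsto:
  "((\<lambda>n. boundary_fraction d q (real (Suc n))) \<longlongrightarrow> 0) sequentially"
proof -
  have "(\<lambda>n. 1 - q / real (Suc n)) \<longlonglongrightarrow> 1 - 0"
    by (intro tendsto_diff tendsto_const LIMSEQ_Suc[OF lim_const_over_n])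
  then have "(\<lambda>n. (real (Suc n) - q) / real (Suc n)) \<longlonglongrightarrow> 1"
    by (simp add: diff_divide_distrib del: of_nat_Suc)
  from tendsto_diff[OF tendsto_const[of 1] tendsto_power[OF this, of d]] show ?thesis
    by (simp add: boundary_fraction_def)
qed

lemma boundary_fraction_eq:
  assumes "0 < r"
  shows "((2 * r) ^ d - (2 * (r - q)) ^ d) / (2 * r) ^ d = boundary_fraction d q r"
proof -
  have "((2 * r) ^ d - (2 * (r - q)) ^ d) / (2 * r) ^ d = 1 - ((2 * (r - q)) / (2 * r)) ^ d"
    using assms by (simp only: diff_divide_distrib power_divide) simp
  also have "(2 * (r - q)) / (2 * r) = (r - q) / r" using assms by (simp add: field_simps)
  finally show ?thesis by (simp add: boundary_fraction_def)
qed

section \<open>Translation averages of Gibbs measures\<close>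

context stable_interaction
begin

text \<open>By \<open>gibbs_shift\<close> a mixture of the Gibbs measures of the cubes
  \<open>(+) u\<close> followed by \<open>cube r\<close>. A window inside \<open>cube q\<close> lies
  in the translated cube for every u in \<open>cube (r - q)\<close>, that is for most u.\<close>

definition avg :: "real \<Rightarrow> 'a set measure" where
  "avg r = distr (uniform_measure lborel (cube r) \<Otimes>\<^sub>M gibbs (cube r)) config_algebra (\<lambda>(u, \<omega>). (+) u ` \<omega>)"

lemma sets_avg [simp, measurable_cong]: "sets (avg r) = sets config_algebra"
  by (simp add: avg_def)

lemma space_avg [simp]: "space (avg r) = configs"
  by (simp add: avg_def)

lemma measurable_avg [simp]: "measurable (avg r) N = measurable config_algebra N"
  by (rule measurable_cong_sets) simp_all

lemma measurable_shift_avg: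
  "(\<lambda>(u, \<omega>). (+) u ` \<omega>) \<in> uniform_measure lborel (cube r) \<Otimes>\<^sub>M gibbs (cube r) \<rightarrow>\<^sub>M config_algebra"
  using measurable_shift_config
  by (simp add: measurable_cong_sets[OF sets_pair_measure_cong[of "uniform_measure lborel (cube r)" borel "gibbs (cube r)" config_algebra] refl])

lemma prob_space_uniform_cube:
  assumes "0 < r" shows "prob_space (uniform_measure lborel (cube r :: 'a set))"
  using assms by (intro prob_space_uniform_measure) (auto simp: emeasure_cube)

lemma prob_space_avg:
  assumes "0 < r" shows "prob_space (avg r)"
proof -
  interpret U: prob_space "uniform_measure lborel (cube r :: 'a set)" by (rule prob_space_uniform_cube) fact
  interpret G: prob_space "gibbs (cube r)" by (rule prob_space_gibbs) simp
  interpret pair_prob_space "uniform_measure lborel (cube r :: 'a set)" "gibbs (cube r)" ..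
  show ?thesis unfolding avg_def by (rule prob_space_distr[OF measurable_shift_avg])
qed

lemma measurable_shift_gibbs_integral:
  assumes F: "F \<in> borel_measurable config_algebra" and "bounded_borel \<Lambda>"
  shows "(\<lambda>u. \<integral>\<^sup>+\<omega>. F ((+) u ` \<omega>) \<partial>gibbs \<Lambda>) \<in> borel_measurable borel"
proof -
  interpret G: prob_space "gibbs \<Lambda>" by (rule prob_space_gibbs) fact
  have "(\<lambda>(u, \<omega>). F ((+) u ` \<omega>)) \<in> borel_measurable (borel \<Otimes>\<^sub>M gibbs \<Lambda>)"
    using measurable_compose[OF measurable_shift_config F]
    by (simp add: split_beta' measurable_cong_sets[OF sets_pair_measure_cong[OF refl sets_gibbs] refl])
  then show ?thesis by (rule G.borel_measurable_nn_integral)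
qed

lemma nn_integral_avg:
  assumes r: "0 < r" and F: "F \<in> borel_measurable config_algebra"
  shows "(\<integral>\<^sup>+\<omega>. F \<omega> \<partial>avg r) =
    (\<integral>\<^sup>+u. (\<integral>\<^sup>+\<omega>. F ((+) u ` \<omega>) \<partial>gibbs (cube r)) * indicator (cube r) u \<partial>lborel) / ennreal ((2 * r) ^ DIM('a))"
proof -
  interpret G: prob_space "gibbs (cube r)" by (rule prob_space_gibbs) simp
  let ?U = "uniform_measure lborel (cube r :: 'a set)"
  have "(\<integral>\<^sup>+\<omega>. F \<omega> \<partial>avg r) = (\<integral>\<^sup>+p. F (case p of (u, \<omega>) \<Rightarrow> (+) u ` \<omega>) \<partial>(?U \<Otimes>\<^sub>M gibbs (cube r)))"
    unfolding avg_def using F by (intro nn_integral_distr measurable_shift_avg) auto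
  also have "\<dots> = (\<integral>\<^sup>+u. \<integral>\<^sup>+\<omega>. F (case (u, \<omega>) of (u, \<omega>) \<Rightarrow> (+) u ` \<omega>) \<partial>gibbs (cube r) \<partial>?U)"
    by (rule G.nn_integral_fst[symmetric]) (rule measurable_compose[OF measurable_shift_avg F])
  also have "\<dots> = (\<integral>\<^sup>+u. \<integral>\<^sup>+\<omega>. F ((+) u ` \<omega>) \<partial>gibbs (cube r) \<partial>?U)" by simp
  also have "\<dots> = (\<integral>\<^sup>+u. (\<integral>\<^sup>+\<omega>. F ((+) u ` \<omega>) \<partial>gibbs (cube r)) * indicator (cube r) u \<partial>lborel) / emeasure lborel (cube r :: 'a set)"
    using measurable_shift_gibbs_integral[OF F, of "cube r"] by (intro nn_integral_uniform_measure) auto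
  finally show ?thesis using r by (simp add: emeasure_cube)
qed

lemma nn_integral_gibbs_shift:
  assumes \<Lambda>: "bounded_borel \<Lambda>" and F: "F \<in> borel_measurable config_algebra"
  shows "(\<integral>\<^sup>+\<omega>. F ((+) u ` \<omega>) \<partial>gibbs \<Lambda>) = (\<integral>\<^sup>+\<omega>. F \<omega> \<partial>gibbs ((+) u ` \<Lambda>))"
  unfolding gibbs_shift[OF \<Lambda>, symmetric] using F measurable_shift_config1
  by (intro nn_integral_distr[symmetric]) auto

text \<open>An estimate that holds whenever the translated cube contains a given window passes to
  the average. The other translations make up a boundary fraction, on which the crude bound
  \<open>B\<close> is spent.\<close>

lemma avg_compare:
  assumes q: "0 \<le> q" "q \<le> r" "0 < r"
    and F1: "F1 \<in> borel_measurable config_algebra" and F2: "F2 \<in> borel_measurable config_algebra"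
    and B: "\<And>\<omega>. \<omega> \<in> configs \<Longrightarrow> F1 \<omega> \<le> ennreal B" "0 \<le> B"
    and le: "\<And>u. u \<in> cube (r - q) \<Longrightarrow>
      (\<integral>\<^sup>+\<omega>. F1 \<omega> \<partial>gibbs ((+) u ` cube r)) \<le> (\<integral>\<^sup>+\<omega>. F2 \<omega> \<partial>gibbs ((+) u ` cube r))"
  shows "(\<integral>\<^sup>+\<omega>. F1 \<omega> \<partial>avg r) \<le> (\<integral>\<^sup>+\<omega>. F2 \<omega> \<partial>avg r) + ennreal (B * boundary_fraction DIM('a) q r)"
proof -
  let ?d = "DIM('a)"
  let ?I = "\<lambda>F u. \<integral>\<^sup>+\<omega>. F ((+) u ` \<omega>) \<partial>gibbs (cube r)"
  have m: "?I F \<in> borel_measurable borel" if "F \<in> borel_measurable config_algebra" for F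
    using that by (rule measurable_shift_gibbs_integral) simp
  have "(\<integral>\<^sup>+u. ?I F1 u * indicator (cube r) u \<partial>lborel) \<le>
    (\<integral>\<^sup>+u. ?I F2 u * indicator (cube r) u + ennreal B * indicator (cube r - cube (r - q)) u \<partial>lborel)"
  proof (intro nn_integral_mono)
    fix u :: 'a
    have "?I F1 u \<le> ennreal B"
    proof -
      interpret G: prob_space "gibbs (cube r)" by (rule prob_space_gibbs) simp
      have "?I F1 u \<le> (\<integral>\<^sup>+\<omega>. ennreal B \<partial>gibbs (cube r))"
        by (intro nn_integral_mono B) (auto intro: configs_shift)
      then show ?thesis using G.emeasure_space_1 by (simp del: space_gibbs)
    qed
    moreover have "?I F1 u \<le> ?I F2 u" if "u \<in> cube (r - q)"
      using le[OF that] by (simp add: nn_integral_gibbs_shift F1 F2)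
    ultimately show "?I F1 u * indicator (cube r) u \<le> ?I F2 u * indicator (cube r) u + ennreal B * indicator (cube r - cube (r - q)) u"
      by (auto split: split_indicator intro: order_trans add_increasing)
  qed
  also have "\<dots> = (\<integral>\<^sup>+u. ?I F2 u * indicator (cube r) u \<partial>lborel) + ennreal B * emeasure lborel (cube r - cube (r - q) :: 'a set)"
    using m[OF F2] sets.Diff[OF bounded_borel_cube(2) bounded_borel_cube(2), of r "r - q"]
    by (subst nn_integral_add) (auto simp: nn_integral_cmult_indicator intro!: borel_measurable_times_ennreal borel_measurable_indicator)
  also have "\<dots> \<le> (\<integral>\<^sup>+u. ?I F2 u * indicator (cube r) u \<partial>lborel) + ennreal B * ennreal ((2 * r) ^ ?d - (2 * (r - q)) ^ ?d)"
    using q by (intro add_left_mono mult_left_mono emeasure_shifted_cube_diff(1)[of 0]) (auto simp: mem_cube)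
  finally have "(\<integral>\<^sup>+u. ?I F1 u * indicator (cube r) u \<partial>lborel) / ennreal ((2 * r) ^ ?d) \<le>
     ((\<integral>\<^sup>+u. ?I F2 u * indicator (cube r) u \<partial>lborel) + ennreal B * ennreal ((2 * r) ^ ?d - (2 * (r - q)) ^ ?d)) / ennreal ((2 * r) ^ ?d)"
    by (rule divide_right_mono_ennreal)
  also have "\<dots> = (\<integral>\<^sup>+u. ?I F2 u * indicator (cube r) u \<partial>lborel) / ennreal ((2 * r) ^ ?d) +
     ennreal (B * boundary_fraction ?d q r)"
  proof -
    have "(2 * (r - q)) ^ ?d \<le> (2 * r) ^ ?d" using q by (intro power_mono) auto
    then have "ennreal B * ennreal ((2 * r) ^ ?d - (2 * (r - q)) ^ ?d) / ennreal ((2 * r) ^ ?d) = ennreal (B * boundary_fraction ?d q r)"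
      using q B by (simp add: ennreal_mult[symmetric] divide_ennreal boundary_fraction_eq[symmetric])
    then show ?thesis by (simp add: add_divide_distrib_ennreal)
  qed
  finally show ?thesis using q F1 F2 by (simp add: nn_integral_avg)
qed

text \<open>A shift by \<open>v\<close> only translates the domain of averaging, and the part of the
  new domain outside the old one is a boundary fraction.\<close>

lemma avg_shift_le:
  assumes q: "0 \<le> q" "q \<le> r" "0 < r" and v: "v \<in> cube q" and S: "S \<in> sets config_algebra"
  shows "emeasure (avg r) {\<omega> \<in> configs. (+) v ` \<omega> \<in> S} \<le> emeasure (avg r) S + ennreal (boundary_fraction DIM('a) q r)"
proof -
  let ?d = "DIM('a)"
  let ?h = "\<lambda>u. \<integral>\<^sup>+\<omega>. indicator S ((+) u ` \<omega>) \<partial>gibbs (cube r)"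
  have mS: "indicator S \<in> borel_measurable config_algebra" using S by simp
  have h: "?h \<in> borel_measurable borel" by (rule measurable_shift_gibbs_integral[OF mS]) simp
  have h1: "?h u \<le> 1" for u
  proof -
    interpret G: prob_space "gibbs (cube r)" by (rule prob_space_gibbs) simp
    have "?h u \<le> (\<integral>\<^sup>+\<omega>. 1 \<partial>gibbs (cube r))" by (intro nn_integral_mono) (auto split: split_indicator)
    then show ?thesis using G.emeasure_space_1 by (simp del: space_gibbs)
  qed
  let ?S' = "{\<omega> \<in> configs. (+) v ` \<omega> \<in> S}"
  have S': "?S' \<in> sets config_algebra"
    using measurable_sets[OF measurable_shift_config1 S, of v] by (simp add: vimage_def Int_def conj_commute)
  have vs: "(+) v ` (+) u ` \<omega> = (+) (v + u) ` \<omega>" for u \<omega> by (auto simp: image_image add.assoc)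
  have "(\<integral>\<^sup>+u. (\<integral>\<^sup>+\<omega>. indicator ?S' ((+) u ` \<omega>) \<partial>gibbs (cube r)) * indicator (cube r) u \<partial>lborel) =
     (\<integral>\<^sup>+u. ?h (v + u) * indicator ((+) v ` cube r) (v + u) \<partial>lborel)"
  proof (intro nn_integral_cong arg_cong2[where f="(*)"])
    fix u :: 'a
    show "(indicator (cube r) u :: ennreal) = indicator ((+) v ` cube r) (v + u)" by (auto split: split_indicator)
    fix \<omega> assume "\<omega> \<in> space (gibbs (cube r))"
    then have "(+) u ` \<omega> \<in> configs" by (auto intro: configs_shift)
    then show "(indicator ?S' ((+) u ` \<omega>) :: ennreal) = indicator S ((+) (v + u) ` \<omega>)"
      by (auto simp: vs split: split_indicator)
  qed
  also have "\<dots> = (\<integral>\<^sup>+u. ?h u * indicator ((+) v ` cube r) u \<partial>lborel)"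
    using h bounded_borel_shift[of "cube r" v] by (intro nn_integral_lborel_shift) auto
  also have "\<dots> \<le> (\<integral>\<^sup>+u. ?h u * indicator (cube r) u + indicator ((+) v ` cube r - cube r) u \<partial>lborel)"
    using h1 by (intro nn_integral_mono) (auto split: split_indicator)
  also have "\<dots> = (\<integral>\<^sup>+u. ?h u * indicator (cube r) u \<partial>lborel) + emeasure lborel ((+) v ` cube r - cube r)"
    using h bounded_borel_shift[of "cube r" v]
    by (subst nn_integral_add) (auto intro!: borel_measurable_times_ennreal borel_measurable_indicator sets.Diff nn_integral_indicator)
  also have "\<dots> \<le> (\<integral>\<^sup>+u. ?h u * indicator (cube r) u \<partial>lborel) + ennreal ((2 * r) ^ ?d - (2 * (r - q)) ^ ?d)"
    using q v by (intro add_left_mono emeasure_shifted_cube_diff(2)) auto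
  finally have "(\<integral>\<^sup>+u. (\<integral>\<^sup>+\<omega>. indicator ?S' ((+) u ` \<omega>) \<partial>gibbs (cube r)) * indicator (cube r) u \<partial>lborel) / ennreal ((2 * r) ^ ?d) \<le>
     ((\<integral>\<^sup>+u. ?h u * indicator (cube r) u \<partial>lborel) + ennreal ((2 * r) ^ ?d - (2 * (r - q)) ^ ?d)) / ennreal ((2 * r) ^ ?d)"
    by (rule divide_right_mono_ennreal)
  also have "\<dots> = (\<integral>\<^sup>+u. ?h u * indicator (cube r) u \<partial>lborel) / ennreal ((2 * r) ^ ?d) + ennreal (boundary_fraction ?d q r)"
  proof -
    have "(2 * (r - q)) ^ ?d \<le> (2 * r) ^ ?d" using q by (intro power_mono) auto
    then have "ennreal ((2 * r) ^ ?d - (2 * (r - q)) ^ ?d) / ennreal ((2 * r) ^ ?d) = ennreal (boundary_fraction ?d q r)"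
      using q by (subst divide_ennreal) (simp_all only: boundary_fraction_eq diff_ge_0_iff_ge zero_less_power zero_less_mult_iff zero_less_numeral simp_thms)
    then show ?thesis by (simp add: add_divide_distrib_ennreal)
  qed
  finally have "(\<integral>\<^sup>+\<omega>. indicator ?S' \<omega> \<partial>avg r) \<le> (\<integral>\<^sup>+\<omega>. indicator S \<omega> \<partial>avg r) + ennreal (boundary_fraction ?d q r)"
    using q S S' by (simp only: nn_integral_avg borel_measurable_indicator)
  then show ?thesis using S S' by simp
qed

end

section \<open>Uniform bounds\<close>

lemma prod_mono_ennreal:
  fixes f g :: "'i \<Rightarrow> ennreal"
  shows "(\<And>i. i \<in> A \<Longrightarrow> f i \<le> g i) \<Longrightarrow> prod f A \<le> prod g A"
  by (induction A rule: infinite_finite_induct) (auto intro!: mult_mono)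

lemma intensity_sup_leI:
  fixes Q :: "'a::euclidean_space set measure"
  assumes "\<And>B. B \<in> sets borel \<Longrightarrow> mean_count Q B \<le> c * emeasure lborel B"
  shows "intensity_sup Q \<le> c"
  unfolding intensity_sup_def
proof (rule SUP_least)
  fix B :: "'a set" assume B: "B \<in> {\<Lambda> \<in> sets borel. 0 < emeasure lborel \<Lambda> \<and> emeasure lborel \<Lambda> < \<infinity>}"
  have "mean_count Q B / emeasure lborel B \<le> c * emeasure lborel B / emeasure lborel B"
    using B assms by (intro divide_right_mono_ennreal) auto
  also have "\<dots> = c * (emeasure lborel B / emeasure lborel B)"
    by (simp add: divide_ennreal_def mult.assoc)
  also have "emeasure lborel B / emeasure lborel B = 1" using B by (intro ennreal_divide_self) auto
  finally show "mean_count Q B / emeasure lborel B \<le> c" by simp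
qed

section \<open>Entropy-free moment bounds and the intensity of the averages\<close>

context stable_interaction
begin

text \<open>The positive part of \<open>H {}\<close>: the contribution to the lower bound for
  \<open>gibbs_norm\<close> that does not grow with the volume.\<close>

definition void_cost :: real where
  "void_cost = max 0 (- ln (exp_minus (H {})))"

lemma void_cost_nonneg: "0 \<le> void_cost"
  by (simp add: void_cost_def)

lemma exp_void_cost: "exp (- void_cost) \<le> exp_minus (H {})"
proof -
  have "exp (- void_cost) \<le> exp (ln (exp_minus (H {})))"
    unfolding void_cost_def by (subst exp_le_cancel_iff) simp
  then show ?thesis using exp_minus_H_empty by simp
qed

text \<open>Instead of Jensen's inequality \<open>E g \<le> ln (E (exp g))\<close> we use \<open>g \<le> t + exp (g - t)\<close>
  with \<open>t\<close> the upper bound for the right-hand side.\<close>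

lemma gibbs_exp_bound:
  assumes \<Lambda>: "bounded_borel \<Lambda>" and g: "g \<in> borel_measurable config_algebra" "\<And>\<omega>. 0 \<le> g \<omega>" and s: "0 \<le> s"
    and le: "(\<integral>\<^sup>+\<omega>. ennreal (exp (a * card (\<omega> \<inter> \<Lambda>) + g (\<omega> \<inter> \<Lambda>))) \<partial>poisson_process \<Lambda>) \<le> ennreal (exp s)"
  shows "(\<integral>\<^sup>+\<omega>. ennreal (g \<omega>) \<partial>gibbs \<Lambda>) \<le> ennreal (s + measure lborel \<Lambda> + void_cost + 1)"
proof -
  define t where "t = s + measure lborel \<Lambda> + void_cost"
  have t: "0 \<le> t" using s void_cost_nonneg by (simp add: t_def)
  interpret G: prob_space "gibbs \<Lambda>" by (rule prob_space_gibbs[OF \<Lambda>])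
  have ge: "(\<lambda>\<omega>. ennreal (exp (g \<omega>))) \<in> borel_measurable config_algebra" using g by measurable
  have "(\<integral>\<^sup>+\<omega>. ennreal (exp (g \<omega>)) \<partial>gibbs \<Lambda>) = (\<integral>\<^sup>+\<omega>. gibbs_weight \<Lambda> \<omega> * ennreal (exp (g (\<omega> \<inter> \<Lambda>))) \<partial>poisson_process \<Lambda>) / gibbs_norm \<Lambda>"
    by (rule nn_integral_gibbs[OF \<Lambda> ge])
  also have "\<dots> \<le> ennreal (exp s) / ennreal (exp (- measure lborel \<Lambda> - void_cost))"
  proof -
    have "(\<integral>\<^sup>+\<omega>. gibbs_weight \<Lambda> \<omega> * ennreal (exp (g (\<omega> \<inter> \<Lambda>))) \<partial>poisson_process \<Lambda>) \<le>
      (\<integral>\<^sup>+\<omega>. ennreal (exp (a * card (\<omega> \<inter> \<Lambda>) + g (\<omega> \<inter> \<Lambda>))) \<partial>poisson_process \<Lambda>)"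
    proof (intro nn_integral_mono)
      fix \<omega> assume "\<omega> \<in> space (poisson_process \<Lambda>)"
      then have "gibbs_weight \<Lambda> \<omega> * ennreal (exp (g (\<omega> \<inter> \<Lambda>))) \<le> ennreal (exp (a * card (\<omega> \<inter> \<Lambda>))) * ennreal (exp (g (\<omega> \<inter> \<Lambda>)))"
        by (intro mult_right_mono gibbs_weight_le[OF \<Lambda>]) auto
      also have "\<dots> = ennreal (exp (a * card (\<omega> \<inter> \<Lambda>) + g (\<omega> \<inter> \<Lambda>)))"
        by (simp add: exp_add ennreal_mult)
      finally show "gibbs_weight \<Lambda> \<omega> * ennreal (exp (g (\<omega> \<inter> \<Lambda>))) \<le> ennreal (exp (a * card (\<omega> \<inter> \<Lambda>) + g (\<omega> \<inter> \<Lambda>)))" .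
    qed
    then have X: "(\<integral>\<^sup>+\<omega>. gibbs_weight \<Lambda> \<omega> * ennreal (exp (g (\<omega> \<inter> \<Lambda>))) \<partial>poisson_process \<Lambda>) \<le> ennreal (exp s)"
      using le by (rule order_trans)
    have "ennreal (exp (- measure lborel \<Lambda> - void_cost)) \<le> ennreal (exp_minus (H {}) * exp (- measure lborel \<Lambda>))"
      using exp_void_cost by (intro ennreal_leI) (simp add: exp_diff exp_minus[of void_cost] divide_inverse mult.commute)
    then have "ennreal (exp (- measure lborel \<Lambda> - void_cost)) \<le> gibbs_norm \<Lambda>"
      using gibbs_norm_ge[OF \<Lambda>] by (rule order_trans)
    moreover obtain z where z: "gibbs_norm \<Lambda> = ennreal z" "0 \<le> z"
      using gibbs_norm_finite[OF \<Lambda>] by (cases "gibbs_norm \<Lambda>") auto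
    ultimately have le: "exp (- measure lborel \<Lambda> - void_cost) \<le> z" by simp
    then have "0 < z" by (rule less_le_trans[OF exp_gt_zero])
    have "(\<integral>\<^sup>+\<omega>. gibbs_weight \<Lambda> \<omega> * ennreal (exp (g (\<omega> \<inter> \<Lambda>))) \<partial>poisson_process \<Lambda>) / gibbs_norm \<Lambda>
      \<le> ennreal (exp s) / ennreal z" unfolding z(1) using X by (rule divide_right_mono_ennreal)
    also have "\<dots> = ennreal (exp s / z)" using \<open>0 < z\<close> by (intro divide_ennreal) auto
    also have "\<dots> \<le> ennreal (exp s / exp (- measure lborel \<Lambda> - void_cost))"
      using le \<open>0 < z\<close> by (intro ennreal_leI divide_left_mono) auto
    finally show ?thesis by (simp add: divide_ennreal)
  qed
  also have "\<dots> = ennreal (exp t)"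
    by (simp add: divide_ennreal exp_diff[symmetric] t_def)
  finally have E: "(\<integral>\<^sup>+\<omega>. ennreal (exp (g \<omega>)) \<partial>gibbs \<Lambda>) \<le> ennreal (exp t)" .
  have "(\<integral>\<^sup>+\<omega>. ennreal (g \<omega>) \<partial>gibbs \<Lambda>) \<le> (\<integral>\<^sup>+\<omega>. ennreal t + ennreal (exp (- t)) * ennreal (exp (g \<omega>)) \<partial>gibbs \<Lambda>)"
  proof (intro nn_integral_mono)
    fix \<omega>
    have "g \<omega> \<le> t + exp (- t) * exp (g \<omega>)"
    proof -
      have "1 + (g \<omega> - t) \<le> exp (g \<omega> - t)" by (rule exp_ge_add_one_self)
      moreover have "exp (- t) * exp (g \<omega>) = exp (g \<omega> - t)" by (simp add: mult_exp_exp)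
      ultimately show ?thesis by linarith
    qed
    then have "ennreal (g \<omega>) \<le> ennreal (t + exp (- t) * exp (g \<omega>))" by (rule ennreal_leI)
    then show "ennreal (g \<omega>) \<le> ennreal t + ennreal (exp (- t)) * ennreal (exp (g \<omega>))"
      using t by (simp add: ennreal_plus ennreal_mult)
  qed
  also have "\<dots> = ennreal t + ennreal (exp (- t)) * (\<integral>\<^sup>+\<omega>. ennreal (exp (g \<omega>)) \<partial>gibbs \<Lambda>)"
    using ge G.emeasure_space_1 by (simp add: nn_integral_add nn_integral_cmult del: space_gibbs)
  also have "\<dots> \<le> ennreal t + ennreal (exp (- t)) * ennreal (exp t)"
    using E by (intro add_left_mono mult_left_mono) auto
  also have "\<dots> = ennreal (t + 1)" using t by (simp add: ennreal_mult[symmetric] mult_exp_exp ennreal_plus)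
  finally show ?thesis by (simp add: t_def)
qed

lemma AE_gibbs_subset:
  assumes "bounded_borel \<Lambda>" shows "AE \<omega> in gibbs \<Lambda>. \<omega> \<subseteq> \<Lambda>"
proof (rule AE_I')
  have A: "avoid (- \<Lambda>) \<in> sets config_algebra" using assms by (intro avoid_sets) auto
  have "emeasure (gibbs \<Lambda>) (configs - avoid (- \<Lambda>)) = 0"
    using A assms by (intro AE_gibbsI) (auto simp: avoid_def finite_in_configs)
  then show "configs - avoid (- \<Lambda>) \<in> null_sets (gibbs \<Lambda>)"
    using sets.compl_sets[OF A] by (auto simp: null_sets_def)
qed (auto simp: avoid_def)

text \<open>\<open>gibbs_exp_bound\<close> for the number of points gives exp (a + 1) and 1 times
  the volume, plus \<open>void_cost\<close> and 1; the last two are absorbed into the volume, which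
  is assumed to be at least 1.\<close>

definition density_bound :: real where
  "density_bound = exp (a + 1) + 2 + void_cost"

lemma density_bound_nonneg: "0 \<le> density_bound"
  using void_cost_nonneg by (simp add: density_bound_def add_nonneg_nonneg)

lemma gibbs_mean_card:
  assumes \<Lambda>: "bounded_borel \<Lambda>" "1 \<le> measure lborel \<Lambda>"
  shows "(\<integral>\<^sup>+\<omega>. of_nat (card (\<omega> \<inter> \<Lambda>)) \<partial>gibbs \<Lambda>) \<le> ennreal (density_bound * measure lborel \<Lambda>)"
proof -
  have "(\<integral>\<^sup>+\<omega>. ennreal (real (card (\<omega> \<inter> \<Lambda>))) \<partial>gibbs \<Lambda>) \<le>
     ennreal (exp (a + 1) * measure lborel \<Lambda> + measure lborel \<Lambda> + void_cost + 1)"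
  proof (rule gibbs_exp_bound[OF \<Lambda>(1)])
    show "(\<lambda>\<omega>. real (card (\<omega> \<inter> \<Lambda>))) \<in> borel_measurable config_algebra"
      by (rule measurable_compose[OF measurable_card_config[OF \<Lambda>(1)]]) simp
    have "a * card (\<omega> \<inter> \<Lambda>) + card (\<omega> \<inter> \<Lambda> \<inter> \<Lambda>) = (a + 1) * card (\<omega> \<inter> \<Lambda>)" for \<omega>
      by (simp add: Int_assoc distrib_right)
    then show "(\<integral>\<^sup>+\<omega>. ennreal (exp (a * card (\<omega> \<inter> \<Lambda>) + card (\<omega> \<inter> \<Lambda> \<inter> \<Lambda>))) \<partial>poisson_process \<Lambda>)
      \<le> ennreal (exp (exp (a + 1) * measure lborel \<Lambda>))"
      using poisson_exp_moment[OF \<Lambda>(1), of "a + 1"] a_nonneg by simp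
  qed auto
  also have "exp (a + 1) * measure lborel \<Lambda> + measure lborel \<Lambda> + void_cost + 1 \<le> density_bound * measure lborel \<Lambda>"
    using mult_left_mono[OF \<Lambda>(2) void_cost_nonneg] \<Lambda>(2) by (simp add: density_bound_def distrib_right)
  finally show ?thesis by (simp add: ennreal_leI ennreal_of_nat_eq_real_of_nat)
qed

lemma one_le_cube: "1 \<le> (r::real) \<Longrightarrow> 1 \<le> (2 * r) ^ DIM('a)"
  by (intro one_le_power) simp

text \<open>By Fubini, each point of a sample is carried into \<open>B\<close> by a set of
  translations of measure at most that of \<open>B\<close>, wherever the point lies. So the total
  number of points, of the order of the volume, bounds the mean count of every Borel set with one
  constant, as \<open>intensity_sup\<close> requires.\<close>

lemma avg_mean_count:
  assumes r: "1 \<le> r" and B: "B \<in> sets borel"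
  shows "mean_count (avg r) B \<le> ennreal density_bound * emeasure lborel B"
proof -
  interpret G: prob_space "gibbs (cube r)" by (rule prob_space_gibbs) simp
  interpret pair_sigma_finite lborel "gibbs (cube r)" ..
  let ?N = "\<lambda>\<omega>. emeasure (count_space UNIV) (\<omega> \<inter> B)"
  have N: "?N \<in> borel_measurable config_algebra" by (rule measurable_count_config[OF B])
  have mN: "(\<lambda>(u, \<omega>). ?N ((+) u ` \<omega>) * indicator (cube r) u) \<in> borel_measurable (lborel \<Otimes>\<^sub>M gibbs (cube r))"
  proof -
    have 1: "(\<lambda>(u, \<omega>). ?N ((+) u ` \<omega>)) \<in> borel_measurable (lborel \<Otimes>\<^sub>M gibbs (cube r))"
      using measurable_compose[OF measurable_shift_config N]
      by (simp add: split_beta' measurable_cong_sets[OF sets_pair_measure_cong[OF sets_lborel sets_gibbs] refl])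
    have 2: "(\<lambda>p. indicator (cube r :: 'a set) (fst p) :: ennreal) \<in> borel_measurable (lborel \<Otimes>\<^sub>M gibbs (cube r))"
      by (rule measurable_compose[OF measurable_fst]) (auto intro!: borel_measurable_indicator)
    show ?thesis using borel_measurable_times_ennreal[OF 1 2] by (simp add: split_beta')
  qed
  have inner: "(\<integral>\<^sup>+u. ?N ((+) u ` \<omega>) * indicator (cube r) u \<partial>lborel) \<le> of_nat (card \<omega>) * emeasure lborel B"
    if fin: "finite \<omega>" for \<omega>
  proof -
    have "?N ((+) u ` \<omega>) = (\<Sum>x\<in>\<omega>. indicator B (x + u))" for u
    proof -
      have "?N ((+) u ` \<omega>) = of_nat (card ((+) u ` {x\<in>\<omega>. u + x \<in> B}))"
      proof -
        have "(+) u ` \<omega> \<inter> B = (+) u ` {x\<in>\<omega>. u + x \<in> B}" by auto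
        then show ?thesis using fin by (simp add: emeasure_count_space_finite)
      qed
      also have "\<dots> = of_nat (card {x\<in>\<omega>. u + x \<in> B})" by (simp add: card_image)
      also have "\<dots> = (\<Sum>x\<in>\<omega>. indicator B (x + u))"
        using fin by (simp add: indicator_def of_bool_def sum.If_cases Int_def add.commute)
      finally show ?thesis .
    qed
    then have "(\<integral>\<^sup>+u. ?N ((+) u ` \<omega>) * indicator (cube r) u \<partial>lborel) \<le> (\<integral>\<^sup>+u. (\<Sum>x\<in>\<omega>. indicator B (x + u)) \<partial>lborel)"
      by (intro nn_integral_mono) (auto split: split_indicator)
    also have "\<dots> = (\<Sum>x\<in>\<omega>. \<integral>\<^sup>+u. indicator B (x + u) \<partial>lborel)"
      using B by (intro nn_integral_sum measurable_compose[of "(+) _" borel borel]) (auto intro!: borel_measurable_indicator)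
    also have "\<dots> = (\<Sum>x\<in>\<omega>. emeasure lborel B)"
      using B by (intro sum.cong refl) (subst nn_integral_lborel_shift, auto)
    finally show ?thesis by simp
  qed
  have card: "(\<integral>\<^sup>+\<omega>. of_nat (card \<omega>) \<partial>gibbs (cube r)) \<le> ennreal (density_bound * (2 * r) ^ DIM('a))"
  proof -
    have "(\<integral>\<^sup>+\<omega>. of_nat (card \<omega>) \<partial>gibbs (cube r)) = (\<integral>\<^sup>+\<omega>. of_nat (card (\<omega> \<inter> cube r)) \<partial>gibbs (cube r))"
      using AE_gibbs_subset[of "cube r"] by (intro nn_integral_cong_AE) (auto simp: Int_absorb2)
    then show ?thesis using gibbs_mean_card[of "cube r"] r one_le_cube by (simp add: measure_cube)
  qed
  have cardm: "(\<lambda>\<omega>. of_nat (card (\<omega> \<inter> cube r)) :: ennreal) \<in> borel_measurable config_algebra"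
    by (rule measurable_compose[OF measurable_card_config]) auto
  have "(\<integral>\<^sup>+u. (\<integral>\<^sup>+\<omega>. ?N ((+) u ` \<omega>) \<partial>gibbs (cube r)) * indicator (cube r) u \<partial>lborel) =
    (\<integral>\<^sup>+u. (\<integral>\<^sup>+\<omega>. ?N ((+) u ` \<omega>) * indicator (cube r) u \<partial>gibbs (cube r)) \<partial>lborel)"
    using measurable_compose[OF measurable_shift_config1 N] by (intro nn_integral_cong nn_integral_multc[symmetric]) auto
  also have "\<dots> = (\<integral>\<^sup>+\<omega>. (\<integral>\<^sup>+u. ?N ((+) u ` \<omega>) * indicator (cube r) u \<partial>lborel) \<partial>gibbs (cube r))"
    by (rule Fubini'[OF mN, symmetric])
  also have "\<dots> \<le> (\<integral>\<^sup>+\<omega>. of_nat (card (\<omega> \<inter> cube r)) * emeasure lborel B \<partial>gibbs (cube r))"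
  proof (rule nn_integral_mono_AE)
    show "AE \<omega> in gibbs (cube r). (\<integral>\<^sup>+u. ?N ((+) u ` \<omega>) * indicator (cube r) u \<partial>lborel) \<le> of_nat (card (\<omega> \<inter> cube r)) * emeasure lborel B"
      using AE_gibbs_subset[OF conjI[OF bounded_borel_cube], of r] AE_space
    proof eventually_elim
      case (elim \<omega>)
      then have "\<omega> \<inter> cube r = \<omega>" "finite (\<omega> \<inter> cube r)" by (auto intro: configs_finite_Int)
      then show ?case using inner[of \<omega>] elim by simp
    qed
  qed
  also have "\<dots> = (\<integral>\<^sup>+\<omega>. of_nat (card (\<omega> \<inter> cube r)) \<partial>gibbs (cube r)) * emeasure lborel B"
    using cardm by (intro nn_integral_multc) simp
  also have "\<dots> \<le> ennreal (density_bound * (2 * r) ^ DIM('a)) * emeasure lborel B"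
    using gibbs_mean_card[of "cube r"] r one_le_cube by (intro mult_right_mono) (auto simp: measure_cube)
  finally have "mean_count (avg r) B \<le> ennreal (density_bound * (2 * r) ^ DIM('a)) * emeasure lborel B / ennreal ((2 * r) ^ DIM('a))"
    unfolding mean_count_def using r nn_integral_avg[OF _ N, of r] by (simp add: divide_right_mono_ennreal)
  also have "\<dots> = (ennreal density_bound * emeasure lborel B) * (ennreal ((2 * r) ^ DIM('a)) / ennreal ((2 * r) ^ DIM('a)))"
    using density_bound_nonneg r by (simp add: ennreal_mult divide_ennreal_def ac_simps)
  also have "ennreal ((2 * r) ^ DIM('a)) / ennreal ((2 * r) ^ DIM('a)) = 1"
    using r by (intro ennreal_divide_self) auto
  finally show ?thesis by simp
qed

lemma avg_intensity_sup: "1 \<le> r \<Longrightarrow> intensity_sup (avg r) \<le> ennreal density_bound"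
  by (intro intensity_sup_leI avg_mean_count)

section \<open>Energies and local events under the averages\<close>

lemma sets_energy_infinite:
  assumes "bounded_borel D" shows "{\<omega> \<in> configs. H (\<omega> \<inter> D) = \<infinity>} \<in> sets config_algebra"
  using measurable_sets[OF measurable_H_restrict[OF assms], of "{\<infinity>}"]
  by (simp add: vimage_def Int_def conj_commute)

text \<open>By heredity, infinite energy in \<open>D\<close> forces infinite energy of the whole
  sample, an event of Gibbs weight zero in every translated cube.\<close>

lemma avg_energy_finite:
  assumes r: "0 < r" and D: "bounded_borel D"
  shows "emeasure (avg r) {\<omega> \<in> configs. H (\<omega> \<inter> D) = \<infinity>} = 0"
proof -
  let ?S = "{\<omega> \<in> configs. H (\<omega> \<inter> D) = \<infinity>}"
  have S: "?S \<in> sets config_algebra"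
    by (rule sets_energy_infinite[OF D])
  have "emeasure (gibbs ((+) u ` cube r)) ?S = 0" for u
  proof -
    have "emeasure (gibbs ((+) u ` cube r)) (configs - (configs - ?S)) = 0"
    proof (rule AE_gibbsI[OF bounded_borel_shift])
      show "configs - ?S \<in> sets config_algebra" using sets.compl_sets[OF S] by simp
      fix \<omega> assume \<omega>: "finite \<omega>" "H \<omega> < \<infinity>"
      then have "H (\<omega> \<inter> D) < \<infinity>" by (rule H_hereditary) simp
      then show "\<omega> \<in> configs - ?S" using \<omega> by (auto simp: finite_in_configs)
    qed simp
    then show ?thesis by (simp add: double_diff)
  qed
  then have "(\<integral>\<^sup>+\<omega>. indicator ?S ((+) u ` \<omega>) \<partial>gibbs (cube r)) = 0" for u
    using nn_integral_gibbs_shift[of "cube r" "indicator ?S" u] S by simp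
  then have "(\<integral>\<^sup>+\<omega>. indicator ?S \<omega> \<partial>avg r) = 0"
    using r S by (subst nn_integral_avg) auto
  then show ?thesis using S by simp
qed

text \<open>The measure \<mu> of the overview for the window \<open>hbox k\<close>: its density exp
  (a * card) with respect to the Poisson process is the bound that stability gives for the Boltzmann
  weight.\<close>

definition local_weight :: "nat \<Rightarrow> 'a set set \<Rightarrow> ennreal" where
  "local_weight k A = (\<integral>\<^sup>+\<omega>. ennreal (exp (a * card (\<omega> \<inter> hbox k))) * indicator A (\<omega> \<inter> hbox k) \<partial>poisson_process (hbox k))"

lemma local_weight_le: "local_weight k A \<le> ennreal (exp (exp a * measure lborel (hbox k :: 'a set)))"
proof -
  have "local_weight k A \<le> (\<integral>\<^sup>+\<omega>. ennreal (exp (a * card (\<omega> \<inter> hbox k))) \<partial>poisson_process (hbox k :: 'a set))"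
    unfolding local_weight_def by (intro nn_integral_mono) (auto split: split_indicator)
  also have "\<dots> \<le> ennreal (exp (exp a * measure lborel (hbox k :: 'a set)))"
    by (rule poisson_exp_moment) (use a_nonneg in auto)
  finally show ?thesis .
qed

lemma ennreal_local_weight: "ennreal (enn2real (local_weight k A)) = local_weight k A"
proof -
  have "local_weight k A < \<infinity>" using local_weight_le by (rule le_less_trans) simp
  then show ?thesis by simp
qed

text \<open>One factor of the product over the cells, transported to \<open>hbox k\<close> by a
  translation. The bound is an exponential, so that the product over the cells becomes a sum in the
  exponent.\<close>

lemma poisson_cell_integral_le:
  assumes A: "A \<in> sets config_algebra" and c: "0 < c"
  shows "(\<integral>\<^sup>+\<omega>. ennreal (exp (a * card (\<omega> \<inter> (+) (- w) ` hbox k))) *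
      ennreal (exp (c * indicator A ((+) w ` (\<omega> \<inter> (+) (- w) ` hbox k) \<inter> hbox k))) \<partial>poisson_process ((+) (- w) ` hbox k))
    \<le> ennreal (exp (exp a * measure lborel (hbox k :: 'a set) + exp c * enn2real (local_weight k A)))"
    (is "?I \<le> _")
proof -
  let ?W = "hbox k :: 'a set" and ?\<mu> = "enn2real (local_weight k A)"
  let ?B = "(+) (- w) ` ?W"
  have m: "(\<lambda>\<omega>. \<omega> \<inter> ?W) \<in> config_algebra \<rightarrow>\<^sub>M config_algebra" by (rule measurable_restrict_config) simp
  have me: "(\<lambda>\<omega>. ennreal (exp (a * card (\<omega> \<inter> ?W)))) \<in> borel_measurable config_algebra"
    by (rule measurable_compose[OF measurable_card_config]) auto
  have mi: "(\<lambda>\<omega>. indicator A (\<omega> \<inter> ?W) :: ennreal) \<in> borel_measurable config_algebra"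
    by (rule measurable_compose[OF m]) (use A in simp)
  have B: "bounded_borel ?B" by (rule bounded_borel_shift) simp
  have mI: "(\<lambda>\<omega>. ennreal (exp (a * card (\<omega> \<inter> ?B))) * ennreal (exp (c * indicator A ((+) w ` (\<omega> \<inter> ?B) \<inter> ?W)))) \<in> borel_measurable config_algebra"
  proof (rule borel_measurable_times_ennreal)
    show "(\<lambda>\<omega>. ennreal (exp (a * card (\<omega> \<inter> ?B)))) \<in> borel_measurable config_algebra"
      by (rule measurable_compose[OF measurable_card_config[OF B]]) auto
    have "(\<lambda>\<omega>. (+) w ` (\<omega> \<inter> ?B) \<inter> ?W) \<in> config_algebra \<rightarrow>\<^sub>M config_algebra"
      using B by (intro measurable_compose[OF measurable_compose[OF measurable_restrict_config measurable_shift_config1] m]) auto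
    from measurable_compose[OF this, of "indicator A :: _ \<Rightarrow> real" borel] A
    have "(\<lambda>\<omega>. indicator A ((+) w ` (\<omega> \<inter> ?B) \<inter> ?W) :: real) \<in> borel_measurable config_algebra" by simp
    then show "(\<lambda>\<omega>. ennreal (exp (c * indicator A ((+) w ` (\<omega> \<inter> ?B) \<inter> ?W)))) \<in> borel_measurable config_algebra"
      by measurable
  qed
  have "?I = (\<integral>\<^sup>+\<omega>. ennreal (exp (a * card ((+) (- w) ` \<omega> \<inter> ?B))) *
      ennreal (exp (c * indicator A ((+) w ` ((+) (- w) ` \<omega> \<inter> ?B) \<inter> ?W))) \<partial>poisson_process ?W)"
    unfolding poisson_shift[OF conjI[OF bounded_borel_hbox], symmetric]
    using mI measurable_shift_config1 by (intro nn_integral_distr) auto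
  also have "\<dots> = (\<integral>\<^sup>+\<omega>. ennreal (exp (a * card (\<omega> \<inter> ?W))) * ennreal (exp (c * indicator A (\<omega> \<inter> ?W))) \<partial>poisson_process ?W)"
  proof (intro nn_integral_cong)
    fix \<omega> :: "'a set"
    have 1: "(+) (- w) ` \<omega> \<inter> ?B = (+) (- w) ` (\<omega> \<inter> ?W)" by (intro image_Int[symmetric] inj_onI) simp
    have 2: "(+) w ` (+) (- w) ` (\<omega> \<inter> ?W) \<inter> ?W = \<omega> \<inter> ?W" by (simp add: image_image)
    have 3: "card ((+) (- w) ` (\<omega> \<inter> ?W)) = card (\<omega> \<inter> ?W)" by (intro card_image inj_onI) simp
    show "ennreal (exp (a * card ((+) (- w) ` \<omega> \<inter> ?B))) * ennreal (exp (c * indicator A ((+) w ` ((+) (- w) ` \<omega> \<inter> ?B) \<inter> ?W)))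
      = ennreal (exp (a * card (\<omega> \<inter> ?W))) * ennreal (exp (c * indicator A (\<omega> \<inter> ?W)))"
      unfolding 1 2 3 ..
  qed
  \<comment> \<open>This uses exp (c * 1) = exp c on A and exp 0 = 1 off A, so exp (c * indicator)
    is at most 1 + exp c * indicator.\<close>
  also have "\<dots> \<le> (\<integral>\<^sup>+\<omega>. ennreal (exp (a * card (\<omega> \<inter> ?W))) + ennreal (exp c) * (ennreal (exp (a * card (\<omega> \<inter> ?W))) * indicator A (\<omega> \<inter> ?W)) \<partial>poisson_process ?W)"
    by (intro nn_integral_mono) (auto simp: mult.commute split: split_indicator)
  also have "\<dots> = (\<integral>\<^sup>+\<omega>. ennreal (exp (a * card (\<omega> \<inter> ?W))) \<partial>poisson_process ?W) + ennreal (exp c) * local_weight k A"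
    unfolding local_weight_def using me mi by (subst nn_integral_add) (auto simp: nn_integral_cmult)
  also have "\<dots> \<le> ennreal (exp (exp a * measure lborel ?W)) + ennreal (exp c) * ennreal ?\<mu>"
    using a_nonneg by (intro add_mono poisson_exp_moment) (auto simp: ennreal_local_weight)
  also have "\<dots> = ennreal (exp (exp a * measure lborel ?W) + exp c * ?\<mu>)"
    by (simp add: ennreal_mult)
  also have "\<dots> \<le> ennreal (exp (exp a * measure lborel ?W + exp c * ?\<mu>))"
  proof (rule ennreal_leI)
    \<comment> \<open>As ?E is at least 1, the summand ?\<theta> may be multiplied by it, and then 1
      + ?\<theta> \<le> exp ?\<theta>.\<close>
    let ?E = "exp (exp a * measure lborel ?W)" and ?\<theta> = "exp c * ?\<mu>"
    have "1 \<le> ?E" by simp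
    then have "?E + ?\<theta> \<le> ?E + ?E * ?\<theta>" using mult_right_mono[of 1 ?E ?\<theta>] by simp
    also have "\<dots> = ?E * (1 + ?\<theta>)" by (simp add: distrib_left)
    also have "\<dots> \<le> ?E * exp ?\<theta>" by (intro mult_left_mono) auto
    finally show "?E + ?\<theta> \<le> exp (exp a * measure lborel ?W + ?\<theta>)" by (simp add: exp_add)
  qed
  finally show ?thesis .
qed

text \<open>Cost per unit of V, the volume of \<open>cube r\<close>. The enlarged cube has volume
  6^d V and enters through the enlargement and through its exponential moment; the cells together
  have volume at most 3^d V; the 2 covers the volume term V and the constant 1 of
  \<open>gibbs_exp_bound\<close>.\<close>

definition tiling_cost :: real where
  "tiling_cost = 6 ^ DIM('a) * (1 + exp a) + 3 ^ DIM('a) * exp a + 2 + void_cost"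

lemma tiling_cost_nonneg: "0 \<le> tiling_cost"
  using void_cost_nonneg by (simp add: tiling_cost_def add_nonneg_nonneg)

text \<open>The total volume of the cells: the lattice overshoots the cube by at most one mesh, so
  its extent L * M is at most 3 r as soon as L is at most 2 r.\<close>

lemma card_lattice_scaled_le:
  assumes "0 \<le> M" "0 < L" "2 * (L * real_of_int M) \<le> 3 * (2 * r)"
  shows "real (card (lattice L M :: 'a set)) * L ^ DIM('a) \<le> 3 ^ DIM('a) * (2 * r) ^ DIM('a)"
proof -
  have "real (card (lattice L M :: 'a set)) * L ^ DIM('a) \<le> (2 * real_of_int M) ^ DIM('a) * L ^ DIM('a)"
    using card_lattice_le[OF assms(1), of L, where ?'a='a] assms(2) by (intro mult_right_mono) auto
  also have "\<dots> = (2 * (L * real_of_int M)) ^ DIM('a)" by (subst power_mult_distrib[symmetric]) (simp only: ac_simps)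
  also have "\<dots> \<le> (3 * (2 * r)) ^ DIM('a)" using assms by (intro power_mono) auto
  finally show ?thesis by (simp only: power_mult_distrib[of 3])
qed

text \<open>The expected number of cells of the tiling with offset \<open>s\<close> whose content
  lies in \<open>A\<close>. Multiplied by \<open>c\<close> it is an additive functional over
  disjoint cells, so its exponential moment factorises. Cells may stick out of
  \<open>cube r\<close>, which is why the Poisson integral is first moved to a larger cube.\<close>

lemma gibbs_tiling_bound:
  fixes k :: nat and M :: int
  assumes k: "1 \<le> k" "real k \<le> r" and c: "0 < c" and A: "A \<in> sets config_algebra"
    and s: "s \<in> corner_box (2 * real k)" and M: "0 \<le> M" "2 * real k * real_of_int M \<le> r + 2 * real k"
  shows "(\<integral>\<^sup>+\<omega>. (\<Sum>v\<in>lattice (2 * real k) M. indicator A ((+) (v + s) ` \<omega> \<inter> hbox k)) \<partial>gibbs (cube r)) \<le>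
    ennreal ((tiling_cost * (2 * r) ^ DIM('a) + real (card (lattice (2 * real k) M :: 'a set)) * (exp c * enn2real (local_weight k A))) / c)"
proof -
  let ?d = "DIM('a)" and ?L = "2 * real k" and ?W = "hbox k :: 'a set" and ?\<theta> = "exp c * enn2real (local_weight k A)"
  \<comment> \<open>The radius 6 r suffices for all cells: their coordinates are bounded by k + 2 k
    + (r + 2 k), from the window, the offset and the lattice vector, and k is at most r.\<close>
  let ?J = "lattice ?L M :: 'a set" and ?\<Lambda> = "cube r :: 'a set" and ?\<Lambda>' = "cube (6 * r) :: 'a set"
  let ?V = "(2 * r) ^ ?d"
  define B where "B v = (+) (- (v + s)) ` ?W" for v
  have L: "0 < ?L" using k by simp
  have r: "1 \<le> r" using k by linarith
  have V: "1 \<le> ?V" by (rule one_le_cube[OF r])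
  have mB: "x \<in> B v \<longleftrightarrow> x + v + s \<in> ?W" for x v
  proof
    show "x \<in> B v \<Longrightarrow> x + v + s \<in> ?W" by (auto simp: B_def)
    show "x + v + s \<in> ?W \<Longrightarrow> x \<in> B v" unfolding B_def by (rule image_eqI[of _ _ "x + v + s"]) auto
  qed
  have Bb: "bounded_borel (B v)" for v unfolding B_def by (rule bounded_borel_shift) simp
  have disj: "disjoint_family_on B ?J"
    unfolding disjoint_family_on_def
  proof (intro ballI impI)
    fix v v' assume v: "v \<in> ?J" "v' \<in> ?J" "v \<noteq> v'"
    show "B v \<inter> B v' = {}"
    proof (rule ccontr)
      assume "B v \<inter> B v' \<noteq> {}"
      then obtain x where x: "x + v + s \<in> ?W" "x + v' + s \<in> ?W" using mB by blast
      have "\<bar>v \<bullet> i - v' \<bullet> i\<bar> < ?L" if "i \<in> Basis" for i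
      proof -
        have "- real k \<le> (x + v + s) \<bullet> i" "(x + v + s) \<bullet> i < real k" "- real k \<le> (x + v' + s) \<bullet> i" "(x + v' + s) \<bullet> i < real k"
          using x that by (auto simp: hbox_def)
        then show ?thesis by (simp add: inner_add_left abs_less_iff)
      qed
      then show False using lattice_separated[OF v(1,2) L] v(3) by blast
    qed
  qed
  have sub: "(\<Union>v\<in>?J. B v) \<subseteq> ?\<Lambda>'"
  proof (rule UN_least, rule subsetI)
    fix v x assume v: "v \<in> ?J" and "x \<in> B v"
    then have x: "x + v + s \<in> ?W" using mB by blast
    show "x \<in> ?\<Lambda>'" unfolding mem_cube
    proof
      fix i :: 'a assume i: "i \<in> Basis"
      have 1: "- real k \<le> (x + v + s) \<bullet> i" "(x + v + s) \<bullet> i < real k" "0 \<le> s \<bullet> i" "s \<bullet> i < ?L"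
        using x s i by (auto simp: hbox_def corner_box_def)
      obtain z where z: "v \<bullet> i = ?L * real_of_int z" "- M \<le> z" "z < M" using lattice_inner[OF v i] by blast
      have zM: "- real_of_int M \<le> real_of_int z" "real_of_int z \<le> real_of_int M" using z by linarith+
      have "?L * (- real_of_int M) \<le> v \<bullet> i" "v \<bullet> i \<le> ?L * real_of_int M"
        unfolding z(1) by (rule mult_left_mono[OF zM(1) less_imp_le[OF L]], rule mult_left_mono[OF zM(2) less_imp_le[OF L]])
      then have "- (r + ?L) \<le> v \<bullet> i" "v \<bullet> i \<le> r + ?L" using M(2) unfolding mult_minus_right by linarith+
      then show "\<bar>x \<bullet> i\<bar> \<le> 6 * r" using 1 k by (simp add: inner_add_left abs_le_iff)
    qed
  qed
  have cardJ: "real (card ?J) * ?L ^ ?d \<le> 3 ^ ?d * ?V"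
    using M(2) k(2) by (intro card_lattice_scaled_le M(1) L) linarith
  have cardW: "real (card ?J) * measure lborel ?W \<le> 3 ^ ?d * ?V"
    using measure_hbox_le[of k, where ?'a='a] by (intro order_trans[OF mult_left_mono cardJ]) auto
  define g where "g \<omega> = c * (\<Sum>v\<in>?J. indicator A ((+) (v + s) ` \<omega> \<inter> ?W))" for \<omega>
  have mind: "(\<lambda>\<omega>. indicator A ((+) w ` \<omega> \<inter> ?W) :: real) \<in> borel_measurable config_algebra" for w
    using A by (intro measurable_compose[OF measurable_compose[OF measurable_shift_config1 measurable_restrict_config]]) auto
  have mg: "g \<in> borel_measurable config_algebra"
    unfolding g_def[abs_def] using mind by (intro borel_measurable_times borel_measurable_sum) auto
  define f where "f v \<eta> = ennreal (exp (c * indicator A ((+) (v + s) ` \<eta> \<inter> ?W)))" for v \<eta>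
  have mf: "f v \<in> borel_measurable config_algebra" for v
    unfolding f_def[abs_def] using mind by measurable
  \<comment> \<open>\<open>f v\<close> depends on the points of the cell \<open>B v\<close> only.
    This permits replacing all cells by the common set \<open>?\<Lambda>'\<close> and recombining
    the product into exp g.\<close>
  have fB: "f v (\<omega> \<inter> B v) = f v (\<omega> \<inter> \<Lambda>')" if "B v \<subseteq> \<Lambda>'" for v \<omega> \<Lambda>'
  proof -
    have "(+) (v + s) ` (\<omega> \<inter> B v) \<inter> ?W = (+) (v + s) ` (\<omega> \<inter> \<Lambda>') \<inter> ?W"
    proof -
      have "x \<in> B v" if "v + s + x \<in> ?W" for x using that by (simp add: mB ac_simps)
      then show ?thesis using \<open>B v \<subseteq> \<Lambda>'\<close> by auto
    qed
    then show ?thesis by (simp add: f_def)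
  qed
  define F where "F \<eta> = ennreal (exp (a * card (\<eta> \<inter> ?\<Lambda>') + g \<eta>))" for \<eta>
  have mF: "F \<in> borel_measurable config_algebra"
  proof -
    have "(\<lambda>\<eta>. real (card (\<eta> \<inter> ?\<Lambda>'))) \<in> borel_measurable config_algebra"
      by (rule measurable_compose[OF measurable_card_config]) auto
    then show ?thesis unfolding F_def[abs_def] using mg by measurable
  qed
  have Fprod: "F (\<omega> \<inter> ?\<Lambda>') = ennreal (exp (a * card (\<omega> \<inter> ?\<Lambda>'))) * (\<Prod>v\<in>?J. f v (\<omega> \<inter> B v))" for \<omega>
  proof -
    have "(\<Prod>v\<in>?J. f v (\<omega> \<inter> B v)) = (\<Prod>v\<in>?J. f v (\<omega> \<inter> ?\<Lambda>'))"
      using sub by (intro prod.cong fB) auto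
    also have "\<dots> = ennreal (exp (g (\<omega> \<inter> ?\<Lambda>')))"
      unfolding f_def g_def sum_distrib_left exp_sum[OF finite_lattice] by (rule prod_ennreal) simp
    finally show ?thesis by (simp add: F_def Int_assoc exp_add ennreal_mult)
  qed
  have le6: "?\<Lambda> \<subseteq> ?\<Lambda>'"
  proof
    fix x :: 'a assume "x \<in> ?\<Lambda>"
    moreover have "r \<le> 6 * r" using r by simp
    ultimately show "x \<in> ?\<Lambda>'" unfolding mem_cube by (meson order_trans)
  qed
  have "(\<integral>\<^sup>+\<omega>. ennreal (exp (a * card (\<omega> \<inter> ?\<Lambda>) + g (\<omega> \<inter> ?\<Lambda>))) \<partial>poisson_process ?\<Lambda>) = (\<integral>\<^sup>+\<omega>. F (\<omega> \<inter> ?\<Lambda>) \<partial>poisson_process ?\<Lambda>)"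
    by (simp only: F_def Int_assoc Int_absorb2[OF le6])
  also have "\<dots> \<le> ennreal (exp (measure lborel (?\<Lambda>' - ?\<Lambda>))) * (\<integral>\<^sup>+\<omega>. F (\<omega> \<inter> ?\<Lambda>') \<partial>poisson_process ?\<Lambda>')"
    using le6 by (intro nn_integral_poisson_le_restrict mF) auto
  also have "\<dots> \<le> ennreal (exp (6 ^ ?d * ?V)) * (ennreal (exp (exp a * (6 ^ ?d * ?V))) * ennreal (exp (real (card ?J) * (exp a * measure lborel ?W + ?\<theta>))))"
  proof (intro mult_mono)
    have "measure lborel ?\<Lambda>' = (2 * (6 * r)) ^ ?d" using r by (intro measure_cube) simp
    also have "2 * (6 * r) = 6 * (2 * r)" by simp
    finally have mL: "measure lborel ?\<Lambda>' = 6 ^ ?d * ?V" by (simp only: power_mult_distrib[of 6])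
    have "measure lborel (?\<Lambda>' - ?\<Lambda>) \<le> measure lborel ?\<Lambda>'"
      using emeasure_bounded_finite[of "?\<Lambda>'"] by (intro measure_mono_fmeasurable fmeasurableI) auto
    then show "ennreal (exp (measure lborel (?\<Lambda>' - ?\<Lambda>))) \<le> ennreal (exp (6 ^ ?d * ?V))"
      unfolding mL by (intro ennreal_leI) simp
    let ?I = "\<lambda>v. \<integral>\<^sup>+\<omega>. ennreal (exp (a * card (\<omega> \<inter> B v))) * f v (\<omega> \<inter> B v) \<partial>poisson_process (B v)"
    have "(\<integral>\<^sup>+\<omega>. F (\<omega> \<inter> ?\<Lambda>') \<partial>poisson_process ?\<Lambda>') \<le> ennreal (exp (exp a * measure lborel ?\<Lambda>')) * (\<Prod>v\<in>?J. ?I v)"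
      unfolding Fprod using Bb disj mf sub a_nonneg by (intro poisson_cells_bound) auto
    also have "(\<Prod>v\<in>?J. ?I v) \<le> (\<Prod>v\<in>?J. ennreal (exp (exp a * measure lborel ?W + ?\<theta>)))"
    proof (rule prod_mono_ennreal)
      fix v
      show "?I v \<le> ennreal (exp (exp a * measure lborel ?W + ?\<theta>))"
        using poisson_cell_integral_le[OF A c, of "v + s" k] by (simp add: B_def f_def)
    qed
    also have "\<dots> = ennreal (exp (real (card ?J) * (exp a * measure lborel ?W + ?\<theta>)))"
      by (simp add: ennreal_power exp_of_nat_mult)
    finally show "(\<integral>\<^sup>+\<omega>. F (\<omega> \<inter> ?\<Lambda>') \<partial>poisson_process ?\<Lambda>') \<le>
       ennreal (exp (exp a * (6 ^ ?d * ?V))) * ennreal (exp (real (card ?J) * (exp a * measure lborel ?W + ?\<theta>)))"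
      by (simp add: mL mult_left_mono)
  qed auto
  also have "\<dots> \<le> ennreal (exp (?V * (6 ^ ?d * (1 + exp a) + 3 ^ ?d * exp a) + real (card ?J) * ?\<theta>))"
  proof -
    have "exp a * (real (card ?J) * measure lborel ?W) \<le> exp a * (3 ^ ?d * ?V)" using cardW by (intro mult_left_mono) auto
    then have "6 ^ ?d * ?V + (exp a * (6 ^ ?d * ?V) + real (card ?J) * (exp a * measure lborel ?W + ?\<theta>)) \<le>
      ?V * (6 ^ ?d * (1 + exp a) + 3 ^ ?d * exp a) + real (card ?J) * ?\<theta>"
      by (simp add: algebra_simps)
    then show ?thesis by (simp add: ennreal_mult[symmetric] exp_add[symmetric] ennreal_leI)
  qed
  finally have bd: "(\<integral>\<^sup>+\<omega>. ennreal (exp (a * card (\<omega> \<inter> ?\<Lambda>) + g (\<omega> \<inter> ?\<Lambda>))) \<partial>poisson_process ?\<Lambda>) \<le>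
    ennreal (exp (?V * (6 ^ ?d * (1 + exp a) + 3 ^ ?d * exp a) + real (card ?J) * ?\<theta>))" .
  have "(\<integral>\<^sup>+\<omega>. ennreal (g \<omega>) \<partial>gibbs ?\<Lambda>) \<le>
     ennreal (?V * (6 ^ ?d * (1 + exp a) + 3 ^ ?d * exp a) + real (card ?J) * ?\<theta> + measure lborel ?\<Lambda> + void_cost + 1)"
    using bd c r by (intro gibbs_exp_bound mg) (auto simp: g_def sum_nonneg)
  also have "\<dots> \<le> ennreal (tiling_cost * ?V + real (card ?J) * ?\<theta>)"
  proof (rule ennreal_leI)
    have "void_cost * 1 \<le> void_cost * ?V" using V void_cost_nonneg by (intro mult_left_mono)
    then show "?V * (6 ^ ?d * (1 + exp a) + 3 ^ ?d * exp a) + real (card ?J) * ?\<theta> + measure lborel ?\<Lambda> + void_cost + 1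
      \<le> tiling_cost * ?V + real (card ?J) * ?\<theta>"
      using V r by (simp add: measure_cube tiling_cost_def algebra_simps)
  qed
  finally have fin: "(\<integral>\<^sup>+\<omega>. ennreal (g \<omega>) \<partial>gibbs ?\<Lambda>) \<le> ennreal (tiling_cost * ?V + real (card ?J) * ?\<theta>)" .
  have geq: "(\<Sum>v\<in>?J. indicator A ((+) (v + s) ` \<omega> \<inter> ?W)) = ennreal (1 / c) * ennreal (g \<omega>)" for \<omega>
  proof -
    have "ennreal (1 / c) * ennreal (g \<omega>) = ennreal (\<Sum>v\<in>?J. indicator A ((+) (v + s) ` \<omega> \<inter> ?W))"
      using c by (subst ennreal_mult[symmetric]) (auto simp: g_def sum_nonneg)
    also have "\<dots> = (\<Sum>v\<in>?J. ennreal (indicator A ((+) (v + s) ` \<omega> \<inter> ?W)))" by (rule sum_ennreal[symmetric]) simp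
    finally show ?thesis by (simp add: ennreal_indicator)
  qed
  have "(\<integral>\<^sup>+\<omega>. (\<Sum>v\<in>?J. indicator A ((+) (v + s) ` \<omega> \<inter> ?W)) \<partial>gibbs ?\<Lambda>) = ennreal (1 / c) * (\<integral>\<^sup>+\<omega>. ennreal (g \<omega>) \<partial>gibbs ?\<Lambda>)"
    unfolding geq using mg by (intro nn_integral_cmult) simp
  also have "\<dots> \<le> ennreal (1 / c) * ennreal (tiling_cost * ?V + real (card ?J) * ?\<theta>)"
    using fin by (intro mult_left_mono) auto
  also have "\<dots> = ennreal ((tiling_cost * ?V + real (card ?J) * ?\<theta>) / c)"
    using c by (subst ennreal_mult''[symmetric]) (auto intro!: add_nonneg_nonneg mult_nonneg_nonneg tiling_cost_nonneg simp: r[THEN order_trans[OF zero_le_one]])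
  finally show ?thesis .
qed

text \<open>The tiling bound is integrated over the offsets, which form a set of volume at most (2
  k)^d, and divided by the volume of the cube. The volume cancels, leaving a bound uniform in
  r.\<close>

lemma avg_local_bound:
  assumes k: "1 \<le> k" "real k \<le> r" and c: "0 < c" and A: "A \<in> sets config_algebra"
  shows "emeasure (avg r) {\<omega> \<in> configs. \<omega> \<inter> hbox k \<in> A} \<le>
    ennreal ((tiling_cost * (2 * real k) ^ DIM('a) + 3 ^ DIM('a) * (exp c * enn2real (local_weight k A))) / c)"
proof -
  let ?d = "DIM('a)" and ?L = "2 * real k" and ?W = "hbox k :: 'a set" and ?\<theta> = "exp c * enn2real (local_weight k A)"
  \<comment> \<open>The choice that makes r < L * M \<le> r + L: the lattice cells cover the cube
    and overshoot it by at most one mesh.\<close>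
  define M where "M = \<lfloor>r / ?L\<rfloor> + 1"
  let ?J = "lattice ?L M :: 'a set"
  let ?V = "(2 * r) ^ ?d"
  have L: "0 < ?L" and r: "1 \<le> r" using k by linarith+
  have M: "0 \<le> M" "?L * real_of_int M \<le> r + ?L" "r < ?L * real_of_int M"
  proof -
    define z where "z = real_of_int \<lfloor>r / ?L\<rfloor>"
    have "z \<le> r / ?L" "r / ?L < z + 1" unfolding z_def by linarith+
    then have "?L * z \<le> r" "r < ?L * (z + 1)" using L by (auto simp: field_simps)
    then show "?L * real_of_int M \<le> r + ?L" "r < ?L * real_of_int M" by (auto simp: M_def z_def algebra_simps)
    have "0 \<le> r / ?L" using r L by simp
    then show "0 \<le> M" by (simp add: M_def)
  qed
  let ?S = "{\<omega> \<in> configs. \<omega> \<inter> ?W \<in> A}"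
  have S: "?S \<in> sets config_algebra"
    using measurable_sets[OF measurable_restrict_config A, of ?W] by (simp add: vimage_def Int_def conj_commute)
  define h where "h u = (\<integral>\<^sup>+\<omega>. indicator ?S ((+) u ` \<omega>) \<partial>gibbs (cube r))" for u
  have mS: "indicator ?S \<in> borel_measurable config_algebra" using S by simp
  have h: "h \<in> borel_measurable borel" unfolding h_def[abs_def] by (rule measurable_shift_gibbs_integral[OF mS]) simp
  let ?X = "(tiling_cost * ?V + real (card ?J) * ?\<theta>) / c"
  have X: "0 \<le> ?X" using c r tiling_cost_nonneg by (intro divide_nonneg_pos add_nonneg_nonneg mult_nonneg_nonneg) auto
  have sum: "(\<Sum>v\<in>?J. h (v + s)) \<le> ennreal ?X" if "s \<in> corner_box ?L" for s
  proof -
    have "(\<Sum>v\<in>?J. h (v + s)) = (\<integral>\<^sup>+\<omega>. (\<Sum>v\<in>?J. indicator ?S ((+) (v + s) ` \<omega>)) \<partial>gibbs (cube r))"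
      unfolding h_def using measurable_compose[OF measurable_shift_config1 mS] by (intro nn_integral_sum[symmetric]) auto
    also have "\<dots> = (\<integral>\<^sup>+\<omega>. (\<Sum>v\<in>?J. indicator A ((+) (v + s) ` \<omega> \<inter> ?W)) \<partial>gibbs (cube r))"
      by (intro nn_integral_cong sum.cong refl) (auto simp: configs_shift split: split_indicator)
    also have "\<dots> \<le> ennreal ?X" by (rule gibbs_tiling_bound[OF k c A that M(1,2)])
    finally show ?thesis .
  qed
  have "(\<integral>\<^sup>+u. h u * indicator (cube r) u \<partial>lborel) \<le> (\<integral>\<^sup>+s. (\<Sum>v\<in>?J. h (v + s)) * indicator (corner_box ?L) s \<partial>lborel)"
    by (rule nn_integral_tiling_le[OF h L M(3)])
  also have "\<dots> \<le> (\<integral>\<^sup>+s. ennreal ?X * indicator (corner_box ?L :: 'a set) s \<partial>lborel)"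
    using sum by (intro nn_integral_mono) (auto split: split_indicator)
  also have "\<dots> = ennreal ?X * emeasure lborel (corner_box ?L :: 'a set)"
    by (intro nn_integral_cmult_indicator) simp
  also have "\<dots> \<le> ennreal ?X * ennreal (?L ^ ?d)"
    using emeasure_corner_box_le[of ?L, where ?'a='a] L by (intro mult_left_mono) auto
  finally have "(\<integral>\<^sup>+u. h u * indicator (cube r) u \<partial>lborel) / ennreal ?V \<le> ennreal ?X * ennreal (?L ^ ?d) / ennreal ?V"
    by (rule divide_right_mono_ennreal)
  also have "\<dots> = ennreal (?X * ?L ^ ?d / ?V)"
  proof -
    have gen: "0 \<le> x \<Longrightarrow> 0 \<le> y \<Longrightarrow> 0 < z \<Longrightarrow> ennreal x * ennreal y / ennreal z = ennreal (x * y / z)" for x y z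
      by (simp add: ennreal_mult[symmetric] divide_ennreal)
    show ?thesis by (rule gen[OF X]) (use L r in auto)
  qed
  also have "\<dots> \<le> ennreal ((tiling_cost * ?L ^ ?d + 3 ^ ?d * ?\<theta>) / c)"
  proof (rule ennreal_leI)
    have V: "0 < ?V" using r by simp
    have gen: "j * l * \<theta> \<le> t * V * \<theta> \<Longrightarrow> (x * V + j * \<theta>) * l \<le> (x * l + t * \<theta>) * V" for j l \<theta> t V x :: real
      by (simp add: algebra_simps)
    have "real (card ?J) * ?L ^ ?d \<le> 3 ^ ?d * ?V"
      using M(2) k(2) by (intro card_lattice_scaled_le M(1) L) linarith
    then have "real (card ?J) * ?L ^ ?d * ?\<theta> \<le> 3 ^ ?d * ?V * ?\<theta>" by (intro mult_right_mono) auto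
    then have "(tiling_cost * ?V + real (card ?J) * ?\<theta>) * ?L ^ ?d \<le> (tiling_cost * ?L ^ ?d + 3 ^ ?d * ?\<theta>) * ?V"
      by (rule gen)
    then have "(tiling_cost * ?V + real (card ?J) * ?\<theta>) * ?L ^ ?d / ?V \<le> tiling_cost * ?L ^ ?d + 3 ^ ?d * ?\<theta>"
      using V by (simp only: pos_divide_le_eq)
    then have "(tiling_cost * ?V + real (card ?J) * ?\<theta>) * ?L ^ ?d / ?V / c \<le> (tiling_cost * ?L ^ ?d + 3 ^ ?d * ?\<theta>) / c"
      using c by (intro divide_right_mono) auto
    then show "?X * ?L ^ ?d / ?V \<le> (tiling_cost * ?L ^ ?d + 3 ^ ?d * ?\<theta>) / c" by (simp add: mult.commute)
  qed
  finally have "(\<integral>\<^sup>+u. h u * indicator (cube r) u \<partial>lborel) / ennreal ?V \<le> ennreal ((tiling_cost * ?L ^ ?d + 3 ^ ?d * ?\<theta>) / c)" .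
  moreover have "emeasure (avg r) ?S = (\<integral>\<^sup>+u. h u * indicator (cube r) u \<partial>lborel) / ennreal ?V"
    using nn_integral_avg[OF _ mS, of r] r S by (simp add: h_def)
  ultimately show ?thesis by simp
qed

end

section \<open>Extension of local laws\<close>

lemma ex_pointwise_convergent_filter:
  fixes p :: "nat \<Rightarrow> 'i \<Rightarrow> real"
  assumes p: "\<And>n i. p n i \<in> {0..1}"
  obtains F and l :: "'i \<Rightarrow> real" where "F \<le> sequentially" "F \<noteq> bot" "\<And>i. ((\<lambda>n. p n i) \<longlongrightarrow> l i) F"
proof -
  have "compactin (product_topology (\<lambda>_. euclidean) UNIV) (PiE UNIV (\<lambda>_::'i. {0..1::real}))"
    by (subst compactin_PiE) auto
  then have "compact (PiE UNIV (\<lambda>_::'i. {0..1::real}))"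
    by (simp only: euclidean_product_topology compactin_euclidean_iff)
  moreover have "filtermap p sequentially \<noteq> bot" by (simp add: filtermap_bot_iff)
  moreover have "eventually (\<lambda>x. x \<in> PiE UNIV (\<lambda>_::'i. {0..1::real})) (filtermap p sequentially)"
    unfolding eventually_filtermap using p by (intro always_eventually allI) (auto simp: PiE_iff)
  ultimately obtain x where x: "inf (nhds x) (filtermap p sequentially) \<noteq> bot"
    unfolding compact_filter by blast
  \<comment> \<open>The cluster point \<open>x\<close> lives in the product space; \<open>F\<close>
    pulls its neighbourhoods back to the indices while staying finer than
    \<open>sequentially\<close>. It is proper precisely because \<open>x\<close> is a cluster
    point.\<close>
  define F where "F = inf sequentially (filtercomap p (nhds x))"
  have "F \<noteq> bot"
  proof
    assume "F = bot"
    then have "eventually (\<lambda>_. False) F" by simp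
    then obtain P Q where P: "eventually P sequentially" and Q: "eventually Q (nhds x)" and PQ: "\<And>n. P n \<Longrightarrow> Q (p n) \<Longrightarrow> False"
      unfolding F_def eventually_inf eventually_filtercomap by blast
    have "eventually (\<lambda>y. \<not> Q y) (filtermap p sequentially)"
      unfolding eventually_filtermap using P by (rule eventually_mono) (use PQ in blast)
    with Q have "eventually (\<lambda>_. False) (inf (nhds x) (filtermap p sequentially))"
      unfolding eventually_inf by blast
    then show False using x by (simp add: trivial_limit_def)
  qed
  have lim: "filterlim p (nhds x) F"
    unfolding filterlim_def F_def by (simp add: filtermap_le_iff_le_filtercomap)
  have "((\<lambda>n. p n i) \<longlongrightarrow> x i) F" for i
  proof -
    have "continuous_on UNIV (\<lambda>y :: 'i \<Rightarrow> real. y i)" by (rule continuous_on_product_coordinates)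
    then have "((\<lambda>y :: 'i \<Rightarrow> real. y i) \<longlongrightarrow> x i) (at x)" unfolding continuous_on_def by auto
    from tendsto_compose[OF this lim] show ?thesis .
  qed
  with \<open>F \<noteq> bot\<close> show ?thesis using that[of F x] by (simp add: F_def)
qed

section \<open>Decomposition of the space into shells\<close>

definition shell :: "nat \<Rightarrow> 'a::euclidean_space set" where
  "shell k = hbox (Suc k) - hbox k"

lemma bounded_borel_shell [simp]: "bounded (shell k)" "shell k \<in> sets borel"
  by (auto simp: shell_def intro: bounded_subset[OF bounded_borel_hbox(1)])

lemma hbox_Suc: "hbox (Suc k) = hbox k \<union> shell k" "hbox k \<inter> shell k = {}"
  using hbox_mono[of k "Suc k"] by (auto simp: shell_def)

lemma hbox_eq_UN_shell: "hbox k = (\<Union>j<k. shell j)"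
  by (induction k) (auto simp: hbox_Suc(1) lessThan_Suc)

lemma shell_disjoint: "i \<noteq> j \<Longrightarrow> shell i \<inter> shell j = {}"
proof (induction i j rule: linorder_wlog)
  case (le i j)
  then have "hbox (Suc i) \<subseteq> hbox j" by (intro hbox_mono) auto
  then show ?case by (auto simp: shell_def)
qed auto

lemma hbox_Int_shell: "hbox k \<inter> shell j = (if j < k then shell j else {} :: 'a::euclidean_space set)"
proof (cases "j < k")
  case True
  then show ?thesis by (auto simp: hbox_eq_UN_shell)
next
  case False
  then have "shell i \<inter> shell j = ({} :: 'a set)" if "i < k" for i using that by (intro shell_disjoint) auto
  then show ?thesis using False by (auto simp: hbox_eq_UN_shell)
qed

text \<open>The coordinates of the product are whole configurations, each used only inside its own
  shell, so that all factors of the product carry the same \<open>config_algebra\<close>.\<close>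

definition glue :: "nat set \<Rightarrow> (nat \<Rightarrow> 'a::euclidean_space set) \<Rightarrow> 'a set" where
  "glue J x = (\<Union>j\<in>J. x j \<inter> shell j)"

lemma glue_restrict: "glue UNIV x \<inter> hbox k = glue {..<k} x"
proof -
  have "glue UNIV x \<inter> hbox k = (\<Union>j. x j \<inter> (hbox k \<inter> shell j))" by (auto simp: glue_def)
  also have "\<dots> = glue {..<k} x" by (auto simp: glue_def hbox_Int_shell split: if_splits)
  finally show ?thesis .
qed

lemma glue_Suc: "glue {..<Suc k} x = glue {..<k} x \<inter> hbox k \<union> x k \<inter> shell k"
proof -
  have "glue {..<k} x \<inter> hbox k = glue {..<k} x" by (simp add: glue_restrict[symmetric] Int_assoc)
  then show ?thesis by (auto simp: glue_def lessThan_Suc)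
qed

lemma glue_cong: "(\<And>j. j \<in> J \<Longrightarrow> x j = y j) \<Longrightarrow> glue J x = glue J y"
  by (simp add: glue_def)

lemma glue_configs:
  assumes x: "\<And>j. j \<in> J \<Longrightarrow> x j \<in> configs" shows "glue J x \<in> configs"
  unfolding configs_def
proof safe
  fix B :: "'a set" assume "bounded B"
  then obtain k where "B \<subseteq> hbox k" by (rule bounded_subset_hbox)
  then have "glue J x \<inter> B \<subseteq> (\<Union>j\<in>J. x j \<inter> (hbox k \<inter> shell j))" by (auto simp: glue_def)
  also have "\<dots> \<subseteq> (\<Union>j\<in>J \<inter> {..<k}. x j \<inter> shell j)" unfolding hbox_Int_shell by (auto split: if_splits)
  finally have "glue J x \<inter> B \<subseteq> (\<Union>j\<in>J \<inter> {..<k}. x j \<inter> shell j)" .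
  moreover have "finite (\<Union>j\<in>J \<inter> {..<k}. x j \<inter> shell j)"
    using x by (auto intro!: configs_finite_Int)
  ultimately show "finite (glue J x \<inter> B)" by (rule finite_subset)
qed

lemma measurable_glue:
  assumes "J \<subseteq> I"
  shows "glue J \<in> PiM I (\<lambda>_. config_algebra) \<rightarrow>\<^sub>M (config_algebra :: 'a::euclidean_space set measure)"
proof (rule measurable_configI)
  let ?P = "PiM I (\<lambda>_. config_algebra :: 'a set measure)"
  show "x \<in> space ?P \<Longrightarrow> glue J x \<in> configs" for x
    using assms by (intro glue_configs) (auto simp: space_PiM PiE_iff)
  fix B :: "'a set" assume B: "open B"
  have "{x \<in> space ?P. glue J x \<inter> B = {}} = {x \<in> space ?P. \<forall>j. j \<in> J \<longrightarrow> x j \<in> avoid (shell j \<inter> B)}"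
    using assms by (auto simp: glue_def avoid_def space_PiM PiE_iff)
  also have "\<dots> \<in> sets ?P"
  proof (rule sets.sets_Collect_countable_All)
    fix j
    show "{x \<in> space ?P. j \<in> J \<longrightarrow> x j \<in> avoid (shell j \<inter> B)} \<in> sets ?P"
    proof (cases "j \<in> J")
      case True
      then have "j \<in> I" using assms by auto
      have "(\<lambda>x. x j) -` avoid (shell j \<inter> B) \<inter> space ?P \<in> sets ?P"
        using B \<open>j \<in> I\<close> by (intro measurable_sets[OF measurable_component_singleton] avoid_sets) auto
      then show ?thesis using True by (simp add: vimage_def Int_def conj_commute)
    qed simp
  qed
  finally show "{x \<in> space ?P. glue J x \<inter> B = {}} \<in> sets ?P" .
qed

text \<open>Kolmogorov extension without topological assumptions: absolute continuity with respect to
  the Poisson processes, which are products over the shells, provides the transition kernels of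
  the Ionescu-Tulcea theorem.\<close>

locale local_laws =
  fixes M :: "nat \<Rightarrow> 'a::euclidean_space set measure"
  assumes prob_M: "\<And>k. prob_space (M k)"
    and sets_M: "\<And>k. sets (M k) = sets config_algebra"
    and ac: "\<And>k. absolutely_continuous (poisson_process (hbox k)) (M k)"
    and consistent: "\<And>k. distr (M (Suc k)) config_algebra (\<lambda>\<omega>. \<omega> \<inter> hbox k) = M k"
begin

definition dens :: "nat \<Rightarrow> 'a set \<Rightarrow> ennreal" where
  "dens k = RN_deriv (poisson_process (hbox k)) (M k)"

lemma measurable_dens: "dens k \<in> borel_measurable config_algebra"
  unfolding dens_def using borel_measurable_RN_deriv[of "poisson_process (hbox k)" "M k"] by simp

lemma nn_integral_M:
  assumes F: "F \<in> borel_measurable config_algebra"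
  shows "(\<integral>\<^sup>+\<omega>. F \<omega> \<partial>M k) = (\<integral>\<^sup>+\<omega>. dens k \<omega> * F \<omega> \<partial>poisson_process (hbox k))"
proof -
  interpret p: sigma_finite_measure "poisson_process (hbox k)" by (rule sigma_finite_poisson) simp
  have "M k = density (poisson_process (hbox k)) (dens k)"
    unfolding dens_def using ac sets_M by (intro p.density_RN_deriv[symmetric]) auto
  then show ?thesis using F measurable_dens by (simp add: nn_integral_density)
qed

definition joint :: "nat \<Rightarrow> 'a set \<Rightarrow> 'a set \<Rightarrow> ennreal" where
  "joint k X y = dens (Suc k) (X \<inter> hbox k \<union> y \<inter> shell k)"

definition marginal :: "nat \<Rightarrow> 'a set \<Rightarrow> ennreal" where
  "marginal k X = (\<integral>\<^sup>+y. joint k X y \<partial>poisson_process (shell k))"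

text \<open>The conditional density of the next shell given the window. The value 1 where the
  quotient makes no sense keeps \<open>kernel\<close> a probability for every \<open>X\<close>, as
  the Ionescu-Tulcea construction requires.\<close>

definition transition :: "nat \<Rightarrow> 'a set \<Rightarrow> 'a set \<Rightarrow> ennreal" where
  "transition k X y = (if 0 < marginal k X \<and> marginal k X < \<infinity> then joint k X y / marginal k X else 1)"

definition kernel :: "nat \<Rightarrow> 'a set \<Rightarrow> 'a set measure" where
  "kernel k X = density (poisson_process (shell k)) (transition k X)"

lemma measurable_pair_config: "measurable (config_algebra \<Otimes>\<^sub>M poisson_process \<Delta>) N = measurable (config_algebra \<Otimes>\<^sub>M config_algebra) N"
  by (intro measurable_cong_sets sets_pair_measure_cong) auto

lemma measurable_join: "(\<lambda>(X, y). X \<inter> hbox k \<union> y \<inter> shell k) \<in> config_algebra \<Otimes>\<^sub>M config_algebra \<rightarrow>\<^sub>M (config_algebra :: 'a set measure)"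
  by (rule measurable_join_config) auto

lemma measurable_joint: "(\<lambda>(X, y). joint k X y) \<in> borel_measurable (config_algebra \<Otimes>\<^sub>M config_algebra)"
  using measurable_compose[OF measurable_join measurable_dens[of "Suc k"], of k] by (simp add: joint_def split_beta')

lemma measurable_marginal: "marginal k \<in> borel_measurable config_algebra"
proof -
  interpret p: sigma_finite_measure "poisson_process (shell k :: 'a set)" by (rule sigma_finite_poisson) simp
  show ?thesis unfolding marginal_def[abs_def]
    using measurable_joint[of k] by (intro p.borel_measurable_nn_integral) (simp add: measurable_pair_config)
qed

lemma measurable_transition: "(\<lambda>(X, y). transition k X y) \<in> borel_measurable (config_algebra \<Otimes>\<^sub>M config_algebra)"
proof -
  have [measurable]: "(\<lambda>p. joint k (fst p) (snd p)) \<in> borel_measurable (config_algebra \<Otimes>\<^sub>M config_algebra)"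
    using measurable_joint[of k] by (simp add: split_beta')
  have [measurable]: "marginal k \<in> borel_measurable config_algebra" by (rule measurable_marginal)
  show ?thesis unfolding transition_def split_beta' by measurable
qed

lemma measurable_joint1: "X \<in> configs \<Longrightarrow> joint k X \<in> borel_measurable config_algebra"
  using measurable_compose[OF measurable_Pair1' measurable_joint, of X k] by simp

lemma measurable_transition1: "X \<in> configs \<Longrightarrow> transition k X \<in> borel_measurable config_algebra"
  using measurable_compose[OF measurable_Pair1' measurable_transition, of X k] by simp

lemma prob_space_kernel:
  assumes X: "X \<in> configs" shows "prob_space (kernel k X)"
proof -
  interpret p: prob_space "poisson_process (shell k :: 'a set)" by (rule prob_space_poisson_process) simp
  have "(\<integral>\<^sup>+y. transition k X y \<partial>poisson_process (shell k)) = 1"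
  proof (cases "0 < marginal k X \<and> marginal k X < \<infinity>")
    case True
    then have "(\<integral>\<^sup>+y. transition k X y \<partial>poisson_process (shell k)) = marginal k X / marginal k X"
      using measurable_joint1[OF X] by (simp add: transition_def nn_integral_divide) (simp add: marginal_def)
    also have "\<dots> = 1" using True by (intro ennreal_divide_self) auto
    finally show ?thesis .
  next
    case False
    then have "transition k X = (\<lambda>y. 1)" by (auto simp: transition_def)
    then show ?thesis using p.emeasure_space_1 by (simp del: space_poisson_process)
  qed
  moreover have "emeasure (kernel k X) (space (kernel k X)) = (\<integral>\<^sup>+y. transition k X y \<partial>poisson_process (shell k))"
    unfolding kernel_def using measurable_transition1[OF X] sets.top[of "config_algebra :: 'a set measure"]
    by (subst emeasure_density) (auto intro!: nn_integral_cong)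
  ultimately show ?thesis by (intro prob_spaceI) simp
qed

lemma measurable_kernel: "kernel k \<in> config_algebra \<rightarrow>\<^sub>M subprob_algebra config_algebra"
proof (rule measurable_subprob_algebra)
  interpret p: sigma_finite_measure "poisson_process (shell k :: 'a set)" by (rule sigma_finite_poisson) simp
  fix X :: "'a set"
  assume "X \<in> space config_algebra"
  then show "subprob_space (kernel k X)" using prob_space_kernel by (intro prob_space_imp_subprob_space) simp
  show "sets (kernel k X) = sets config_algebra" by (simp add: kernel_def)
next
  interpret p: sigma_finite_measure "poisson_process (shell k :: 'a set)" by (rule sigma_finite_poisson) simp
  fix A :: "'a set set" assume A: "A \<in> sets config_algebra"
  have "(\<lambda>(X, y). transition k X y * indicator A y) \<in> borel_measurable (config_algebra \<Otimes>\<^sub>M poisson_process (shell k))"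
    unfolding measurable_pair_config split_beta' using measurable_transition[of k] A
    by (intro borel_measurable_times_ennreal measurable_compose[OF measurable_snd, of "indicator A"]) (auto simp: split_beta')
  then have "(\<lambda>X. \<integral>\<^sup>+y. transition k X y * indicator A y \<partial>poisson_process (shell k)) \<in> borel_measurable config_algebra"
    by (rule p.borel_measurable_nn_integral)
  moreover have "emeasure (kernel k X) A = (\<integral>\<^sup>+y. transition k X y * indicator A y \<partial>poisson_process (shell k))" if "X \<in> space config_algebra" for X
    unfolding kernel_def using that A measurable_transition1 by (intro emeasure_density) auto
  ultimately show "(\<lambda>X. emeasure (kernel k X) A) \<in> borel_measurable config_algebra"
    by (subst measurable_cong[of config_algebra _ "\<lambda>X. \<integral>\<^sup>+y. transition k X y * indicator A y \<partial>poisson_process (shell k)"]) auto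
qed

lemma nn_integral_M_Suc:
  assumes F: "F \<in> borel_measurable config_algebra"
  shows "(\<integral>\<^sup>+\<omega>. F \<omega> \<partial>M (Suc k)) =
    (\<integral>\<^sup>+X. \<integral>\<^sup>+y. joint k X y * F (X \<inter> hbox k \<union> y \<inter> shell k) \<partial>poisson_process (shell k) \<partial>poisson_process (hbox k))"
proof -
  have "(\<integral>\<^sup>+\<omega>. F \<omega> \<partial>M (Suc k)) = (\<integral>\<^sup>+\<omega>. dens (Suc k) \<omega> * F \<omega> \<partial>poisson_process (hbox k \<union> shell k))"
    using nn_integral_M[OF F, of "Suc k"] by (simp only: hbox_Suc)
  also have "\<dots> = (\<integral>\<^sup>+X. \<integral>\<^sup>+y. joint k X y * F (X \<inter> hbox k \<union> y \<inter> shell k) \<partial>poisson_process (shell k) \<partial>poisson_process (hbox k))"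
    unfolding joint_def using F measurable_dens hbox_Suc(2)
    by (intro nn_integral_poisson_Un borel_measurable_times_ennreal) auto
  finally show ?thesis .
qed

text \<open>By consistency \<open>marginal k\<close> is also a density of \<open>M k\<close>.
  Working with this version matches the denominator of \<open>transition\<close> without an
  almost-everywhere comparison with \<open>dens k\<close>.\<close>

lemma nn_integral_M_marginal:
  assumes F: "F \<in> borel_measurable config_algebra"
  shows "(\<integral>\<^sup>+\<omega>. F \<omega> \<partial>M k) = (\<integral>\<^sup>+X. marginal k X * F (X \<inter> hbox k) \<partial>poisson_process (hbox k))"
proof -
  have mr: "(\<lambda>\<omega>. \<omega> \<inter> hbox k) \<in> config_algebra \<rightarrow>\<^sub>M (config_algebra :: 'a set measure)"
    by (rule measurable_restrict_config) simp
  have Fr: "(\<lambda>\<omega>. F (\<omega> \<inter> hbox k)) \<in> borel_measurable config_algebra" by (rule measurable_compose[OF mr F])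
  have "(\<integral>\<^sup>+\<omega>. F \<omega> \<partial>M k) = (\<integral>\<^sup>+\<omega>. F (\<omega> \<inter> hbox k) \<partial>M (Suc k))"
    unfolding consistent[symmetric, of k] using F mr
    by (intro nn_integral_distr) (simp_all add: measurable_cong_sets[OF sets_M refl])
  also have "\<dots> = (\<integral>\<^sup>+X. \<integral>\<^sup>+y. joint k X y * F ((X \<inter> hbox k \<union> y \<inter> shell k) \<inter> hbox k) \<partial>poisson_process (shell k) \<partial>poisson_process (hbox k))"
    by (rule nn_integral_M_Suc[OF Fr])
  also have "\<dots> = (\<integral>\<^sup>+X. marginal k X * F (X \<inter> hbox k) \<partial>poisson_process (hbox k))"
  proof (intro nn_integral_cong)
    fix X :: "'a set" assume "X \<in> space (poisson_process (hbox k))"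
    moreover have "(X \<inter> hbox k \<union> y \<inter> shell k) \<inter> hbox k = X \<inter> hbox k" for y using hbox_Suc(2)[of k] by auto
    ultimately show "(\<integral>\<^sup>+y. joint k X y * F ((X \<inter> hbox k \<union> y \<inter> shell k) \<inter> hbox k) \<partial>poisson_process (shell k)) = marginal k X * F (X \<inter> hbox k)"
      unfolding marginal_def using measurable_joint1[of X k] by (simp add: nn_integral_multc)
  qed
  finally show ?thesis .
qed

lemma transition_restrict: "transition k (X \<inter> hbox k) = transition k X"
  by (simp only: transition_def fun_eq_iff marginal_def joint_def Int_assoc Int_absorb simp_thms)

text \<open>Disintegration of \<open>M (Suc k)\<close> over \<open>M k\<close>: the law of a window
  followed by the kernel of the next shell.\<close>

lemma nn_integral_kernel_step:
  assumes F: "F \<in> borel_measurable config_algebra"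
  shows "(\<integral>\<^sup>+\<omega>. F \<omega> \<partial>M (Suc k)) = (\<integral>\<^sup>+X. \<integral>\<^sup>+y. F (X \<inter> hbox k \<union> y \<inter> shell k) \<partial>kernel k X \<partial>M k)"
proof -
  interpret p: sigma_finite_measure "poisson_process (shell k :: 'a set)" by (rule sigma_finite_poisson) simp
  define \<Phi> where "\<Phi> X = (\<integral>\<^sup>+y. transition k X y * F (X \<inter> hbox k \<union> y \<inter> shell k) \<partial>poisson_process (shell k))" for X
  have mJ: "(\<lambda>p. F (fst p \<inter> hbox k \<union> snd p \<inter> shell k)) \<in> borel_measurable (config_algebra \<Otimes>\<^sub>M config_algebra)"
    using measurable_compose[OF measurable_join F, of k] by (simp add: split_beta')
  have m\<Phi>: "\<Phi> \<in> borel_measurable config_algebra"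
    unfolding \<Phi>_def[abs_def] using mJ measurable_transition[of k]
    by (intro p.borel_measurable_nn_integral) (simp add: measurable_pair_config split_beta' borel_measurable_times_ennreal)
  have mF1: "(\<lambda>y. F (X \<inter> hbox k \<union> y \<inter> shell k)) \<in> borel_measurable config_algebra" if "X \<in> configs" for X
    using measurable_compose[OF measurable_Pair1' mJ, of X] that by simp
  have "(\<integral>\<^sup>+X. \<integral>\<^sup>+y. F (X \<inter> hbox k \<union> y \<inter> shell k) \<partial>kernel k X \<partial>M k) = (\<integral>\<^sup>+X. \<Phi> X \<partial>M k)"
  proof (intro nn_integral_cong)
    fix X assume "X \<in> space (M k)"
    then have "X \<in> configs" using sets_eq_imp_space_eq[OF sets_M] by auto
    then show "(\<integral>\<^sup>+y. F (X \<inter> hbox k \<union> y \<inter> shell k) \<partial>kernel k X) = \<Phi> X"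
      unfolding kernel_def \<Phi>_def using mF1 measurable_transition1 by (intro nn_integral_density) auto
  qed
  also have "\<dots> = (\<integral>\<^sup>+X. marginal k X * \<Phi> (X \<inter> hbox k) \<partial>poisson_process (hbox k))"
    by (rule nn_integral_M_marginal[OF m\<Phi>])
  also have "\<dots> = (\<integral>\<^sup>+X. \<integral>\<^sup>+y. joint k X y * F (X \<inter> hbox k \<union> y \<inter> shell k) \<partial>poisson_process (shell k) \<partial>poisson_process (hbox k))"
  proof (rule nn_integral_cong_AE)
    \<comment> \<open>The marginal density integrates to 1, so it is almost everywhere finite; where
      it is 0 the joint density vanishes almost everywhere in the shell. The default value in
      \<open>transition\<close> therefore never contributes.\<close>
    have "(\<integral>\<^sup>+X. marginal k X \<partial>poisson_process (hbox k)) = (\<integral>\<^sup>+\<omega>. 1 \<partial>M k)"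
      using nn_integral_M_marginal[of "\<lambda>_. 1" k] by simp
    also have "\<dots> = 1" using prob_space.emeasure_space_1[OF prob_M] by simp
    finally have "AE X in poisson_process (hbox k). marginal k X \<noteq> \<infinity>"
      using measurable_marginal[of k] by (intro nn_integral_PInf_AE) auto
    then show "AE X in poisson_process (hbox k). marginal k X * \<Phi> (X \<inter> hbox k) =
      (\<integral>\<^sup>+y. joint k X y * F (X \<inter> hbox k \<union> y \<inter> shell k) \<partial>poisson_process (shell k))"
      using AE_space
    proof eventually_elim
      case (elim X)
      then have X: "X \<in> configs" by simp
      have \<Phi>: "\<Phi> (X \<inter> hbox k) = \<Phi> X"
        by (simp only: \<Phi>_def transition_restrict Int_assoc Int_absorb)
      have mt: "(\<lambda>y. transition k X y * F (X \<inter> hbox k \<union> y \<inter> shell k)) \<in> borel_measurable config_algebra"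
        using mF1[OF X] measurable_transition1[OF X] by (intro borel_measurable_times_ennreal) auto
      show ?case
      proof (cases "marginal k X = 0")
        case True
        then have "AE y in poisson_process (shell k). joint k X y = 0"
          unfolding marginal_def using measurable_joint1[OF X] by (subst (asm) nn_integral_0_iff_AE) auto
        then have "(\<integral>\<^sup>+y. joint k X y * F (X \<inter> hbox k \<union> y \<inter> shell k) \<partial>poisson_process (shell k)) = (\<integral>\<^sup>+y. 0 \<partial>poisson_process (shell k :: 'a set))"
          by (intro nn_integral_cong_AE) auto
        then show ?thesis using True by simp
      next
        case False
        then have pos: "0 < marginal k X" "marginal k X < \<infinity>" using elim by (auto simp: less_top zero_less_iff_neq_zero)
        have "marginal k X * \<Phi> X = (\<integral>\<^sup>+y. marginal k X * (transition k X y * F (X \<inter> hbox k \<union> y \<inter> shell k)) \<partial>poisson_process (shell k))"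
          unfolding \<Phi>_def using mt by (intro nn_integral_cmult[symmetric]) simp
        also have "\<dots> = (\<integral>\<^sup>+y. joint k X y * F (X \<inter> hbox k \<union> y \<inter> shell k) \<partial>poisson_process (shell k))"
        proof (intro nn_integral_cong)
          fix y
          have "marginal k X * transition k X y = joint k X y"
            using pos by (simp add: transition_def ennreal_times_divide mult.commute[of "marginal k X"] ennreal_mult_divide_eq)
          then show "marginal k X * (transition k X y * F (X \<inter> hbox k \<union> y \<inter> shell k)) = joint k X y * F (X \<inter> hbox k \<union> y \<inter> shell k)"
            by (simp add: mult.assoc[symmetric])
        qed
        finally show ?thesis by (simp add: \<Phi>)
      qed
    qed
  qed
  also have "\<dots> = (\<integral>\<^sup>+\<omega>. F \<omega> \<partial>M (Suc k))" by (rule nn_integral_M_Suc[OF F, symmetric])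
  finally show ?thesis ..
qed

sublocale IT: Ionescu_Tulcea "\<lambda>k x. kernel k (glue {..<k} x)" "\<lambda>_. config_algebra :: 'a set measure"
proof (rule Ionescu_Tulcea.intro, goal_cases)
  case (1 i)
  show ?case by (rule measurable_compose[OF measurable_glue measurable_kernel]) auto
next
  case (2 i x)
  then show ?case by (intro prob_space_kernel glue_configs) (auto simp: space_PiM PiE_iff)
qed

text \<open>Identifies the glued law of the first k coordinates with \<open>M k\<close>, one
  disintegration per step.\<close>

lemma nn_integral_C:
  assumes "F \<in> borel_measurable config_algebra"
  shows "(\<integral>\<^sup>+x. F (glue {..<k} x) \<partial>IT.C 0 k (\<lambda>_. undefined)) = (\<integral>\<^sup>+\<omega>. F \<omega> \<partial>M k)"
  using assms
proof (induction k arbitrary: F)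
  case 0
  \<comment> \<open>Since \<open>hbox 0\<close> is empty, consistency forces \<open>M 0\<close> to
    be the point mass at the empty configuration.\<close>
  have "(\<integral>\<^sup>+\<omega>. F \<omega> \<partial>M 0) = (\<integral>\<^sup>+\<omega>. F (\<omega> \<inter> hbox 0) \<partial>M (Suc 0))"
    unfolding consistent[symmetric, of 0] using 0 measurable_restrict_config[of "{} :: 'a set"]
    by (subst nn_integral_distr) (simp_all add: measurable_cong_sets[OF sets_M refl])
  also have "\<dots> = F {}" using prob_space.emeasure_space_1[OF prob_M] by simp
  moreover have "(\<integral>\<^sup>+x. F (glue {..<0} x) \<partial>IT.C 0 0 (\<lambda>_. undefined)) = F {}"
  proof -
    have "prob_space (IT.C 0 0 (\<lambda>_. undefined))" by (rule IT.prob_space_C) (simp add: space_PiM)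
    then show ?thesis using prob_space.emeasure_space_1 by (simp only: glue_def lessThan_0 UN_empty nn_integral_const) (simp add: prob_space.emeasure_space_1)
  qed
  ultimately show ?case by simp
next
  case (Suc k)
  let ?C = "IT.C 0 k (\<lambda>_. undefined)"
  have sC: "sets ?C = sets (Pi\<^sub>M {0..<k} (\<lambda>_. config_algebra))" using IT.sets_C[of _ 0 k] by simp
  define \<Phi> where "\<Phi> X = (\<integral>\<^sup>+y. F (X \<inter> hbox k \<union> y \<inter> shell k) \<partial>kernel k X)" for X
  have m\<Phi>: "\<Phi> \<in> borel_measurable config_algebra"
  proof -
    have "(\<lambda>(X, y). F (X \<inter> hbox k \<union> y \<inter> shell k)) \<in> borel_measurable (config_algebra \<Otimes>\<^sub>M config_algebra)"
      using measurable_compose[OF measurable_join Suc.prems, of k] by (simp add: split_beta')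
    then show ?thesis unfolding \<Phi>_def[abs_def] by (intro nn_integral_measurable_subprob_algebra2[OF _ measurable_kernel]) auto
  qed
  have gl: "glue {..<Suc k} \<in> Pi\<^sub>M {0..<Suc k} (\<lambda>_. config_algebra) \<rightarrow>\<^sub>M (config_algebra :: 'a set measure)"
    by (rule measurable_glue) auto
  have "(\<integral>\<^sup>+x. F (glue {..<Suc k} x) \<partial>IT.C 0 (Suc k) (\<lambda>_. undefined)) =
     (\<integral>\<^sup>+x. \<integral>\<^sup>+z. F (glue {..<Suc k} z) \<partial>IT.eP k x \<partial>?C)"
    unfolding IT.C.simps add_0
  proof (rule nn_integral_bind[where B="Pi\<^sub>M {0..<Suc k} (\<lambda>_. config_algebra)"], goal_cases)
    case 1
    show ?case by (rule measurable_compose[OF gl Suc.prems])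
  next
    case 2
    show ?case using IT.measurable_eP[of k] by (simp add: measurable_cong_sets[OF sC refl])
  qed
  also have "\<dots> = (\<integral>\<^sup>+x. \<Phi> (glue {..<k} x) \<partial>?C)"
  proof (rule nn_integral_cong)
    fix x assume "x \<in> space ?C"
    then have x: "x \<in> space (Pi\<^sub>M {0..<k} (\<lambda>_. config_algebra :: 'a set measure))"
      using sets_eq_imp_space_eq[OF sC] by simp
    have "(\<integral>\<^sup>+z. F (glue {..<Suc k} z) \<partial>IT.eP k x) = (\<integral>\<^sup>+y. F (glue {..<Suc k} (x(k := y))) \<partial>kernel k (glue {..<k} x))"
      by (rule IT.nn_integral_eP[OF x measurable_compose[OF gl Suc.prems]])
    also have "\<dots> = \<Phi> (glue {..<k} x)"
    proof -
      have "glue {..<Suc k} (x(k := y)) = glue {..<k} x \<inter> hbox k \<union> y \<inter> shell k" for y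
        using glue_cong[of "{..<k}" "x(k := y)" x] by (simp add: glue_Suc)
      then show ?thesis by (simp add: \<Phi>_def)
    qed
    finally show "(\<integral>\<^sup>+z. F (glue {..<Suc k} z) \<partial>IT.eP k x) = \<Phi> (glue {..<k} x)" .
  qed
  also have "\<dots> = (\<integral>\<^sup>+X. \<Phi> X \<partial>M k)" by (rule Suc.IH[OF m\<Phi>])
  also have "\<dots> = (\<integral>\<^sup>+\<omega>. F \<omega> \<partial>M (Suc k))" unfolding \<Phi>_def by (rule nn_integral_kernel_step[OF Suc.prems, symmetric])
  finally show ?case .
qed

definition extension :: "'a set measure" where
  "extension = distr IT.PF.lim config_algebra (glue UNIV)"

lemma sets_lim: "sets IT.PF.lim = sets (Pi\<^sub>M UNIV (\<lambda>_. config_algebra :: 'a set measure))"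
  by simp

lemma distr_extension: "distr extension config_algebra (\<lambda>\<omega>. \<omega> \<inter> hbox k) = M k"
proof (rule measure_eqI)
  let ?P = "\<lambda>I. Pi\<^sub>M I (\<lambda>_. config_algebra :: 'a set measure)"
  fix A assume "A \<in> sets (distr extension config_algebra (\<lambda>\<omega>. \<omega> \<inter> hbox k))"
  then have A: "A \<in> sets config_algebra" by simp
  have mr: "(\<lambda>\<omega>. \<omega> \<inter> hbox k) \<in> config_algebra \<rightarrow>\<^sub>M (config_algebra :: 'a set measure)" by (rule measurable_restrict_config) simp
  have mg: "glue UNIV \<in> ?P UNIV \<rightarrow>\<^sub>M (config_algebra :: 'a set measure)" by (rule measurable_glue) simp
  have mk: "glue {..<k} \<in> ?P {0..<k} \<rightarrow>\<^sub>M (config_algebra :: 'a set measure)" by (rule measurable_glue) auto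
  let ?X = "glue {..<k} -` A \<inter> space (?P {0..<k})"
  have X: "?X \<in> sets (?P {0..<k})" by (rule measurable_sets[OF mk A])
  have "emeasure (distr extension config_algebra (\<lambda>\<omega>. \<omega> \<inter> hbox k)) A = 
      emeasure (distr IT.PF.lim config_algebra (\<lambda>x. glue UNIV x \<inter> hbox k)) A"
    unfolding extension_def using mr mg by (subst distr_distr) (auto simp: comp_def measurable_cong_sets[OF sets_lim refl])
  also have "\<dots> = emeasure IT.PF.lim ((\<lambda>x. glue UNIV x \<inter> hbox k) -` A \<inter> space IT.PF.lim)"
    using A measurable_compose[OF mg mr] by (intro emeasure_distr) (auto simp: measurable_cong_sets[OF sets_lim refl])
  also have "(\<lambda>x. glue UNIV x \<inter> hbox k) -` A \<inter> space IT.PF.lim = IT.PF.emb UNIV {0..<k} ?X"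
  proof -
    have gr: "glue {..<k} (restrict x {0..<k}) = glue {..<k} x" for x :: "nat \<Rightarrow> 'a set" by (rule glue_cong) auto
    have R: "restrict x {0..<k} \<in> space (?P {0..<k})" if "x \<in> space (?P UNIV)" for x :: "nat \<Rightarrow> 'a set"
      using that by (auto simp: space_PiM PiE_iff)
    have "IT.PF.emb UNIV {0..<k} ?X = {x \<in> space (?P UNIV). restrict x {0..<k} \<in> ?X}"
      unfolding prod_emb_def space_PiM by blast
    also have "\<dots> = {x \<in> space (?P UNIV). glue {..<k} x \<in> A}"
      using R by (auto simp only: gr mem_Collect_eq vimage_eq Int_iff)
    also have "\<dots> = (\<lambda>x. glue UNIV x \<inter> hbox k) -` A \<inter> space IT.PF.lim"
      unfolding glue_restrict sets_eq_imp_space_eq[OF sets_lim] by blast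
    finally show ?thesis ..
  qed
  also have "emeasure IT.PF.lim (IT.PF.emb UNIV {0..<k} ?X) = emeasure (IT.CI {0..<k}) ?X"
    using X by (intro IT.lim) auto
  also have "\<dots> = emeasure (IT.C 0 k (\<lambda>_. undefined)) (IT.PF.emb {0..<k} {0..<k} ?X)"
    using X by (intro IT.emeasure_CI) auto
  also have "IT.PF.emb {0..<k} {0..<k} ?X = ?X"
    using sets.sets_into_space[OF X] by (intro prod_emb_id) (auto simp: space_PiM)
  also have "emeasure (IT.C 0 k (\<lambda>_. undefined)) ?X = (\<integral>\<^sup>+x. indicator A (glue {..<k} x) \<partial>IT.C 0 k (\<lambda>_. undefined))"
  proof -
    have sC: "sets (IT.C 0 k (\<lambda>_. undefined)) = sets (?P {0..<k})" using IT.sets_C[of _ 0 k] by simp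
    have "emeasure (IT.C 0 k (\<lambda>_. undefined)) ?X = (\<integral>\<^sup>+x. indicator ?X x \<partial>IT.C 0 k (\<lambda>_. undefined))"
      using X sC by simp
    also have "\<dots> = (\<integral>\<^sup>+x. indicator A (glue {..<k} x) \<partial>IT.C 0 k (\<lambda>_. undefined))"
      using sets_eq_imp_space_eq[OF sC] by (intro nn_integral_cong) (auto split: split_indicator)
    finally show ?thesis .
  qed
  also have "\<dots> = (\<integral>\<^sup>+\<omega>. indicator A \<omega> \<partial>M k)" using A by (intro nn_integral_C) simp
  also have "\<dots> = emeasure (M k) A" using A sets_M by simp
  finally show "emeasure (distr extension config_algebra (\<lambda>\<omega>. \<omega> \<inter> hbox k)) A = emeasure (M k) A" .
qed (simp add: sets_M)

lemma sets_extension [simp]: "sets extension = sets config_algebra"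
  by (simp add: extension_def)

lemma prob_space_extension: "prob_space extension"
proof (rule prob_space_distrD)
  show "(\<lambda>\<omega>. \<omega> \<inter> hbox 0) \<in> extension \<rightarrow>\<^sub>M config_algebra"
    unfolding measurable_cong_sets[OF sets_extension refl] by (rule measurable_restrict_config) (rule bounded_borel_hbox)
  show "prob_space (distr extension config_algebra (\<lambda>\<omega>. \<omega> \<inter> hbox 0))"
    unfolding distr_extension by (rule prob_M)
qed

end

section \<open>The limit measure\<close>

definition local_event :: "nat \<Rightarrow> 'a::euclidean_space set set \<Rightarrow> 'a set set" where
  "local_event k A = {\<omega> \<in> configs. \<omega> \<inter> hbox k \<in> A}"

lemma local_event_sets [measurable]:
  assumes "A \<in> sets config_algebra" shows "local_event k A \<in> sets config_algebra"
  using measurable_sets[OF measurable_restrict_config assms, of "hbox k"]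
  by (simp add: local_event_def vimage_def Int_def conj_commute)

text \<open>An event of a window is an event of the next one too. This gives the consistency of the
  limit laws and lets estimates for \<open>Suc k\<close> be applied to window
  \<open>k\<close>.\<close>

lemma local_event_Suc:
  fixes A :: "'a::euclidean_space set set"
  shows "local_event (Suc k) (local_event k A) = local_event k A"
proof -
  have "\<omega> \<inter> hbox (Suc k) \<inter> hbox k = \<omega> \<inter> hbox k" for \<omega> :: "'a set" using hbox_mono[of k "Suc k"] by auto
  then show ?thesis by (auto simp: local_event_def intro: configs_subset)
qed

lemma AE_poisson_subset:
  assumes "bounded_borel \<Delta>" shows "AE \<omega> in poisson_process \<Delta>. \<omega> \<subseteq> \<Delta>"
proof -
  interpret prob_space "poisson_process \<Delta>" by (rule prob_space_poisson_process) fact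
  have "emeasure (poisson_process \<Delta>) (avoid (- \<Delta>)) = 1"
    using assms by (subst poisson_avoid) auto
  then have "AE \<omega> in poisson_process \<Delta>. \<omega> \<in> avoid (- \<Delta>)"
    using assms by (intro AE_prob_1) (simp add: emeasure_eq_measure)
  then show ?thesis by eventually_elim (auto simp: avoid_def)
qed

text \<open>The Poisson law of a window as a marginal of the next one. It carries null sets to the
  window \<open>Suc k\<close>, where the bounds on the averages are stated.\<close>

lemma poisson_local_event:
  assumes A: "A \<in> sets config_algebra"
  shows "emeasure (poisson_process (hbox (Suc k))) (local_event k A) = emeasure (poisson_process (hbox k)) A"
proof -
  interpret s: prob_space "poisson_process (shell k :: 'a set)" by (rule prob_space_poisson_process) simp
  have mi: "(indicator (local_event k A) :: _ \<Rightarrow> ennreal) \<in> borel_measurable config_algebra"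
    using local_event_sets[OF A] by simp
  have "emeasure (poisson_process (hbox (Suc k))) (local_event k A) =
    (\<integral>\<^sup>+\<omega>. indicator (local_event k A) \<omega> \<partial>poisson_process (hbox k \<union> shell k))"
    using local_event_sets[OF A] by (simp add: hbox_Suc)
  also have "\<dots> = (\<integral>\<^sup>+X. \<integral>\<^sup>+y. indicator (local_event k A) (X \<inter> hbox k \<union> y \<inter> shell k) \<partial>poisson_process (shell k) \<partial>poisson_process (hbox k))"
    by (rule nn_integral_poisson_Un[OF _ _ hbox_Suc(2) mi]) auto
  also have "\<dots> = (\<integral>\<^sup>+X. indicator A X \<partial>poisson_process (hbox k))"
  proof (rule nn_integral_cong_AE)
    show "AE X in poisson_process (hbox k). (\<integral>\<^sup>+y. indicator (local_event k A) (X \<inter> hbox k \<union> y \<inter> shell k) \<partial>poisson_process (shell k)) = (indicator A X :: ennreal)"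
      using AE_poisson_subset[OF conjI[OF bounded_borel_hbox], of k] AE_space
    proof eventually_elim
      case (elim X)
      have "indicator (local_event k A) (X \<inter> hbox k \<union> y \<inter> shell k) = (indicator A X :: ennreal)" if "y \<in> configs" for y
      proof -
        have "(X \<inter> hbox k \<union> y \<inter> shell k) \<inter> hbox k = X" using elim hbox_Suc(2)[of k] by auto
        moreover have "X \<inter> hbox k \<union> y \<inter> shell k \<in> configs" using elim that by (auto intro: configs_Un configs_subset)
        ultimately show ?thesis by (auto simp: local_event_def split: split_indicator)
      qed
      then have "(\<integral>\<^sup>+y. indicator (local_event k A) (X \<inter> hbox k \<union> y \<inter> shell k) \<partial>poisson_process (shell k)) =
        (\<integral>\<^sup>+y. indicator A X \<partial>poisson_process (shell k :: 'a set))"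
        by (intro nn_integral_cong) simp
      then show ?case using s.emeasure_space_1 by (simp del: space_poisson_process)
    qed
  qed
  also have "\<dots> = emeasure (poisson_process (hbox k)) A" using A by simp
  finally show ?thesis .
qed

text \<open>A bounded local function is within B / m of B / m times a sum of m indicators of its
  level events. The error is the same under every probability measure, so convergence on local
  events suffices, along any filter.\<close>

lemma tendsto_local_integral:
  fixes f :: "'a::euclidean_space set \<Rightarrow> real"
  assumes F: "F \<noteq> bot" and Q: "\<And>n. prob_space (Q n)" "\<And>n. sets (Q n) = sets config_algebra"
    and P: "prob_space P" "sets P = sets config_algebra"
    and lim: "\<And>A. A \<in> sets config_algebra \<Longrightarrow>
      ((\<lambda>n. measure (Q n) (local_event k A)) \<longlongrightarrow> measure P (local_event k A)) F"
    and f: "f \<in> borel_measurable config_algebra" "\<And>\<omega>. \<omega> \<in> configs \<Longrightarrow> f \<omega> = f (\<omega> \<inter> hbox k)"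
    and B: "\<And>\<omega>. \<omega> \<in> configs \<Longrightarrow> 0 \<le> f \<omega>" "\<And>\<omega>. \<omega> \<in> configs \<Longrightarrow> f \<omega> \<le> B" "0 < B"
  shows "((\<lambda>n. \<integral>\<omega>. f \<omega> \<partial>Q n) \<longlongrightarrow> (\<integral>\<omega>. f \<omega> \<partial>P)) F"
proof (rule tendstoI)
  fix e :: real assume e: "0 < e"
  obtain m :: nat where m: "3 * B / e < real m" using reals_Archimedean2 by blast
  then have m0: "0 < real m" using B(3) e by (metis divide_pos_pos less_trans mult_pos_pos zero_less_numeral)
  have Bm: "B / real m < e / 3" using m m0 e by (simp add: field_simps)
  define S where "S i = {\<omega> \<in> configs. real i * (B / real m) \<le> f \<omega>}" for i :: nat
  have S: "S i \<in> sets config_algebra" for i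
  proof -
    have "S i = f -` {real i * (B / real m)..} \<inter> space config_algebra" by (auto simp: S_def)
    then show ?thesis using measurable_sets[OF f(1)] by simp
  qed
  have Sl: "local_event k (S i) = S i" for i
  proof -
    have "f (\<omega> \<inter> hbox k) = f \<omega>" if "\<omega> \<in> configs" for \<omega> using f(2)[OF that] by (rule sym)
    moreover have "\<omega> \<inter> hbox k \<in> configs" if "\<omega> \<in> configs" for \<omega> :: "'a set"
      using configs_subset[OF that, of "\<omega> \<inter> hbox k"] by simp
    ultimately show ?thesis by (auto simp: local_event_def S_def)
  qed
  \<comment> \<open>\<open>g\<close> rounds \<open>f\<close> down to a multiple of B / m, by
    counting the levels that \<open>f\<close> reaches.\<close>
  define g where "g \<omega> = B / real m * (\<Sum>i=1..m. indicator (S i) \<omega>)" for \<omega>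
  have g: "\<bar>f \<omega> - g \<omega>\<bar> \<le> B / real m" if \<omega>: "\<omega> \<in> configs" for \<omega>
  proof -
    define y where "y = f \<omega> * real m / B"
    have y: "0 \<le> y" "y \<le> real m" using B(1,2)[OF \<omega>] B(3) m0 unfolding y_def
      by (simp_all add: pos_divide_le_eq mult.commute[of "real m"] mult_right_mono)
    have fy: "f \<omega> = B / real m * y" using B(3) m0 by (simp add: y_def)
    have "\<omega> \<in> S i \<longleftrightarrow> real i \<le> y" for i
    proof -
      have "real i * (B / real m) \<le> f \<omega> \<longleftrightarrow> (B / real m) * real i \<le> (B / real m) * y" by (simp add: fy mult.commute)
      also have "\<dots> \<longleftrightarrow> real i \<le> y" using B(3) m0 by (intro mult_le_cancel_left_pos) simp
      finally show ?thesis using \<omega> by (simp add: S_def)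
    qed
    then have "(\<Sum>i=1..m. indicator (S i) \<omega>) = real (card {i \<in> {1..m}. real i \<le> y})"
      by (simp add: indicator_def of_bool_def sum.If_cases Int_def)
    also have "{i \<in> {1..m}. real i \<le> y} = {1..nat \<lfloor>y\<rfloor>}"
      using y by (auto simp: le_nat_floor le_nat_iff le_floor_iff nat_le_iff floor_le_iff)
    finally have "(\<Sum>i=1..m. indicator (S i) \<omega>) = real_of_int \<lfloor>y\<rfloor>" using y by simp
    then have "f \<omega> - g \<omega> = B / real m * (y - real_of_int \<lfloor>y\<rfloor>)" by (simp add: g_def fy right_diff_distrib)
    moreover have "0 \<le> y - real_of_int \<lfloor>y\<rfloor>" "y - real_of_int \<lfloor>y\<rfloor> \<le> 1" by linarith+
    moreover have "B / real m * (y - real_of_int \<lfloor>y\<rfloor>) \<le> B / real m * 1"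
      using B(3) m0 by (intro mult_left_mono) (linarith, simp)
    moreover have "0 \<le> B / real m * (y - real_of_int \<lfloor>y\<rfloor>)"
      using B(3) m0 by (intro mult_nonneg_nonneg) auto
    ultimately show ?thesis by simp
  qed
  have gm: "g \<in> borel_measurable config_algebra"
    unfolding g_def[abs_def] using S by (intro borel_measurable_times borel_measurable_sum borel_measurable_indicator) auto
  have close: "\<bar>(\<integral>\<omega>. f \<omega> \<partial>R) - B / real m * (\<Sum>i=1..m. measure R (S i))\<bar> \<le> B / real m"
    if R: "prob_space R" "sets R = sets config_algebra" for R
  proof -
    interpret R: prob_space R by fact
    have sp: "space R = configs" using sets_eq_imp_space_eq[OF R(2)] by simp
    have mR: "measurable R N = measurable config_algebra N" for N :: "real measure"
      by (rule measurable_cong_sets[OF R(2) refl])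
    have fi: "integrable R f" using f B by (intro R.integrable_const_bound[where B=B]) (auto simp: mR sp)
    have gb: "norm (g \<omega>) \<le> B + B / real m" if "\<omega> \<in> configs" for \<omega>
      using g[OF that] B(1,2)[OF that] unfolding real_norm_def by linarith
    have gi: "integrable R g"
      using gb gm by (intro R.integrable_const_bound[where B="B + B / real m"]) (auto simp: mR sp)
    have "(\<integral>\<omega>. g \<omega> \<partial>R) = B / real m * (\<Sum>i=1..m. measure R (S i))"
      unfolding g_def using S R(2) by (subst integral_mult_right_zero, subst Bochner_Integration.integral_sum) (auto simp: R.emeasure_eq_measure)
    then have "(\<integral>\<omega>. f \<omega> \<partial>R) - B / real m * (\<Sum>i=1..m. measure R (S i)) = (\<integral>\<omega>. f \<omega> - g \<omega> \<partial>R)"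
      using fi gi by simp
    also have "\<bar>\<dots>\<bar> \<le> (\<integral>\<omega>. B / real m \<partial>R)"
      using fi gi g by (intro integral_abs_bound[THEN order_trans] integral_mono) (auto simp: sp)
    finally show ?thesis using R.prob_space by simp
  qed
  have "((\<lambda>n. B / real m * (\<Sum>i=1..m. measure (Q n) (S i))) \<longlongrightarrow> B / real m * (\<Sum>i=1..m. measure P (S i))) F"
    using lim[OF S] unfolding Sl by (intro tendsto_intros)
  then have "\<forall>\<^sub>F n in F. dist (B / real m * (\<Sum>i=1..m. measure (Q n) (S i))) (B / real m * (\<Sum>i=1..m. measure P (S i))) < e / 3"
    using e by (intro tendstoD) auto
  then show "\<forall>\<^sub>F n in F. dist (\<integral>\<omega>. f \<omega> \<partial>Q n) (\<integral>\<omega>. f \<omega> \<partial>P) < e"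
  proof eventually_elim
    case (elim n)
    then show ?case using close[OF Q, of n] close[OF P] Bm unfolding dist_real_def by linarith
  qed
qed

section \<open>Construction of the limit measure\<close>

context stable_interaction
begin

definition finite_volume :: "nat \<Rightarrow> 'a set measure" where
  "finite_volume n = avg (real (Suc n))"

lemma sets_finite_volume [simp]: "sets (finite_volume n) = sets config_algebra"
  by (simp add: finite_volume_def)

lemma prob_space_finite_volume: "prob_space (finite_volume n)"
  unfolding finite_volume_def by (rule prob_space_avg) simp

text \<open>The event is regarded in the window \<open>Suc k\<close>, because
  \<open>avg_local_bound\<close> excludes the empty window; the side condition becomes
  \<open>Suc k \<le> Suc n\<close>.\<close>

lemma finite_volume_bound:
  assumes c: "0 < c" and A: "A \<in> sets config_algebra" and n: "k \<le> n"
  shows "measure (finite_volume n) (local_event k A) \<le>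
    (tiling_cost * (2 * real (Suc k)) ^ DIM('a) + 3 ^ DIM('a) * (exp c * enn2real (local_weight (Suc k) (local_event k A)))) / c"
    (is "_ \<le> ?r")
proof -
  interpret prob_space "finite_volume n" by (rule prob_space_finite_volume)
  have "emeasure (finite_volume n) {\<omega> \<in> configs. \<omega> \<inter> hbox (Suc k) \<in> local_event k A} \<le> ennreal ?r"
    unfolding finite_volume_def using n by (intro avg_local_bound c local_event_sets A) auto
  then have "ennreal (measure (finite_volume n) (local_event k A)) \<le> ennreal ?r"
    by (simp only: local_event_def[of "Suc k", symmetric] local_event_Suc emeasure_eq_measure)
  moreover have "0 \<le> ?r" using c tiling_cost_nonneg by (intro divide_nonneg_pos add_nonneg_nonneg) auto
  ultimately show ?thesis by simp
qed

text \<open>Exhibits the weight as a value of a genuine measure with a Poisson density, so that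
  continuity from above and absolute continuity are available.\<close>

lemma local_weight_local_event:
  assumes A: "A \<in> sets config_algebra"
  shows "local_weight (Suc k) (local_event k A) =
    emeasure (density (poisson_process (hbox (Suc k))) (\<lambda>\<omega>. ennreal (exp (a * card (\<omega> \<inter> hbox (Suc k)))))) (local_event k A)"
proof -
  have m: "(\<lambda>\<omega>. ennreal (exp (a * card (\<omega> \<inter> hbox (Suc k))))) \<in> borel_measurable config_algebra"
    by (rule measurable_compose[OF measurable_card_config]) auto
  have "indicator (local_event k A) (\<omega> \<inter> hbox (Suc k)) = (indicator (local_event k A) \<omega> :: ennreal)" if "\<omega> \<in> configs" for \<omega>
  proof -
    have "\<omega> \<in> local_event (Suc k) (local_event k A) \<longleftrightarrow> \<omega> \<in> local_event k A" by (simp only: local_event_Suc)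
    then show ?thesis using that by (auto simp: local_event_def[of "Suc k"] split: split_indicator)
  qed
  then show ?thesis unfolding local_weight_def using m local_event_sets[OF A]
    by (subst emeasure_density) (auto intro!: nn_integral_cong)
qed

lemma ex_limit:
  obtains F and P :: "'a set measure"
  where "F \<le> sequentially" "F \<noteq> bot" "prob_space P" "sets P = sets config_algebra"
    "\<And>k A. A \<in> sets config_algebra \<Longrightarrow>
      ((\<lambda>n. measure (finite_volume n) (local_event k A)) \<longlongrightarrow> measure P (local_event k A)) F"
proof -
  define p where "p n i = measure (finite_volume n) (local_event (fst i) (snd i))" for n and i :: "nat \<times> 'a set set"
  have p01: "p n i \<in> {0..1}" for n i
    using prob_space.prob_le_1[OF prob_space_finite_volume] by (simp add: p_def)
  obtain F l where F: "F \<le> sequentially" "F \<noteq> bot" and l': "\<And>i. ((\<lambda>n. p n i) \<longlongrightarrow> l i) F"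
    using ex_pointwise_convergent_filter[of p, OF p01] by blast
  define m where "m k A = l (k, A)" for k A
  have m: "((\<lambda>n. measure (finite_volume n) (local_event k A)) \<longlongrightarrow> m k A) F" for k A
    using l'[of "(k, A)"] by (simp add: p_def m_def)
  have m0: "0 \<le> m k A" for k A using F(2) by (intro tendsto_lowerbound[OF m]) auto
  have ev: "\<forall>\<^sub>F n in F. k \<le> n" for k by (rule filter_leD[OF F(1)]) (rule eventually_ge_at_top)
  \<comment> \<open>One event read in two windows; this becomes the consistency of the laws
    \<open>M k\<close>.\<close>
  have m_Suc: "m (Suc k) (local_event k A) = m k A" for k A
    using m[of "Suc k" "local_event k A"] unfolding local_event_Suc by (rule tendsto_unique[OF F(2) _ m])
  have m_add: "m k (A \<union> B) = m k A + m k B" if "A \<in> sets config_algebra" "B \<in> sets config_algebra" "A \<inter> B = {}" for k A B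
  proof (rule tendsto_unique[OF F(2) m])
    have "measure (finite_volume n) (local_event k (A \<union> B)) = measure (finite_volume n) (local_event k A) + measure (finite_volume n) (local_event k B)" for n
    proof -
      interpret prob_space "finite_volume n" by (rule prob_space_finite_volume)
      have "local_event k (A \<union> B) = local_event k A \<union> local_event k B" by (auto simp: local_event_def)
      then show ?thesis using that by (simp only:) (intro finite_measure_Union, auto simp: local_event_def[of k] intro!: local_event_sets[unfolded local_event_def])
    qed
    then show "((\<lambda>n. measure (finite_volume n) (local_event k (A \<union> B))) \<longlongrightarrow> m k A + m k B) F"
      using tendsto_add[OF m m] by simp
  qed
  have m_le: "m k A \<le> (tiling_cost * (2 * real (Suc k)) ^ DIM('a) + 3 ^ DIM('a) * (exp c * enn2real (local_weight (Suc k) (local_event k A)))) / c"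
    if "0 < c" "A \<in> sets config_algebra" for k A c
    by (rule tendsto_upperbound[OF m _ F(2)]) (rule eventually_mono[OF ev], rule finite_volume_bound[OF that])
  \<comment> \<open>For weight zero the bound is a constant divided by c, for every positive
    c.\<close>
  have m_null: "m k A = 0" if A: "A \<in> sets config_algebra" and lw: "local_weight (Suc k) (local_event k A) = 0" for k A
  proof -
    let ?K = "tiling_cost * (2 * real (Suc k)) ^ DIM('a)"
    have le: "m k A \<le> ?K / c" if "0 < c" for c using m_le[OF that A, of k] lw by simp
    have "m k A \<le> 0"
    proof (rule field_le_epsilon)
      fix e :: real assume e: "0 < e"
      have K: "0 \<le> ?K" using tiling_cost_nonneg by simp
      have "m k A \<le> ?K / ((?K + 1) / e)" using K e by (intro le divide_pos_pos) auto
      also have "\<dots> \<le> e" using K e by (simp add: field_simps)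
      finally show "m k A \<le> 0 + e" by simp
    qed
    then show ?thesis using m0[of k A] by simp
  qed
  \<comment> \<open>First c is fixed so large that the part of the bound without the weight is below
    e / 2; then the weight of the decreasing events tends to 0 by continuity from above.\<close>
  have m_cont: "(\<lambda>i. m k (A i)) \<longlonglongrightarrow> 0"
    if A: "range A \<subseteq> sets config_algebra" "decseq A" "(\<Inter>i. A i) = {}" for k and A :: "nat \<Rightarrow> 'a set set"
  proof -
    let ?K = "tiling_cost * (2 * real (Suc k)) ^ DIM('a)"
    let ?\<nu> = "density (poisson_process (hbox (Suc k) :: 'a set)) (\<lambda>\<omega>. ennreal (exp (a * card (\<omega> \<inter> hbox (Suc k)))))"
    let ?B = "\<lambda>i. local_event k (A i)"
    have Ai: "A i \<in> sets config_algebra" for i using A by auto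
    have w: "local_weight (Suc k) (?B i) = emeasure ?\<nu> (?B i)" for i by (rule local_weight_local_event[OF Ai])
    have "(\<lambda>i. emeasure ?\<nu> (?B i)) \<longlonglongrightarrow> emeasure ?\<nu> (\<Inter>i. ?B i)"
    proof (rule Lim_emeasure_decseq)
      show "range ?B \<subseteq> sets ?\<nu>" using Ai by (auto intro!: local_event_sets)
      show "decseq ?B" using A(2) by (auto simp: decseq_def local_event_def)
      show "emeasure ?\<nu> (?B i) \<noteq> \<infinity>" for i
        using local_weight_le[of "Suc k" "?B i"] by (auto simp: w top_unique)
    qed
    moreover have "(\<Inter>i. ?B i) = {}" using A(3) by (auto simp: local_event_def)
    ultimately have "(\<lambda>i. local_weight (Suc k) (?B i)) \<longlonglongrightarrow> ennreal 0" by (simp add: w)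
    then have lw: "(\<lambda>i. enn2real (local_weight (Suc k) (?B i))) \<longlonglongrightarrow> 0"
      by (subst (asm) ennreal_local_weight[symmetric]) (subst (asm) tendsto_ennreal_iff, auto)
    show ?thesis
    proof (rule LIMSEQ_I)
      fix e :: real assume e: "0 < e"
      have K: "0 \<le> ?K" using tiling_cost_nonneg by simp
      define c where "c = (?K + 1) * 2 / e"
      have c: "0 < c" using K e by (simp add: c_def)
      have Kc: "?K / c < e / 2" using K e by (simp add: c_def field_simps)
      have "(\<lambda>i. (?K + 3 ^ DIM('a) * (exp c * enn2real (local_weight (Suc k) (?B i)))) / c) \<longlonglongrightarrow> (?K + 3 ^ DIM('a) * (exp c * 0)) / c"
        using c by (intro tendsto_divide tendsto_add tendsto_const tendsto_mult_left lw) auto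
      then have "(\<lambda>i. (?K + 3 ^ DIM('a) * (exp c * enn2real (local_weight (Suc k) (?B i)))) / c) \<longlonglongrightarrow> ?K / c" by simp
      moreover have "?K / c < e" using Kc e by linarith
      ultimately have "\<forall>\<^sub>F i in sequentially. (?K + 3 ^ DIM('a) * (exp c * enn2real (local_weight (Suc k) (?B i)))) / c < e"
        by (rule order_tendstoD(2))
      then have "\<forall>\<^sub>F i in sequentially. norm (m k (A i) - 0) < e"
      proof eventually_elim
        case (elim i)
        then show ?case using m_le[OF c Ai[of i], of k] m0[of k "A i"] by simp
      qed
      then show "\<exists>no. \<forall>n\<ge>no. norm (m k (A n) - 0) < e" by (simp add: eventually_sequentially)
    qed
  qed
  define M where "M k = measure_of configs (sets config_algebra) (\<lambda>A. ennreal (m k A))" for k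
  have sub: "sets config_algebra \<subseteq> Pow (configs :: 'a set set)" using sets.space_closed[of config_algebra] by simp
  have sM: "sets (M k) = sets config_algebra" for k
    unfolding M_def using sub sets.sigma_sets_eq[of config_algebra] by (subst sets_measure_of) auto
  have spM: "space (M k) = configs" for k using sets_eq_imp_space_eq[OF sM] by simp
  have m_empty: "m k {} = 0" for k using m_add[of "{}" "{}" k] by simp
  have eM: "emeasure (M k) A = ennreal (m k A)" if A: "A \<in> sets config_algebra" for k A
  proof (rule emeasure_measure_of[OF M_def])
    show "sets config_algebra \<subseteq> Pow (configs :: 'a set set)" by (rule sub)
    show "A \<in> sets (M k)" using A sM by simp
    show pos: "positive (sets (M k)) (\<lambda>A. ennreal (m k A))" by (simp add: positive_def m_empty)
    have "ring_of_sets configs (sets config_algebra)"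
      using sets.ring_of_sets_axioms[of config_algebra] by simp
    then show "countably_additive (sets (M k)) (\<lambda>A. ennreal (m k A))"
      unfolding sM
    proof (rule ring_of_sets.empty_continuous_imp_countably_additive)
      show "positive (sets config_algebra) (\<lambda>A. ennreal (m k A))" using pos sM by simp
      show "additive (sets config_algebra) (\<lambda>A. ennreal (m k A))"
        unfolding additive_def using m_add m0 by (auto simp: ennreal_plus[symmetric] simp del: ennreal_plus)
      show "(\<lambda>i. ennreal (m k (A i))) \<longlonglongrightarrow> 0"
        if "range A \<subseteq> sets config_algebra" "decseq A" "(\<Inter>i. A i) = {}" for A :: "nat \<Rightarrow> 'a set set"
        using tendsto_ennrealI[OF m_cont[OF that]] by simp
    qed auto
  qed
  interpret L: local_laws M
  proof (rule local_laws.intro)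
    fix k
    have "m k configs = 1"
    proof (rule tendsto_unique[OF F(2) m])
      have "local_event k configs = (configs :: 'a set set)" by (auto simp: local_event_def intro: configs_subset)
      moreover have "measure (finite_volume n) configs = 1" for n
        using prob_space.prob_space[OF prob_space_finite_volume, of n] sets_eq_imp_space_eq[OF sets_finite_volume, of n] by simp
      ultimately show "((\<lambda>n. measure (finite_volume n) (local_event k configs)) \<longlongrightarrow> 1) F" by simp
    qed
    then show "prob_space (M k)" using eM[of configs k] sets.top[of "config_algebra :: 'a set measure"]
      by (intro prob_spaceI) (simp add: spM)
    show "sets (M k) = sets config_algebra" by (rule sM)
    show "absolutely_continuous (poisson_process (hbox k)) (M k)"
      unfolding absolutely_continuous_def
    proof
      fix A :: "'a set set" assume "A \<in> null_sets (poisson_process (hbox k))"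
      then have A: "A \<in> sets config_algebra" "emeasure (poisson_process (hbox k)) A = 0" by auto
      have "local_event k A \<in> null_sets (poisson_process (hbox (Suc k)))"
        using poisson_local_event[OF A(1), of k] A local_event_sets[OF A(1)] by auto
      moreover have "(\<lambda>\<omega>. ennreal (exp (a * card (\<omega> \<inter> hbox (Suc k))))) \<in> borel_measurable (poisson_process (hbox (Suc k)))"
        using measurable_compose[OF measurable_card_config[OF conjI[OF bounded_borel_hbox]], of "\<lambda>n. ennreal (exp (a * real n))" borel "Suc k"] by simp
      ultimately have "local_weight (Suc k) (local_event k A) = 0"
        unfolding local_weight_local_event[OF A(1)]
        using absolutely_continuousI_density[of "\<lambda>\<omega>. ennreal (exp (a * card (\<omega> \<inter> hbox (Suc k))))" "poisson_process (hbox (Suc k))"]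
        by (auto simp: absolutely_continuous_def)
      then show "A \<in> null_sets (M k)" using m_null[OF A(1)] eM[OF A(1)] A(1) sM by auto
    qed
    show "distr (M (Suc k)) config_algebra (\<lambda>\<omega>. \<omega> \<inter> hbox k) = M k"
    proof (rule measure_eqI)
      fix A assume "A \<in> sets (distr (M (Suc k)) config_algebra (\<lambda>\<omega>. \<omega> \<inter> hbox k))"
      then have A: "A \<in> sets config_algebra" by simp
      have "(\<lambda>\<omega>. \<omega> \<inter> hbox k) \<in> M (Suc k) \<rightarrow>\<^sub>M config_algebra"
        unfolding measurable_cong_sets[OF sM refl] by (rule measurable_restrict_config) simp
      then have "emeasure (distr (M (Suc k)) config_algebra (\<lambda>\<omega>. \<omega> \<inter> hbox k)) A = emeasure (M (Suc k)) (local_event k A)"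
        using A by (simp add: emeasure_distr spM local_event_def vimage_def Int_def conj_commute)
      also have "\<dots> = emeasure (M k) A" using A by (simp add: eM local_event_sets m_Suc)
      finally show "emeasure (distr (M (Suc k)) config_algebra (\<lambda>\<omega>. \<omega> \<inter> hbox k)) A = emeasure (M k) A" .
    qed (simp add: sM)
  qed
  have "measure L.extension (local_event k A) = m k A" if A: "A \<in> sets config_algebra" for k A
  proof -
    have "(\<lambda>\<omega>. \<omega> \<inter> hbox k) \<in> L.extension \<rightarrow>\<^sub>M config_algebra"
      unfolding measurable_cong_sets[OF L.sets_extension refl] by (rule measurable_restrict_config) simp
    then have "measure (distr L.extension config_algebra (\<lambda>\<omega>. \<omega> \<inter> hbox k)) A = measure L.extension (local_event k A)"
      using A sets_eq_imp_space_eq[OF L.sets_extension] by (simp add: measure_distr local_event_def vimage_def Int_def conj_commute)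
    then show ?thesis using eM[OF A, of k] m0[of k A] by (simp add: L.distr_extension measure_def)
  qed
  then show ?thesis using that[OF F L.prob_space_extension L.sets_extension] m by simp
qed

end

section \<open>Stationarity, intensity and energies of the limit\<close>

locale gibbs_limit = stable_interaction H a for H :: "'a::euclidean_space set \<Rightarrow> ereal" and a +
  fixes F :: "nat filter" and P :: "'a set measure"
  assumes F: "F \<le> sequentially" "F \<noteq> bot"
    and prob_P: "prob_space P" and sets_P [simp]: "sets P = sets config_algebra"
    and limP: "\<And>k A. A \<in> sets config_algebra \<Longrightarrow>
      ((\<lambda>n. measure (finite_volume n) (local_event k A)) \<longlongrightarrow> measure P (local_event k A)) F"
begin

lemma space_P [simp]: "space P = configs"
  using sets_eq_imp_space_eq[OF sets_P] by simp

lemma measurable_P [simp]: "measurable P N = measurable config_algebra N"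
  by (rule measurable_cong_sets) simp_all

lemma space_finite_volume [simp]: "space (finite_volume n) = configs"
  using sets_eq_imp_space_eq[OF sets_finite_volume] by simp

lemma measurable_finite_volume [simp]: "measurable (finite_volume n) N = measurable config_algebra N"
  by (rule measurable_cong_sets) simp_all

lemma lim_integral:
  fixes f :: "'a set \<Rightarrow> real"
  assumes "f \<in> borel_measurable config_algebra" "\<And>\<omega>. \<omega> \<in> configs \<Longrightarrow> f \<omega> = f (\<omega> \<inter> hbox k)"
    and "\<And>\<omega>. \<omega> \<in> configs \<Longrightarrow> 0 \<le> f \<omega>" "\<And>\<omega>. \<omega> \<in> configs \<Longrightarrow> f \<omega> \<le> B" "0 < B"
  shows "((\<lambda>n. \<integral>\<omega>. f \<omega> \<partial>finite_volume n) \<longlongrightarrow> (\<integral>\<omega>. f \<omega> \<partial>P)) F"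
  using F(2) prob_space_finite_volume prob_P limP assms by (intro tendsto_local_integral[where k=k and B=B]) auto

lemma eventually_F: "eventually Q sequentially \<Longrightarrow> eventually Q F"
  by (rule filter_leD[OF F(1)])

lemma lim_avoid:
  assumes "bounded B" "B \<in> sets borel"
  shows "((\<lambda>n. measure (finite_volume n) (avoid B)) \<longlongrightarrow> measure P (avoid B)) F"
proof -
  obtain k where "B \<subseteq> hbox k" using bounded_subset_hbox[OF assms(1)] by blast
  then have "local_event k (avoid B) = avoid B"
    by (auto simp: local_event_def avoid_def intro: configs_subset)
  then show ?thesis using limP[of "avoid B" k] assms(2) by (simp add: avoid_sets)
qed

lemma stationary_limit: "stationary P"
  unfolding stationary_def
proof (intro allI config_measure_eqI)
  fix v :: 'a
  interpret P: prob_space P by (rule prob_P)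
  have m: "(\<lambda>\<omega>. (+) v ` \<omega>) \<in> P \<rightarrow>\<^sub>M config_algebra" by (simp add: measurable_shift_config1)
  interpret D: prob_space "distr P config_algebra (\<lambda>\<omega>. (+) v ` \<omega>)" by (rule P.prob_space_distr[OF m])
  show "finite_measure (distr P config_algebra (\<lambda>\<omega>. (+) v ` \<omega>))" by (rule D.finite_measure_axioms)
  fix B :: "'a set" assume B: "bounded B" "open B"
  let ?B = "(+) (- v) ` B"
  have B': "bounded_borel ?B" using B by (intro bounded_borel_shift) auto
  have pre: "{\<omega> \<in> configs. (+) v ` \<omega> \<in> avoid B} = avoid ?B"
  proof -
    have "?B = (+) v -` B" using shift_vimage[of "- v" B] unfolding minus_minus by (rule sym)
    then show ?thesis by (auto simp: avoid_def configs_shift)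
  qed
  have pre': "{\<omega> \<in> configs. (+) (- v) ` \<omega> \<in> avoid ?B} = avoid B"
  proof -
    have "(+) (- v) ` \<omega> \<inter> (+) (- v) ` B = (+) (- v) ` (\<omega> \<inter> B)" for \<omega> by (intro image_Int[symmetric] inj_onI) simp
    then show ?thesis using configs_shift[of _ "- v"] by (auto simp: avoid_def)
  qed
  obtain q where q: "0 \<le> q" "{v, - v} \<subseteq> cube q" using bounded_subset_cube[of "{v, - v}"] by auto
  \<comment> \<open>Only the upper estimate \<open>avg_shift_le\<close> is at hand; applied to
    \<open>v\<close> and to \<open>- v\<close> it gives equality in the limit.\<close>
  have le: "measure P (avoid C1) \<le> measure P (avoid C2)"
    if C: "bounded_borel C1" "bounded_borel C2" and w: "w \<in> cube q" and eq: "{\<omega> \<in> configs. (+) w ` \<omega> \<in> avoid C2} = avoid C1" for C1 C2 w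
  proof (rule tendsto_le[OF F(2) _ lim_avoid])
    show "bounded C1" "C1 \<in> sets borel" using C by auto
    have "((\<lambda>n. measure (finite_volume n) (avoid C2) + boundary_fraction DIM('a) q (real (Suc n))) \<longlongrightarrow> measure P (avoid C2) + 0) F"
      using C by (intro tendsto_add lim_avoid tendsto_mono[OF F(1) boundary_fraction_tendsto]) auto
    then show "((\<lambda>n. measure (finite_volume n) (avoid C2) + boundary_fraction DIM('a) q (real (Suc n))) \<longlongrightarrow> measure P (avoid C2)) F" by simp
    obtain n0 :: nat where n0: "q \<le> real n0" using real_arch_simple by blast
    show "\<forall>\<^sub>F n in F. measure (finite_volume n) (avoid C1) \<le> measure (finite_volume n) (avoid C2) + boundary_fraction DIM('a) q (real (Suc n))"
    proof (rule eventually_mono[OF eventually_F[OF eventually_ge_at_top[of n0]]])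
      fix n assume n: "n0 \<le> n"
      then have qn: "q \<le> real (Suc n)" using n0 by simp
      interpret prob_space "finite_volume n" by (rule prob_space_finite_volume)
      have bf: "0 \<le> boundary_fraction DIM('a) q (real (Suc n))"
        unfolding boundary_fraction_def using q qn by (simp add: power_le_one)
      have "emeasure (finite_volume n) (avoid C1) \<le> emeasure (finite_volume n) (avoid C2) + ennreal (boundary_fraction DIM('a) q (real (Suc n)))"
        unfolding finite_volume_def eq[symmetric] using q qn w C by (intro avg_shift_le) (auto intro!: avoid_sets)
      then show "measure (finite_volume n) (avoid C1) \<le> measure (finite_volume n) (avoid C2) + boundary_fraction DIM('a) q (real (Suc n))"
        using bf by (simp add: emeasure_eq_measure ennreal_plus[symmetric] del: ennreal_plus)
    qed
  qed
  have "measure P (avoid ?B) = measure P (avoid B)"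
    using B B' q by (intro antisym le[of _ _ v] le[of _ _ "- v"] pre pre') auto
  moreover have "emeasure (distr P config_algebra (\<lambda>\<omega>. (+) v ` \<omega>)) (avoid B) = emeasure P (avoid ?B)"
    using m B pre by (subst emeasure_distr) (auto intro!: avoid_sets simp: vimage_def Int_def conj_commute)
  ultimately show "emeasure (distr P config_algebra (\<lambda>\<omega>. (+) v ` \<omega>)) (avoid B) = emeasure P (avoid B)"
    by (simp add: P.emeasure_eq_measure)
qed simp_all

lemma mean_count_limit:
  assumes B: "B \<in> sets borel"
  shows "mean_count P B \<le> ennreal density_bound * emeasure lborel B"
proof -
  interpret P: prob_space P by (rule prob_P)
  \<comment> \<open>Counts are neither bounded nor local. Cutting both the region and the value at
    the same \<open>j\<close> gives bounded local functions increasing to the count.\<close>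
  define f where "f j \<omega> = min (card (\<omega> \<inter> (B \<inter> hbox j))) j" for j and \<omega> :: "'a set"
  have fm: "f j \<in> config_algebra \<rightarrow>\<^sub>M count_space UNIV" for j
    unfolding f_def[abs_def] using B by (intro measurable_compose[OF measurable_card_config, of "B \<inter> hbox j"]) auto
  have fmr: "(\<lambda>\<omega>. real (f j \<omega>)) \<in> borel_measurable config_algebra" for j by (rule measurable_compose[OF fm]) simp
  have fme: "(\<lambda>\<omega>. of_nat (f j \<omega>) :: ennreal) \<in> borel_measurable config_algebra" for j by (rule measurable_compose[OF fm]) simp
  have inc: "f i \<omega> \<le> f j \<omega>" if "\<omega> \<in> configs" "i \<le> j" for i j \<omega>
  proof -
    have "card (\<omega> \<inter> (B \<inter> hbox i)) \<le> card (\<omega> \<inter> (B \<inter> hbox j))"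
      using that hbox_mono[OF that(2)] by (intro card_mono configs_finite_Int) auto
    then show ?thesis using that by (auto simp: f_def)
  qed
  have bound: "(\<integral>\<^sup>+\<omega>. of_nat (f j \<omega>) \<partial>P) \<le> ennreal density_bound * emeasure lborel B" for j
  proof (cases "emeasure lborel B = \<infinity>")
    \<comment> \<open>Positivity of \<open>density_bound\<close> matters here: 0 times an infinite
      volume would be 0 in \<open>ennreal\<close>.\<close>
    case True
    have "0 < density_bound" using void_cost_nonneg by (simp add: density_bound_def add_pos_nonneg)
    then show ?thesis using True by (simp add: ennreal_mult_top)
  next
    case False
    then obtain b where b: "emeasure lborel B = ennreal b" "0 \<le> b" by (cases "emeasure lborel B") auto
    have lim: "((\<lambda>n. \<integral>\<omega>. real (f j \<omega>) \<partial>finite_volume n) \<longlongrightarrow> (\<integral>\<omega>. real (f j \<omega>) \<partial>P)) F"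
    proof (rule lim_integral[where k=j and B="real (Suc j)"])
      fix \<omega> :: "'a set"
      have "\<omega> \<inter> hbox j \<inter> (B \<inter> hbox j) = \<omega> \<inter> (B \<inter> hbox j)" by auto
      then show "real (f j \<omega>) = real (f j (\<omega> \<inter> hbox j))" by (simp add: f_def)
      show "(\<lambda>\<omega>. real (f j \<omega>)) \<in> borel_measurable config_algebra" by (rule fmr)
    qed (auto simp: f_def)
    have le: "(\<integral>\<omega>. real (f j \<omega>) \<partial>finite_volume n) \<le> density_bound * b" for n
    proof -
      interpret prob_space "finite_volume n" by (rule prob_space_finite_volume)
      have "(\<integral>\<^sup>+\<omega>. ennreal (real (f j \<omega>)) \<partial>finite_volume n) \<le> mean_count (finite_volume n) B"
        unfolding mean_count_def
      proof (intro nn_integral_mono)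
        fix \<omega> assume "\<omega> \<in> space (finite_volume n)"
        then have "of_nat (card (\<omega> \<inter> (B \<inter> hbox j))) = emeasure (count_space UNIV) (\<omega> \<inter> (B \<inter> hbox j))"
          by (simp add: emeasure_count_space configs_finite_Int)
        also have "\<dots> \<le> emeasure (count_space UNIV) (\<omega> \<inter> B)" by (intro emeasure_mono) auto
        finally have le: "of_nat (card (\<omega> \<inter> (B \<inter> hbox j))) \<le> emeasure (count_space UNIV) (\<omega> \<inter> B)" .
        show "ennreal (real (f j \<omega>)) \<le> emeasure (count_space UNIV) (\<omega> \<inter> B)"
          by (rule order_trans[OF _ le]) (auto simp: f_def ennreal_of_nat_eq_real_of_nat intro!: ennreal_leI)
      qed
      also have "\<dots> \<le> ennreal (density_bound * b)"
        unfolding finite_volume_def using avg_mean_count[OF _ B, of "real (Suc n)"] b density_bound_nonneg by (simp add: ennreal_mult)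
      finally have "enn2real (\<integral>\<^sup>+\<omega>. ennreal (real (f j \<omega>)) \<partial>finite_volume n) \<le> density_bound * b"
        using b density_bound_nonneg by (intro enn2real_leI) auto
      then show ?thesis using fmr by (subst integral_eq_nn_integral) auto
    qed
    have "(\<integral>\<omega>. real (f j \<omega>) \<partial>P) \<le> density_bound * b"
      using F(2) le by (intro tendsto_upperbound[OF lim]) auto
    moreover have "integrable P (\<lambda>\<omega>. real (f j \<omega>))"
      using fmr by (intro P.integrable_const_bound[where B="real j"]) (auto simp: f_def)
    ultimately have "(\<integral>\<^sup>+\<omega>. ennreal (real (f j \<omega>)) \<partial>P) \<le> ennreal (density_bound * b)"
      by (subst nn_integral_eq_integral) (auto intro: ennreal_leI)
    then show ?thesis using b density_bound_nonneg by (simp add: ennreal_mult ennreal_of_nat_eq_real_of_nat)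
  qed
  have "mean_count P B = (\<integral>\<^sup>+\<omega>. (SUP j. of_nat (f j \<omega>)) \<partial>P)"
    unfolding mean_count_def
  proof (intro nn_integral_cong)
    fix \<omega> :: "'a set" assume "\<omega> \<in> space P"
    then have \<omega>: "\<omega> \<in> configs" by simp
    let ?N = "\<lambda>j. emeasure (count_space UNIV) (\<omega> \<inter> (B \<inter> hbox j))"
    have Nj: "?N j = of_nat (card (\<omega> \<inter> (B \<inter> hbox j)))" for j
      using \<omega> by (simp add: emeasure_count_space configs_finite_Int)
    have "(\<Union>j. \<omega> \<inter> (B \<inter> hbox j)) = \<omega> \<inter> B" using UN_hbox by blast
    then have eq: "emeasure (count_space UNIV) (\<omega> \<inter> B) = (SUP j. ?N j)"
      using hbox_mono by (subst SUP_emeasure_incseq) (auto simp: incseq_def dest: subsetD)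
    show "emeasure (count_space UNIV) (\<omega> \<inter> B) = (SUP j. of_nat (f j \<omega>))"
      unfolding eq
    proof (rule antisym)
      show "(SUP j. ?N j) \<le> (SUP j. of_nat (f j \<omega>))"
      proof (rule SUP_least)
        fix j
        let ?c = "card (\<omega> \<inter> (B \<inter> hbox j))"
        have "card (\<omega> \<inter> (B \<inter> hbox j)) \<le> card (\<omega> \<inter> (B \<inter> hbox (max j ?c)))"
          using \<omega> hbox_mono[of j "max j ?c"] by (intro card_mono configs_finite_Int) auto
        then have "?c \<le> f (max j ?c) \<omega>" by (simp add: f_def)
        then have "?N j \<le> of_nat (f (max j ?c) \<omega>)" unfolding Nj by simp
        also have "\<dots> \<le> (SUP j. of_nat (f j \<omega>))" by (rule SUP_upper) simp
        finally show "?N j \<le> (SUP j. of_nat (f j \<omega>))" .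
      qed
      show "(SUP j. of_nat (f j \<omega>)) \<le> (SUP j. ?N j)"
        by (intro SUP_mono') (simp add: Nj f_def)
    qed
  qed
  also have "\<dots> = (SUP j. \<integral>\<^sup>+\<omega>. of_nat (f j \<omega>) \<partial>P)"
  proof (rule nn_integral_monotone_convergence_SUP_AE)
    show "AE \<omega> in P. (of_nat (f i \<omega>) :: ennreal) \<le> of_nat (f (Suc i) \<omega>)" for i
      using AE_space by eventually_elim (simp add: inc)
  qed (simp add: fme)
  also have "\<dots> \<le> ennreal density_bound * emeasure lborel B" using bound by (rule SUP_least)
  finally show ?thesis .
qed

lemma intensity_limit: "intensity_sup P \<le> ennreal density_bound"
  by (intro intensity_sup_leI mean_count_limit)

lemma finite_intensity_limit: "finite_intensity P"
  unfolding finite_intensity_def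
proof (intro allI impI)
  fix B :: "'a set" assume B: "bounded_borel B"
  have "mean_count P B \<le> ennreal density_bound * emeasure lborel B" using B by (intro mean_count_limit) simp
  also have "\<dots> < \<infinity>" using B emeasure_bounded_finite[of B] by (simp add: ennreal_mult_less_top)
  finally show "mean_count P B < \<infinity>" .
qed

text \<open>The event of infinite energy in \<open>D\<close> is local and has probability zero under
  all \<open>finite_volume n\<close>, so its limit probability is zero as well.\<close>

lemma energy_finite_limit:
  assumes D: "bounded_borel D" shows "AE \<omega> in P. H (\<omega> \<inter> D) < \<infinity>"
proof -
  interpret P: prob_space P by (rule prob_P)
  let ?S = "{\<omega> \<in> configs. H (\<omega> \<inter> D) = \<infinity>}"
  have S: "?S \<in> sets config_algebra"
    by (rule sets_energy_infinite[OF D])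
  obtain k where k: "D \<subseteq> hbox k" using bounded_subset_hbox D by blast
  have "\<omega> \<inter> hbox k \<inter> D = \<omega> \<inter> D" for \<omega> using k by auto
  then have "local_event k ?S = ?S" by (auto simp: local_event_def intro: configs_subset)
  then have "((\<lambda>n. measure (finite_volume n) ?S) \<longlongrightarrow> measure P ?S) F" using limP[OF S, of k] by simp
  moreover have "measure (finite_volume n) ?S = 0" for n
    unfolding finite_volume_def using avg_energy_finite[OF _ D, of "real (Suc n)"] by (simp add: measure_def)
  ultimately have "((\<lambda>n. 0) \<longlongrightarrow> measure P ?S) F" by simp
  then have "measure P ?S = 0" using F(2) by (simp add: tendsto_const_iff)
  then have "?S \<in> null_sets P" using S by (auto simp: null_sets_def P.emeasure_eq_measure)
  then show ?thesis by (rule AE_I') auto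
qed

end

section \<open>Resampling in the limit\<close>

text \<open>\<open>truncation K h\<close> and \<open>truncated_weight K h = exp (- h) * truncation K h\<close> are bounded Lipschitz functions of the
  energy; they replace \<open>1\<close> and \<open>exp (- h)\<close> until \<open>K\<close> is sent to infinity.\<close>

definition truncation :: "real \<Rightarrow> ereal \<Rightarrow> real" where
  "truncation K h = K / max (exp_minus h) K"

definition truncated_weight :: "real \<Rightarrow> ereal \<Rightarrow> real" where
  "truncated_weight K h = min (exp_minus h) K"

lemma truncation_weight: "0 < K \<Longrightarrow> truncation K h * exp_minus h = truncated_weight K h"
  by (cases "h = \<infinity>") (auto simp: truncation_def truncated_weight_def max_def min_def exp_minus_def)

lemma truncation_bounds: "0 < K \<Longrightarrow> 0 \<le> truncation K h" "0 < K \<Longrightarrow> truncation K h \<le> 1"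
  by (auto simp: truncation_def max_def)

lemma truncated_weight_bounds: "0 < K \<Longrightarrow> 0 \<le> truncated_weight K h" "truncated_weight K h \<le> K"
  by (auto simp: truncated_weight_def)

lemma measurable_truncation [measurable]: "truncation K \<in> borel_measurable borel"
  unfolding truncation_def[abs_def] by measurable

lemma measurable_truncated_weight [measurable]: "truncated_weight K \<in> borel_measurable borel"
  unfolding truncated_weight_def[abs_def] by measurable

text \<open>The derivative of exp (- x) is in modulus its value, which is at most K where the
  truncation is not active. The tangent inequality 1 + t \<le> exp t replaces differentiation across
  the kink.\<close>

lemma truncated_weight_lipschitz:
  assumes "0 < K" shows "\<bar>truncated_weight K (ereal x) - truncated_weight K (ereal y)\<bar> \<le> K * \<bar>x - y\<bar>"
proof (induction x y rule: linorder_wlog)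
  case (le x y)
  have e: "exp_minus (ereal x) = exp (- x)" "exp_minus (ereal y) = exp (- y)" by (simp_all add: exp_minus_def)
  define m where "m = min (exp (- x)) K"
  have m: "0 < m" "m \<le> K" "m \<le> exp (- x)" using assms by (auto simp: m_def)
  have "exp (x - y) \<le> 1" using le by simp
  then have "m * exp (x - y) \<le> m * 1" using m by (intro mult_left_mono) auto
  then have "m * exp (x - y) \<le> K" using m by linarith
  moreover have "m * exp (x - y) \<le> exp (- x) * exp (x - y)" using m by (intro mult_right_mono) auto
  then have "m * exp (x - y) \<le> exp (- y)" by (simp add: mult_exp_exp)
  ultimately have lower: "m * exp (x - y) \<le> min (exp (- y)) K" by simp
  have "1 + (x - y) \<le> exp (x - y)" by (rule exp_ge_add_one_self)
  then have "m * (1 + (x - y)) \<le> m * exp (x - y)" using m by (intro mult_left_mono) auto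
  then have "m * (1 + (x - y)) \<le> min (exp (- y)) K" using lower by (rule order_trans)
  moreover have "m * (1 + (x - y)) = m - m * (y - x)" by (simp add: algebra_simps)
  ultimately have "m - min (exp (- y)) K \<le> m * (y - x)" by linarith
  also have "\<dots> \<le> K * (y - x)" using m le by (intro mult_right_mono) auto
  finally have 1: "m - min (exp (- y)) K \<le> K * (y - x)" .
  have "min (exp (- y)) K \<le> m" unfolding m_def by (rule min.mono) (use le in simp_all)
  then show ?case using 1 le by (simp add: truncated_weight_def e m_def[symmetric])
next
  case (sym x y)
  then show ?case by (simp add: abs_minus_commute)
qed

text \<open>\<open>truncation K\<close> is min (K exp x) 1, that is
  \<open>truncated_weight 1\<close> after the reflection x to - x - ln K, so the Lipschitz constant
  is 1 for every K.\<close>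

lemma truncation_lipschitz:
  assumes K: "0 < K" shows "\<bar>truncation K (ereal x) - truncation K (ereal y)\<bar> \<le> \<bar>x - y\<bar>"
proof -
  have truncation: "truncation K (ereal x) = truncated_weight 1 (ereal (- x - ln K))" for x
  proof -
    have "K * exp x = exp (x + ln K)" using K by (simp add: exp_add)
    have "truncation K (ereal x) = K / max (exp (- x)) K" by (simp add: truncation_def exp_minus_def)
    also have "\<dots> = min (K * exp x) 1"
      using K by (auto simp: max_def min_def exp_minus field_simps)
    finally show ?thesis by (simp add: truncated_weight_def exp_minus_def \<open>K * exp x = _\<close> add.commute)
  qed
  show ?thesis using truncated_weight_lipschitz[of 1 "- x - ln K" "- y - ln K"] unfolding truncation by simp
qed

locale gibbs_limit_region = gibbs_limit H a F P for H :: "'a::euclidean_space set \<Rightarrow> ereal" and a F P +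
  fixes \<Delta> :: "'a set" and D :: "nat \<Rightarrow> 'a set"
  assumes \<Delta>: "bounded_borel \<Delta>" and regular: "regular_sequence H \<Delta> D"
begin

lemma D: "bounded_borel (D l)" "incseq D" "(\<Union>l. D l) = UNIV" "\<Delta> \<subseteq> D l"
proof -
  show *: "bounded_borel (D l)" "incseq D" "(\<Union>l. D l) = UNIV"
    using regular by (simp_all add: regular_sequence_def)
  have "\<Delta> \<subseteq> D 0" using regular by (simp add: regular_sequence_def)
  then show "\<Delta> \<subseteq> D l" using incseqD[OF *(2), of 0 l] by simp
qed

text \<open>The configurations to which the estimate of \<open>regular_sequence\<close> may be
  applied. The energies involved see only points outside \<open>\<Delta>\<close>, hence resampling
  preserves the property.\<close>

definition good :: "'a set \<Rightarrow> bool" where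
  "good \<omega> \<longleftrightarrow> \<omega> \<in> configs \<and> (\<forall>l. H (\<omega> \<inter> (D l - \<Delta>)) < \<infinity>)"

definition resample :: "'a set \<Rightarrow> 'a set \<Rightarrow> 'a set" where
  "resample \<omega> \<omega>' = \<omega>' \<inter> \<Delta> \<union> (\<omega> - \<Delta>)"

lemma resample_configs: "\<omega> \<in> configs \<Longrightarrow> \<omega>' \<in> configs \<Longrightarrow> resample \<omega> \<omega>' \<in> configs"
  unfolding resample_def by (intro configs_Un) (auto intro: configs_subset)

lemma resample_Diff: "resample \<omega> \<omega>' - \<Delta> = \<omega> - \<Delta>"
  by (auto simp: resample_def)

lemma good_resample: "good \<omega> \<Longrightarrow> \<omega>' \<in> configs \<Longrightarrow> good (resample \<omega> \<omega>')"
proof -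
  have "resample \<omega> \<omega>' \<inter> (D l - \<Delta>) = \<omega> \<inter> (D l - \<Delta>)" for l by (auto simp: resample_def)
  then show "good \<omega> \<Longrightarrow> \<omega>' \<in> configs \<Longrightarrow> good (resample \<omega> \<omega>')"
    using resample_configs by (simp add: good_def)
qed

text \<open>A common class for the finite-volume laws and the limit; estimates uniform over it
  justify exchanging the limits in the volume and in \<open>l\<close>.\<close>

definition admissible :: "'a set measure \<Rightarrow> bool" where
  "admissible Q \<longleftrightarrow> point_process Q \<and> intensity_sup Q \<le> ennreal density_bound \<and> (AE \<omega> in Q. good \<omega>)"

lemma admissible_P: "admissible P"
proof -
  have "AE \<omega> in P. \<forall>l. H (\<omega> \<inter> (D l - \<Delta>)) < \<infinity>"
    unfolding AE_all_countable using D(1) \<Delta> by (intro allI energy_finite_limit) (auto intro: bounded_subset)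
  then have "AE \<omega> in P. good \<omega>" using AE_space by eventually_elim (simp add: good_def)
  then show ?thesis using prob_P intensity_limit by (simp add: admissible_def point_process_def)
qed

lemma admissible_finite_volume: "admissible (finite_volume n)"
proof -
  have "AE \<omega> in finite_volume n. H (\<omega> \<inter> (D l - \<Delta>)) < \<infinity>" for l
  proof -
    have b: "bounded_borel (D l - \<Delta>)" using D(1) \<Delta> by (auto intro: bounded_subset)
    let ?S = "{\<omega> \<in> configs. H (\<omega> \<inter> (D l - \<Delta>)) = \<infinity>}"
    have "?S \<in> sets config_algebra"
      by (rule sets_energy_infinite[OF b])
    then have "?S \<in> null_sets (finite_volume n)"
      using avg_energy_finite[OF _ b, of "real (Suc n)"] by (auto simp: null_sets_def finite_volume_def)
    then show ?thesis by (rule AE_I') auto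
  qed
  then have "AE \<omega> in finite_volume n. \<forall>l. H (\<omega> \<inter> (D l - \<Delta>)) < \<infinity>" unfolding AE_all_countable by blast
  then have "AE \<omega> in finite_volume n. good \<omega>" using AE_space by eventually_elim (simp add: good_def)
  moreover have "intensity_sup (finite_volume n) \<le> ennreal density_bound"
    unfolding finite_volume_def by (rule avg_intensity_sup) simp
  ultimately show ?thesis using prob_space_finite_volume by (simp add: admissible_def point_process_def)
qed

section \<open>Uniform approximation of the local energy\<close>

abbreviation "E l \<equiv> energy_in H \<Delta> (D l)"
abbreviation "h \<equiv> local_energy H \<Delta> D"

text \<open>\<open>R l\<close> bounds, per point of \<open>\<Delta>\<close>, the error of replacing
  \<open>h\<close> by the local energy \<open>E l\<close>. Invariance under \<open>resample\<close>
  allows taking it out of the resampling integral. The separate alternative for infinite energies is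
  needed because their difference measures nothing.\<close>

definition remainder :: "(nat \<Rightarrow> 'a set \<Rightarrow> ennreal) \<Rightarrow> (nat \<Rightarrow> ennreal) \<Rightarrow> bool" where
  "remainder R \<epsilon> \<longleftrightarrow>
    (\<forall>l. R l \<in> borel_measurable config_algebra) \<and>
    (\<forall>l \<omega> \<omega>'. R l (resample \<omega> \<omega>') = R l \<omega>) \<and>
    (\<forall>l \<omega>. good \<omega> \<longrightarrow> of_nat (card (\<omega> \<inter> \<Delta>)) * R l \<omega> < \<infinity> \<longrightarrow>
      (E l \<omega> = \<infinity> \<and> h \<omega> = \<infinity>) \<or>
      (\<exists>x y. E l \<omega> = ereal x \<and> h \<omega> = ereal y \<and> ennreal \<bar>x - y\<bar> \<le> of_nat (card (\<omega> \<inter> \<Delta>)) * R l \<omega>)) \<and>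
    (\<forall>l Q. admissible Q \<longrightarrow> (\<integral>\<^sup>+\<omega>. R l \<omega> \<partial>Q) \<le> \<epsilon> l) \<and>
    \<epsilon> \<longlonglongrightarrow> 0"

lemma remainderD:
  assumes "remainder R \<epsilon>"
  shows "R l \<in> borel_measurable config_algebra"
    and "R l (resample \<omega> \<omega>') = R l \<omega>"
    and "good \<omega> \<Longrightarrow> of_nat (card (\<omega> \<inter> \<Delta>)) * R l \<omega> < \<infinity> \<Longrightarrow>
      (E l \<omega> = \<infinity> \<and> h \<omega> = \<infinity>) \<or>
      (\<exists>x y. E l \<omega> = ereal x \<and> h \<omega> = ereal y \<and> ennreal \<bar>x - y\<bar> \<le> of_nat (card (\<omega> \<inter> \<Delta>)) * R l \<omega>)"
    and "admissible Q \<Longrightarrow> (\<integral>\<^sup>+\<omega>. R l \<omega> \<partial>Q) \<le> \<epsilon> l"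
    and "\<epsilon> \<longlonglongrightarrow> 0"
  using assms unfolding remainder_def by blast+

text \<open>\<open>R l\<close> is the tail of the series of the functions G, and its expectation is
  at most the tail of \<alpha> times \<psi> at \<open>density_bound\<close>, by monotonicity of
  \<psi> uniformly over admissible laws.\<close>

lemma ex_remainder: obtains R \<epsilon> where "remainder R \<epsilon>"
proof -
  from conjunct2[OF conjunct2[OF conjunct2[OF conjunct2[OF regular[unfolded regular_sequence_def]]]]]
  show ?thesis
  proof (elim exE conjE, goal_cases)
    case prems: (1 G \<alpha> \<psi>)
    have G: "\<And>l. G l \<in> borel_measurable (outer_configs \<Delta>)"
        "\<And>l \<omega>. \<omega> \<in> space (outer_configs \<Delta>) \<Longrightarrow> 0 \<le> G l \<omega>"
      using prems(1,2) by blast+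
    have step: "\<bar>E (Suc l) \<omega> - E l \<omega>\<bar> \<le> ereal (card (\<omega> \<inter> \<Delta>) * G l (\<omega> - \<Delta>))"
      if "\<omega> \<in> configs" "H (\<omega> \<inter> (D (Suc l) - \<Delta>)) < \<infinity>" "E l \<omega> < \<infinity>" for l \<omega>
      using prems(3) that by blast
    have \<psi>: "mono \<psi>" "\<And>t. t < \<infinity> \<Longrightarrow> \<psi> t < \<infinity>" using prems(4,5) by blast+
    have \<alpha>: "\<And>l. 0 \<le> \<alpha> l" "summable \<alpha>" using prems(6,7) by blast+
    have int: "(\<integral>\<^sup>+ \<omega>. ennreal (G l (\<omega> - \<Delta>)) \<partial>Q) \<le> ennreal (\<alpha> l) * \<psi> (intensity_sup Q)"
      if "point_process Q" for l Q using prems(8) that by blast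
    define R where "R l \<omega> = (\<Sum>k. ennreal (G (k + l) (\<omega> - \<Delta>)))" for l \<omega>
    define \<epsilon> where "\<epsilon> l = ennreal (\<Sum>k. \<alpha> (k + l)) * \<psi> (ennreal density_bound)" for l
    have outer: "\<omega> - \<Delta> \<in> space (outer_configs \<Delta>)" if "\<omega> \<in> configs" for \<omega>
      using that by (auto simp: outer_configs_def space_restrict_space intro: configs_subset)
    have Gm: "(\<lambda>\<omega>. ennreal (G l (\<omega> - \<Delta>))) \<in> borel_measurable config_algebra" for l
    proof -
      have "(\<lambda>\<omega>. \<omega> - \<Delta>) \<in> config_algebra \<rightarrow>\<^sub>M outer_configs \<Delta>"
        unfolding outer_configs_def using \<Delta> by (intro measurable_restrict_space2 measurable_Diff_config) auto
      from measurable_compose[OF this G(1)] show ?thesis by measurable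
    qed
    have Rm: "R l \<in> borel_measurable config_algebra" for l
      unfolding R_def[abs_def] using Gm by (intro borel_measurable_suminf_order)
    have Rr: "R l (resample \<omega> \<omega>') = R l \<omega>" for l \<omega> \<omega>' by (simp add: R_def resample_Diff)
    have Rint: "(\<integral>\<^sup>+\<omega>. R l \<omega> \<partial>Q) \<le> \<epsilon> l" if Q: "admissible Q" for l Q
    proof -
      have pp: "point_process Q" and xi: "intensity_sup Q \<le> ennreal density_bound" using Q by (auto simp: admissible_def)
      have sQ: "sets Q = sets config_algebra" using pp by (simp add: point_process_def)
      have "(\<integral>\<^sup>+\<omega>. R l \<omega> \<partial>Q) = (\<Sum>k. \<integral>\<^sup>+\<omega>. ennreal (G (k + l) (\<omega> - \<Delta>)) \<partial>Q)"
        unfolding R_def using Gm by (intro nn_integral_suminf) (simp add: measurable_cong_sets[OF sQ refl])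
      also have "\<dots> \<le> (\<Sum>k. ennreal (\<alpha> (k + l)) * \<psi> (ennreal density_bound))"
        using monoD[OF \<psi>(1) xi] by (intro suminf_le order_trans[OF int[OF pp]] mult_left_mono) auto
      also have "\<dots> = \<epsilon> l" unfolding \<epsilon>_def using \<alpha>
        by (simp add: suminf_ennreal2 summable_ignore_initial_segment)
      finally show ?thesis .
    qed
    have "(\<lambda>l. \<Sum>k. \<alpha> (k + l)) \<longlonglongrightarrow> 0" by (rule suminf_exist_split2[OF \<alpha>(2)])
    then have "(\<lambda>l. ennreal (\<Sum>k. \<alpha> (k + l))) \<longlonglongrightarrow> ennreal 0" by (rule tendsto_ennrealI)
    \<comment> \<open>Finiteness of \<psi> at a finite argument is what makes this product tend to
      0.\<close>
    then have "(\<lambda>l. ennreal (\<Sum>k. \<alpha> (k + l)) * \<psi> (ennreal density_bound)) \<longlonglongrightarrow> ennreal 0 * \<psi> (ennreal density_bound)"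
      using \<psi>(2)[of "ennreal density_bound"] by (intro tendsto_mult_ennreal tendsto_const) auto
    then have \<epsilon>0: "\<epsilon> \<longlonglongrightarrow> 0" by (simp add: \<epsilon>_def[abs_def])
    have approx: "(E l \<omega> = \<infinity> \<and> h \<omega> = \<infinity>) \<or>
        (\<exists>x y. E l \<omega> = ereal x \<and> h \<omega> = ereal y \<and> ennreal \<bar>x - y\<bar> \<le> of_nat (card (\<omega> \<inter> \<Delta>)) * R l \<omega>)"
      if good: "good \<omega>" and fin: "of_nat (card (\<omega> \<inter> \<Delta>)) * R l \<omega> < \<infinity>" for l \<omega>
    proof -
      have \<omega>: "\<omega> \<in> configs" and bd: "\<And>l. H (\<omega> \<inter> (D l - \<Delta>)) < \<infinity>" using good by (auto simp: good_def)
      have fD: "finite (\<omega> \<inter> D l)" for l using \<omega> D(1) by (auto intro: configs_finite_Int)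
      have nM: "E k \<omega> \<noteq> - \<infinity>" for k using energy_in_not_MInf[OF fD bd] .
      have lim: "h \<omega> = e" if "(\<lambda>k. E k \<omega>) \<longlonglongrightarrow> e" for e using local_energy_eqI[OF fD D(2) bd that] .
      show ?thesis
      proof (cases "E l \<omega> = \<infinity>")
        case True
        then have "E k \<omega> = \<infinity>" if "l \<le> k" for k using energy_in_PInf_mono[OF fD D(2) bd that] by blast
        then have "\<forall>\<^sub>F k in sequentially. E k \<omega> = \<infinity>" by (auto simp: eventually_sequentially)
        then show ?thesis using True lim[OF tendsto_eventually] by blast
      next
        case False
        define c where "c k = card (\<omega> \<inter> \<Delta>) * G (k + l) (\<omega> - \<Delta>)" for k
        have c0: "0 \<le> c k" for k using G(2)[OF outer[OF \<omega>]] by (simp add: c_def)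
        have "(\<Sum>k. ennreal (c k)) = of_nat (card (\<omega> \<inter> \<Delta>)) * R l \<omega>"
          unfolding c_def R_def using G(2)[OF outer[OF \<omega>]]
          by (simp add: ennreal_mult ennreal_of_nat_eq_real_of_nat[symmetric] ennreal_suminf_cmult)
        then have cs: "(\<Sum>k. ennreal (c k)) \<noteq> \<top>" and csum: "of_nat (card (\<omega> \<inter> \<Delta>)) * R l \<omega> = (\<Sum>k. ennreal (c k))"
          using fin by auto
        have sc: "summable c" using summable_suminf_not_top[OF c0 cs] .
        \<comment> \<open>A finite increment cannot lead from a finite to an infinite energy, so
          from index l on the energies are all finite and may be summed in the reals.\<close>
        have Ek: "E (k + l) \<omega> \<noteq> \<infinity>" for k
        proof (induction k)
          case 0
          then show ?case using False by simp
        next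
          case (Suc k)
          then have lt: "E (k + l) \<omega> < \<infinity>" by simp
          obtain r where r: "E (k + l) \<omega> = ereal r" using Suc nM[of "k + l"] by (cases "E (k + l) \<omega>") auto
          show ?case using step[OF \<omega> bd lt] by (auto simp: r)
        qed
        define e where "e k = real_of_ereal (E (k + l) \<omega>)" for k
        have e: "E (k + l) \<omega> = ereal (e k)" for k using Ek[of k] nM[of "k + l"] by (cases "E (k + l) \<omega>") (auto simp: e_def)
        have ec: "\<bar>e (Suc k) - e k\<bar> \<le> c k" for k
          using step[OF \<omega> bd, of "k + l"] e[of k] e[of "Suc k"] by (simp add: c_def)
        have ss: "summable (\<lambda>k. \<bar>e (Suc k) - e k\<bar>)" by (rule summable_comparison_test'[OF sc, of 0]) (use ec in simp)
        then have s: "summable (\<lambda>k. e (Suc k) - e k)" by (rule summable_rabs_cancel)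
        define y where "y = e 0 + (\<Sum>k. e (Suc k) - e k)"
        have "(\<lambda>n. \<Sum>k<n. e (Suc k) - e k) \<longlonglongrightarrow> (\<Sum>k. e (Suc k) - e k)" by (rule summable_LIMSEQ[OF s])
        then have "(\<lambda>n. e n - e 0) \<longlonglongrightarrow> (\<Sum>k. e (Suc k) - e k)" by (simp add: sum_lessThan_telescope)
        then have "(\<lambda>n. e 0 + (e n - e 0)) \<longlonglongrightarrow> y" unfolding y_def by (intro tendsto_add tendsto_const)
        then have "e \<longlonglongrightarrow> y" by simp
        then have "(\<lambda>k. E (k + l) \<omega>) \<longlonglongrightarrow> ereal y" unfolding e by simp
        then have hy: "h \<omega> = ereal y" using lim LIMSEQ_offset[of "\<lambda>k. E k \<omega>" l] by blast
        have "\<bar>e 0 - y\<bar> = \<bar>\<Sum>k. e (Suc k) - e k\<bar>" by (simp add: y_def)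
        also have "\<dots> \<le> (\<Sum>k. \<bar>e (Suc k) - e k\<bar>)" by (rule summable_rabs[OF ss])
        also have "\<dots> \<le> (\<Sum>k. c k)" by (rule suminf_le[OF ec ss sc])
        finally have "ennreal \<bar>e 0 - y\<bar> \<le> ennreal (\<Sum>k. c k)" by (rule ennreal_leI)
        also have "\<dots> = of_nat (card (\<omega> \<inter> \<Delta>)) * R l \<omega>" unfolding csum by (rule suminf_ennreal2[OF c0 sc, symmetric])
        finally show ?thesis using hy e[of 0] by auto
      qed
    qed
    have "remainder R \<epsilon>" unfolding remainder_def using Rm Rr approx Rint \<epsilon>0 by blast
    then show ?case by (rule that)
  qed
qed

lemma measurable_h: "h \<in> borel_measurable config_algebra"
  using D(1) \<Delta> by (intro measurable_local_energy) auto

lemma measurable_E: "E l \<in> borel_measurable config_algebra"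
  using D(1) \<Delta> by (intro measurable_energy_in) auto

lemma measurable_resample':
  "(\<lambda>(\<omega>, \<omega>'). resample \<omega> \<omega>') \<in> config_algebra \<Otimes>\<^sub>M config_algebra \<rightarrow>\<^sub>M config_algebra"
  unfolding resample_def using \<Delta> by (intro measurable_resample) auto

lemma measurable_resample1:
  "\<omega> \<in> configs \<Longrightarrow> resample \<omega> \<in> config_algebra \<rightarrow>\<^sub>M config_algebra"
  using measurable_compose[OF measurable_Pair1' measurable_resample', of \<omega>] by simp

text \<open>Void events suffice to determine a law. The cutoff at \<open>q\<close> points in
  \<open>\<Delta>\<close> turns the factor \<open>card (\<omega> \<inter> \<Delta>)\<close> of the
  remainder into a constant.\<close>

definition test :: "'a set \<Rightarrow> nat \<Rightarrow> 'a set \<Rightarrow> real" where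
  "test B q \<omega> = indicator {\<omega>' \<in> avoid B. card (\<omega>' \<inter> \<Delta>) \<le> q} \<omega>"

lemma measurable_test: "B \<in> sets borel \<Longrightarrow> test B q \<in> borel_measurable config_algebra"
proof -
  assume B: "B \<in> sets borel"
  have "{\<omega> \<in> configs. card (\<omega> \<inter> \<Delta>) \<in> {..q}} \<in> sets config_algebra"
    using measurable_sets[OF measurable_card_config[OF \<Delta>], of "{..q}"] by (simp add: vimage_def Int_def conj_commute)
  then have "avoid B \<inter> {\<omega> \<in> configs. card (\<omega> \<inter> \<Delta>) \<in> {..q}} \<in> sets config_algebra"
    using avoid_sets[OF B] by auto
  also have "avoid B \<inter> {\<omega> \<in> configs. card (\<omega> \<inter> \<Delta>) \<in> {..q}} = {\<omega>' \<in> avoid B. card (\<omega>' \<inter> \<Delta>) \<le> q}"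
    by (auto simp: avoid_def)
  finally show ?thesis unfolding test_def[abs_def] by (rule borel_measurable_indicator)
qed

lemma test_bounds: "0 \<le> test B q \<omega>" "test B q \<omega> \<le> 1"
  by (auto simp: test_def split: split_indicator)

text \<open>The right-hand side of the resampling identity, up to the factor \<open>exp (\<lambda>(\<Delta>))\<close>.\<close>

definition empty_resample :: "('a set \<Rightarrow> ennreal) \<Rightarrow> 'a set \<Rightarrow> ennreal" where
  "empty_resample f \<omega> = indicator (avoid \<Delta>) \<omega> * (\<integral>\<^sup>+\<omega>'. f (resample \<omega> \<omega>') \<partial>poisson_process \<Delta>)"

lemma measurable_resample_nn_integral:
  "f \<in> borel_measurable config_algebra \<Longrightarrow> (\<lambda>\<omega>. \<integral>\<^sup>+\<omega>'. f (resample \<omega> \<omega>') \<partial>poisson_process \<Delta>) \<in> borel_measurable config_algebra"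
  unfolding resample_def by (rule measurable_resample_integral[OF \<Delta>])

lemma measurable_empty_resample:
  "f \<in> borel_measurable config_algebra \<Longrightarrow> empty_resample f \<in> borel_measurable config_algebra"
  unfolding empty_resample_def[abs_def] using \<Delta>
  by (intro borel_measurable_times_ennreal measurable_resample_nn_integral borel_measurable_indicator avoid_sets) auto

lemma measurable_resample_comp:
  "f \<in> borel_measurable config_algebra \<Longrightarrow> \<omega> \<in> configs \<Longrightarrow> (\<lambda>\<omega>'. f (resample \<omega> \<omega>')) \<in> borel_measurable config_algebra"
  by (rule measurable_compose[OF measurable_resample1])

lemma empty_resample_le:
  assumes "\<And>\<omega>. \<omega> \<in> configs \<Longrightarrow> f \<omega> \<le> c" "\<omega> \<in> configs"
  shows "empty_resample f \<omega> \<le> c"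
proof -
  interpret p: prob_space "poisson_process \<Delta>" by (rule prob_space_poisson_process[OF \<Delta>])
  have "(\<integral>\<^sup>+\<omega>'. f (resample \<omega> \<omega>') \<partial>poisson_process \<Delta>) \<le> (\<integral>\<^sup>+\<omega>'. c \<partial>poisson_process \<Delta>)"
    using assms resample_configs by (intro nn_integral_mono) auto
  also have "\<dots> = c" using p.emeasure_space_1 by (simp del: space_poisson_process)
  finally show ?thesis by (auto simp: empty_resample_def split: split_indicator)
qed

text \<open>The error is constant along resampling and the Poisson law has mass one, so it passes
  through the integral unchanged.\<close>

lemma empty_resample_approx:
  assumes f: "f \<in> borel_measurable config_algebra" and g: "g \<in> borel_measurable config_algebra"
    and le: "\<And>\<omega>. good \<omega> \<Longrightarrow> f \<omega> \<le> g \<omega> + c * r \<omega>"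
    and r: "\<And>\<omega> \<omega>'. r (resample \<omega> \<omega>') = r \<omega>" and \<omega>: "good \<omega>"
  shows "empty_resample f \<omega> \<le> empty_resample g \<omega> + c * r \<omega>"
proof -
  interpret p: prob_space "poisson_process \<Delta>" by (rule prob_space_poisson_process[OF \<Delta>])
  have "\<omega> \<in> configs" using \<omega> by (simp add: good_def)
  have "(\<integral>\<^sup>+\<omega>'. f (resample \<omega> \<omega>') \<partial>poisson_process \<Delta>) \<le> (\<integral>\<^sup>+\<omega>'. g (resample \<omega> \<omega>') + c * r \<omega> \<partial>poisson_process \<Delta>)"
  proof (intro nn_integral_mono)
    fix \<omega>' assume "\<omega>' \<in> space (poisson_process \<Delta>)"
    then show "f (resample \<omega> \<omega>') \<le> g (resample \<omega> \<omega>') + c * r \<omega>"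
      using le[of "resample \<omega> \<omega>'"] good_resample[OF \<omega>] by (simp add: r)
  qed
  also have "\<dots> = (\<integral>\<^sup>+\<omega>'. g (resample \<omega> \<omega>') \<partial>poisson_process \<Delta>) + c * r \<omega>"
    using p.emeasure_space_1 measurable_resample_comp[OF g \<open>\<omega> \<in> configs\<close>]
    by (subst nn_integral_add) (auto simp del: space_poisson_process)
  finally show ?thesis by (auto simp: empty_resample_def split: split_indicator)
qed

text \<open>Quasilocality in the mean, uniformly over admissible laws. Two one-sided inequalities
  stand for a distance, because subtraction in \<open>ennreal\<close> is truncated.\<close>

definition approximable :: "('a set \<Rightarrow> ennreal) \<Rightarrow> bool" where
  "approximable X \<longleftrightarrow> X \<in> borel_measurable config_algebra \<and>
     (\<exists>(Y :: nat \<Rightarrow> 'a set \<Rightarrow> real) \<eta> b. \<eta> \<longlonglongrightarrow> 0 \<and> 0 < b \<and>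
       (\<forall>l. Y l \<in> borel_measurable config_algebra \<and> (\<exists>k. \<forall>\<omega>\<in>configs. Y l \<omega> = Y l (\<omega> \<inter> hbox k)) \<and>
          (\<forall>\<omega>\<in>configs. 0 \<le> Y l \<omega> \<and> Y l \<omega> \<le> b)) \<and>
       (\<forall>l Q. admissible Q \<longrightarrow>
          (\<integral>\<^sup>+\<omega>. X \<omega> \<partial>Q) \<le> (\<integral>\<^sup>+\<omega>. ennreal (Y l \<omega>) \<partial>Q) + \<eta> l \<and>
          (\<integral>\<^sup>+\<omega>. ennreal (Y l \<omega>) \<partial>Q) \<le> (\<integral>\<^sup>+\<omega>. X \<omega> \<partial>Q) + \<eta> l))"

lemma approximableI:
  fixes Y :: "nat \<Rightarrow> 'a set \<Rightarrow> real" and R :: "nat \<Rightarrow> 'a set \<Rightarrow> ennreal" and c :: real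
  assumes X: "X \<in> borel_measurable config_algebra"
    and Y: "\<And>l. Y l \<in> borel_measurable config_algebra" "\<And>l. \<exists>k. \<forall>\<omega>\<in>configs. Y l \<omega> = Y l (\<omega> \<inter> hbox k)"
      "\<And>l \<omega>. \<omega> \<in> configs \<Longrightarrow> 0 \<le> Y l \<omega> \<and> Y l \<omega> \<le> b" "0 < b"
    and R: "\<And>l. R l \<in> borel_measurable config_algebra"
      "\<And>l Q. admissible Q \<Longrightarrow> (\<integral>\<^sup>+\<omega>. R l \<omega> \<partial>Q) \<le> \<epsilon> l" "\<epsilon> \<longlonglongrightarrow> 0"
    and XY: "\<And>l \<omega>. good \<omega> \<Longrightarrow> X \<omega> \<le> ennreal (Y l \<omega>) + ennreal c * R l \<omega>"
      "\<And>l \<omega>. good \<omega> \<Longrightarrow> ennreal (Y l \<omega>) \<le> X \<omega> + ennreal c * R l \<omega>"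
  shows "approximable X"
proof -
  have lim: "(\<lambda>l. ennreal c * \<epsilon> l) \<longlonglongrightarrow> 0"
    using tendsto_mult_ennreal[OF tendsto_const[of "ennreal c"] R(3)] by simp
  have gen: "(\<integral>\<^sup>+\<omega>. f \<omega> \<partial>Q) \<le> (\<integral>\<^sup>+\<omega>. g \<omega> \<partial>Q) + ennreal c * \<epsilon> l"
    if Q: "admissible Q" and g: "g \<in> borel_measurable config_algebra"
      and le: "\<And>\<omega>. good \<omega> \<Longrightarrow> f \<omega> \<le> g \<omega> + ennreal c * R l \<omega>" for f g l Q
  proof -
    have sQ: "sets Q = sets config_algebra" and AE: "AE \<omega> in Q. good \<omega>" using Q by (auto simp: admissible_def point_process_def)
    have "(\<integral>\<^sup>+\<omega>. f \<omega> \<partial>Q) \<le> (\<integral>\<^sup>+\<omega>. g \<omega> + ennreal c * R l \<omega> \<partial>Q)"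
      using AE by (intro nn_integral_mono_AE) (auto elim!: eventually_mono intro: le)
    also have "\<dots> = (\<integral>\<^sup>+\<omega>. g \<omega> \<partial>Q) + ennreal c * (\<integral>\<^sup>+\<omega>. R l \<omega> \<partial>Q)"
      using g R(1)[of l] by (simp add: nn_integral_add nn_integral_cmult measurable_cong_sets[OF sQ refl])
    also have "\<dots> \<le> (\<integral>\<^sup>+\<omega>. g \<omega> \<partial>Q) + ennreal c * \<epsilon> l"
      using R(2)[OF Q] by (intro add_left_mono mult_left_mono) auto
    finally show ?thesis .
  qed
  have Ye: "(\<lambda>\<omega>. ennreal (Y l \<omega>)) \<in> borel_measurable config_algebra" for l using Y(1) by measurable
  have "\<forall>l Q. admissible Q \<longrightarrow>
          (\<integral>\<^sup>+\<omega>. X \<omega> \<partial>Q) \<le> (\<integral>\<^sup>+\<omega>. ennreal (Y l \<omega>) \<partial>Q) + ennreal c * \<epsilon> l \<and>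
          (\<integral>\<^sup>+\<omega>. ennreal (Y l \<omega>) \<partial>Q) \<le> (\<integral>\<^sup>+\<omega>. X \<omega> \<partial>Q) + ennreal c * \<epsilon> l"
    using gen[OF _ Ye XY(1)] gen[OF _ X XY(2)] by blast
  then show ?thesis unfolding approximable_def using X Y lim
    by (intro conjI exI[of _ Y] exI[of _ "\<lambda>l. ennreal c * \<epsilon> l"] exI[of _ b]) auto
qed

text \<open>For fixed l both functions are replaced by bounded local ones, whose expectations
  converge along \<open>F\<close>; the errors \<eta> l and \<eta>' l are paid once in the finite
  volume and once in the limit. Then l tends to infinity.\<close>

lemma approximable_transfer:
  assumes X: "approximable X" and X': "approximable X'" and \<delta>: "\<delta> \<longlonglongrightarrow> (0::ennreal)"
    and le: "\<forall>\<^sub>F n in sequentially. (\<integral>\<^sup>+\<omega>. X \<omega> \<partial>finite_volume n) \<le> (\<integral>\<^sup>+\<omega>. X' \<omega> \<partial>finite_volume n) + \<delta> n"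
  shows "(\<integral>\<^sup>+\<omega>. X \<omega> \<partial>P) \<le> (\<integral>\<^sup>+\<omega>. X' \<omega> \<partial>P)"
proof -
  have lim: "((\<lambda>n. \<integral>\<^sup>+\<omega>. ennreal (f \<omega>) \<partial>finite_volume n) \<longlongrightarrow> (\<integral>\<^sup>+\<omega>. ennreal (f \<omega>) \<partial>P)) F"
    if f: "f \<in> borel_measurable config_algebra" "\<exists>k. \<forall>\<omega>\<in>configs. f \<omega> = f (\<omega> \<inter> hbox k)" "\<forall>\<omega>\<in>configs. 0 \<le> f \<omega> \<and> f \<omega> \<le> b" "0 < b"
    for f :: "'a set \<Rightarrow> real" and b
  proof -
    have eq: "(\<integral>\<^sup>+\<omega>. ennreal (f \<omega>) \<partial>Q) = ennreal (\<integral>\<omega>. f \<omega> \<partial>Q)" if "prob_space Q" "sets Q = sets config_algebra" for Q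
    proof (rule nn_integral_eq_integral)
      interpret prob_space Q by fact
      have sp: "space Q = configs" using sets_eq_imp_space_eq[OF that(2)] by simp
      show "integrable Q f" using f by (intro integrable_const_bound[where B=b]) (auto simp: sp measurable_cong_sets[OF that(2) refl])
      show "AE x in Q. 0 \<le> f x" using f by (auto simp: sp)
    qed
    obtain k where k: "\<forall>\<omega>\<in>configs. f \<omega> = f (\<omega> \<inter> hbox k)" using f by blast
    have "((\<lambda>n. \<integral>\<omega>. f \<omega> \<partial>finite_volume n) \<longlongrightarrow> (\<integral>\<omega>. f \<omega> \<partial>P)) F"
    proof (rule lim_integral[OF f(1) _ _ _ f(4)])
      show "\<omega> \<in> configs \<Longrightarrow> f \<omega> = f (\<omega> \<inter> hbox k)" for \<omega> using k by blast
    qed (use f(3) in auto)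
    from tendsto_ennrealI[OF this] show ?thesis by (simp add: eq prob_P prob_space_finite_volume)
  qed
  from X obtain Y \<eta> b where Y: "\<eta> \<longlonglongrightarrow> 0" "0 < b"
      "\<And>l. Y l \<in> borel_measurable config_algebra" "\<And>l. \<exists>k. \<forall>\<omega>\<in>configs. Y l \<omega> = Y l (\<omega> \<inter> hbox k)"
      "\<And>l. \<forall>\<omega>\<in>configs. 0 \<le> Y l \<omega> \<and> Y l \<omega> \<le> (b::real)"
      "\<And>l Q. admissible Q \<Longrightarrow> (\<integral>\<^sup>+\<omega>. X \<omega> \<partial>Q) \<le> (\<integral>\<^sup>+\<omega>. ennreal (Y l \<omega>) \<partial>Q) + \<eta> l"
      "\<And>l Q. admissible Q \<Longrightarrow> (\<integral>\<^sup>+\<omega>. ennreal (Y l \<omega>) \<partial>Q) \<le> (\<integral>\<^sup>+\<omega>. X \<omega> \<partial>Q) + \<eta> l"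
    unfolding approximable_def by blast
  from X' obtain Y' \<eta>' b' where Y': "\<eta>' \<longlonglongrightarrow> 0" "0 < b'"
      "\<And>l. Y' l \<in> borel_measurable config_algebra" "\<And>l. \<exists>k. \<forall>\<omega>\<in>configs. Y' l \<omega> = Y' l (\<omega> \<inter> hbox k)"
      "\<And>l. \<forall>\<omega>\<in>configs. 0 \<le> Y' l \<omega> \<and> Y' l \<omega> \<le> (b'::real)"
      "\<And>l Q. admissible Q \<Longrightarrow> (\<integral>\<^sup>+\<omega>. X' \<omega> \<partial>Q) \<le> (\<integral>\<^sup>+\<omega>. ennreal (Y' l \<omega>) \<partial>Q) + \<eta>' l"
      "\<And>l Q. admissible Q \<Longrightarrow> (\<integral>\<^sup>+\<omega>. ennreal (Y' l \<omega>) \<partial>Q) \<le> (\<integral>\<^sup>+\<omega>. X' \<omega> \<partial>Q) + \<eta>' l"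
    unfolding approximable_def by blast
  have main: "(\<integral>\<^sup>+\<omega>. X \<omega> \<partial>P) \<le> (\<integral>\<^sup>+\<omega>. X' \<omega> \<partial>P) + (\<eta>' l + \<eta>' l + \<eta> l + \<eta> l)" for l
  proof -
    \<comment> \<open>The summand 0 is the limit of \<delta>; it keeps the two sides in the same
      shape for \<open>tendsto_add\<close>.\<close>
    have "(\<integral>\<^sup>+\<omega>. ennreal (Y l \<omega>) \<partial>P) \<le> (\<integral>\<^sup>+\<omega>. ennreal (Y' l \<omega>) \<partial>P) + \<eta>' l + 0 + \<eta> l"
    proof (rule tendsto_le[OF F(2) _ lim[OF Y(3,4,5,2)]])
      show "((\<lambda>n. (\<integral>\<^sup>+\<omega>. ennreal (Y' l \<omega>) \<partial>finite_volume n) + \<eta>' l + \<delta> n + \<eta> l) \<longlongrightarrow>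
          (\<integral>\<^sup>+\<omega>. ennreal (Y' l \<omega>) \<partial>P) + \<eta>' l + 0 + \<eta> l) F"
        by (intro tendsto_add tendsto_const lim[OF Y'(3,4,5,2)] tendsto_mono[OF F(1) \<delta>])
      show "\<forall>\<^sub>F n in F. (\<integral>\<^sup>+\<omega>. ennreal (Y l \<omega>) \<partial>finite_volume n) \<le> (\<integral>\<^sup>+\<omega>. ennreal (Y' l \<omega>) \<partial>finite_volume n) + \<eta>' l + \<delta> n + \<eta> l"
        using eventually_F[OF le]
      proof eventually_elim
        case (elim n)
        have "(\<integral>\<^sup>+\<omega>. ennreal (Y l \<omega>) \<partial>finite_volume n) \<le> (\<integral>\<^sup>+\<omega>. X \<omega> \<partial>finite_volume n) + \<eta> l"
          by (rule Y(7)[OF admissible_finite_volume])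
        also have "\<dots> \<le> ((\<integral>\<^sup>+\<omega>. X' \<omega> \<partial>finite_volume n) + \<delta> n) + \<eta> l" using elim by (rule add_right_mono)
        also have "\<dots> \<le> (((\<integral>\<^sup>+\<omega>. ennreal (Y' l \<omega>) \<partial>finite_volume n) + \<eta>' l) + \<delta> n) + \<eta> l"
          by (intro add_right_mono Y'(6)[OF admissible_finite_volume])
        finally show ?case .
      qed
    qed
    have "(\<integral>\<^sup>+\<omega>. X \<omega> \<partial>P) \<le> (\<integral>\<^sup>+\<omega>. ennreal (Y l \<omega>) \<partial>P) + \<eta> l" by (rule Y(6)[OF admissible_P])
    also have "\<dots> \<le> ((\<integral>\<^sup>+\<omega>. ennreal (Y' l \<omega>) \<partial>P) + \<eta>' l + 0 + \<eta> l) + \<eta> l" by (rule add_right_mono) fact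
    also have "\<dots> \<le> (((\<integral>\<^sup>+\<omega>. X' \<omega> \<partial>P) + \<eta>' l) + \<eta>' l + 0 + \<eta> l) + \<eta> l"
      by (intro add_right_mono Y'(7)[OF admissible_P])
    finally show ?thesis by (simp add: add.assoc)
  qed
  have "(\<lambda>l. (\<integral>\<^sup>+\<omega>. X' \<omega> \<partial>P) + (\<eta>' l + \<eta>' l + \<eta> l + \<eta> l)) \<longlonglongrightarrow> (\<integral>\<^sup>+\<omega>. X' \<omega> \<partial>P) + (0 + 0 + 0 + 0)"
    by (intro tendsto_add tendsto_const Y(1) Y'(1))
  from tendsto_lowerbound[OF this] main show ?thesis by simp
qed

end

section \<open>The truncated resampling identity\<close>

context gibbs_limit_region
begin

text \<open>The reciprocal of the Poisson probability that \<open>\<Delta>\<close> is empty.\<close>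

definition outer_factor :: real where
  "outer_factor = exp (measure lborel \<Delta>)"

lemma outer_factor_pos: "0 < outer_factor"
  by (simp add: outer_factor_def)

lemma ex_local_scale:
  assumes "bounded (B :: 'a set)" obtains k where "D l \<subseteq> hbox k" "B \<subseteq> hbox k" "\<Delta> \<subseteq> hbox k"
proof -
  have "bounded (D l \<union> B \<union> \<Delta>)" using assms D(1) \<Delta> by simp
  then obtain k where "D l \<union> B \<union> \<Delta> \<subseteq> hbox k" by (rule bounded_subset_hbox)
  then show ?thesis using that[of k] by simp
qed

lemma test_local:
  assumes "B \<subseteq> hbox k" "\<Delta> \<subseteq> hbox k" "\<omega> \<in> configs"
  shows "test B q (\<omega> \<inter> hbox k) = test B q \<omega>"
proof -
  have "\<omega> \<inter> hbox k \<inter> B = \<omega> \<inter> B" "\<omega> \<inter> hbox k \<inter> \<Delta> = \<omega> \<inter> \<Delta>" using assms by auto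
  moreover have "\<omega> \<inter> hbox k \<in> configs" by (rule configs_subset[OF assms(3) Int_lower1])
  ultimately have "\<omega> \<inter> hbox k \<in> {\<omega>' \<in> avoid B. card (\<omega>' \<inter> \<Delta>) \<le> q} \<longleftrightarrow> \<omega> \<in> {\<omega>' \<in> avoid B. card (\<omega>' \<inter> \<Delta>) \<le> q}"
    using assms(3) unfolding avoid_def by simp
  then show ?thesis by (simp only: test_def indicator_def)
qed

lemma E_local: "D l \<subseteq> hbox k \<Longrightarrow> E l (\<omega> \<inter> hbox k) = E l \<omega>"
proof -
  assume "D l \<subseteq> hbox k"
  then have "\<omega> \<inter> hbox k \<inter> D l = \<omega> \<inter> D l" "\<omega> \<inter> hbox k \<inter> (D l - \<Delta>) = \<omega> \<inter> (D l - \<Delta>)" by auto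
  then show ?thesis by (simp add: energy_in_def)
qed

lemma empty_resample_local:
  assumes f: "\<And>\<omega>. \<omega> \<in> configs \<Longrightarrow> f (\<omega> \<inter> hbox k) = f \<omega>" and k: "\<Delta> \<subseteq> hbox k" and \<omega>: "\<omega> \<in> configs"
  shows "empty_resample f (\<omega> \<inter> hbox k) = empty_resample f \<omega>"
proof -
  have "\<omega> \<inter> hbox k \<in> configs" by (rule configs_subset[OF \<omega> Int_lower1])
  moreover have "\<omega> \<inter> hbox k \<inter> \<Delta> = \<omega> \<inter> \<Delta>" using k by auto
  ultimately have "(indicator (avoid \<Delta>) (\<omega> \<inter> hbox k) :: ennreal) = indicator (avoid \<Delta>) \<omega>"
    using \<omega> unfolding indicator_def avoid_def by simp
  moreover have "(\<integral>\<^sup>+\<omega>'. f (resample (\<omega> \<inter> hbox k) \<omega>') \<partial>poisson_process \<Delta>) = (\<integral>\<^sup>+\<omega>'. f (resample \<omega> \<omega>') \<partial>poisson_process \<Delta>)"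
  proof (intro nn_integral_cong)
    fix \<omega>' assume "\<omega>' \<in> space (poisson_process \<Delta>)"
    moreover have "resample (\<omega> \<inter> hbox k) \<omega>' = resample \<omega> \<omega>' \<inter> hbox k" using k by (auto simp: resample_def)
    ultimately show "f (resample (\<omega> \<inter> hbox k) \<omega>') = f (resample \<omega> \<omega>')"
      using f[OF resample_configs[OF \<omega>, of \<omega>']] by simp
  qed
  ultimately show ?thesis by (simp add: empty_resample_def)
qed

text \<open>Where the test function is nonzero there are at most \<open>q\<close> points, and a
  Lipschitz function of the energy has error at most c q R. Where both energies are infinite the two
  values coincide, whatever \<phi> is there; an infinite bound is trivial because c is
  positive.\<close>

lemma test_approx:
  fixes \<phi> :: "ereal \<Rightarrow> real" and c :: real
  assumes \<phi>: "\<And>h. 0 \<le> \<phi> h" "\<And>x y. \<bar>\<phi> (ereal x) - \<phi> (ereal y)\<bar> \<le> c * \<bar>x - y\<bar>" and c_pos: "0 < c"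
    and R: "of_nat (card (\<omega> \<inter> \<Delta>)) * R < \<infinity> \<Longrightarrow>
      (s = \<infinity> \<and> t = \<infinity>) \<or>
      (\<exists>x y. s = ereal x \<and> t = ereal y \<and> ennreal \<bar>x - y\<bar> \<le> of_nat (card (\<omega> \<inter> \<Delta>)) * R)"
  shows "ennreal (test B q \<omega> * \<phi> t) \<le> ennreal (test B q \<omega> * \<phi> s) + ennreal (c * real q) * R"
    and "ennreal (test B q \<omega> * \<phi> s) \<le> ennreal (test B q \<omega> * \<phi> t) + ennreal (c * real q) * R"
proof -
  have c: "0 \<le> c" using c_pos by simp
  have main: "ennreal (\<phi> t) \<le> ennreal (\<phi> s) + ennreal (c * real q) * R \<and> ennreal (\<phi> s) \<le> ennreal (\<phi> t) + ennreal (c * real q) * R"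
    if q: "card (\<omega> \<inter> \<Delta>) \<le> q"
  proof -
    let ?N = "of_nat (card (\<omega> \<inter> \<Delta>)) :: ennreal"
    have "?N \<le> of_nat q" using q by simp
    then have "ennreal c * (?N * R) \<le> ennreal c * (of_nat q * R)" by (intro mult_left_mono mult_right_mono) auto
    also have "\<dots> = ennreal (c * real q) * R"
      using c by (simp add: ennreal_mult ennreal_of_nat_eq_real_of_nat mult.assoc)
    finally have le: "ennreal c * (?N * R) \<le> ennreal (c * real q) * R" .
    show ?thesis
    proof (cases "?N * R < \<infinity>")
      case False
      then have "?N * R = \<infinity>" by (simp add: less_top[symmetric])
      then have "ennreal c * (?N * R) = \<infinity>" using c_pos by (simp add: ennreal_mult_top)
      then have "ennreal (c * real q) * R = \<infinity>" using le by (simp add: top_unique)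
      then show ?thesis by simp
    next
      case True
      from R[OF True] show ?thesis
      proof (elim disjE exE conjE)
        assume "s = \<infinity>" "t = \<infinity>"
        then show ?thesis by simp
      next
        fix x y assume xy: "s = ereal x" "t = ereal y" "ennreal \<bar>x - y\<bar> \<le> ?N * R"
        have "ennreal (c * \<bar>x - y\<bar>) = ennreal c * ennreal \<bar>x - y\<bar>" using c by (simp add: ennreal_mult)
        also have "\<dots> \<le> ennreal c * (?N * R)" using xy(3) by (intro mult_left_mono) auto
        finally have d: "ennreal (c * \<bar>x - y\<bar>) \<le> ennreal (c * real q) * R" using le by (rule order_trans)
        have "\<phi> t \<le> \<phi> s + c * \<bar>x - y\<bar>" "\<phi> s \<le> \<phi> t + c * \<bar>x - y\<bar>" using \<phi>(2)[of x y] by (auto simp: xy)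
        then have "ennreal (\<phi> t) \<le> ennreal (\<phi> s) + ennreal (c * \<bar>x - y\<bar>)" "ennreal (\<phi> s) \<le> ennreal (\<phi> t) + ennreal (c * \<bar>x - y\<bar>)"
          using \<phi>(1) c by (simp_all add: ennreal_plus[symmetric] ennreal_leI del: ennreal_plus)
        then show ?thesis using d by (meson add_left_mono order_trans)
      qed
    qed
  qed
  have "test B q \<omega> = 0 \<or> (test B q \<omega> = 1 \<and> card (\<omega> \<inter> \<Delta>) \<le> q)" by (auto simp: test_def indicator_def)
  then show "ennreal (test B q \<omega> * \<phi> t) \<le> ennreal (test B q \<omega> * \<phi> s) + ennreal (c * real q) * R"
    and "ennreal (test B q \<omega> * \<phi> s) \<le> ennreal (test B q \<omega> * \<phi> t) + ennreal (c * real q) * R"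
    using main by auto
qed

definition lhs :: "'a set \<Rightarrow> nat \<Rightarrow> real \<Rightarrow> 'a set \<Rightarrow> ennreal" where
  "lhs B q K \<omega> = ennreal (test B q \<omega> * truncation K (h \<omega>))"

definition rhs :: "'a set \<Rightarrow> nat \<Rightarrow> real \<Rightarrow> 'a set \<Rightarrow> ennreal" where
  "rhs B q K \<omega> = ennreal outer_factor * empty_resample (\<lambda>\<omega>. ennreal (test B q \<omega> * truncated_weight K (h \<omega>))) \<omega>"

lemma measurable_test_comp:
  assumes "B \<in> sets borel" "\<phi> \<in> borel_measurable borel" "g \<in> borel_measurable config_algebra"
  shows "(\<lambda>\<omega>. test B q \<omega> * \<phi> (g \<omega>)) \<in> borel_measurable config_algebra"
  using assms by (intro borel_measurable_times measurable_test measurable_compose[OF assms(3,2)])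

lemma measurable_lhs: "B \<in> sets borel \<Longrightarrow> lhs B q K \<in> borel_measurable config_algebra"
  unfolding lhs_def[abs_def] using measurable_test_comp[OF _ measurable_truncation measurable_h] by simp

lemma measurable_rhs: "B \<in> sets borel \<Longrightarrow> rhs B q K \<in> borel_measurable config_algebra"
  unfolding rhs_def[abs_def] using measurable_test_comp[OF _ measurable_truncated_weight measurable_h, of B q K]
  by (intro borel_measurable_times_ennreal measurable_empty_resample borel_measurable_const) simp

lemma approximable_lhs:
  assumes B: "bounded_borel B" and K: "0 < K" shows "approximable (lhs B q K)"
proof -
  obtain R \<epsilon> where R: "remainder R \<epsilon>" by (rule ex_remainder)
  note Rm = remainderD(1)[OF R] and Ra = remainderD(3)[OF R]
    and Ri = remainderD(4)[OF R] and \<epsilon> = remainderD(5)[OF R]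
  have ta: "ennreal (test B q \<omega> * truncation K (h \<omega>)) \<le> ennreal (test B q \<omega> * truncation K (E l \<omega>)) + ennreal (1 * real q) * R l \<omega>"
    "ennreal (test B q \<omega> * truncation K (E l \<omega>)) \<le> ennreal (test B q \<omega> * truncation K (h \<omega>)) + ennreal (1 * real q) * R l \<omega>"
    if "good \<omega>" for l \<omega>
    using test_approx[of "truncation K" 1 \<omega> "R l \<omega>" "E l \<omega>" "h \<omega>" B q] Ra[OF that, of l] truncation_bounds[OF K] truncation_lipschitz[OF K]
    by auto
  show ?thesis
  proof (rule approximableI[where Y="\<lambda>l \<omega>. test B q \<omega> * truncation K (E l \<omega>)" and R=R and c="1 * real q" and b=1 and \<epsilon>=\<epsilon>])
    show "lhs B q K \<in> borel_measurable config_algebra" using B by (intro measurable_lhs) simp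
    show "(\<lambda>\<omega>. test B q \<omega> * truncation K (E l \<omega>)) \<in> borel_measurable config_algebra" for l
      using B by (intro measurable_test_comp measurable_truncation measurable_E) simp
    show "\<exists>k. \<forall>\<omega>\<in>configs. test B q \<omega> * truncation K (E l \<omega>) = test B q (\<omega> \<inter> hbox k) * truncation K (E l (\<omega> \<inter> hbox k))" for l
    proof -
      obtain k where "D l \<subseteq> hbox k" "B \<subseteq> hbox k" "\<Delta> \<subseteq> hbox k" using ex_local_scale B by blast
      then show ?thesis by (intro exI[of _ k]) (simp add: test_local E_local)
    qed
    show "0 \<le> test B q \<omega> * truncation K (E l \<omega>) \<and> test B q \<omega> * truncation K (E l \<omega>) \<le> 1" for l \<omega>
      using test_bounds truncation_bounds[OF K] by (auto intro!: mult_le_one)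
    show "lhs B q K \<omega> \<le> ennreal (test B q \<omega> * truncation K (E l \<omega>)) + ennreal (1 * real q) * R l \<omega>" if "good \<omega>" for l \<omega>
      unfolding lhs_def using ta(1)[OF that] .
    show "ennreal (test B q \<omega> * truncation K (E l \<omega>)) \<le> lhs B q K \<omega> + ennreal (1 * real q) * R l \<omega>" if "good \<omega>" for l \<omega>
      unfolding lhs_def using ta(2)[OF that] .
  qed (use Rm Ri \<epsilon> in auto)
qed

text \<open>Resampling with \<open>E l\<close> in place of \<open>h\<close> keeps the function
  local, because the fresh points lie in \<open>\<Delta>\<close>, and the error \<open>R l\<close>
  is untouched by it. The factor \<open>K\<close> enters as the Lipschitz constant and as the bound
  of \<open>truncated_weight\<close>.\<close>

lemma approximable_rhs:
  assumes B: "bounded_borel B" and K: "0 < K" shows "approximable (rhs B q K)"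
proof -
  obtain R \<epsilon> where R: "remainder R \<epsilon>" by (rule ex_remainder)
  note Rm = remainderD(1)[OF R] and Rr = remainderD(2)[OF R] and Ra = remainderD(3)[OF R]
    and Ri = remainderD(4)[OF R] and \<epsilon> = remainderD(5)[OF R]
  define f where "f l \<omega> = ennreal (test B q \<omega> * truncated_weight K (E l \<omega>))" for l \<omega>
  define g where "g \<omega> = ennreal (test B q \<omega> * truncated_weight K (h \<omega>))" for \<omega>
  have gm: "g \<in> borel_measurable config_algebra"
    unfolding g_def[abs_def] using B measurable_test_comp[OF _ measurable_truncated_weight measurable_h, of B q K] by simp
  have fm: "f l \<in> borel_measurable config_algebra" for l
    unfolding f_def[abs_def] using B measurable_test_comp[OF _ measurable_truncated_weight measurable_E, of B q K l] by simp
  have fK: "f l \<omega> \<le> ennreal K" for l \<omega>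
    unfolding f_def using test_bounds[of B q \<omega>] truncated_weight_bounds(1)[OF K, of "E l \<omega>"] truncated_weight_bounds(2)[of K "E l \<omega>"]
    by (intro ennreal_leI) (meson mult_left_le_one_le order_trans)
  have ta: "g \<omega> \<le> f l \<omega> + ennreal (K * real q) * R l \<omega>" "f l \<omega> \<le> g \<omega> + ennreal (K * real q) * R l \<omega>"
    if "good \<omega>" for l \<omega>
    using test_approx[of "truncated_weight K" K \<omega> "R l \<omega>" "E l \<omega>" "h \<omega>" B q] Ra[OF that, of l] truncated_weight_bounds(1)[OF K] truncated_weight_lipschitz[OF K] K
    by (auto simp: f_def g_def)
  have tV: "empty_resample g \<omega> \<le> empty_resample (f l) \<omega> + ennreal (K * real q) * R l \<omega>"
    "empty_resample (f l) \<omega> \<le> empty_resample g \<omega> + ennreal (K * real q) * R l \<omega>"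
    if "good \<omega>" for l \<omega>
    by (rule empty_resample_approx[OF gm fm ta(1) Rr that], assumption, rule empty_resample_approx[OF fm gm ta(2) Rr that], assumption)
  have fin: "empty_resample (f l) \<omega> \<le> ennreal K" if "\<omega> \<in> configs" for l \<omega>
    using fK that by (rule empty_resample_le)
  define Y where "Y l \<omega> = outer_factor * enn2real (empty_resample (f l) \<omega>)" for l \<omega>
  have Ye: "ennreal (Y l \<omega>) = ennreal outer_factor * empty_resample (f l) \<omega>" if "\<omega> \<in> configs" for l \<omega>
  proof -
    have "empty_resample (f l) \<omega> < \<top>" by (rule le_less_trans[OF fin[OF that]]) simp
    then show ?thesis unfolding Y_def using outer_factor_pos by (simp add: ennreal_mult)
  qed
  show ?thesis
  proof (rule approximableI[where Y=Y and R=R and c="outer_factor * (K * real q)" and b="outer_factor * K" and \<epsilon>=\<epsilon>])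
    show "rhs B q K \<in> borel_measurable config_algebra" using B by (intro measurable_rhs) simp
    show "Y l \<in> borel_measurable config_algebra" for l
      unfolding Y_def[abs_def] using measurable_empty_resample[OF fm[of l]] by measurable
    show "\<exists>k. \<forall>\<omega>\<in>configs. Y l \<omega> = Y l (\<omega> \<inter> hbox k)" for l
    proof -
      obtain k where k: "D l \<subseteq> hbox k" "B \<subseteq> hbox k" "\<Delta> \<subseteq> hbox k" using ex_local_scale B by blast
      have "f l (\<omega> \<inter> hbox k) = f l \<omega>" if "\<omega> \<in> configs" for \<omega> using k that by (simp add: f_def test_local E_local)
      then have "empty_resample (f l) (\<omega> \<inter> hbox k) = empty_resample (f l) \<omega>" if "\<omega> \<in> configs" for \<omega>
        using k(3) that by (rule empty_resample_local)
      then show ?thesis by (intro exI[of _ k]) (simp add: Y_def)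
    qed
    show "0 \<le> Y l \<omega> \<and> Y l \<omega> \<le> outer_factor * K" if "\<omega> \<in> configs" for l \<omega>
      unfolding Y_def using outer_factor_pos K enn2real_leI[OF less_imp_le[OF K] fin[OF that, of l]] by simp
    show "rhs B q K \<omega> \<le> ennreal (Y l \<omega>) + ennreal (outer_factor * (K * real q)) * R l \<omega>" if "good \<omega>" for l \<omega>
    proof -
      have "\<omega> \<in> configs" using that by (simp add: good_def)
      have "rhs B q K \<omega> \<le> ennreal outer_factor * (empty_resample (f l) \<omega> + ennreal (K * real q) * R l \<omega>)"
        unfolding rhs_def g_def[symmetric] using tV(1)[OF that] by (intro mult_left_mono) auto
      then show ?thesis using outer_factor_pos K by (simp add: Ye[OF \<open>\<omega> \<in> configs\<close>] distrib_left ennreal_mult mult.assoc)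
    qed
    show "ennreal (Y l \<omega>) \<le> rhs B q K \<omega> + ennreal (outer_factor * (K * real q)) * R l \<omega>" if "good \<omega>" for l \<omega>
    proof -
      have "\<omega> \<in> configs" using that by (simp add: good_def)
      have "ennreal outer_factor * empty_resample (f l) \<omega> \<le> ennreal outer_factor * (empty_resample g \<omega> + ennreal (K * real q) * R l \<omega>)"
        using tV(2)[OF that] by (intro mult_left_mono) auto
      then show ?thesis unfolding rhs_def g_def[symmetric] using outer_factor_pos K by (simp add: Ye[OF \<open>\<omega> \<in> configs\<close>] distrib_left ennreal_mult mult.assoc)
    qed
  qed (use Rm Ri \<epsilon> outer_factor_pos K in auto)
qed

text \<open>The case F = \<open>lhs\<close> of \<open>gibbs_resample\<close>. The truncation is
  inserted into F, so that its product with the Boltzmann weight is the bounded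
  \<open>truncated_weight\<close> and the identity stays exact.\<close>

lemma gibbs_lhs_rhs:
  assumes B: "bounded_borel B" and K: "0 < K" and \<Lambda>: "bounded_borel \<Lambda>" "\<Delta> \<subseteq> \<Lambda>"
  shows "(\<integral>\<^sup>+\<omega>. lhs B q K \<omega> \<partial>gibbs \<Lambda>) = (\<integral>\<^sup>+\<omega>. rhs B q K \<omega> \<partial>gibbs \<Lambda>)"
proof -
  have eq: "lhs B q K \<eta> * ennreal (exp_minus (h \<eta>)) = ennreal (test B q \<eta> * truncated_weight K (h \<eta>))" for \<eta>
    unfolding lhs_def truncation_weight[OF K, symmetric]
    using test_bounds truncation_bounds[OF K] by (subst ennreal_mult[symmetric]) (auto simp: mult.assoc)
  have "(\<integral>\<^sup>+\<omega>. lhs B q K \<omega> \<partial>gibbs \<Lambda>) = ennreal outer_factor *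
    (\<integral>\<^sup>+\<omega>. indicator (avoid \<Delta>) \<omega> * (\<integral>\<^sup>+\<omega>'. lhs B q K (resample \<omega> \<omega>') *
      ennreal (exp_minus (h (resample \<omega> \<omega>'))) \<partial>poisson_process \<Delta>) \<partial>gibbs \<Lambda>)"
    unfolding outer_factor_def resample_def using B
    by (intro gibbs_resample[OF \<Lambda>(1) \<Delta> \<Lambda>(2) D(1,2,3)] measurable_lhs) simp
  also have "\<dots> = ennreal outer_factor * (\<integral>\<^sup>+\<omega>. empty_resample (\<lambda>\<omega>. ennreal (test B q \<omega> * truncated_weight K (h \<omega>))) \<omega> \<partial>gibbs \<Lambda>)"
    unfolding eq empty_resample_def ..
  also have "\<dots> = (\<integral>\<^sup>+\<omega>. rhs B q K \<omega> \<partial>gibbs \<Lambda>)"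
    unfolding rhs_def using B measurable_test_comp[OF _ measurable_truncated_weight measurable_h, of B q K]
    by (intro nn_integral_cmult[symmetric]) (simp add: measurable_empty_resample)
  finally show ?thesis .
qed

lemma lhs_le: "0 < K \<Longrightarrow> lhs B q K \<omega> \<le> ennreal 1"
  unfolding lhs_def using test_bounds truncation_bounds by (intro ennreal_leI mult_le_one) auto

lemma rhs_le:
  assumes K: "0 < K" and \<omega>: "\<omega> \<in> configs" shows "rhs B q K \<omega> \<le> ennreal (outer_factor * K)"
proof -
  have "empty_resample (\<lambda>\<omega>. ennreal (test B q \<omega> * truncated_weight K (h \<omega>))) \<omega> \<le> ennreal K"
  proof (rule empty_resample_le[OF _ \<omega>])
    fix \<eta>
    show "ennreal (test B q \<eta> * truncated_weight K (h \<eta>)) \<le> ennreal K"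
      using test_bounds[of B q \<eta>] truncated_weight_bounds(1)[OF K, of "h \<eta>"] truncated_weight_bounds(2)[of K "h \<eta>"]
      by (intro ennreal_leI) (meson mult_left_le_one_le order_trans)
  qed
  then show ?thesis unfolding rhs_def using outer_factor_pos K by (simp add: ennreal_mult mult_left_mono)
qed

text \<open>The identity is exact in every translated cube containing \<open>\<Delta>\<close>, hence
  holds for the averages up to a boundary fraction, in each direction with the bound of its own left
  side.\<close>

lemma limit_lhs_rhs:
  assumes B: "bounded_borel B" and K: "0 < K"
  shows "(\<integral>\<^sup>+\<omega>. lhs B q K \<omega> \<partial>P) = (\<integral>\<^sup>+\<omega>. rhs B q K \<omega> \<partial>P)"
proof -
  obtain p where p: "0 \<le> p" "\<Delta> \<subseteq> cube p" using bounded_subset_cube \<Delta> by blast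
  let ?bf = "\<lambda>n. boundary_fraction DIM('a) p (real (Suc n))"
  have eq: "(\<integral>\<^sup>+\<omega>. lhs B q K \<omega> \<partial>gibbs ((+) u ` cube r)) = (\<integral>\<^sup>+\<omega>. rhs B q K \<omega> \<partial>gibbs ((+) u ` cube r))"
    if u: "u \<in> cube (r - p)" for u r
  proof (rule gibbs_lhs_rhs[OF B K])
    show "bounded_borel ((+) u ` cube r)" by (rule bounded_borel_shift) simp
    show "\<Delta> \<subseteq> (+) u ` cube r"
    proof
      fix x assume "x \<in> \<Delta>"
      then have x: "x \<in> cube p" using p by auto
      have "x - u \<in> cube r" unfolding mem_cube
      proof
        fix i :: 'a assume "i \<in> Basis"
        then have "\<bar>x \<bullet> i\<bar> \<le> p" "\<bar>u \<bullet> i\<bar> \<le> r - p" using x u by (auto simp: mem_cube)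
        then show "\<bar>(x - u) \<bullet> i\<bar> \<le> r" by (simp add: inner_diff_left)
      qed
      then show "x \<in> (+) u ` cube r" by (intro image_eqI[of _ _ "x - u"]) auto
    qed
  qed
  obtain n0 :: nat where n0: "p \<le> real n0" using real_arch_simple by blast
  have ev: "\<forall>\<^sub>F n in sequentially. p \<le> real (Suc n)"
    using eventually_ge_at_top[of n0] by eventually_elim (use n0 in auto)
  have B': "B \<in> sets borel" using B by simp
  have t: "(\<lambda>n. ennreal (b * ?bf n)) \<longlonglongrightarrow> 0" for b
    using tendsto_ennrealI[OF tendsto_mult[OF tendsto_const[of b] boundary_fraction_tendsto[of "DIM('a)" p]]] by simp
  show ?thesis
  proof (rule antisym)
    show "(\<integral>\<^sup>+\<omega>. lhs B q K \<omega> \<partial>P) \<le> (\<integral>\<^sup>+\<omega>. rhs B q K \<omega> \<partial>P)"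
    proof (rule approximable_transfer[OF approximable_lhs[OF B K] approximable_rhs[OF B K] t[of 1]])
      show "\<forall>\<^sub>F n in sequentially. (\<integral>\<^sup>+\<omega>. lhs B q K \<omega> \<partial>finite_volume n) \<le> (\<integral>\<^sup>+\<omega>. rhs B q K \<omega> \<partial>finite_volume n) + ennreal (1 * ?bf n)"
        using ev
      proof eventually_elim
        case (elim n)
        then show ?case unfolding finite_volume_def using p eq lhs_le[OF K]
          by (intro avg_compare measurable_lhs measurable_rhs B') auto
      qed
    qed
    show "(\<integral>\<^sup>+\<omega>. rhs B q K \<omega> \<partial>P) \<le> (\<integral>\<^sup>+\<omega>. lhs B q K \<omega> \<partial>P)"
    proof (rule approximable_transfer[OF approximable_rhs[OF B K] approximable_lhs[OF B K] t[of "outer_factor * K"]])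
      show "\<forall>\<^sub>F n in sequentially. (\<integral>\<^sup>+\<omega>. rhs B q K \<omega> \<partial>finite_volume n) \<le> (\<integral>\<^sup>+\<omega>. lhs B q K \<omega> \<partial>finite_volume n) + ennreal (outer_factor * K * ?bf n)"
        using ev
      proof eventually_elim
        case (elim n)
        then show ?case unfolding finite_volume_def using p eq rhs_le[OF K] outer_factor_pos K
          by (intro avg_compare measurable_lhs measurable_rhs B') auto
      qed
    qed
  qed
qed

section \<open>Removal of the truncation\<close>

definition weight :: "'a set \<Rightarrow> ennreal" where
  "weight \<omega> = ennreal (exp_minus (h \<omega>))"

lemma measurable_weight: "weight \<in> borel_measurable config_algebra"
  unfolding weight_def[abs_def]
  using measurable_compose[OF measurable_h exp_minus_measurable] by simp

text \<open>Both cutoffs are sent to infinity along one index j, with q = j and K = exp j, which is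
  positive from j = 0 on. Everything increases in j and is eventually constant at each configuration
  before integration, so monotone convergence applies on both sides.\<close>

lemma limit_avoid:
  assumes B: "bounded_borel B"
  shows "emeasure P (avoid B) = (\<integral>\<^sup>+\<omega>. ennreal outer_factor * empty_resample (\<lambda>\<omega>. indicator (avoid B) \<omega> * weight \<omega>) \<omega> \<partial>P)"
proof -
  have B': "B \<in> sets borel" using B by simp
  have test_inc: "test B i \<omega> \<le> test B j \<omega>" if "i \<le> j" for i j \<omega> using that by (auto simp: test_def split: split_indicator)
  have K: "0 < exp (real j)" for j by simp
  have Kinc: "exp (real i) \<le> exp (real j)" if "i \<le> j" for i j :: nat using that by simp
  \<comment> \<open>For a positive Boltzmann weight the truncation is min 1 (c / weight), which
    increases in c; for weight 0 it is 1 for every positive c.\<close>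
  have trunc_inc: "truncation (exp (real i)) x \<le> truncation (exp (real j)) x" if "i \<le> j" for i j x
  proof -
    have *: "truncation c x = min 1 (c / exp_minus x)" if "0 < c" "exp_minus x \<noteq> 0" for c
    proof -
      have "0 < exp_minus x" using that(2) exp_minus_nonneg[of x] by linarith
      then show ?thesis using that(1) by (auto simp: truncation_def max_def min_def le_divide_eq_1_pos)
    qed
    show ?thesis
    proof (cases "exp_minus x = 0")
      case True
      then show ?thesis by (simp add: truncation_def exp_minus_def)
    next
      case False
      have "exp (real i) / exp_minus x \<le> exp (real j) / exp_minus x" using Kinc[OF that] by (intro divide_right_mono) auto
      then show ?thesis using False by (subst (1 2) *) auto
    qed
  qed
  have tw_inc: "truncated_weight (exp (real i)) x \<le> truncated_weight (exp (real j)) x" if "i \<le> j" for i j x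
    unfolding truncated_weight_def by (rule min.mono[OF order_refl Kinc[OF that]])
  have large: "\<exists>n0. \<forall>n\<ge>n0. exp_minus x \<le> exp (real n) \<and> N \<le> n" for x and N :: nat
  proof -
    obtain m :: nat where m: "exp_minus x \<le> real m" using real_arch_simple by blast
    have "exp_minus x \<le> exp (real n)" if "m \<le> n" for n
    proof -
      have "real n \<le> exp (real n)" using exp_ge_add_one_self[of "real n"] by linarith
      then show ?thesis using m that by linarith
    qed
    then show ?thesis by (intro exI[of _ "max m N"]) auto
  qed
  have SUPconst: "(SUP j. u j) = c" if "incseq u" "\<exists>n0. \<forall>n\<ge>n0. u n = c" for u :: "nat \<Rightarrow> ennreal" and c
  proof -
    have "u \<longlonglongrightarrow> c" using that(2) by (intro tendsto_eventually) (auto simp: eventually_sequentially)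
    then show ?thesis using LIMSEQ_SUP[OF that(1)] LIMSEQ_unique by blast
  qed
  have fin_test: "test B n \<omega> = indicator (avoid B) \<omega>" if "card (\<omega> \<inter> \<Delta>) \<le> n" for n \<omega>
    using that by (auto simp: test_def split: split_indicator)
  have linc: "incseq (\<lambda>j. lhs B j (exp (real j)) \<omega>)" for \<omega>
    unfolding lhs_def incseq_def using test_inc trunc_inc test_bounds truncation_bounds
    by (auto intro!: ennreal_leI mult_mono)
  have lsup: "(SUP j. lhs B j (exp (real j)) \<omega>) = indicator (avoid B) \<omega>" for \<omega>
  proof (rule SUPconst[OF linc])
    obtain n0 where n0: "\<forall>n\<ge>n0. exp_minus (h \<omega>) \<le> exp (real n) \<and> card (\<omega> \<inter> \<Delta>) \<le> n" using large by blast
    have "lhs B n (exp (real n)) \<omega> = indicator (avoid B) \<omega>" if "n0 \<le> n" for n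
    proof -
      have "max (exp_minus (h \<omega>)) (exp (real n)) = exp (real n)" using n0 that by (simp add: max_absorb2)
      then show ?thesis using n0 that by (simp add: lhs_def fin_test truncation_def ennreal_indicator)
    qed
    then show "\<exists>n0. \<forall>n\<ge>n0. lhs B n (exp (real n)) \<omega> = indicator (avoid B) \<omega>" by blast
  qed
  define g where "g j \<omega> = ennreal (test B j \<omega> * truncated_weight (exp (real j)) (h \<omega>))" for j \<omega>
  have gm: "g j \<in> borel_measurable config_algebra" for j
    unfolding g_def[abs_def] using measurable_test_comp[OF B' measurable_truncated_weight measurable_h, of j "exp (real j)"] by simp
  have ginc: "incseq (\<lambda>j. g j \<omega>)" for \<omega>
    unfolding g_def incseq_def using test_inc tw_inc test_bounds truncated_weight_bounds(1)[OF K]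
    by (auto intro!: ennreal_leI mult_mono)
  have gsup: "(SUP j. g j \<omega>) = indicator (avoid B) \<omega> * weight \<omega>" for \<omega>
  proof (rule SUPconst[OF ginc])
    obtain n0 where n0: "\<forall>n\<ge>n0. exp_minus (h \<omega>) \<le> exp (real n) \<and> card (\<omega> \<inter> \<Delta>) \<le> n" using large by blast
    have "g n \<omega> = indicator (avoid B) \<omega> * weight \<omega>" if "n0 \<le> n" for n
    proof -
      have "truncated_weight (exp (real n)) (h \<omega>) = exp_minus (h \<omega>)" using n0 that by (simp add: truncated_weight_def)
      then show ?thesis using n0 that by (auto simp: g_def weight_def fin_test split: split_indicator)
    qed
    then show "\<exists>n0. \<forall>n\<ge>n0. g n \<omega> = indicator (avoid B) \<omega> * weight \<omega>" by blast
  qed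
  have rsup: "(SUP j. rhs B j (exp (real j)) \<omega>) = ennreal outer_factor * empty_resample (\<lambda>\<omega>. indicator (avoid B) \<omega> * weight \<omega>) \<omega>"
    if \<omega>: "\<omega> \<in> configs" for \<omega>
  proof -
    have "(\<integral>\<^sup>+\<omega>'. indicator (avoid B) (resample \<omega> \<omega>') * weight (resample \<omega> \<omega>') \<partial>poisson_process \<Delta>) =
      (\<integral>\<^sup>+\<omega>'. (SUP j. g j (resample \<omega> \<omega>')) \<partial>poisson_process \<Delta>)" by (simp add: gsup)
    also have "\<dots> = (SUP j. \<integral>\<^sup>+\<omega>'. g j (resample \<omega> \<omega>') \<partial>poisson_process \<Delta>)"
      using ginc measurable_resample_comp[OF gm \<omega>]
      by (intro nn_integral_monotone_convergence_SUP) (auto simp: incseq_def le_fun_def)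
    finally show ?thesis
      by (simp add: rhs_def empty_resample_def g_def[symmetric] SUP_mult_left_ennreal)
  qed
  have rinc: "rhs B i (exp (real i)) \<omega> \<le> rhs B j (exp (real j)) \<omega>" if "i \<le> j" for i j \<omega>
    unfolding rhs_def empty_resample_def g_def[symmetric]
    using ginc that by (intro mult_left_mono nn_integral_mono) (auto simp: incseq_def)
  have "emeasure P (avoid B) = (\<integral>\<^sup>+\<omega>. (SUP j. lhs B j (exp (real j)) \<omega>) \<partial>P)"
    using B' by (simp add: lsup avoid_sets)
  also have "\<dots> = (SUP j. \<integral>\<^sup>+\<omega>. lhs B j (exp (real j)) \<omega> \<partial>P)"
    using linc measurable_lhs[OF B'] by (intro nn_integral_monotone_convergence_SUP) (auto simp: incseq_def le_fun_def)
  also have "\<dots> = (SUP j. \<integral>\<^sup>+\<omega>. rhs B j (exp (real j)) \<omega> \<partial>P)"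
    by (simp add: limit_lhs_rhs[OF B])
  also have "\<dots> = (\<integral>\<^sup>+\<omega>. (SUP j. rhs B j (exp (real j)) \<omega>) \<partial>P)"
    using rinc measurable_rhs[OF B'] by (intro nn_integral_monotone_convergence_SUP[symmetric]) (auto simp: incseq_def le_fun_def)
  also have "\<dots> = (\<integral>\<^sup>+\<omega>. ennreal outer_factor * empty_resample (\<lambda>\<omega>. indicator (avoid B) \<omega> * weight \<omega>) \<omega> \<partial>P)"
    using rsup by (intro nn_integral_cong) simp
  finally show ?thesis .
qed

text \<open>The right-hand side is the expectation under a measure \<nu>: resample, with density
  \<open>outer_factor\<close> times the weight on the event that \<open>\<Delta>\<close> is empty.
  Agreement on void events gives \<open>P = \<nu>\<close>, and so the identity for every nonnegative
  f.\<close>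

lemma limit_resample:
  assumes f: "f \<in> borel_measurable config_algebra"
  shows "(\<integral>\<^sup>+\<omega>. f \<omega> \<partial>P) = (\<integral>\<^sup>+\<omega>. ennreal outer_factor * empty_resample (\<lambda>\<omega>. f \<omega> * weight \<omega>) \<omega> \<partial>P)"
proof -
  interpret P: prob_space P by (rule prob_P)
  interpret p: prob_space "poisson_process \<Delta>" by (rule prob_space_poisson_process[OF \<Delta>])
  let ?PP = "P \<Otimes>\<^sub>M poisson_process \<Delta>"
  have sPP: "sets ?PP = sets (config_algebra \<Otimes>\<^sub>M config_algebra)" by (intro sets_pair_measure_cong) auto
  have mr: "(\<lambda>(\<omega>, \<omega>'). resample \<omega> \<omega>') \<in> ?PP \<rightarrow>\<^sub>M config_algebra"
    using measurable_resample' by (simp add: measurable_cong_sets[OF sPP refl])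
  define w where "w p = ennreal outer_factor * (indicator (avoid \<Delta>) (fst p) * weight (case p of (\<omega>, \<omega>') \<Rightarrow> resample \<omega> \<omega>'))" for p
  have mw: "w \<in> borel_measurable ?PP"
  proof -
    have "(\<lambda>p. indicator (avoid \<Delta>) (fst p) :: ennreal) \<in> borel_measurable ?PP"
      by (rule measurable_compose[OF measurable_fst]) (use \<Delta> in \<open>auto intro!: borel_measurable_indicator avoid_sets\<close>)
    then show ?thesis unfolding w_def[abs_def]
      by (intro borel_measurable_times_ennreal borel_measurable_const measurable_compose[OF mr measurable_weight])
  qed
  define \<nu> where "\<nu> = distr (density ?PP w) config_algebra (\<lambda>(\<omega>, \<omega>'). resample \<omega> \<omega>')"
  have \<nu>: "(\<integral>\<^sup>+\<omega>. g \<omega> \<partial>\<nu>) = (\<integral>\<^sup>+\<omega>. ennreal outer_factor * empty_resample (\<lambda>\<omega>. g \<omega> * weight \<omega>) \<omega> \<partial>P)"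
    if g: "g \<in> borel_measurable config_algebra" for g
  proof -
    have mgr: "(\<lambda>p. g (case p of (\<omega>, \<omega>') \<Rightarrow> resample \<omega> \<omega>')) \<in> borel_measurable ?PP" by (rule measurable_compose[OF mr g])
    have "(\<integral>\<^sup>+\<omega>. g \<omega> \<partial>\<nu>) = (\<integral>\<^sup>+p. g (case p of (\<omega>, \<omega>') \<Rightarrow> resample \<omega> \<omega>') \<partial>density ?PP w)"
      unfolding \<nu>_def using mr g by (intro nn_integral_distr) auto
    also have "\<dots> = (\<integral>\<^sup>+p. w p * g (case p of (\<omega>, \<omega>') \<Rightarrow> resample \<omega> \<omega>') \<partial>?PP)"
      by (rule nn_integral_density[OF mw mgr])
    also have "\<dots> = (\<integral>\<^sup>+\<omega>. \<integral>\<^sup>+\<omega>'. w (\<omega>, \<omega>') * g (case (\<omega>, \<omega>') of (\<omega>, \<omega>') \<Rightarrow> resample \<omega> \<omega>') \<partial>poisson_process \<Delta> \<partial>P)"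
      using mw mgr by (intro p.nn_integral_fst[symmetric]) auto
    also have "\<dots> = (\<integral>\<^sup>+\<omega>. ennreal outer_factor * empty_resample (\<lambda>\<omega>. g \<omega> * weight \<omega>) \<omega> \<partial>P)"
    proof (intro nn_integral_cong)
      fix \<omega> assume "\<omega> \<in> space P"
      then have \<omega>: "\<omega> \<in> configs" by simp
      have m: "(\<lambda>\<omega>'. g (resample \<omega> \<omega>') * weight (resample \<omega> \<omega>')) \<in> borel_measurable config_algebra"
        using g measurable_weight \<omega> by (intro borel_measurable_times_ennreal measurable_resample_comp)
      have "(\<integral>\<^sup>+\<omega>'. w (\<omega>, \<omega>') * g (case (\<omega>, \<omega>') of (\<omega>, \<omega>') \<Rightarrow> resample \<omega> \<omega>') \<partial>poisson_process \<Delta>) =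
        (\<integral>\<^sup>+\<omega>'. (ennreal outer_factor * indicator (avoid \<Delta>) \<omega>) * (g (resample \<omega> \<omega>') * weight (resample \<omega> \<omega>')) \<partial>poisson_process \<Delta>)"
        by (simp add: w_def ac_simps)
      also have "\<dots> = (ennreal outer_factor * indicator (avoid \<Delta>) \<omega>) * (\<integral>\<^sup>+\<omega>'. g (resample \<omega> \<omega>') * weight (resample \<omega> \<omega>') \<partial>poisson_process \<Delta>)"
        using m by (intro nn_integral_cmult) simp
      finally show "(\<integral>\<^sup>+\<omega>'. w (\<omega>, \<omega>') * g (case (\<omega>, \<omega>') of (\<omega>, \<omega>') \<Rightarrow> resample \<omega> \<omega>') \<partial>poisson_process \<Delta>) =
        ennreal outer_factor * empty_resample (\<lambda>\<omega>. g \<omega> * weight \<omega>) \<omega>"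
        by (simp add: empty_resample_def mult.assoc)
    qed
    finally show ?thesis .
  qed
  have "P = \<nu>"
  proof (rule config_measure_eqI)
    show "finite_measure P" by (rule P.finite_measure_axioms)
    show "sets \<nu> = sets config_algebra" by (simp add: \<nu>_def)
    fix B :: "'a set" assume B: "bounded B" "open B"
    then have A: "avoid B \<in> sets config_algebra" by (intro avoid_sets) auto
    have "emeasure P (avoid B) = (\<integral>\<^sup>+\<omega>. indicator (avoid B) \<omega> \<partial>\<nu>)"
      using B A by (subst \<nu>) (auto intro!: limit_avoid)
    also have "\<dots> = emeasure \<nu> (avoid B)" using A by (simp add: \<nu>_def)
    finally show "emeasure P (avoid B) = emeasure \<nu> (avoid B)" .
  qed simp
  then show ?thesis using \<nu>[OF f] by simp
qed

section \<open>The partition function and the DLR equation\<close>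

definition partition_integral :: "'a set \<Rightarrow> ennreal" where
  "partition_integral \<omega> = (\<integral>\<^sup>+\<omega>'. weight (resample \<omega> \<omega>') \<partial>poisson_process \<Delta>)"

lemma resample_resample: "resample (resample \<omega> \<eta>) \<omega>' = resample \<omega> \<omega>'"
  by (auto simp: resample_def)

lemma measurable_partition: "partition_integral \<in> borel_measurable config_algebra"
  unfolding partition_integral_def[abs_def] by (rule measurable_resample_nn_integral[OF measurable_weight])

text \<open>For functions of the outer configuration the identity says that
  \<open>outer_factor * partition_integral\<close> is the density of the outer law with respect to
  the outer law restricted to an empty \<open>\<Delta>\<close>.\<close>

lemma limit_outer:
  assumes g: "g \<in> borel_measurable config_algebra" "\<And>\<omega> \<omega>'. g (resample \<omega> \<omega>') = g \<omega>"
  shows "(\<integral>\<^sup>+\<omega>. g \<omega> \<partial>P) = (\<integral>\<^sup>+\<omega>. ennreal outer_factor * (indicator (avoid \<Delta>) \<omega> * (g \<omega> * partition_integral \<omega>)) \<partial>P)"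
  unfolding limit_resample[OF g(1)] empty_resample_def g(2)
proof (intro nn_integral_cong)
  fix \<omega> assume "\<omega> \<in> space P"
  then have "(\<lambda>\<omega>'. weight (resample \<omega> \<omega>')) \<in> borel_measurable config_algebra"
    by (intro measurable_resample_comp measurable_weight) simp
  then show "ennreal outer_factor * (indicator (avoid \<Delta>) \<omega> * (\<integral>\<^sup>+\<omega>'. g \<omega> * weight (resample \<omega> \<omega>') \<partial>poisson_process \<Delta>)) =
    ennreal outer_factor * (indicator (avoid \<Delta>) \<omega> * (g \<omega> * partition_integral \<omega>))"
    by (simp add: nn_integral_cmult partition_integral_def)
qed

lemma partition_resample: "partition_integral (resample \<omega> \<omega>') = partition_integral \<omega>"
  by (simp add: partition_integral_def resample_resample)

text \<open>\<open>limit_outer\<close> is tested with the indicators of the values 0 and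
  \<infinity>. For 0 the right-hand side vanishes; for \<infinity> the left-hand side is at most 1,
  although the integrand on the right is infinite wherever it is nonzero.\<close>

lemma AE_partition: "AE \<omega> in P. 0 < partition_integral \<omega> \<and> partition_integral \<omega> < \<infinity>"
proof -
  interpret P: prob_space P by (rule prob_P)
  have m: "(\<lambda>\<omega>. indicator {z} (partition_integral \<omega>) :: ennreal) \<in> borel_measurable config_algebra" for z
    by (rule measurable_compose[OF measurable_partition]) simp
  have "(\<integral>\<^sup>+\<omega>. indicator {0} (partition_integral \<omega>) \<partial>P) = (\<integral>\<^sup>+\<omega>. 0 \<partial>P)"
    unfolding limit_outer[OF m, unfolded partition_resample, OF refl]
    by (intro nn_integral_cong) (auto split: split_indicator)
  then have "AE \<omega> in P. indicator {0} (partition_integral \<omega>) = (0 :: ennreal)"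
    using m[of 0] nn_integral_0_iff_AE[of "\<lambda>\<omega>. indicator {0} (partition_integral \<omega>)" P] by simp
  then have 0: "AE \<omega> in P. partition_integral \<omega> \<noteq> 0"
    by eventually_elim (auto split: split_indicator_asm)
  let ?I = "\<lambda>\<omega>. ennreal outer_factor * (indicator (avoid \<Delta>) \<omega> * (indicator {\<infinity>} (partition_integral \<omega>) * partition_integral \<omega>))"
  have I: "(\<integral>\<^sup>+\<omega>. indicator {\<infinity>} (partition_integral \<omega>) \<partial>P) = (\<integral>\<^sup>+\<omega>. ?I \<omega> \<partial>P)"
    by (rule limit_outer[OF m]) (simp add: partition_resample)
  have "(\<integral>\<^sup>+\<omega>. indicator {\<infinity>} (partition_integral \<omega>) \<partial>P) \<le> (\<integral>\<^sup>+\<omega>. 1 \<partial>P)"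
    by (intro nn_integral_mono) (auto split: split_indicator)
  then have fin: "(\<integral>\<^sup>+\<omega>. ?I \<omega> \<partial>P) \<noteq> \<infinity>" using P.emeasure_space_1 I by (auto simp: top_unique simp del: space_P)
  have mI: "?I \<in> borel_measurable config_algebra"
    using m \<Delta> measurable_partition by (intro borel_measurable_times_ennreal borel_measurable_const borel_measurable_indicator avoid_sets) auto
  have "AE \<omega> in P. ?I \<omega> \<noteq> \<infinity>" using mI fin by (intro nn_integral_PInf_AE) auto
  \<comment> \<open>The integrand takes only the values 0 and \<infinity>, as
    \<open>outer_factor\<close> is positive.\<close>
  then have "AE \<omega> in P. ?I \<omega> = 0"
  proof eventually_elim
    case (elim \<omega>)
    then show ?case using outer_factor_pos by (auto simp: ennreal_mult_top split: split_indicator split_indicator_asm)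
  qed
  then have "(\<integral>\<^sup>+\<omega>. ?I \<omega> \<partial>P) = 0" using mI by (subst nn_integral_0_iff_AE) auto
  then have "AE \<omega> in P. indicator {\<infinity>} (partition_integral \<omega>) = (0 :: ennreal)"
    using m[of \<infinity>] nn_integral_0_iff_AE[of "\<lambda>\<omega>. indicator {\<infinity>} (partition_integral \<omega>)" P] I by simp
  then have "AE \<omega> in P. partition_integral \<omega> \<noteq> \<infinity>"
    by eventually_elim (auto split: split_indicator_asm)
  then show ?thesis using 0 by eventually_elim (auto simp: less_top zero_less_iff_neq_zero)
qed

text \<open>Also valid for an infinite integral: the Bochner integral and \<open>enn2real\<close>
  then both return 0.\<close>

lemma partition_function_eq:
  assumes \<omega>: "\<omega> \<in> configs" shows "partition_function H \<Delta> D (\<omega> - \<Delta>) = enn2real (partition_integral \<omega>)"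
proof -
  have m: "(\<lambda>\<omega>'. exp_minus (h (resample \<omega> \<omega>'))) \<in> borel_measurable config_algebra"
    using measurable_compose[OF measurable_compose[OF measurable_resample1[OF \<omega>] measurable_h] exp_minus_measurable] .
  have "partition_function H \<Delta> D (\<omega> - \<Delta>) = (\<integral>\<omega>'. exp_minus (h (resample \<omega> \<omega>')) \<partial>poisson_process \<Delta>)"
    by (simp add: partition_function_def resample_def)
  also have "\<dots> = enn2real (partition_integral \<omega>)"
    unfolding partition_integral_def weight_def using m by (intro integral_eq_nn_integral) auto
  finally show ?thesis .
qed

definition dlr_kernel :: "('a set \<Rightarrow> real) \<Rightarrow> 'a set \<Rightarrow> real" where
  "dlr_kernel f \<omega> = (\<integral>\<omega>'. f (\<omega>' \<inter> \<Delta> \<union> (\<omega> - \<Delta>)) * (1 / partition_function H \<Delta> D (\<omega> - \<Delta>)) *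
     exp_minus (h (\<omega>' \<inter> \<Delta> \<union> (\<omega> - \<Delta>))) \<partial>poisson_process \<Delta>)"

lemma dlr_kernel_eq:
  assumes \<omega>: "\<omega> \<in> configs"
  shows "dlr_kernel f \<omega> = (1 / enn2real (partition_integral \<omega>)) * (\<integral>\<omega>'. f (resample \<omega> \<omega>') * exp_minus (h (resample \<omega> \<omega>')) \<partial>poisson_process \<Delta>)"
  unfolding dlr_kernel_def partition_function_eq[OF \<omega>] resample_def[symmetric]
  by (subst integral_mult_right_zero[symmetric]) (simp add: ac_simps)

lemma measurable_dlr_kernel:
  assumes f: "f \<in> borel_measurable config_algebra"
  shows "dlr_kernel f \<in> borel_measurable config_algebra"
proof -
  interpret p: sigma_finite_measure "poisson_process \<Delta>" by (rule sigma_finite_poisson[OF \<Delta>])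
  have sP: "sets (config_algebra \<Otimes>\<^sub>M poisson_process \<Delta>) = sets (config_algebra \<Otimes>\<^sub>M (config_algebra :: 'a set measure))"
    by (intro sets_pair_measure_cong) auto
  have "(\<lambda>\<eta>. f \<eta> * exp_minus (h \<eta>)) \<in> borel_measurable config_algebra"
    using f measurable_compose[OF measurable_h exp_minus_measurable] by (intro borel_measurable_times)
  from measurable_compose[OF measurable_resample' this]
  have "(\<lambda>(\<omega>, \<omega>'). f (resample \<omega> \<omega>') * exp_minus (h (resample \<omega> \<omega>'))) \<in> borel_measurable (config_algebra \<Otimes>\<^sub>M poisson_process \<Delta>)"
    by (simp add: measurable_cong_sets[OF sP refl] split_beta')
  then have "(\<lambda>\<omega>. \<integral>\<omega>'. f (resample \<omega> \<omega>') * exp_minus (h (resample \<omega> \<omega>')) \<partial>poisson_process \<Delta>) \<in> borel_measurable config_algebra"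
    by (rule p.borel_measurable_lebesgue_integral)
  then have "(\<lambda>\<omega>. (1 / enn2real (partition_integral \<omega>)) * (\<integral>\<omega>'. f (resample \<omega> \<omega>') * exp_minus (h (resample \<omega> \<omega>')) \<partial>poisson_process \<Delta>)) \<in> borel_measurable config_algebra"
    using measurable_partition by measurable
  then show ?thesis by (subst measurable_cong[of config_algebra "dlr_kernel f"]) (auto simp: dlr_kernel_eq)
qed

text \<open>The quotient g of the resampling integral I by the partition integral depends only on
  the outer configuration. \<open>limit_outer\<close> applied to g multiplies it by the partition
  integral again, which leaves I, and \<open>limit_resample\<close> evaluates the result.\<close>

lemma nn_integral_dlr_kernel:
  fixes f :: "'a set \<Rightarrow> real"
  assumes f: "f \<in> borel_measurable config_algebra" and b: "\<And>\<omega>. \<omega> \<in> configs \<Longrightarrow> 0 \<le> f \<omega>"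
    and fin: "(\<integral>\<^sup>+\<omega>. ennreal (f \<omega>) \<partial>P) \<noteq> \<infinity>"
  shows "(\<integral>\<^sup>+\<omega>. ennreal (dlr_kernel f \<omega>) \<partial>P) = (\<integral>\<^sup>+\<omega>. ennreal (f \<omega>) \<partial>P)"
proof -
  have fe: "(\<lambda>\<omega>. ennreal (f \<omega>)) \<in> borel_measurable config_algebra" using f by simp
  define I where "I \<omega> = (\<integral>\<^sup>+\<omega>'. ennreal (f (resample \<omega> \<omega>')) * weight (resample \<omega> \<omega>') \<partial>poisson_process \<Delta>)" for \<omega>
  have mI: "I \<in> borel_measurable config_algebra"
    unfolding I_def[abs_def] using fe measurable_weight
    by (intro measurable_resample_nn_integral[of "\<lambda>\<eta>. ennreal (f \<eta>) * weight \<eta>"] borel_measurable_times_ennreal)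
  have Ir: "I (resample \<omega> \<omega>') = I \<omega>" for \<omega> \<omega>' by (simp add: I_def resample_resample)
  define g where "g \<omega> = I \<omega> / partition_integral \<omega>" for \<omega>
  have mg: "g \<in> borel_measurable config_algebra" unfolding g_def[abs_def] using mI measurable_partition by measurable
  have "(\<integral>\<^sup>+\<omega>. g \<omega> \<partial>P) = (\<integral>\<^sup>+\<omega>. ennreal outer_factor * (indicator (avoid \<Delta>) \<omega> * (g \<omega> * partition_integral \<omega>)) \<partial>P)"
    by (rule limit_outer[OF mg]) (simp add: g_def Ir partition_resample)
  also have "\<dots> = (\<integral>\<^sup>+\<omega>. ennreal outer_factor * empty_resample (\<lambda>\<omega>. ennreal (f \<omega>) * weight \<omega>) \<omega> \<partial>P)"
  proof (rule nn_integral_cong_AE)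
    show "AE \<omega> in P. ennreal outer_factor * (indicator (avoid \<Delta>) \<omega> * (g \<omega> * partition_integral \<omega>)) =
      ennreal outer_factor * empty_resample (\<lambda>\<omega>. ennreal (f \<omega>) * weight \<omega>) \<omega>"
      using AE_partition
    proof eventually_elim
      case (elim \<omega>)
      have "g \<omega> * partition_integral \<omega> = I \<omega> * partition_integral \<omega> / partition_integral \<omega>"
        unfolding g_def divide_ennreal_def by (simp only: ac_simps)
      also have "\<dots> = I \<omega>" using elim by (intro ennreal_mult_divide_eq) auto
      finally have "g \<omega> * partition_integral \<omega> = I \<omega>" .
      then show ?case by (simp add: empty_resample_def I_def)
    qed
  qed
  also have "\<dots> = (\<integral>\<^sup>+\<omega>. ennreal (f \<omega>) \<partial>P)" by (rule limit_resample[OF fe, symmetric])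
  finally have eq: "(\<integral>\<^sup>+\<omega>. g \<omega> \<partial>P) = (\<integral>\<^sup>+\<omega>. ennreal (f \<omega>) \<partial>P)" .
  have ker: "dlr_kernel f \<omega> = enn2real (g \<omega>)" if \<omega>: "\<omega> \<in> configs" and Z: "0 < partition_integral \<omega>" "partition_integral \<omega> < \<infinity>" for \<omega>
  proof -
    have m: "(\<lambda>\<omega>'. f (resample \<omega> \<omega>') * exp_minus (h (resample \<omega> \<omega>'))) \<in> borel_measurable config_algebra"
      using measurable_compose[OF measurable_resample1[OF \<omega>] f]
        measurable_compose[OF measurable_compose[OF measurable_resample1[OF \<omega>] measurable_h] exp_minus_measurable]
      by (intro borel_measurable_times)
    have "(\<integral>\<omega>'. f (resample \<omega> \<omega>') * exp_minus (h (resample \<omega> \<omega>')) \<partial>poisson_process \<Delta>) =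
      enn2real (\<integral>\<^sup>+\<omega>'. ennreal (f (resample \<omega> \<omega>') * exp_minus (h (resample \<omega> \<omega>'))) \<partial>poisson_process \<Delta>)"
      using m b resample_configs[OF \<omega>] by (intro integral_eq_nn_integral) auto
    also have "(\<integral>\<^sup>+\<omega>'. ennreal (f (resample \<omega> \<omega>') * exp_minus (h (resample \<omega> \<omega>'))) \<partial>poisson_process \<Delta>) = I \<omega>"
      unfolding I_def weight_def using b resample_configs[OF \<omega>] by (intro nn_integral_cong) (simp add: ennreal_mult)
    finally have eq: "(\<integral>\<omega>'. f (resample \<omega> \<omega>') * exp_minus (h (resample \<omega> \<omega>')) \<partial>poisson_process \<Delta>) = enn2real (I \<omega>)" .
    obtain z where z: "partition_integral \<omega> = ennreal z" "0 < z"
      using Z by (cases "partition_integral \<omega>") auto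
    show ?thesis unfolding dlr_kernel_eq[OF \<omega>] g_def eq z(1) using z(2)
      by (cases "I \<omega>") (simp_all add: divide_ennreal ennreal_top_divide)
  qed
  \<comment> \<open>\<open>enn2real\<close> turns \<infinity> into 0, so identifying the real kernel
    with g needs g finite; this holds because its integral equals the finite one of f.\<close>
  have "AE \<omega> in P. g \<omega> \<noteq> \<infinity>" using mg fin by (intro nn_integral_PInf_AE) (auto simp: eq)
  then have "AE \<omega> in P. ennreal (dlr_kernel f \<omega>) = g \<omega>"
    using AE_partition AE_space
  proof eventually_elim
    case (elim \<omega>)
    then show ?case using ker[of \<omega>] by (simp add: less_top)
  qed
  then show ?thesis unfolding eq[symmetric] by (rule nn_integral_cong_AE)
qed

lemma dlr_kernel_nonneg:
  assumes "\<And>\<omega>. \<omega> \<in> configs \<Longrightarrow> 0 \<le> f \<omega>" "\<omega> \<in> configs" shows "0 \<le> dlr_kernel f \<omega>"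
  unfolding dlr_kernel_eq[OF assms(2)] using assms resample_configs
  by (intro mult_nonneg_nonneg integral_nonneg_AE AE_I2) auto

text \<open>Where the partition integral is positive and finite the kernel has total mass one, so it
  commutes with adding constants. This reduces bounded functions to nonnegative ones.\<close>

lemma dlr_kernel_add_const:
  assumes f: "f \<in> borel_measurable config_algebra" "\<And>\<omega>. \<omega> \<in> configs \<Longrightarrow> \<bar>f \<omega>\<bar> \<le> c"
    and \<omega>: "\<omega> \<in> configs" and Z: "0 < partition_integral \<omega>" "partition_integral \<omega> < \<infinity>"
  shows "dlr_kernel (\<lambda>\<omega>. f \<omega> + c) \<omega> = dlr_kernel f \<omega> + c"
proof -
  let ?w = "\<lambda>\<omega>'. exp_minus (h (resample \<omega> \<omega>'))"
  have mw: "?w \<in> borel_measurable config_algebra"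
    using measurable_compose[OF measurable_compose[OF measurable_resample1[OF \<omega>] measurable_h] exp_minus_measurable] .
  have mf: "(\<lambda>\<omega>'. f (resample \<omega> \<omega>')) \<in> borel_measurable config_algebra"
    using measurable_compose[OF measurable_resample1[OF \<omega>] f(1)] .
  have iw: "integrable (poisson_process \<Delta>) ?w"
    using mw Z(2) by (intro integrableI_nonneg) (auto simp: partition_integral_def weight_def)
  have ifw: "integrable (poisson_process \<Delta>) (\<lambda>\<omega>'. f (resample \<omega> \<omega>') * ?w \<omega>')"
  proof (rule Bochner_Integration.integrable_bound[OF integrable_mult_right[OF iw, of c]])
    show "(\<lambda>\<omega>'. f (resample \<omega> \<omega>') * ?w \<omega>') \<in> borel_measurable (poisson_process \<Delta>)"
      using mf mw by (simp add: borel_measurable_times)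
    show "AE \<omega>' in poisson_process \<Delta>. norm (f (resample \<omega> \<omega>') * ?w \<omega>') \<le> norm (c * ?w \<omega>')"
    proof (rule AE_I2)
      fix \<omega>' assume "\<omega>' \<in> space (poisson_process \<Delta>)"
      then have "\<bar>f (resample \<omega> \<omega>')\<bar> \<le> \<bar>c\<bar>" using f(2)[OF resample_configs[OF \<omega>, of \<omega>']] by simp
      then show "norm (f (resample \<omega> \<omega>') * ?w \<omega>') \<le> norm (c * ?w \<omega>')"
        by (simp add: abs_mult mult_right_mono)
    qed
  qed
  have "(\<integral>\<omega>'. ?w \<omega>' \<partial>poisson_process \<Delta>) = enn2real (partition_integral \<omega>)"
    unfolding partition_integral_def weight_def using mw by (intro integral_eq_nn_integral) auto
  moreover have "0 < enn2real (partition_integral \<omega>)" using Z by (simp add: enn2real_positive_iff)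
  moreover have "(\<integral>\<omega>'. (f (resample \<omega> \<omega>') + c) * ?w \<omega>' \<partial>poisson_process \<Delta>) =
    (\<integral>\<omega>'. f (resample \<omega> \<omega>') * ?w \<omega>' \<partial>poisson_process \<Delta>) + c * (\<integral>\<omega>'. ?w \<omega>' \<partial>poisson_process \<Delta>)"
    using iw ifw by (simp add: distrib_right)
  ultimately show ?thesis unfolding dlr_kernel_eq[OF \<omega>] by (simp add: distrib_left)
qed

lemma dlr_equation:
  fixes f :: "'a set \<Rightarrow> real"
  assumes f: "f \<in> borel_measurable config_algebra" and bd: "bounded (f ` configs)"
  shows "(\<integral>\<omega>. f \<omega> \<partial>P) = (\<integral>\<omega>. dlr_kernel f \<omega> \<partial>P)"
proof -
  interpret P: prob_space P by (rule prob_P)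
  obtain c where c: "\<And>\<omega>. \<omega> \<in> configs \<Longrightarrow> \<bar>f \<omega>\<bar> \<le> c" using bd by (auto simp: bounded_iff)
  \<comment> \<open>The shift by the bound c makes f nonnegative, as the extended integrals
    require.\<close>
  let ?f = "\<lambda>\<omega>. f \<omega> + c"
  have mf: "?f \<in> borel_measurable config_algebra" using f by simp
  have nn: "0 \<le> ?f \<omega>" if "\<omega> \<in> configs" for \<omega> using c[OF that] by linarith
  have int_f: "integrable P f" using f c by (intro P.integrable_const_bound[where B=c]) auto
  then have int_f': "integrable P ?f" by simp
  have fin: "(\<integral>\<^sup>+\<omega>. ennreal (?f \<omega>) \<partial>P) \<noteq> \<infinity>"
    using nn by (subst nn_integral_eq_integral[OF int_f']) auto
  have nk: "(\<integral>\<^sup>+\<omega>. ennreal (dlr_kernel ?f \<omega>) \<partial>P) = (\<integral>\<^sup>+\<omega>. ennreal (?f \<omega>) \<partial>P)"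
    by (rule nn_integral_dlr_kernel[OF mf nn fin])
  have mk: "dlr_kernel ?f \<in> borel_measurable config_algebra" by (rule measurable_dlr_kernel[OF mf])
  have int_k: "integrable P (dlr_kernel ?f)"
    using mk nk fin dlr_kernel_nonneg[of ?f, OF nn] by (intro integrableI_nonneg) (auto simp: less_top)
  have "(\<integral>\<omega>. dlr_kernel ?f \<omega> \<partial>P) = enn2real (\<integral>\<^sup>+\<omega>. ennreal (dlr_kernel ?f \<omega>) \<partial>P)"
    using mk dlr_kernel_nonneg[of ?f, OF nn] by (intro integral_eq_nn_integral) auto
  also have "\<dots> = (\<integral>\<omega>. ?f \<omega> \<partial>P)"
    unfolding nk using mf nn by (intro integral_eq_nn_integral[symmetric]) auto
  finally have k: "(\<integral>\<omega>. dlr_kernel ?f \<omega> \<partial>P) = (\<integral>\<omega>. f \<omega> \<partial>P) + c"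
    using int_f P.prob_space by simp
  have "AE \<omega> in P. dlr_kernel f \<omega> = dlr_kernel ?f \<omega> - c"
    using AE_partition AE_space
  proof eventually_elim
    case (elim \<omega>)
    then show ?case using dlr_kernel_add_const[OF f c, of \<omega>] by simp
  qed
  then have "(\<integral>\<omega>. dlr_kernel f \<omega> \<partial>P) = (\<integral>\<omega>. dlr_kernel ?f \<omega> - c \<partial>P)"
    using mk measurable_dlr_kernel[OF f] by (intro integral_cong_AE) auto
  also have "\<dots> = (\<integral>\<omega>. f \<omega> \<partial>P)" using int_k k P.prob_space by simp
  finally show ?thesis ..
qed

end

context gibbs_limit
begin

lemma gibbs_point_process_limit: "gibbs_point_process H P"
  unfolding gibbs_point_process_def
proof (intro conjI allI impI)
  show "point_process P" by (simp add: point_process_def prob_P)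
  show "bounded_intensity P"
    unfolding bounded_intensity_def by (rule le_less_trans[OF intensity_limit]) simp
  fix \<Delta> :: "'a set" assume \<Delta>: "bounded_borel \<Delta>"
  show "DLR H \<Delta> P"
    unfolding DLR_def
  proof (intro allI impI, elim conjE)
    fix D and f :: "'a set \<Rightarrow> real"
    assume "regular_sequence H \<Delta> D" and f: "f \<in> borel_measurable config_algebra" "bounded (f ` configs)"
    then interpret gibbs_limit_region H a F P \<Delta> D
      by unfold_locales (use \<Delta> in auto)
    show "(\<integral>\<omega>. f \<omega> \<partial>P) = (\<integral>\<omega>. (\<integral>\<omega>'. f (\<omega>' \<inter> \<Delta> \<union> (\<omega> - \<Delta>)) * (1 / partition_function H \<Delta> D (\<omega> - \<Delta>)) *
                 exp_minus (local_energy H \<Delta> D (\<omega>' \<inter> \<Delta> \<union> (\<omega> - \<Delta>))) \<partial>poisson_process \<Delta>) \<partial>P)"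
      using dlr_equation[OF f] unfolding dlr_kernel_def .
  qed
qed

end

theorem theorem1:
  fixes H :: "(real ^ 'd) set \<Rightarrow> ereal"
  assumes "energy_function H" and "stable_energy H" and "intensity_regular H"
  shows "\<exists>P. gibbs_point_process H P \<and> stationary P \<and> finite_intensity P"
proof -
  obtain A :: real where A: "A \<le> 0" "\<And>\<omega>. finite \<omega> \<Longrightarrow> ereal (A * card \<omega>) \<le> H \<omega>"
    using assms(2) by (auto simp: stable_energy_def)
  interpret stable_interaction H "- A"
    using A assms(1) by unfold_locales auto
  obtain F and P :: "(real ^ 'd) set measure" where
    "F \<le> sequentially" "F \<noteq> bot" "prob_space P" "sets P = sets config_algebra"
    "\<And>k A. A \<in> sets config_algebra \<Longrightarrow>
      ((\<lambda>n. measure (finite_volume n) (local_event k A)) \<longlongrightarrow> measure P (local_event k A)) F"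
    using ex_limit by blast
  then interpret gibbs_limit H "- A" F P
    by (intro gibbs_limit.intro gibbs_limit_axioms.intro stable_interaction_axioms)
  show ?thesis using gibbs_point_process_limit stationary_limit finite_intensity_limit by blast
qed

end
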